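(* Let $K$ be a field of characteristic zero and $n\ge1$. Let $\widehat{\mathbb I}_n(\mathrm{weight})_r$ (resp. $\widehat{\mathbb I}_n(\mathrm{gen.\ weight})_r$) denote the set of isomorphism classes of simple weight (resp. simple generalized weight) right $\mathbb I_n$-modules. (1) $\widehat{\mathbb I}_n(\mathrm{gen.\ weight})_r=\widehat{\mathbb I}_n(\mathrm{weight})_r=\widehat{\mathbb I}_1(\mathrm{weight})_r^{\otimes n}$. That is: any simple generalized weight right $\mathbb I_n$-module is a simple weight right $\mathbb I_n$-module, and vice versa; the simple weight right $\mathbb I_n$-modules are, up to isomorphism, exactly the tensor products $M_1\otimes\cdots\otimes M_n$ of simple weight right $\mathbb I_1$-modules; and two such modules are isomorphic, $M_1\otimes\cdots\otimes M_n\simeq M_1'\otimes\cdots\otimes M_n'$, iff for each $i=1,\dots,n$ the right $\mathbb I_1$-modules $M_i$ and $M_i'$ are isomorphic. Furthermore, $\widehat{\mathbb I}_1(\mathrm{weight})_r=\{P_1^*\simeq\mathbb I_1/\int\mathbb I_1\simeq K[\partial],\ M(1,\lambda)^*\simeq B_1/(H-\lambda)B_1\mid\lambda\in K\}$, $\mathrm{Supp}(K[\partial])=\mathbb N_+$ and $\mathrm{Supp}(M(1,\lambda)^* )=\lambda+\mathbb Z$. (2) For each simple weight right $\mathbb I_n$-module $M=\bigotimes_{i=1}^nM_i$ (with $M_i$ simple weight right $\mathbb I_1$-modules), $\mathrm{Supp}(M)=\prod_{i=1}^n\mathrm{Supp}(M_i)$.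
   Context: $\otimes=\otimes_K$, $\mathbb N_+=\{1,2,\dots\}$. $P_n=K[x_1,\dots,x_n]$. $\mathbb I_n$ is the $K$-subalgebra of $\mathrm{End}_K(P_n)$ generated by the multiplications by $x_i$, the partial derivatives $\partial_i$, and the integrations $\int_i$ ($K$-linear, $x^\alpha\mapsto x_ix^\alpha/(\alpha_i+1)$), $i=1,\dots,n$; $\mathbb I_n=\mathbb I_1(1)\otimes\cdots\otimes\mathbb I_1(n)$ with $\mathbb I_1(i)=K\langle x_i,\partial_i,\int_i\rangle\simeq\mathbb I_1$. $H_i=\partial_ix_i$; $D_n=K[H_1,\dots,H_n]\subset\mathbb I_n$ is a polynomial algebra. For $n=1$ the subscript is dropped ($x,\partial,\int,H$). $\mathbb I_n$ has an involution (anti-automorphism of order two) $*$ with $\partial_i^*=\int_i$, $\int_i^*=\partial_i$, $H_i^*=H_i$. For a left $\mathbb I_n$-module $M$, $M^*$ is the right $\mathbb I_n$-module with $M^*=M$ as a vector space and $va:=a^*v$ for $v\in M$, $a\in\mathbb I_n$. For $\lambda\in K^n$, $\mathfrak m_\lambda=(H_1-\lambda_1,\dots,H_n-\lambda_n)\subset D_n$. For a right $\mathbb I_n$-module $M$, $M_\lambda=\{v: v\mathfrak m_\lambda=0\}$, $M^\lambda=\{v:v\mathfrak m_\lambda^i=0\text{ for some }i\}$; $M$ is weight (resp. generalized weight) if $M=\bigoplus_\lambda M_\lambda$ (resp. $M=\bigoplus_\lambda M^\lambda$), and $\mathrm{Supp}(M)=\{\lambda\in K^n:M^\lambda\ne0\}$.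 $\mathbb I_1$ has a unique proper nonzero ideal $F$, spanned by $\int^s\partial^t-\int^{s+1}\partial^{t+1}$ ($s,t\ge0$); $B_1=\mathbb I_1/F$ is the skew Laurent polynomial algebra $K[H][\partial^{\pm1}]$ with $\partial H=(H+1)\partial$, $\int\mapsto\partial^{-1}$; $M(1,\lambda)=B_1/B_1(H-\lambda)$, a left $\mathbb I_1$-module. $K[\partial]$ is the right $\mathbb I_1$-module with $\partial^k\cdot H=(k+1)\partial^k$, $\partial^k\cdot\partial=\partial^{k+1}$, $\partial^k\cdot\int=\partial^{k-1}$ for $k\ge1$ and $1\cdot\int=0$. *)

theory Defs
  imports
    "HOL-Algebra.Module"
    "HOL-Algebra.QuotRing"
    "HOL-Algebra.Ideal_Product"
    "HOL-Library.Poly_Mapping"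
    "HOL-Computational_Algebra.Polynomial"
begin

section \<open>The algebra of polynomial integro-differential operators\<close>

text \<open>The variables of \<open>P\<^sub>n\<close> are indexed by a finite type \<open>'n\<close>, so that \<open>n = CARD('n)\<close>; for
  \<open>n = 1\<close> the index type is \<open>unit\<close>. A monomial is a finitely supported exponent vector.\<close>

type_synonym ('k, 'n) pol = "('n \<Rightarrow>\<^sub>0 nat) \<Rightarrow>\<^sub>0 'k"
type_synonym ('k, 'n) op = "('k, 'n) pol \<Rightarrow> ('k, 'n) pol"

definition Cop :: "'k \<Rightarrow> ('k::field_char_0, 'n::finite) op" where
  "Cop c p = Poly_Mapping.single 0 c * p"

definition Xop :: "'n \<Rightarrow> ('k::field_char_0, 'n::finite) op" where
  "Xop i p = Poly_Mapping.single (Poly_Mapping.single i 1) 1 * p"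

definition Dop :: "'n \<Rightarrow> ('k::field_char_0, 'n::finite) op" where
  "Dop i p = (\<Sum>\<alpha>\<in>Poly_Mapping.keys p.
     Poly_Mapping.single (\<alpha> - Poly_Mapping.single i 1)
       (of_nat (Poly_Mapping.lookup \<alpha> i) * Poly_Mapping.lookup p \<alpha>))"

definition Jop :: "'n \<Rightarrow> ('k::field_char_0, 'n::finite) op" where
  "Jop i p = (\<Sum>\<alpha>\<in>Poly_Mapping.keys p.
     Poly_Mapping.single (\<alpha> + Poly_Mapping.single i 1)
       (Poly_Mapping.lookup p \<alpha> / (of_nat (Poly_Mapping.lookup \<alpha> i) + 1)))"

definition Hop :: "'n \<Rightarrow> ('k::field_char_0, 'n::finite) op" where
  "Hop i = Dop i \<circ> Xop i"

inductive_set subalg :: "('k::field_char_0, 'n::finite) op set \<Rightarrow> ('k, 'n) op set"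
  for S where
    scalar: "Cop c \<in> subalg S"
  | gen: "a \<in> S \<Longrightarrow> a \<in> subalg S"
  | add: "a \<in> subalg S \<Longrightarrow> b \<in> subalg S \<Longrightarrow> (\<lambda>p. a p + b p) \<in> subalg S"
  | mult: "a \<in> subalg S \<Longrightarrow> b \<in> subalg S \<Longrightarrow> a \<circ> b \<in> subalg S"

definition op_ring :: "('k::field_char_0, 'n::finite) op set \<Rightarrow> ('k, 'n) op ring" where
  "op_ring S = \<lparr>carrier = subalg S, monoid.mult = (\<circ>), one = id,
     zero = (\<lambda>_. 0), add = (\<lambda>a b p. a p + b p)\<rparr>"

text \<open>\<open>\<I>\<^sub>n\<close> and \<open>D\<^sub>n = K[H\<^sub>1, \<dots>, H\<^sub>n]\<close>.\<close>

definition II :: "('k::field_char_0, 'n::finite) op ring" where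
  "II = op_ring (range Xop \<union> range Dop \<union> range Jop)"

definition DD :: "('k::field_char_0, 'n::finite) op ring" where
  "DD = op_ring (range Hop)"


section \<open>Modules over a noncommutative ring\<close>

text \<open>The library's module record is reused, but its locale \<open>module\<close> requires a commutative ring.
  For a right module, \<open>a \<odot>\<^bsub>M\<^esub> v\<close> stands for \<open>v a\<close>. The fields \<open>mult\<close> and \<open>one\<close> of a module
  record play no role.\<close>

locale right_module = ring R + M?: abelian_group M
  for R :: "('r, 'x) ring_scheme" (structure) and M :: "('r, 'v, 'y) module_scheme" +
  assumes "\<lbrakk>a \<in> carrier R; v \<in> carrier M\<rbrakk> \<Longrightarrow> a \<odot>\<^bsub>M\<^esub> v \<in> carrier M"
    and "\<lbrakk>a \<in> carrier R; b \<in> carrier R; v \<in> carrier M\<rbrakk> \<Longrightarrow>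
           (a \<oplus> b) \<odot>\<^bsub>M\<^esub> v = a \<odot>\<^bsub>M\<^esub> v \<oplus>\<^bsub>M\<^esub> b \<odot>\<^bsub>M\<^esub> v"
    and "\<lbrakk>a \<in> carrier R; u \<in> carrier M; v \<in> carrier M\<rbrakk> \<Longrightarrow>
           a \<odot>\<^bsub>M\<^esub> (u \<oplus>\<^bsub>M\<^esub> v) = a \<odot>\<^bsub>M\<^esub> u \<oplus>\<^bsub>M\<^esub> a \<odot>\<^bsub>M\<^esub> v"
    and "\<lbrakk>a \<in> carrier R; b \<in> carrier R; v \<in> carrier M\<rbrakk> \<Longrightarrow>
           (a \<otimes> b) \<odot>\<^bsub>M\<^esub> v = b \<odot>\<^bsub>M\<^esub> (a \<odot>\<^bsub>M\<^esub> v)"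
    and "v \<in> carrier M \<Longrightarrow> \<one> \<odot>\<^bsub>M\<^esub> v = v"

definition right_simple :: "('r, 'x) ring_scheme \<Rightarrow> ('r, 'v) module \<Rightarrow> bool" where
  "right_simple R M \<longleftrightarrow> right_module R M \<and> carrier M \<noteq> {\<zero>\<^bsub>M\<^esub>} \<and>
     (\<forall>N. submodule N R M \<longrightarrow> N = {\<zero>\<^bsub>M\<^esub>} \<or> N = carrier M)"

definition right_iso :: "('r, 'x) ring_scheme \<Rightarrow> ('r, 'v) module \<Rightarrow> ('r, 'w) module \<Rightarrow> bool" where
  "right_iso R M N \<longleftrightarrow> right_module R M \<and> right_module R N \<and>
     (\<exists>\<phi>\<in>iso (add_monoid M) (add_monoid N).
        \<forall>a\<in>carrier R. \<forall>v\<in>carrier M. \<phi> (a \<odot>\<^bsub>M\<^esub> v) = a \<odot>\<^bsub>N\<^esub> \<phi> v)"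

definition with_action :: "('v, 'x) ring_scheme \<Rightarrow> ('r \<Rightarrow> 'v \<Rightarrow> 'v) \<Rightarrow> ('r, 'v) module" where
  "with_action M \<sigma> = \<lparr>carrier = carrier M, monoid.mult = monoid.mult M, one = one M,
     zero = zero M, add = add M, module.smult = \<sigma>\<rparr>"

definition quot_module :: "('r, 'v) module \<Rightarrow> 'v set \<Rightarrow> ('r, 'v set) module" where
  "quot_module M N = \<lparr>carrier = a_rcosets\<^bsub>M\<^esub> N, monoid.mult = undefined, one = undefined,
     zero = N, add = set_add M, module.smult = (\<lambda>a V. \<Union>v\<in>V. N +>\<^bsub>M\<^esub> (a \<odot>\<^bsub>M\<^esub> v))\<rparr>"


section \<open>Weight modules\<close>

definition max_ideal :: "('n \<Rightarrow> 'k) \<Rightarrow> ('k::field_char_0, 'n::finite) op set" where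
  "max_ideal \<mu> = genideal DD {(\<lambda>p. Hop i p - Cop (\<mu> i) p) | i. True}"

definition wspace :: "(('k::field_char_0, 'n::finite) op, 'v) module \<Rightarrow> ('n \<Rightarrow> 'k) \<Rightarrow> 'v set" where
  "wspace M \<mu> = {v \<in> carrier M. \<forall>a\<in>max_ideal \<mu>. a \<odot>\<^bsub>M\<^esub> v = \<zero>\<^bsub>M\<^esub>}"

definition gen_wspace :: "(('k::field_char_0, 'n::finite) op, 'v) module \<Rightarrow> ('n \<Rightarrow> 'k) \<Rightarrow> 'v set" where
  "gen_wspace M \<mu> = {v \<in> carrier M. \<exists>m::nat. \<forall>a\<in>max_ideal \<mu> [^]\<^bsub>ideals_set DD\<^esub> m.
     a \<odot>\<^bsub>M\<^esub> v = \<zero>\<^bsub>M\<^esub>}"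

definition internal_direct_sum :: "('v, 'x) ring_scheme \<Rightarrow> ('i \<Rightarrow> 'v set) \<Rightarrow> bool" where
  "internal_direct_sum M W \<longleftrightarrow>
     (\<forall>i. W i \<subseteq> carrier M) \<and>
     (\<forall>v\<in>carrier M. \<exists>!c. (\<forall>i. c i \<in> W i) \<and> finite {i. c i \<noteq> \<zero>\<^bsub>M\<^esub>} \<and>
        v = (\<Oplus>\<^bsub>M\<^esub>i\<in>{i. c i \<noteq> \<zero>\<^bsub>M\<^esub>}. c i))"

definition weight :: "(('k::field_char_0, 'n::finite) op, 'v) module \<Rightarrow> bool" where
  "weight M \<longleftrightarrow> right_module II M \<and> internal_direct_sum M (wspace M)"

definition gen_weight :: "(('k::field_char_0, 'n::finite) op, 'v) module \<Rightarrow> bool" where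
  "gen_weight M \<longleftrightarrow> right_module II M \<and> internal_direct_sum M (gen_wspace M)"

definition Supp :: "(('k::field_char_0, 'n::finite) op, 'v) module \<Rightarrow> ('n \<Rightarrow> 'k) set" where
  "Supp M = {\<mu>. gen_wspace M \<mu> \<noteq> {\<zero>\<^bsub>M\<^esub>}}"

text \<open>The support for \<open>n = 1\<close>, under the identification \<open>K\<^sup>1 = K\<close>.\<close>

definition Supp1 :: "(('k::field_char_0, unit) op, 'v) module \<Rightarrow> 'k set" where
  "Supp1 M = (\<lambda>\<mu>. \<mu> ()) ` Supp M"

definition simple_weight :: "(('k::field_char_0, 'n::finite) op, 'v) module \<Rightarrow> bool" where
  "simple_weight M \<longleftrightarrow> right_simple II M \<and> weight M"

definition simple_gen_weight :: "(('k::field_char_0, 'n::finite) op, 'v) module \<Rightarrow> bool" where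
  "simple_gen_weight M \<longleftrightarrow> right_simple II M \<and> gen_weight M"


section \<open>The involution and the right module attached to a left module\<close>

text \<open>There is exactly one such map on \<open>\<I>\<^sub>n\<close>: the elements \<open>\<partial>\<^sub>i\<close>, \<open>\<integral>\<^sub>i\<close> and \<open>H\<^sub>i\<close> generate the
  algebra, because \<open>x\<^sub>i = \<integral>\<^sub>i H\<^sub>i\<close>.\<close>

definition is_involution :: "(('k::field_char_0, 'n::finite) op \<Rightarrow> ('k, 'n) op) \<Rightarrow> bool" where
  "is_involution s \<longleftrightarrow> bij_betw s (carrier II) (carrier II) \<and>
     (\<forall>a\<in>carrier II. \<forall>b\<in>carrier II.
        s (a \<oplus>\<^bsub>II\<^esub> b) = s a \<oplus>\<^bsub>II\<^esub> s b \<and> s (a \<otimes>\<^bsub>II\<^esub> b) = s b \<otimes>\<^bsub>II\<^esub> s a) \<and>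
     (\<forall>a\<in>carrier II. s (s a) = a) \<and>
     (\<forall>c. s (Cop c) = Cop c) \<and>
     (\<forall>i. s (Dop i) = Jop i \<and> s (Jop i) = Dop i \<and> s (Hop i) = Hop i)"

definition star :: "('k::field_char_0, 'n::finite) op \<Rightarrow> ('k, 'n) op" where
  "star a = (THE b. \<exists>s. is_involution s \<and> b = s a)"

definition star_module :: "(('k::field_char_0, 'n::finite) op, 'v) module \<Rightarrow> (('k, 'n) op, 'v) module" where
  "star_module M = with_action M (\<lambda>a v. star a \<odot>\<^bsub>M\<^esub> v)"


section \<open>Modules over \<open>\<I>\<^sub>1\<close>\<close>

definition P1 :: "(('k::field_char_0, unit) op, ('k, unit) pol) module" where
  "P1 = \<lparr>carrier = UNIV, monoid.mult = (*), one = 1, zero = 0, add = (+), module.smult = (\<lambda>a p. a p)\<rparr>"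

definition I1_mod_int :: "(('k::field_char_0, unit) op, ('k, unit) op set) module" where
  "I1_mod_int = quot_module (with_action II (\<lambda>a b. b \<otimes>\<^bsub>II\<^esub> a)) {Jop () \<otimes>\<^bsub>II\<^esub> b | b. b \<in> carrier II}"

text \<open>The action on \<open>K[\<partial>]\<close> is prescribed on \<open>K\<close> and on the generators \<open>H\<close>, \<open>\<partial>\<close>, \<open>\<integral>\<close> of \<open>\<I>\<^sub>1\<close>
  (recall \<open>x = \<integral>H\<close>); there is exactly one such action. The power \<open>\<partial>\<^sup>k\<close> is \<open>monom 1 k\<close>.\<close>

definition poly_space :: "'k::field_char_0 poly ring" where
  "poly_space = \<lparr>carrier = UNIV, monoid.mult = (*), one = 1, zero = 0, add = (+)\<rparr>"

definition is_Kd_action :: "(('k::field_char_0, unit) op \<Rightarrow> 'k poly \<Rightarrow> 'k poly) \<Rightarrow> bool" where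
  "is_Kd_action \<sigma> \<longleftrightarrow> right_module II (with_action poly_space \<sigma>) \<and>
     (\<forall>c p. \<sigma> (Cop c) p = Polynomial.smult c p) \<and>
     (\<forall>k. \<sigma> (Hop ()) (Polynomial.monom 1 k) = Polynomial.monom (of_nat k + 1) k) \<and>
     (\<forall>k. \<sigma> (Dop ()) (Polynomial.monom 1 k) = Polynomial.monom 1 (k + 1)) \<and>
     (\<forall>k\<ge>1. \<sigma> (Jop ()) (Polynomial.monom 1 k) = Polynomial.monom 1 (k - 1)) \<and>
     \<sigma> (Jop ()) 1 = 0"

definition Kd :: "(('k::field_char_0, unit) op, 'k poly) module" where
  "Kd = with_action poly_space (\<lambda>a p. THE q. \<exists>\<sigma>. is_Kd_action \<sigma> \<and> q = \<sigma> a p)"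

text \<open>The ideal \<open>F\<close>, as the \<open>K\<close>-linear span of the elements \<open>\<integral>\<^sup>s\<partial>\<^sup>t - \<integral>\<^sup>s\<^sup>+\<^sup>1\<partial>\<^sup>t\<^sup>+\<^sup>1\<close>.\<close>

definition Fideal :: "('k::field_char_0, unit) op set" where
  "Fideal = {(\<lambda>p. \<Sum>(s, t)\<in>T. Cop (c s t)
       ((Jop () ^^ s) ((Dop () ^^ t) p) - (Jop () ^^ (s + 1)) ((Dop () ^^ (t + 1)) p)))
     | T c. finite T}"

definition B1 :: "('k::field_char_0, unit) op set ring" where
  "B1 = II Quot Fideal"

abbreviation toB1 :: "('k::field_char_0, unit) op \<Rightarrow> ('k, unit) op set" where
  "toB1 a \<equiv> Fideal +>\<^bsub>II\<^esub> a"

text \<open>\<open>M(1, \<mu>) = B\<^sub>1/B\<^sub>1(H - \<mu>)\<close> and \<open>B\<^sub>1/(H - \<mu>)B\<^sub>1\<close>, as modules over \<open>\<I>\<^sub>1\<close>.\<close>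

definition M1 :: "'k \<Rightarrow> (('k::field_char_0, unit) op, ('k, unit) op set set) module" where
  "M1 \<mu> = quot_module (with_action B1 (\<lambda>a b. toB1 a \<otimes>\<^bsub>B1\<^esub> b))
     {b \<otimes>\<^bsub>B1\<^esub> toB1 (\<lambda>p. Hop () p - Cop \<mu> p) | b. b \<in> carrier B1}"

definition B1_mod_right :: "'k \<Rightarrow> (('k::field_char_0, unit) op, ('k, unit) op set set) module" where
  "B1_mod_right \<mu> = quot_module (with_action B1 (\<lambda>a b. b \<otimes>\<^bsub>B1\<^esub> toB1 a))
     {toB1 (\<lambda>p. Hop () p - Cop \<mu> p) \<otimes>\<^bsub>B1\<^esub> b | b. b \<in> carrier B1}"


section \<open>Tensor products over \<open>K\<close>\<close>

text \<open>The \<open>K\<close>-space \<open>\<Otimes>\<^sub>i M\<^sub>i\<close> is the free \<open>K\<close>-space on \<open>\<Prod>\<^sub>i M\<^sub>i\<close> modulo the multilinearity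
  relations, where \<open>K\<close> acts on \<open>M\<^sub>i\<close> through \<open>K \<subseteq> \<I>\<^sub>1\<close>.\<close>

definition pm_scale :: "'k::field_char_0 \<Rightarrow> ('f \<Rightarrow>\<^sub>0 'k) \<Rightarrow> ('f \<Rightarrow>\<^sub>0 'k)" where
  "pm_scale c = Poly_Mapping.map ((*) c)"

abbreviation basis_vec :: "'f \<Rightarrow> ('f \<Rightarrow>\<^sub>0 'k::field_char_0)" where
  "basis_vec f \<equiv> Poly_Mapping.single f 1"

definition tfamilies :: "('n \<Rightarrow> (('k::field_char_0, unit) op, 'w) module) \<Rightarrow> ('n \<Rightarrow> 'w) set" where
  "tfamilies M = {f. \<forall>i. f i \<in> carrier (M i)}"

definition tfree :: "('n \<Rightarrow> (('k::field_char_0, unit) op, 'w) module) \<Rightarrow>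
    ('k, ('n \<Rightarrow> 'w) \<Rightarrow>\<^sub>0 'k) module" where
  "tfree M = \<lparr>carrier = {p. Poly_Mapping.keys p \<subseteq> tfamilies M},
     monoid.mult = undefined, one = undefined, zero = 0, add = (+), module.smult = pm_scale\<rparr>"

definition trels :: "('n \<Rightarrow> (('k::field_char_0, unit) op, 'w) module) \<Rightarrow> (('n \<Rightarrow> 'w) \<Rightarrow>\<^sub>0 'k) set" where
  "trels M = module.span pm_scale
     ({basis_vec (f(i := u \<oplus>\<^bsub>M i\<^esub> v)) - basis_vec (f(i := u)) - basis_vec (f(i := v))
        | f i u v. f \<in> tfamilies M \<and> u \<in> carrier (M i) \<and> v \<in> carrier (M i)} \<union>
      {basis_vec (f(i := Cop c \<odot>\<^bsub>M i\<^esub> u)) - pm_scale c (basis_vec (f(i := u)))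
        | f i c u. f \<in> tfamilies M \<and> u \<in> carrier (M i)})"

definition tspace :: "('n \<Rightarrow> (('k::field_char_0, unit) op, 'w) module) \<Rightarrow>
    ('k, (('n \<Rightarrow> 'w) \<Rightarrow>\<^sub>0 'k) set) module" where
  "tspace M = quot_module (tfree M) (trels M)"

definition pure_tensor :: "('n \<Rightarrow> (('k::field_char_0, unit) op, 'w) module) \<Rightarrow> ('n \<Rightarrow> 'w) \<Rightarrow>
    (('n \<Rightarrow> 'w) \<Rightarrow>\<^sub>0 'k) set" where
  "pure_tensor M f = trels M +>\<^bsub>tfree M\<^esub> basis_vec f"

text \<open>The right module structure over \<open>\<I>\<^sub>n = \<I>\<^sub>1(1) \<otimes> \<dots> \<otimes> \<I>\<^sub>1(n)\<close>: the \<open>i\<close>-th factor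
  \<open>\<I>\<^sub>1(i) = K\<langle>x\<^sub>i, \<partial>\<^sub>i, \<integral>\<^sub>i\<rangle> \<simeq> \<I>\<^sub>1\<close> acts on the \<open>i\<close>-th tensor factor. Since the \<open>x\<^sub>i\<close>, \<open>\<partial>\<^sub>i\<close>,
  \<open>\<integral>\<^sub>i\<close> generate \<open>\<I>\<^sub>n\<close>, there is exactly one such action when every \<open>M\<^sub>i\<close> is a right
  \<open>\<I>\<^sub>1\<close>-module.\<close>

definition is_tensor_action :: "('n::finite \<Rightarrow> (('k::field_char_0, unit) op, 'w) module) \<Rightarrow>
    (('k, 'n) op \<Rightarrow> (('n \<Rightarrow> 'w) \<Rightarrow>\<^sub>0 'k) set \<Rightarrow> (('n \<Rightarrow> 'w) \<Rightarrow>\<^sub>0 'k) set) \<Rightarrow> bool" where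
  "is_tensor_action M \<sigma> \<longleftrightarrow> right_module II (with_action (tspace M) \<sigma>) \<and>
     (\<forall>c. \<forall>w\<in>carrier (tspace M). \<sigma> (Cop c) w = c \<odot>\<^bsub>tspace M\<^esub> w) \<and>
     (\<forall>f\<in>tfamilies M. \<forall>i.
        \<sigma> (Xop i) (pure_tensor M f) = pure_tensor M (f(i := Xop () \<odot>\<^bsub>M i\<^esub> f i)) \<and>
        \<sigma> (Dop i) (pure_tensor M f) = pure_tensor M (f(i := Dop () \<odot>\<^bsub>M i\<^esub> f i)) \<and>
        \<sigma> (Jop i) (pure_tensor M f) = pure_tensor M (f(i := Jop () \<odot>\<^bsub>M i\<^esub> f i)))"

definition tensor :: "('n::finite \<Rightarrow> (('k::field_char_0, unit) op, 'w) module) \<Rightarrow>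
    (('k, 'n) op, (('n \<Rightarrow> 'w) \<Rightarrow>\<^sub>0 'k) set) module" where
  "tensor M = with_action (tspace M) (\<lambda>a w. THE u. \<exists>\<sigma>. is_tensor_action M \<sigma> \<and> u = \<sigma> a w)"

end

theory Submission
  imports Defs
begin

text \<open>For a set \<open>T\<close> of directions and \<open>\<rho> \<in> K\<^sup>n\<close>, let \<open>\<nu>\<close> range over the weights with \<open>\<nu>\<^sub>i \<in> \<nat>\<^sub>+\<close> for \<open>i \<in> T\<close> and
  \<open>\<nu>\<^sub>i \<in> \<rho>\<^sub>i + \<int>\<close> otherwise. The vectors \<open>b\<^sub>\<nu>\<close> on which \<open>\<partial>\<^sub>i\<close> and \<open>\<integral>\<^sub>i\<close> shift \<open>\<nu>\<^sub>i\<close> by one, with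
  \<open>b\<^sub>\<nu> \<integral>\<^sub>i = 0\<close> if \<open>i \<in> T\<close> and \<open>\<nu>\<^sub>i = 1\<close>, span a right module: for \<open>T\<close> all of the directions it is
  the transpose of the action on polynomials in divided powers, and a relation between operators
  survives the removal of a direction from \<open>T\<close> because its coefficients are polynomial in \<open>\<nu>\<^sub>i\<close> and
  vanish for all large integers. The weights are distinct and connected by shifts that do not
  vanish, so this module is simple.

  Conversely let \<open>M\<close> be simple with a generalized weight vector, hence with a weight vector. The
  elements killed by all of the \<open>\<integral>\<^sub>i\<^sup>s (1 - \<integral>\<^sub>i \<partial>\<^sub>i)\<close> form a submodule, which is \<open>0\<close> or \<open>M\<close>. If it is
  \<open>M\<close>, then \<open>\<integral>\<^sub>i\<close> and \<open>\<partial>\<^sub>i\<close> are inverse to each other on \<open>M\<close>; otherwise some weight vector is killed by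
  \<open>\<integral>\<^sub>i\<close>. Either way the orbit of a suitable weight vector is a basis as above. Supports and
  isomorphisms are then read off from \<open>T\<close> and \<open>\<rho>\<close> modulo \<open>\<int>\<close>, and the tensor products have
  the product bases.\<close>

section \<open>The generators on coefficients\<close>

text \<open>An element of \<open>II\<close> is a function on polynomials and comes without a normal
  form; the obstacle is to let it act on anything else. Formal words in \<open>expr\<close> replace
  a presentation by generators and relations: a word acts on polynomials through \<open>ev\<close>
  and on weight functions through \<open>evr T\<close>, and \<open>evr_well_defined\<close> says
  that the second action depends only on the first. This justifies choosing words in the standard
  modules, in the action on \<open>K[\<partial>]\<close> and in the action on tensor products. The
  transposition from which it starts also yields the involution. The elements
  \<open>\<integral>\<^sub>i^s (1 - \<integral>\<^sub>i \<partial>\<^sub>i)\<close> have their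
  origin in the ideal \<open>F\<close>: multiplied on the right by the powers of
  \<open>\<partial>\<^sub>i\<close> they span its copy in direction \<open>i\<close>, so that being
  killed by them means being killed by an ideal, which is why they cut out a submodule. On
  polynomials \<open>1 - \<integral>\<^sub>i \<partial>\<^sub>i\<close> projects onto the terms free
  of \<open>x\<^sub>i\<close>, where \<open>H\<^sub>i\<close> is 1. Hence a weight vector pushed
  through such an element gets weight 1 in direction \<open>i\<close> and is killed by
  \<open>\<integral>\<^sub>i\<close>; this is the origin of the lowest weight 1.\<close>

abbreviation lk :: "('a \<Rightarrow>\<^sub>0 'b::zero) \<Rightarrow> 'a \<Rightarrow> 'b" where "lk \<equiv> Poly_Mapping.lookup"
abbreviation sgl :: "'a \<Rightarrow> 'b::zero \<Rightarrow> 'a \<Rightarrow>\<^sub>0 'b" where "sgl \<equiv> Poly_Mapping.single"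
abbreviation eps :: "'n \<Rightarrow> 'n \<Rightarrow>\<^sub>0 nat" where "eps i \<equiv> sgl i (Suc 0)"

lemma poly_mapping_additive_induct [case_names zero single add]:
  assumes "P 0" "\<And>a c. P (sgl a c)" "\<And>p q. P p \<Longrightarrow> P q \<Longrightarrow> P (p + q)"
  shows "P (p :: 'a \<Rightarrow>\<^sub>0 'b::monoid_add)"
proof (induction p rule: update_induct)
  case const
  show ?case by (rule assms(1))
next
  case (update f a b)
  have "Poly_Mapping.update a b f = sgl a b + f"
    using update by (intro poly_mapping_eqI) (auto simp: lookup_update lookup_add lookup_single in_keys_iff when_def)
  with update show ?case by (simp add: assms)
qed

lemma add_eps_minus [simp]: "(\<beta> + eps i) - eps i = (\<beta> :: 'n \<Rightarrow>\<^sub>0 nat)"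
  by simp

lemma minus_add_eps [simp]: "lk \<beta> i \<noteq> 0 \<Longrightarrow> (\<beta> - eps i) + eps i = (\<beta> :: 'n \<Rightarrow>\<^sub>0 nat)"
  by (intro poly_mapping_eqI) (auto simp: lookup_add lookup_minus lookup_single when_def)

lemma lookup_Cop [simp]: "lk (Cop c p) \<beta> = c * lk p \<beta>"
  by (simp add: Cop_def mult_map_scale_conv_mult[symmetric] map.rep_eq when_def)

text \<open>With such coefficient formulas every identity between generators is checked one
  coefficient at a time, without returning to the defining sums.\<close>

lemma lookup_Xop [simp]: "lk (Xop i p) \<beta> = (if lk \<beta> i = 0 then 0 else lk p (\<beta> - eps i))"
proof (induction p rule: poly_mapping_additive_induct)
  case (single a c)
  have "(eps i + a = \<beta>) = (lk \<beta> i \<noteq> 0 \<and> a = \<beta> - eps i)"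
    by (metis add_eps_minus minus_add_eps add.commute lookup_add lookup_single_eq add_is_0 nat.distinct(2))
  then show ?case by (auto simp: Xop_def mult_single lookup_single when_def)
qed (auto simp: Xop_def distrib_left lookup_add)

lemma lookup_Dop [simp]:
  fixes p :: "('k::field_char_0, 'n::finite) pol"
  shows "lk (Dop i p) \<beta> = of_nat (lk \<beta> i + 1) * lk p (\<beta> + eps i)"
proof -
  have "lk (Dop i p) \<beta> = (\<Sum>\<alpha>\<in>Poly_Mapping.keys p. of_nat (lk \<alpha> i) * lk p \<alpha> when \<alpha> - eps i = \<beta>)"
    by (simp add: Dop_def lookup_sum lookup_single)
  also have "\<dots> = (\<Sum>\<alpha>\<in>Poly_Mapping.keys p. if \<alpha> = \<beta> + eps i then of_nat (lk \<alpha> i) * lk p \<alpha> else 0)"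
  proof (rule sum.cong[OF refl])
    fix \<alpha> :: "'n \<Rightarrow>\<^sub>0 nat"
    show "(of_nat (lk \<alpha> i) * lk p \<alpha> when \<alpha> - eps i = \<beta>)
      = (if \<alpha> = \<beta> + eps i then of_nat (lk \<alpha> i) * lk p \<alpha> else 0)"
      \<comment> \<open>Truncated subtraction sends an exponent with \<open>i\<close>-th entry 0 to
        itself, which would be a spurious term; its factor \<open>lk \<alpha> i\<close> is
        0.\<close>
      by (cases "lk \<alpha> i = 0") (auto simp: when_def)
  qed
  also have "\<dots> = of_nat (lk (\<beta> + eps i) i) * lk p (\<beta> + eps i)"
    by (auto simp: in_keys_iff)
  finally show ?thesis by (simp add: lookup_add)
qed

lemma lookup_Jop [simp]:
  "lk (Jop i p) \<beta> = (if lk \<beta> i = 0 then 0 else lk p (\<beta> - eps i) / of_nat (lk \<beta> i))"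
proof -
  have eq: "(\<alpha> + eps i = \<beta>) = (lk \<beta> i \<noteq> 0 \<and> \<alpha> = \<beta> - eps i)" for \<alpha>
    by (metis add_eps_minus minus_add_eps lookup_add lookup_single_eq add_is_0 nat.distinct(2))
  have "lk (Jop i p) \<beta> = (\<Sum>\<alpha>\<in>Poly_Mapping.keys p.
      lk p \<alpha> / (of_nat (lk \<alpha> i) + 1) when \<alpha> + eps i = \<beta>)"
    by (simp add: Jop_def lookup_sum lookup_single)
  also have "\<dots> = (\<Sum>\<alpha>\<in>Poly_Mapping.keys p. if \<alpha> = \<beta> - eps i then
      (if lk \<beta> i = 0 then 0 else lk p \<alpha> / (of_nat (lk \<alpha> i) + 1)) else 0)"
    by (rule sum.cong[OF refl]) (use eq in \<open>auto simp: when_def\<close>)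
  also have "\<dots> = (if lk \<beta> i = 0 then 0 else lk p (\<beta> - eps i) / (of_nat (lk (\<beta> - eps i) i) + 1))"
    by (auto simp: in_keys_iff)
  also have "\<dots> = (if lk \<beta> i = 0 then 0 else lk p (\<beta> - eps i) / of_nat (lk \<beta> i))"
    by (cases "lk \<beta> i") (auto simp: lookup_minus add.commute)
  finally show ?thesis .
qed

lemma lookup_Hop [simp]: "lk (Hop i p) \<beta> = of_nat (lk \<beta> i + 1) * lk p \<beta>"
  by (simp add: Hop_def lookup_add)

section \<open>The algebra as a ring\<close>

text \<open>The letter \<open>x\<^sub>i\<close> is missing because
  \<open>x\<^sub>i = \<integral>\<^sub>i H\<^sub>i\<close>. With the letters
  \<open>\<partial>\<^sub>i\<close>, \<open>\<integral>\<^sub>i\<close>, \<open>H\<^sub>i\<close>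
  the involution permutes letters, and on weight functions each letter is a shift or a
  multiplication.\<close>

datatype ('k, 'n) expr = Sc 'k | GD 'n | GJ 'n | GH 'n
  | Add "('k, 'n) expr" "('k, 'n) expr" | Mul "('k, 'n) expr" "('k, 'n) expr"

primrec ev :: "('k, 'n) expr \<Rightarrow> ('k::field_char_0, 'n::finite) op" where
  "ev (Sc c) = Cop c"
| "ev (GD i) = Dop i"
| "ev (GJ i) = Jop i"
| "ev (GH i) = Hop i"
| "ev (Add a b) = (\<lambda>p. ev a p + ev b p)"
| "ev (Mul a b) = ev a \<circ> ev b"

declare ev.simps(6) [simp del]

lemma ev_Mul [simp]: "ev (Mul a b) = ev a \<circ> ev b"
  by (simp add: ev.simps(6) fun_eq_iff)

text \<open>The involution on words. That it respects equality of operators is a theorem,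
  \<open>ev_st_cong\<close>.\<close>

primrec st :: "('k, 'n) expr \<Rightarrow> ('k, 'n) expr" where
  "st (Sc c) = Sc c"
| "st (GD i) = GJ i"
| "st (GJ i) = GD i"
| "st (GH i) = GH i"
| "st (Add a b) = Add (st a) (st b)"
| "st (Mul a b) = Mul (st b) (st a)"

lemma st_st [simp]: "st (st e) = e"
  by (induction e) auto

lemma one_plus_of_nat_neq_0 [simp]:
  "1 + of_nat n \<noteq> (0 :: 'k::field_char_0)" "of_nat n + 1 \<noteq> (0 :: 'k::field_char_0)"
  by (metis of_nat_neq_0 of_nat_Suc) (metis of_nat_neq_0 of_nat_Suc add.commute)

lemma Xop_eq: "Xop i = Jop i \<circ> Hop i"
  by (intro ext poly_mapping_eqI) (auto simp: lookup_minus)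

text \<open>This opens induction over words for elements of \<open>II\<close>; the one generator
  that has to be rewritten is \<open>Xop i\<close>.\<close>

lemma carrier_II: "carrier II = range ev"
proof
  show "carrier (II :: ('k::field_char_0, 'n::finite) op ring) \<subseteq> range ev"
  proof
    fix a :: "('k, 'n) op"
    assume "a \<in> carrier II"
    then have "a \<in> subalg (range Xop \<union> range Dop \<union> range Jop)" by (simp add: II_def op_ring_def)
    then show "a \<in> range ev"
    proof induction
      case (scalar c) show ?case by (rule range_eqI[of _ _ "Sc c"]) simp
    next
      case (gen a)
      then consider i where "a = Xop i" | i where "a = Dop i" | i where "a = Jop i" by blast
      then show ?case
      proof cases
        case (1 i) then show ?thesis by (intro range_eqI[of _ _ "Mul (GJ i) (GH i)"]) (simp add: Xop_eq)
      next
        case (2 i) then show ?thesis by (intro range_eqI[of _ _ "GD i"]) simp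
      next
        case (3 i) then show ?thesis by (intro range_eqI[of _ _ "GJ i"]) simp
      qed
    next
      case (add a b)
      then obtain e e' where "a = ev e" "b = ev e'" by blast
      then show ?case by (intro range_eqI[of _ _ "Add e e'"]) simp
    next
      case (mult a b)
      then obtain e e' where "a = ev e" "b = ev e'" by blast
      then show ?case by (intro range_eqI[of _ _ "Mul e e'"]) simp
    qed
  qed
  show "range ev \<subseteq> carrier (II :: ('k::field_char_0, 'n::finite) op ring)"
  proof
    fix a :: "('k, 'n) op"
    assume "a \<in> range ev"
    then obtain e where "a = ev e" by auto
    moreover have "ev e \<in> subalg (range Xop \<union> range Dop \<union> range Jop)" for e :: "('k, 'n) expr"
    proof (induction e)
      case (GH i)
      show ?case unfolding ev.simps Hop_def by (rule subalg.mult; rule subalg.gen) auto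
    next
      case (Add a b)
      then show ?case unfolding ev.simps by (rule subalg.add)
    next
      case (Mul a b)
      then show ?case unfolding ev_Mul by (rule subalg.mult)
    qed (auto intro: subalg.scalar subalg.gen)
    ultimately show "a \<in> carrier II" by (simp add: II_def op_ring_def)
  qed
qed

lemma ev_in_carrier_II [simp, intro]: "ev e \<in> carrier II"
  by (simp add: carrier_II)

lemma in_carrier_II [simp, intro]:
  "Cop c \<in> carrier II" "Dop i \<in> carrier II" "Jop i \<in> carrier II" "Hop i \<in> carrier II"
  "Xop i \<in> carrier II"
  using ev_in_carrier_II[of "Sc c"] ev_in_carrier_II[of "GD i"] ev_in_carrier_II[of "GJ i"]
    ev_in_carrier_II[of "GH i"] ev_in_carrier_II[of "Mul (GJ i) (GH i)"]
  by (simp_all add: Xop_eq)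

lemma II_simps [simp]:
  "a \<otimes>\<^bsub>II\<^esub> b = a \<circ> b" "a \<oplus>\<^bsub>II\<^esub> b = (\<lambda>p. a p + b p)" "\<one>\<^bsub>II\<^esub> = id" "\<zero>\<^bsub>II\<^esub> = (\<lambda>_. 0)"
  by (simp_all add: II_def op_ring_def)

lemma Cop_add: "Cop (c + d) p = Cop c p + Cop d p"
  and Cop_mult: "Cop (c * d) p = Cop c (Cop d p)"
  and Cop_1: "Cop 1 = id"
  and Cop_0: "Cop 0 = (\<lambda>_. 0)"
  and Cop_minus_1: "Cop (- 1) p = - p"
  by (intro ext poly_mapping_eqI; simp add: lookup_add algebra_simps)+

lemma gens_add:
  "Cop c (p + q) = Cop c p + Cop c q" "Dop i (p + q) = Dop i p + Dop i q"
  "Jop i (p + q) = Jop i p + Jop i q" "Hop i (p + q) = Hop i p + Hop i q"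
  by (intro poly_mapping_eqI; simp add: lookup_add algebra_simps add_divide_distrib)+

lemma ev_add: "ev e (p + q) = ev e p + ev e q"
  by (induction e arbitrary: p q) (auto simp: gens_add)

text \<open>Pointwise sums satisfy \<open>(a + b) \<circ> c = a \<circ> c + b \<circ> c\<close> for
  arbitrary functions; the other distributive law is where additivity enters. Negatives come from
  the scalar -1.\<close>

lemma subalg_ring:
  assumes "\<And>a p q. a \<in> subalg S \<Longrightarrow> a (p + q) = a p + a q"
  shows "ring (op_ring S)"
proof (rule ringI)
  show "abelian_group (op_ring S)"
  proof (rule abelian_groupI)
    show "\<zero>\<^bsub>op_ring S\<^esub> \<in> carrier (op_ring S)"
      using subalg.scalar[of 0 S] by (simp add: op_ring_def Cop_0)
    fix a assume a: "a \<in> carrier (op_ring S)"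
    then have "Cop (-1) \<circ> a \<in> carrier (op_ring S)"
      by (simp add: op_ring_def subalg.mult subalg.scalar)
    moreover have "(Cop (-1) \<circ> a) \<oplus>\<^bsub>op_ring S\<^esub> a = \<zero>\<^bsub>op_ring S\<^esub>"
      by (simp add: op_ring_def Cop_minus_1)
    ultimately show "\<exists>y\<in>carrier (op_ring S). y \<oplus>\<^bsub>op_ring S\<^esub> a = \<zero>\<^bsub>op_ring S\<^esub>" by blast
  qed (auto simp: op_ring_def algebra_simps intro: subalg.add)
  show "monoid (op_ring S)"
    using subalg.scalar[of 1 S] by (intro monoidI) (auto simp: op_ring_def Cop_1 intro: subalg.mult)
qed (auto simp: op_ring_def assms)

lemma ring_II: "ring II"
  unfolding II_def
proof (rule subalg_ring)
  fix a :: "('k::field_char_0, 'n::finite) op" and p q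
  assume "a \<in> subalg (range Xop \<union> range Dop \<union> range Jop)"
  then have "a \<in> carrier II" by (simp add: II_def op_ring_def)
  then show "a (p + q) = a p + a q" by (auto simp: carrier_II ev_add)
qed

lemma carrier_II_add: "a \<in> carrier II \<Longrightarrow> b \<in> carrier II \<Longrightarrow> (\<lambda>p. a p + b p) \<in> carrier II"
  and carrier_II_mult: "a \<in> carrier II \<Longrightarrow> b \<in> carrier II \<Longrightarrow> a \<circ> b \<in> carrier II"
  and carrier_II_id: "id \<in> carrier II"
  by (auto simp: II_def op_ring_def intro: subalg.intros simp flip: Cop_1)

section \<open>The commutative subalgebra \<open>DD\<close>\<close>

lemma carrier_DD_subset: "carrier DD \<subseteq> carrier II"
proof
  fix a :: "('k::field_char_0, 'n::finite) op"
  assume "a \<in> carrier DD"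
  then have "a \<in> subalg (range Hop)" by (simp add: DD_def op_ring_def)
  then show "a \<in> carrier II"
    by induction (auto simp del: o_apply intro: carrier_II_add carrier_II_mult)
qed

lemma DD_simps [simp]:
  "a \<otimes>\<^bsub>DD\<^esub> b = a \<circ> b" "a \<oplus>\<^bsub>DD\<^esub> b = (\<lambda>p. a p + b p)" "\<one>\<^bsub>DD\<^esub> = id" "\<zero>\<^bsub>DD\<^esub> = (\<lambda>_. 0)"
  by (simp_all add: DD_def op_ring_def)

lemma ring_DD: "ring DD"
  unfolding DD_def
proof (rule subalg_ring)
  fix a :: "('k::field_char_0, 'n::finite) op" and p q
  assume "a \<in> subalg (range Hop)"
  then have "a \<in> carrier II" using carrier_DD_subset by (auto simp: DD_def op_ring_def)
  then show "a (p + q) = a p + a q" by (auto simp: carrier_II ev_add)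
qed

text \<open>Monomials are simultaneous eigenvectors of the \<open>H\<^sub>i\<close>, hence of
  everything they generate. Commutativity of \<open>DD\<close> is read off from this.\<close>

lemma DD_diagonal: "a \<in> carrier DD \<Longrightarrow> \<exists>h. \<forall>p \<beta>. lk (a p) \<beta> = h \<beta> * lk p \<beta>"
proof -
  assume "a \<in> carrier DD"
  then have "a \<in> subalg (range Hop)" by (simp add: DD_def op_ring_def)
  then show ?thesis
  proof induction
    case (scalar c) show ?case by (rule exI[of _ "\<lambda>_. c"]) simp
  next
    case (gen a)
    then obtain i where "a = Hop i" by auto
    then show ?case by (intro exI[of _ "\<lambda>\<beta>. of_nat (lk \<beta> i + 1)"]) simp
  next
    case (add a b)
    then obtain h h' where "\<forall>p \<beta>. lk (a p) \<beta> = h \<beta> * lk p \<beta>" "\<forall>p \<beta>. lk (b p) \<beta> = h' \<beta> * lk p \<beta>" by blast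
    then show ?case by (intro exI[of _ "\<lambda>\<beta>. h \<beta> + h' \<beta>"]) (simp add: lookup_add algebra_simps)
  next
    case (mult a b)
    then obtain h h' where "\<forall>p \<beta>. lk (a p) \<beta> = h \<beta> * lk p \<beta>" "\<forall>p \<beta>. lk (b p) \<beta> = h' \<beta> * lk p \<beta>" by blast
    then show ?case by (intro exI[of _ "\<lambda>\<beta>. h \<beta> * h' \<beta>"]) (simp add: algebra_simps)
  qed
qed

lemma DD_commute: "a \<in> carrier DD \<Longrightarrow> b \<in> carrier DD \<Longrightarrow> a \<circ> b = b \<circ> a"
proof -
  assume "a \<in> carrier DD" "b \<in> carrier DD"
  then obtain h h' where "\<forall>p \<beta>. lk (a p) \<beta> = h \<beta> * lk p \<beta>" "\<forall>p \<beta>. lk (b p) \<beta> = h' \<beta> * lk p \<beta>"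
    using DD_diagonal by meson
  then show ?thesis by (intro ext poly_mapping_eqI) simp
qed

text \<open>The fourth relation is \<open>(1 - \<integral>\<^sub>i \<partial>\<^sub>i) (H\<^sub>i -
  1) = 0\<close> rearranged so that only sums occur: the first factor projects onto the terms free
  of \<open>x\<^sub>i\<close>, on which \<open>H\<^sub>i\<close> is the identity.\<close>

lemma op_relations:
  fixes i :: "'n::finite"
  shows "Dop i \<circ> Jop i = (id :: ('k::field_char_0, 'n) op)"
  "Dop i \<circ> Hop i = (\<lambda>p. (Hop i \<circ> Dop i) p + Dop i p :: ('k, 'n) pol)"
  "Hop i \<circ> Jop i = (\<lambda>p. (Jop i \<circ> Hop i) p + Jop i p :: ('k, 'n) pol)"
  "(\<lambda>p. Hop i p + Jop i (Dop i p)) = (\<lambda>p. Jop i (Dop i (Hop i p)) + p :: ('k, 'n) pol)"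
proof -
  note [simp] = lookup_add lookup_minus
  have nz: "of_nat (lk \<beta> i) \<noteq> (0 :: 'k)" if "lk \<beta> i \<noteq> 0" for \<beta> :: "'n \<Rightarrow>\<^sub>0 nat"
    using that by simp
  have JD: "lk (Jop i (Dop i p)) \<beta> = (if lk \<beta> i = 0 then 0 else lk p \<beta>)" for p :: "('k, 'n) pol" and \<beta>
    by (cases "lk \<beta> i") auto
  show "Dop i \<circ> Jop i = (id :: ('k, 'n) op)"
    by (intro ext poly_mapping_eqI) simp
  show "Dop i \<circ> Hop i = (\<lambda>p. (Hop i \<circ> Dop i) p + Dop i p :: ('k, 'n) pol)"
    by (intro ext poly_mapping_eqI) (simp add: algebra_simps)
  show "Hop i \<circ> Jop i = (\<lambda>p. (Jop i \<circ> Hop i) p + Jop i p :: ('k, 'n) pol)"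
    by (intro ext poly_mapping_eqI) (auto simp: add_divide_distrib distrib_right)
  show "(\<lambda>p. Hop i p + Jop i (Dop i p)) = (\<lambda>p. Jop i (Dop i (Hop i p)) + p :: ('k, 'n) pol)"
    by (intro ext poly_mapping_eqI) (auto simp: JD distrib_right simp del: lookup_Jop lookup_Dop)
qed

lemma add_eps_commute: "i \<noteq> j \<Longrightarrow> \<beta> - eps i + eps j = (\<beta> + eps j) - (eps i :: 'n \<Rightarrow>\<^sub>0 nat)"
  by (intro poly_mapping_eqI) (auto simp: lookup_add lookup_minus lookup_single when_def)

lemma op_commute:
  fixes i j :: "'n::finite"
  assumes "i \<noteq> j"
  shows "Dop i \<circ> Dop j = (Dop j \<circ> Dop i :: ('k::field_char_0, 'n) op)"
    "Dop i \<circ> Jop j = (Jop j \<circ> Dop i :: ('k::field_char_0, 'n) op)"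
    "Dop i \<circ> Hop j = (Hop j \<circ> Dop i :: ('k::field_char_0, 'n) op)"
    "Jop i \<circ> Dop j = (Dop j \<circ> Jop i :: ('k::field_char_0, 'n) op)"
    "Jop i \<circ> Jop j = (Jop j \<circ> Jop i :: ('k::field_char_0, 'n) op)"
    "Jop i \<circ> Hop j = (Hop j \<circ> Jop i :: ('k::field_char_0, 'n) op)"
    "Hop i \<circ> Dop j = (Dop j \<circ> Hop i :: ('k::field_char_0, 'n) op)"
    "Hop i \<circ> Jop j = (Jop j \<circ> Hop i :: ('k::field_char_0, 'n) op)"
    "Hop i \<circ> Hop j = (Hop j \<circ> Hop i :: ('k::field_char_0, 'n) op)"
proof -
  note [simp] = lookup_add lookup_minus lookup_single assms assms[symmetric]
  have 1: "\<beta> - eps i + eps j = (\<beta> + eps j) - eps i" "\<beta> - eps j + eps i = (\<beta> + eps i) - eps j"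
    for \<beta> :: "'n \<Rightarrow>\<^sub>0 nat"
    by (simp_all only: add_eps_commute assms assms[symmetric] not_False_eq_True)
  have 2: "\<beta> + eps j + eps i = \<beta> + eps i + eps j" "\<beta> - eps j - eps i = \<beta> - eps i - eps j"
    for \<beta> :: "'n \<Rightarrow>\<^sub>0 nat"
    by (simp_all only: ac_simps diff_diff_add)
  show "Dop i \<circ> Dop j = (Dop j \<circ> Dop i :: ('k, 'n) op)"
    "Dop i \<circ> Jop j = (Jop j \<circ> Dop i :: ('k, 'n) op)"
    "Dop i \<circ> Hop j = (Hop j \<circ> Dop i :: ('k, 'n) op)"
    "Jop i \<circ> Dop j = (Dop j \<circ> Jop i :: ('k, 'n) op)"
    "Jop i \<circ> Jop j = (Jop j \<circ> Jop i :: ('k, 'n) op)"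
    "Jop i \<circ> Hop j = (Hop j \<circ> Jop i :: ('k, 'n) op)"
    "Hop i \<circ> Dop j = (Dop j \<circ> Hop i :: ('k, 'n) op)"
    "Hop i \<circ> Jop j = (Jop j \<circ> Hop i :: ('k, 'n) op)"
    "Hop i \<circ> Hop j = (Hop j \<circ> Hop i :: ('k, 'n) op)"
    by (intro ext poly_mapping_eqI, simp only: o_def lookup_Dop lookup_Jop lookup_Hop lookup_add
        lookup_minus 1 2, simp add: field_simps)+
qed

lemma Cop_commute: "a \<in> carrier II \<Longrightarrow> a \<circ> Cop c = Cop c \<circ> a"
proof -
  have "ev e \<circ> Cop c = Cop c \<circ> ev e" for e :: "('k::field_char_0, 'n::finite) expr" and c
  proof (induction e)
    case (Add a b)
    then show ?case by (auto simp: fun_eq_iff gens_add)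
  next
    case (Mul a b)
    then show ?case by (auto simp: fun_eq_iff)
  qed (intro ext poly_mapping_eqI, simp add: algebra_simps)+
  then show "a \<in> carrier II \<Longrightarrow> a \<circ> Cop c = Cop c \<circ> a" by (auto simp: carrier_II)
qed

section \<open>Finitely supported functions on weights\<close>

definition fs :: "'a set \<Rightarrow> ('a \<Rightarrow> 'c::zero) set" where
  "fs S = {f. finite {\<nu>. f \<nu> \<noteq> 0} \<and> (\<forall>\<nu>. \<nu> \<notin> S \<longrightarrow> f \<nu> = 0)}"

definition delta :: "'a \<Rightarrow> 'a \<Rightarrow> 'c::zero_neq_one" where
  "delta \<mu> = (\<lambda>\<nu>. if \<nu> = \<mu> then 1 else 0)"

lemma fsI: "finite {\<nu>. f \<nu> \<noteq> 0} \<Longrightarrow> (\<And>\<nu>. f \<nu> \<noteq> 0 \<Longrightarrow> \<nu> \<in> S) \<Longrightarrow> f \<in> fs S"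
  unfolding fs_def by auto

lemma fs_finite: "f \<in> fs S \<Longrightarrow> finite {\<nu>. f \<nu> \<noteq> 0}"
  and fs_out: "f \<in> fs S \<Longrightarrow> \<nu> \<notin> S \<Longrightarrow> f \<nu> = 0"
  and fs_in: "f \<in> fs S \<Longrightarrow> f \<nu> \<noteq> 0 \<Longrightarrow> \<nu> \<in> S"
  unfolding fs_def by auto

lemma fs_zero [simp]: "(\<lambda>_. 0) \<in> fs S"
  by (simp add: fs_def)

lemma fs_delta [simp]: "\<mu> \<in> S \<Longrightarrow> delta \<mu> \<in> fs S"
  by (simp add: fs_def delta_def)

lemma fs_add: "f \<in> fs S \<Longrightarrow> g \<in> fs S \<Longrightarrow> (\<lambda>\<nu>. f \<nu> + g \<nu> :: 'c::monoid_add) \<in> fs S"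
  by (rule fsI, rule finite_subset[of _ "{\<nu>. f \<nu> \<noteq> 0} \<union> {\<nu>. g \<nu> \<noteq> 0}"])
    (auto simp: fs_finite dest: fs_out, metis add_0 fs_out)

lemma fs_scale: "f \<in> fs S \<Longrightarrow> (\<lambda>\<nu>. h \<nu> * f \<nu> :: 'c::mult_zero) \<in> fs S"
  by (rule fsI, rule finite_subset[of _ "{\<nu>. f \<nu> \<noteq> 0}"]) (auto simp: fs_def)

lemma fs_mono: "S \<subseteq> S' \<Longrightarrow> f \<in> fs S \<Longrightarrow> f \<in> fs S'"
  by (auto simp: fs_def)

lemma fs_induct [consumes 1, case_names zero add]:
  fixes f :: "'a \<Rightarrow> 'c::ring_1"
  assumes "f \<in> fs S" and "P (\<lambda>_. 0)"
    and step: "\<And>g \<nu> c. g \<in> fs S \<Longrightarrow> \<nu> \<in> S \<Longrightarrow> P g \<Longrightarrow> P (\<lambda>\<kappa>. c * delta \<nu> \<kappa> + g \<kappa>)"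
  shows "P f"
proof -
  have "finite A \<Longrightarrow> f \<in> fs S \<Longrightarrow> {\<nu>. f \<nu> \<noteq> 0} \<subseteq> A \<Longrightarrow> P f" for A f
  proof (induction A arbitrary: f rule: finite_induct)
    case empty
    then have "f = (\<lambda>_. 0)" by auto
    then show ?case using assms(2) by simp
  next
    case (insert x A)
    show ?case
    proof (cases "x \<in> S")
      case True
      have "f(x := 0) \<in> fs S"
        using insert.prems(1) by (auto simp: fs_def elim: rev_finite_subset)
      moreover have "{\<nu>. (f(x := 0)) \<nu> \<noteq> 0} \<subseteq> A" using insert.prems by auto
      ultimately have "P (f(x := 0))" by (rule insert.IH)
      with \<open>f(x := 0) \<in> fs S\<close> True have "P (\<lambda>\<kappa>. f x * delta x \<kappa> + (f(x := 0)) \<kappa>)" by (intro step)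
      also have "(\<lambda>\<kappa>. f x * delta x \<kappa> + (f(x := 0)) \<kappa>) = f" by (auto simp: delta_def)
      finally show ?thesis .
    next
      case False
      then have "f x = 0" using insert.prems(1) by (simp add: fs_out)
      then show ?thesis using insert by blast
    qed
  qed
  then show ?thesis using assms(1) fs_finite[OF assms(1)] by blast
qed

lemma inj_shift: "inj (\<lambda>\<nu>. \<nu>(i := \<nu> i + c :: 'k::ab_group_add))"
  by (rule inj_on_inverseI[of _ "\<lambda>\<nu>. \<nu>(i := \<nu> i - c)"]) simp

lemma finite_shift:
  assumes "finite {\<nu>. f \<nu> \<noteq> 0}"
  shows "finite {\<nu>. f (\<nu>(i := \<nu> i + c :: 'k::ab_group_add)) \<noteq> 0}"
  using finite_vimageI[OF assms inj_shift[of i c]] by (simp add: vimage_def)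

section \<open>The right action of the generators\<close>

text \<open>The functions \<open>f\<close> stand for \<open>\<Sum>\<nu>. f \<nu> b\<^sub>\<nu>\<close>, where \<open>b\<^sub>\<nu>\<close> has weight \<open>\<nu>\<close>, \<open>b\<^sub>\<nu> \<partial>\<^sub>i = b\<^sub>\<nu>\<^sub>+\<^sub>e\<^sub>i\<close>, and
  \<open>b\<^sub>\<nu> \<integral>\<^sub>i = b\<^sub>\<nu>\<^sub>-\<^sub>e\<^sub>i\<close> except that \<open>b\<^sub>\<nu> \<integral>\<^sub>i = 0\<close> if \<open>i \<in> T\<close> and \<open>\<nu>\<^sub>i = 1\<close>.\<close>

definition Dm :: "'n \<Rightarrow> (('n \<Rightarrow> 'k::field_char_0) \<Rightarrow> 'k) \<Rightarrow> ('n \<Rightarrow> 'k) \<Rightarrow> 'k" where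
  "Dm i f = (\<lambda>\<nu>. f (\<nu>(i := \<nu> i - 1)))"

text \<open>Seen on coefficients, the exceptional case sits at the target: the term that would come
  down from weight 1 to weight 0 is the one that is dropped.\<close>

definition Jm :: "'n set \<Rightarrow> 'n \<Rightarrow> (('n \<Rightarrow> 'k::field_char_0) \<Rightarrow> 'k) \<Rightarrow> ('n \<Rightarrow> 'k) \<Rightarrow> 'k" where
  "Jm T i f = (\<lambda>\<nu>. if i \<in> T \<and> \<nu> i = 0 then 0 else f (\<nu>(i := \<nu> i + 1)))"

definition Hm :: "'n \<Rightarrow> (('n \<Rightarrow> 'k::field_char_0) \<Rightarrow> 'k) \<Rightarrow> ('n \<Rightarrow> 'k) \<Rightarrow> 'k" where
  "Hm i f = (\<lambda>\<nu>. \<nu> i * f \<nu>)"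

text \<open>In \<open>Mul a b\<close> the word \<open>a\<close> acts before \<open>b\<close>, as a
  product does on a right module; \<open>ev\<close> has the opposite order.\<close>

primrec evr :: "'n set \<Rightarrow> ('k::field_char_0, 'n) expr \<Rightarrow> (('n \<Rightarrow> 'k) \<Rightarrow> 'k) \<Rightarrow> ('n \<Rightarrow> 'k) \<Rightarrow> 'k" where
  "evr T (Sc c) f = (\<lambda>\<nu>. c * f \<nu>)"
| "evr T (GD i) f = Dm i f"
| "evr T (GJ i) f = Jm T i f"
| "evr T (GH i) f = Hm i f"
| "evr T (Add a b) f = (\<lambda>\<nu>. evr T a f \<nu> + evr T b f \<nu>)"
| "evr T (Mul a b) f = evr T b (evr T a f)"

text \<open>Exactly what makes \<open>fs S\<close> stable under the generators: a step down may
  leave \<open>S\<close> only where \<open>Jm\<close> drops the term.\<close>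

definition step_closed :: "'n set \<Rightarrow> ('n \<Rightarrow> 'k::field_char_0) set \<Rightarrow> bool" where
  "step_closed T S \<longleftrightarrow> (\<forall>\<nu>\<in>S. \<forall>i. \<nu>(i := \<nu> i + 1) \<in> S \<and>
     (i \<in> T \<and> \<nu> i = 1 \<or> \<nu>(i := \<nu> i - 1) \<in> S))"

definition wtset :: "'n set \<Rightarrow> ('n \<Rightarrow> 'k::field_char_0) \<Rightarrow> ('n \<Rightarrow> 'k) set" where
  "wtset T \<rho> = {\<mu>. \<forall>k. if k \<in> T then \<exists>m::nat. \<mu> k = of_nat m + 1 else \<exists>m::int. \<mu> k = \<rho> k + of_int m}"

text \<open>The components outside \<open>T\<close> are left free, not confined to one class modulo
  the integers. The extrapolation in \<open>evr_eq_step\<close> has to move such a component between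
  positive integers and an arbitrary value.\<close>

definition posset :: "'n set \<Rightarrow> ('n \<Rightarrow> 'k::field_char_0) set" where
  "posset T = {\<mu>. \<forall>k\<in>T. \<exists>m::nat. \<mu> k = of_nat m + 1}"

lemma wtset_subset: "wtset T \<rho> \<subseteq> posset T"
  by (auto simp: wtset_def posset_def)

lemma pos_step:
  assumes "\<exists>m::nat. x = of_nat m + (1 :: 'k::field_char_0)"
  shows "\<exists>m::nat. x = of_nat m" "x \<noteq> 0" "x = 1 \<or> (\<exists>m::nat. x - 1 = of_nat m + 1)"
proof -
  from assms obtain m where m: "x = of_nat m + 1" by blast
  then show "x \<noteq> 0" by simp
  show "\<exists>m::nat. x = of_nat m" using m by (intro exI[of _ "Suc m"]) simp
  show "x = 1 \<or> (\<exists>m::nat. x - 1 = of_nat m + 1)" using m by (cases m) auto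
qed

lemma step_closed_posset: "step_closed T (posset T)"
  unfolding step_closed_def
proof (intro ballI allI conjI)
  fix \<nu> i
  assume \<nu>: "\<nu> \<in> posset T"
  have *: "\<exists>m::nat. \<nu> k = of_nat m + 1" if "k \<in> T" for k using \<nu> that by (simp add: posset_def)
  show "\<nu>(i := \<nu> i + 1) \<in> posset T"
    using * pos_step(1)[of "\<nu> i"] by (auto simp: posset_def)
  show "i \<in> T \<and> \<nu> i = 1 \<or> \<nu>(i := \<nu> i - 1) \<in> posset T"
  proof (cases "i \<in> T \<and> \<nu> i \<noteq> 1")
    case True
    then show ?thesis using * pos_step(3)[of "\<nu> i"] by (simp add: posset_def)
  next
    case False
    then show ?thesis using * by (auto simp: posset_def)
  qed
qed

lemma step_closed_wtset: "step_closed T (wtset T \<rho>)"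
  unfolding step_closed_def
proof (intro ballI allI conjI)
  fix \<nu> i
  assume \<nu>: "\<nu> \<in> wtset T \<rho>"
  have *: "\<exists>m::int. x + 1 = l + of_int m" "\<exists>m::int. x - 1 = l + of_int m"
    if "\<exists>m::int. x = l + of_int m" for x l :: 'b
    using that by (auto intro: exI[of _ "_ + 1 :: int"] exI[of _ "_ - 1 :: int"])
  show "\<nu>(i := \<nu> i + 1) \<in> wtset T \<rho>"
    using \<nu> pos_step(1)[of "\<nu> i"] *[of "\<nu> i" "\<rho> i"] by (auto simp: wtset_def)
  show "i \<in> T \<and> \<nu> i = 1 \<or> \<nu>(i := \<nu> i - 1) \<in> wtset T \<rho>"
    using \<nu> pos_step(3)[of "\<nu> i"] *[of "\<nu> i" "\<rho> i"] by (auto simp: wtset_def)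
qed

lemma fs_Dm:
  assumes "step_closed T S" "f \<in> fs S" shows "Dm i f \<in> fs S"
proof (rule fsI)
  show "finite {\<nu>. Dm i f \<nu> \<noteq> 0}"
    using finite_shift[OF fs_finite[OF assms(2)], of i "-1"] by (simp add: Dm_def)
  fix \<nu> assume "Dm i f \<nu> \<noteq> 0"
  then have "\<nu>(i := \<nu> i - 1) \<in> S" using assms(2) by (auto simp: Dm_def dest: fs_in)
  then have "(\<nu>(i := \<nu> i - 1))(i := (\<nu>(i := \<nu> i - 1)) i + 1) \<in> S"
    using assms(1) unfolding step_closed_def by blast
  then show "\<nu> \<in> S" by simp
qed

lemma fs_Jm:
  assumes "step_closed T S" "f \<in> fs S" shows "Jm T i f \<in> fs S"
proof (rule fsI)
  show "finite {\<nu>. Jm T i f \<nu> \<noteq> 0}"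
    by (rule finite_subset[OF _ finite_shift[OF fs_finite[OF assms(2)], of i 1]])
      (auto simp: Jm_def split: if_splits)
  fix \<nu> assume *: "Jm T i f \<nu> \<noteq> 0"
  then have "\<nu>(i := \<nu> i + 1) \<in> S"
    using assms(2) by (auto simp: Jm_def dest: fs_in split: if_splits)
  moreover from * have "\<not> (i \<in> T \<and> (\<nu>(i := \<nu> i + 1)) i = 1)" by (auto simp: Jm_def)
  ultimately have "(\<nu>(i := \<nu> i + 1))(i := (\<nu>(i := \<nu> i + 1)) i - 1) \<in> S"
    using assms(1) unfolding step_closed_def by blast
  then show "\<nu> \<in> S" by simp
qed

lemma fs_evr: "step_closed T S \<Longrightarrow> f \<in> fs S \<Longrightarrow> evr T e f \<in> fs S"
  by (induction e arbitrary: f) (auto simp: fs_Dm fs_Jm Hm_def intro: fs_add fs_scale)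

lemma evr_add: "evr T e (\<lambda>\<nu>. f \<nu> + g \<nu>) = (\<lambda>\<nu>. evr T e f \<nu> + evr T e g \<nu>)"
  by (induction e arbitrary: f g) (auto simp: Dm_def Jm_def Hm_def algebra_simps)

lemma evr_scale: "evr T e (\<lambda>\<nu>. c * f \<nu>) = (\<lambda>\<nu>. c * evr T e f \<nu>)"
  by (induction e arbitrary: f) (auto simp: Dm_def Jm_def Hm_def algebra_simps)

lemma evr_zero: "evr T e (\<lambda>\<nu>. 0) = (\<lambda>\<nu>. 0)"
  using evr_scale[of T e 0 "\<lambda>_. 0"] by simp

lemma evr_eqI:
  assumes "\<And>\<nu>. \<nu> \<in> S \<Longrightarrow> evr T e (delta \<nu>) = evr T e' (delta \<nu>)" "f \<in> fs S"
  shows "evr T e f = evr T e' f"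
  using assms(2) by (induction rule: fs_induct) (simp_all add: evr_zero evr_add evr_scale assms(1))

section \<open>Polynomials as functions on weights\<close>

text \<open>The weight of a monomial: \<open>H\<^sub>i = \<partial>\<^sub>i x\<^sub>i\<close>
  multiplies \<open>x^\<alpha>\<close> by \<open>\<alpha>\<^sub>i + 1\<close>, so weights begin at
  1.\<close>

definition wtm :: "('n::finite \<Rightarrow>\<^sub>0 nat) \<Rightarrow> 'n \<Rightarrow> 'k::field_char_0" where
  "wtm \<alpha> = (\<lambda>i. of_nat (lk \<alpha> i) + 1)"

lemma inj_wtm: "inj wtm"
  by (auto intro!: injI poly_mapping_eqI simp: wtm_def fun_eq_iff)

lemma range_wtm: "range wtm = posset UNIV"
proof
  show "posset UNIV \<subseteq> range (wtm :: ('n::finite \<Rightarrow>\<^sub>0 nat) \<Rightarrow> 'n \<Rightarrow> 'k::field_char_0)"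
  proof
    fix \<mu> :: "'n \<Rightarrow> 'k" assume "\<mu> \<in> posset UNIV"
    then obtain m :: "'n \<Rightarrow> nat" where "\<And>i. \<mu> i = of_nat (m i) + 1" by (simp add: posset_def) metis
    then have "\<mu> = wtm (Abs_poly_mapping m)" by (auto simp: wtm_def)
    then show "\<mu> \<in> range wtm" by simp
  qed
qed (auto simp: wtm_def posset_def)

lemma wtm_eps: "wtm (\<alpha> + eps i) = (wtm \<alpha>)(i := wtm \<alpha> i + 1)"
  by (auto simp: wtm_def lookup_add lookup_single when_def)

lemma wtm_minus_eps: "lk \<alpha> i \<noteq> 0 \<Longrightarrow> wtm (\<alpha> - eps i) = (wtm \<alpha>)(i := wtm \<alpha> i - 1)"
  by (auto simp: wtm_def lookup_minus lookup_single when_def of_nat_diff)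

text \<open>The factorial of a multi-index, the rescaling under which derivation and integration
  become shifts without coefficients.\<close>

definition fct :: "('n::finite \<Rightarrow>\<^sub>0 nat) \<Rightarrow> 'k::field_char_0" where
  "fct \<alpha> = (\<Prod>i\<in>UNIV. fact (lk \<alpha> i))"

lemma fct_eps: "fct (\<alpha> + eps i) = of_nat (lk \<alpha> i + 1) * fct \<alpha>"
proof -
  have "fct (\<alpha> + eps i) = fact (lk (\<alpha> + eps i) i) * (\<Prod>j\<in>UNIV - {i}. fact (lk (\<alpha> + eps i) j))"
    unfolding fct_def by (rule prod.remove) auto
  also have "(\<Prod>j\<in>UNIV - {i}. fact (lk (\<alpha> + eps i) j)) = (\<Prod>j\<in>UNIV - {i}. fact (lk \<alpha> j))"
    by (rule prod.cong) (auto simp: lookup_add lookup_single)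
  also have "fact (lk (\<alpha> + eps i) i) * \<dots> = of_nat (lk \<alpha> i + 1) * (fact (lk \<alpha> i) * (\<Prod>j\<in>UNIV - {i}. fact (lk \<alpha> j)))"
    by (simp add: lookup_add algebra_simps)
  also have "fact (lk \<alpha> i) * (\<Prod>j\<in>UNIV - {i}. fact (lk \<alpha> j)) = fct \<alpha>"
    unfolding fct_def by (rule prod.remove[symmetric]) auto
  finally show ?thesis .
qed

lemma fct_neq_0 [simp]: "fct \<alpha> \<noteq> 0"
  by (simp add: fct_def)

text \<open>The coefficients with respect to the divided powers \<open>x\<^sup>\<alpha> / \<alpha>!\<close>, placed at the weight \<open>\<alpha> + 1\<close>.\<close>

definition divided :: "('k::field_char_0, 'n::finite) pol \<Rightarrow> ('n \<Rightarrow> 'k) \<Rightarrow> 'k" where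
  "divided p \<nu> = (if \<nu> \<in> posset UNIV then fct (the_inv wtm \<nu>) * lk p (the_inv wtm \<nu>) else 0)"

lemma divided_wtm [simp]: "divided p (wtm \<alpha>) = fct \<alpha> * lk p \<alpha>"
  by (auto simp: divided_def range_wtm[symmetric] the_inv_f_f[OF inj_wtm])

lemma divided_out: "\<nu> \<notin> posset UNIV \<Longrightarrow> divided p \<nu> = 0"
  by (simp add: divided_def)

lemma divided_eqI:
  assumes "\<And>\<alpha>. f (wtm \<alpha>) = g (wtm \<alpha>)" "\<And>\<nu>. \<nu> \<notin> posset UNIV \<Longrightarrow> f \<nu> = 0" "\<And>\<nu>. \<nu> \<notin> posset UNIV \<Longrightarrow> g \<nu> = 0"
  shows "f = g"
proof
  fix \<nu> show "f \<nu> = g \<nu>"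
    using assms by (cases "\<nu> \<in> posset UNIV") (auto simp: range_wtm[symmetric])
qed

lemma inj_divided: "inj divided"
proof (rule injI, rule poly_mapping_eqI)
  fix p q :: "('k::field_char_0, 'n::finite) pol" and \<alpha>
  assume "divided p = divided q"
  then have "divided p (wtm \<alpha>) = divided q (wtm \<alpha>)" by simp
  then show "lk p \<alpha> = lk q \<alpha>" by simp
qed

lemma divided_fs: "divided p \<in> fs (posset UNIV)"
proof (rule fsI)
  have "{\<nu>. divided p \<nu> \<noteq> 0} \<subseteq> wtm ` Poly_Mapping.keys p"
  proof
    fix \<nu> assume *: "\<nu> \<in> {\<nu>. divided p \<nu> \<noteq> 0}"
    then have "\<nu> \<in> posset UNIV" using divided_out by blast
    then obtain \<alpha> where "\<nu> = wtm \<alpha>" by (auto simp: range_wtm[symmetric])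
    with * show "\<nu> \<in> wtm ` Poly_Mapping.keys p" by (auto simp: in_keys_iff)
  qed
  then show "finite {\<nu>. divided p \<nu> \<noteq> 0}" by (rule finite_subset) simp
qed (use divided_out in blast)

lemma divided_surj: "f \<in> fs (posset UNIV) \<Longrightarrow> \<exists>p. f = divided p"
proof -
  assume f: "f \<in> fs (posset UNIV)"
  have "finite {\<alpha>. f (wtm \<alpha>) \<noteq> 0}"
    using finite_vimageI[OF fs_finite[OF f] inj_wtm] by (simp add: vimage_def)
  then have "finite {\<alpha>. f (wtm \<alpha>) / fct \<alpha> \<noteq> 0}" by simp
  then have "f = divided (Abs_poly_mapping (\<lambda>\<alpha>. f (wtm \<alpha>) / fct \<alpha>))"
    by (intro divided_eqI) (auto simp: divided_out fs_out[OF f])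
  then show ?thesis ..
qed

text \<open>On divided powers \<open>\<partial>\<^sub>i\<close> and
  \<open>\<integral>\<^sub>i\<close> are the plain shifts down and up. These are the maps
  \<open>Jm UNIV i\<close> and \<open>Dm i\<close> belonging to the opposite letters, and operators
  compose in the opposite order to \<open>evr\<close>; both facts together give
  \<open>st\<close>.\<close>

lemma divided_ev:
  fixes p :: "('k::field_char_0, 'n::finite) pol"
  shows "divided (ev e p) = evr UNIV (st e) (divided p)"
proof (induction e arbitrary: p)
  case (GD i)
  show ?case
  proof (rule divided_eqI)
    fix \<nu> :: "'n \<Rightarrow> 'k" assume "\<nu> \<notin> posset UNIV"
    then show "evr UNIV (st (GD i)) (divided p) \<nu> = 0"
      using fs_out[OF fs_Jm[OF step_closed_posset divided_fs]] by simp
  next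
    fix \<alpha> :: "'n \<Rightarrow>\<^sub>0 nat"
    have "wtm \<alpha> i \<noteq> (0 :: 'k)" by (simp add: wtm_def)
    then show "divided (ev (GD i) p) (wtm \<alpha>) = evr UNIV (st (GD i)) (divided p) (wtm \<alpha>)"
      by (simp add: Jm_def wtm_eps[symmetric] fct_eps)
  qed (simp add: divided_out)
next
  case (GJ i)
  show ?case
  proof (rule divided_eqI)
    fix \<nu> :: "'n \<Rightarrow> 'k" assume "\<nu> \<notin> posset UNIV"
    then show "evr UNIV (st (GJ i)) (divided p) \<nu> = 0"
      using fs_out[OF fs_Dm[OF step_closed_posset divided_fs]] by simp
  next
    fix \<alpha> :: "'n \<Rightarrow>\<^sub>0 nat"
    show "divided (ev (GJ i) p) (wtm \<alpha>) = evr UNIV (st (GJ i)) (divided p) (wtm \<alpha>)"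
    proof (cases "lk \<alpha> i = 0")
      case True
      \<comment> \<open>An integral has no term free of \<open>x\<^sub>i\<close>; on the other side
        the lowered weight has \<open>i\<close>-th component 0, where \<open>divided p\<close>
        vanishes.\<close>
      then have "(wtm \<alpha>)(i := wtm \<alpha> i - 1) \<notin> (posset UNIV :: ('n \<Rightarrow> 'k) set)"
        by (auto simp: posset_def wtm_def intro!: exI[of _ i])
      with True show ?thesis by (simp add: Dm_def divided_out)
    next
      case False
      then have "fct \<alpha> = of_nat (lk \<alpha> i) * (fct (\<alpha> - eps i) :: 'k)"
        using fct_eps[of "\<alpha> - eps i" i] by (simp add: lookup_minus)
      with False show ?thesis by (simp add: Dm_def wtm_minus_eps[symmetric])
    qed
  qed (simp add: divided_out)
next
  case (Add a b)
  have "divided (p + q) = (\<lambda>\<nu>. divided p \<nu> + divided q \<nu>)" for p q :: "('k, 'n) pol"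
    by (intro divided_eqI) (simp_all add: divided_out lookup_add distrib_left)
  with Add show ?case by simp
next
  case (GH i)
  show ?case by (intro divided_eqI) (simp_all add: divided_out Hm_def, simp add: wtm_def algebra_simps)
qed (auto intro!: divided_eqI simp: divided_out)

section \<open>Relations between operators hold in the weight modules\<close>

text \<open>Summation over the support of \<open>f\<close> keeps the sum finite for arbitrary
  \<open>g\<close>, which makes linearity in \<open>g\<close> immediate; symmetry is a separate
  lemma.\<close>

definition pairing :: "('a \<Rightarrow> 'k::field_char_0) \<Rightarrow> ('a \<Rightarrow> 'k) \<Rightarrow> 'k" where
  "pairing f g = (\<Sum>\<nu> | f \<nu> \<noteq> 0. f \<nu> * g \<nu>)"

lemma pairing_sum: "finite A \<Longrightarrow> {\<nu>. f \<nu> \<noteq> 0} \<subseteq> A \<Longrightarrow> pairing f g = (\<Sum>\<nu>\<in>A. f \<nu> * g \<nu>)"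
  unfolding pairing_def by (rule sum.mono_neutral_left) auto

lemma pairing_commute:
  assumes "f \<in> fs S" "g \<in> fs S" shows "pairing f g = pairing g f"
proof -
  let ?A = "{\<nu>. f \<nu> \<noteq> 0} \<union> {\<nu>. g \<nu> \<noteq> 0}"
  have "finite ?A" using assms by (simp add: fs_finite)
  then show ?thesis
    using pairing_sum[of ?A f g] pairing_sum[of ?A g f] by (simp add: mult.commute)
qed

lemma pairing_delta:
  assumes "f \<in> fs S" shows "pairing f (delta \<nu>) = f \<nu>"
  using fs_finite[OF assms] by (simp add: pairing_def delta_def if_distrib cong: if_cong)

lemma pairing_Dm:
  assumes "f \<in> fs (posset UNIV)"
  shows "pairing (Dm i f) g = pairing f (Jm UNIV i g)"
proof -
  have "pairing (Dm i f) g = (\<Sum>\<nu>\<in>(\<lambda>\<kappa>. \<kappa>(i := \<kappa> i + 1)) ` {\<kappa>. f \<kappa> \<noteq> 0}. Dm i f \<nu> * g \<nu>)"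
  proof (rule pairing_sum)
    show "{\<nu>. Dm i f \<nu> \<noteq> 0} \<subseteq> (\<lambda>\<kappa>. \<kappa>(i := \<kappa> i + 1)) ` {\<kappa>. f \<kappa> \<noteq> 0}"
    proof
      fix \<nu> assume "\<nu> \<in> {\<nu>. Dm i f \<nu> \<noteq> 0}"
      then show "\<nu> \<in> (\<lambda>\<kappa>. \<kappa>(i := \<kappa> i + 1)) ` {\<kappa>. f \<kappa> \<noteq> 0}"
        by (intro image_eqI[where x = "\<nu>(i := \<nu> i - 1)"]) (auto simp: Dm_def)
    qed
  qed (use fs_finite[OF assms] in simp)
  also have "\<dots> = (\<Sum>\<kappa> | f \<kappa> \<noteq> 0. f \<kappa> * g (\<kappa>(i := \<kappa> i + 1)))"
    by (subst sum.reindex) (auto intro: inj_on_subset[OF inj_shift] simp: Dm_def)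
  also have "\<dots> = pairing f (Jm UNIV i g)"
    unfolding pairing_def
  proof (rule sum.cong[OF refl])
    \<comment> \<open>The support of \<open>f\<close> consists of positive weights, so the
      truncation of \<open>Jm\<close> at component 0 is never met.\<close>
    fix \<kappa> assume "\<kappa> \<in> {\<kappa>. f \<kappa> \<noteq> 0}"
    then have "\<kappa> \<in> posset UNIV" by (intro fs_in[OF assms]) simp
    then have "\<kappa> i \<noteq> 0" by (intro pos_step(2)) (simp add: posset_def)
    then show "f \<kappa> * g (\<kappa>(i := \<kappa> i + 1)) = f \<kappa> * Jm UNIV i g \<kappa>" by (simp add: Jm_def)
  qed
  finally show ?thesis .
qed

text \<open>\<open>Dm i\<close> and \<open>Jm UNIV i\<close> are transposes of each other, scalars
  and \<open>Hm i\<close> are diagonal, and transposition reverses products. Thus \<open>st\<close>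
  is transposition of words.\<close>

lemma pairing_evr:
  fixes f :: "('n::finite \<Rightarrow> 'k::field_char_0) \<Rightarrow> 'k"
  assumes "f \<in> fs (posset UNIV)" "g \<in> fs (posset UNIV)"
  shows "pairing (evr UNIV e f) g = pairing f (evr UNIV (st e) g)"
  using assms
proof (induction e arbitrary: f g)
  case (GJ i)
  then have "pairing (Jm UNIV i f) g = pairing g (Jm UNIV i f)"
    by (intro pairing_commute[of _ "posset UNIV"] fs_Jm step_closed_posset)
  also have "\<dots> = pairing (Dm i g) f" using GJ by (simp add: pairing_Dm)
  also have "\<dots> = pairing f (Dm i g)"
    using GJ by (intro pairing_commute[of _ "posset UNIV"] fs_Dm[OF step_closed_posset])
  finally show ?case by simp
next
  case (Add a b)
  have "pairing (\<lambda>\<nu>. f \<nu> + f' \<nu>) g = pairing f g + pairing f' g"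
    if "f \<in> fs (posset UNIV)" "f' \<in> fs (posset UNIV)" for f f' g :: "('n \<Rightarrow> 'k) \<Rightarrow> 'k"
  proof -
    let ?A = "{\<nu>. f \<nu> \<noteq> 0} \<union> {\<nu>. f' \<nu> \<noteq> 0}"
    have "finite ?A" using that by (simp add: fs_finite)
    then show ?thesis
      by (subst (1 2 3) pairing_sum[of ?A]) (auto simp: sum.distrib algebra_simps)
  qed
  then have "pairing (evr UNIV (Add a b) f) g = pairing (evr UNIV a f) g + pairing (evr UNIV b f) g"
    using Add.prems by (simp add: fs_evr step_closed_posset)
  also have "\<dots> = pairing f (evr UNIV (st a) g) + pairing f (evr UNIV (st b) g)"
    using Add by simp
  also have "\<dots> = pairing f (evr UNIV (st (Add a b)) g)"
    by (simp add: pairing_def sum.distrib algebra_simps)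
  finally show ?case .
next
  case (Mul a b)
  then show ?case by (simp add: fs_evr step_closed_posset)
next
  case (Sc c)
  have "pairing (\<lambda>\<nu>. c * f \<nu>) g = (\<Sum>\<nu> | f \<nu> \<noteq> 0. c * f \<nu> * g \<nu>)"
    by (rule pairing_sum) (use Sc in \<open>auto simp: fs_finite\<close>)
  then show ?case by (simp add: pairing_def algebra_simps)
next
  case (GH i)
  have "pairing (\<lambda>\<nu>. \<nu> i * f \<nu>) g = (\<Sum>\<nu> | f \<nu> \<noteq> 0. \<nu> i * f \<nu> * g \<nu>)"
    by (rule pairing_sum) (use GH in \<open>auto simp: fs_finite\<close>)
  then show ?case by (simp add: pairing_def Hm_def algebra_simps)
qed (simp add: pairing_Dm)

text \<open>Two translations are combined. The pairing with delta functions turns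
  \<open>ev e = ev e'\<close> into equality of \<open>evr UNIV e\<close> and
  \<open>evr UNIV e'\<close>, while injectivity of \<open>divided\<close> turns the latter into
  \<open>ev (st e) = ev (st e')\<close>. Together they give the congruence for \<open>st\<close>,
  and applying that to \<open>st e\<close> gives the converse direction.\<close>

lemma ev_eq_iff:
  "ev e = ev e' \<longleftrightarrow> (\<forall>f\<in>fs (posset UNIV). evr UNIV e f = evr UNIV e' f)" (is "?L \<longleftrightarrow> ?R")
  and ev_st_cong: "ev e = ev e' \<Longrightarrow> ev (st e) = ev (st e')"
proof -
  have *: "\<forall>f\<in>fs (posset UNIV). evr UNIV e f = evr UNIV e' f" if eq: "ev e = ev e'"
    for e e' :: "('k::field_char_0, 'n::finite) expr"
  proof
    fix f :: "('n \<Rightarrow> 'k) \<Rightarrow> 'k" assume f: "f \<in> fs (posset UNIV)"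
    have val: "evr UNIV e f \<nu> = pairing f (divided (ev e p))"
      if "\<nu> \<in> posset UNIV" "delta \<nu> = divided p" for \<nu> p and e :: "('k, 'n) expr"
    proof -
      have "evr UNIV e f \<nu> = pairing (evr UNIV e f) (delta \<nu>)"
        by (rule pairing_delta[symmetric, of _ "posset UNIV"]) (simp add: fs_evr f step_closed_posset)
      also have "\<dots> = pairing f (evr UNIV (st e) (divided p))"
        using that by (simp add: pairing_evr f divided_fs)
      finally show ?thesis by (simp add: divided_ev)
    qed
    show "evr UNIV e f = evr UNIV e' f"
    proof
      fix \<nu>
      show "evr UNIV e f \<nu> = evr UNIV e' f \<nu>"
      proof (cases "\<nu> \<in> posset UNIV")
        case True
        then obtain p where "delta \<nu> = divided p" using divided_surj[OF fs_delta[OF True]] by auto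
        then show ?thesis using val[OF True, of p] by (simp add: eq)
      next
        case False
        then show ?thesis by (simp add: fs_out[OF fs_evr[OF step_closed_posset f]])
      qed
    qed
  qed
  have **: "ev (st e) = ev (st e')" if "\<forall>f\<in>fs (posset UNIV). evr UNIV e f = evr UNIV e' f"
    for e e' :: "('k::field_char_0, 'n::finite) expr"
  proof
    fix p
    have "divided (ev (st e) p) = divided (ev (st e') p)" using that by (simp add: divided_ev divided_fs)
    then show "ev (st e) p = ev (st e') p" by (rule injD[OF inj_divided])
  qed
  show 1: "ev (st e) = ev (st e')" if "ev e = ev e'" for e e' :: "('k::field_char_0, 'n::finite) expr"
    using *[OF that] by (rule **)
  show "?L \<longleftrightarrow> ?R"
    using *[of e e'] **[of e e'] 1[of "st e" "st e'"] unfolding st_st by blast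
qed

text \<open>Coefficients that depend polynomially on the \<open>i\<close>-th component \<open>z\<close> of the weight.\<close>

definition family :: "'n \<Rightarrow> (('n \<Rightarrow> 'k::field_char_0) \<Rightarrow> 'k poly) \<Rightarrow> 'k \<Rightarrow> ('n \<Rightarrow> 'k) \<Rightarrow> 'k" where
  "family i p z = (\<lambda>\<nu>. poly (p (\<nu>(i := \<nu> i - z))) z)"

text \<open>As \<open>i\<close> is not in \<open>T\<close>, no case distinction looks at the
  \<open>i\<close>-th component. Shifts and scalars only rearrange the coefficient polynomials, and
  \<open>H\<^sub>i\<close> multiplies them by a linear one.\<close>

lemma evr_family:
  fixes p :: "('n \<Rightarrow> 'k::field_char_0) \<Rightarrow> 'k poly"
  assumes "i \<notin> T"
  shows "\<exists>q. \<forall>z. evr T e (family i p z) = family i q z"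
proof (induction e arbitrary: p)
  case (Sc c)
  show ?case by (rule exI[of _ "\<lambda>\<kappa>. Polynomial.smult c (p \<kappa>)"]) (simp add: family_def)
next
  case (GD k)
  show ?case
  proof (rule exI[of _ "\<lambda>\<kappa>. p (\<kappa>(k := \<kappa> k - 1))"], intro allI ext)
    fix z :: 'k and \<nu> :: "'n \<Rightarrow> 'k"
    have "\<nu>(k := \<nu> k - 1, i := (\<nu>(k := \<nu> k - 1)) i - z) = \<nu>(i := \<nu> i - z, k := (\<nu>(i := \<nu> i - z)) k - 1)"
      by (auto simp: fun_eq_iff algebra_simps)
    then show "evr T (GD k) (family i p z) \<nu> = family i (\<lambda>\<kappa>. p (\<kappa>(k := \<kappa> k - 1))) z \<nu>"
      by (simp add: family_def Dm_def)
  qed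
next
  case (GJ k)
  let ?q = "\<lambda>\<kappa>. if k \<in> T \<and> \<kappa> k = 0 then 0 else p (\<kappa>(k := \<kappa> k + 1))"
  show ?case
  proof (rule exI[of _ ?q], intro allI ext)
    fix z :: 'k and \<nu> :: "'n \<Rightarrow> 'k"
    have "\<nu>(k := \<nu> k + 1, i := (\<nu>(k := \<nu> k + 1)) i - z) = \<nu>(i := \<nu> i - z, k := (\<nu>(i := \<nu> i - z)) k + 1)"
      by (auto simp: fun_eq_iff algebra_simps)
    moreover have "k \<in> T \<Longrightarrow> (\<nu>(i := \<nu> i - z)) k = \<nu> k" using assms by auto
    ultimately show "evr T (GJ k) (family i p z) \<nu> = family i ?q z \<nu>"
      by (auto simp: family_def Jm_def)
  qed
next
  case (GH k)
  \<comment> \<open>The argument of \<open>p\<close> stores the offset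
    \<open>\<kappa> i = \<nu> i - z\<close>, so the eigenvalue \<open>\<nu> i\<close> is the
    polynomial \<open>\<kappa> i + z\<close> in \<open>z\<close>.\<close>
  let ?q = "\<lambda>\<kappa>. (if k = i then [:\<kappa> k, 1:] else [:\<kappa> k:]) * p \<kappa>"
  show ?case
    by (rule exI[of _ ?q]) (auto simp: family_def Hm_def fun_eq_iff)
next
  case (Add a b)
  then obtain q q' where "\<forall>z. evr T a (family i p z) = family i q z" "\<forall>z. evr T b (family i p z) = family i q' z"
    by meson
  then show ?case by (intro exI[of _ "\<lambda>\<kappa>. q \<kappa> + q' \<kappa>"]) (simp add: family_def)
next
  case (Mul a b)
  then show ?case by (metis evr.simps(6))
qed

text \<open>An upper bound for the number of shifts that a word performs; adding the lengths in a
  sum of words is crude but enough.\<close>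

primrec len :: "('k, 'n) expr \<Rightarrow> nat" where
  "len (Sc c) = 0"
| "len (GD i) = 1"
| "len (GJ i) = 1"
| "len (GH i) = 0"
| "len (Add a b) = len a + len b"
| "len (Mul a b) = len a + len b"

text \<open>Distance from the place of truncation, measured only at integral components: a
  nonintegral component never reaches 0 by integral steps.\<close>

definition far :: "'n \<Rightarrow> nat \<Rightarrow> (('n \<Rightarrow> 'k::field_char_0) \<Rightarrow> 'k) \<Rightarrow> bool" where
  "far i m f \<longleftrightarrow> (\<forall>\<nu> k. f \<nu> \<noteq> 0 \<longrightarrow> \<nu> i = of_int k \<longrightarrow> int m < \<bar>k\<bar>)"

text \<open>The actions for \<open>insert i T\<close> and \<open>T\<close> differ only in
  \<open>Jm\<close>, and there only at component 0. Each shift costs at most one unit of the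
  distance, so a word started far enough away never gets there.\<close>

lemma evr_far:
  "far i (m + len e) f \<Longrightarrow> evr (insert i T) e f = evr T e f \<and> far i m (evr T e f)"
proof (induction e arbitrary: m f)
  case (GD j)
  have "far i m (Dm j f)"
    unfolding far_def
  proof (intro allI impI)
    fix \<nu> k assume *: "Dm j f \<nu> \<noteq> 0" "\<nu> i = of_int k"
    show "int m < \<bar>k\<bar>"
    proof (cases "j = i")
      case True
      have "(\<nu>(i := \<nu> i - 1)) i = of_int (k - 1)" using * by simp
      then have "int (m + 1) < \<bar>k - 1\<bar>"
        using GD * True unfolding far_def Dm_def by (metis len.simps(2))
      then show ?thesis by simp
    next
      case False
      then have "(\<nu>(j := \<nu> j - 1)) i = of_int k" using * by simp
      then have "int (m + 1) < \<bar>k\<bar>"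
        using GD * unfolding far_def Dm_def by (metis len.simps(2))
      then show ?thesis by simp
    qed
  qed
  then show ?case by simp
next
  case (GJ j)
  have eq: "Jm (insert i T) j f \<nu> = Jm T j f \<nu>" for \<nu>
  proof (cases "j = i \<and> \<nu> i = 0")
    case True
    \<comment> \<open>The only place of disagreement reads \<open>f\<close> at component 1, and
      \<open>far\<close> with bound \<open>m + 1\<close> excludes that from the support.\<close>
    then have "(\<nu>(i := \<nu> i + 1)) i = of_int 1" by simp
    then have "f (\<nu>(i := \<nu> i + 1)) = 0"
      using GJ unfolding far_def by (metis abs_one len.simps(3) less_irrefl of_nat_1 of_nat_add
          add_increasing of_nat_0_le_iff not_less order_refl)
    then show ?thesis using True by (simp add: Jm_def)
  qed (auto simp: Jm_def)
  have "far i m (Jm T j f)"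
    unfolding far_def
  proof (intro allI impI)
    fix \<nu> k assume *: "Jm T j f \<nu> \<noteq> 0" "\<nu> i = of_int k"
    then have nz: "f (\<nu>(j := \<nu> j + 1)) \<noteq> 0" by (auto simp: Jm_def split: if_splits)
    show "int m < \<bar>k\<bar>"
    proof (cases "j = i")
      case True
      have "(\<nu>(i := \<nu> i + 1)) i = of_int (k + 1)" using * by simp
      then have "int (m + 1) < \<bar>k + 1\<bar>"
        using GJ nz True unfolding far_def by (metis len.simps(3))
      then show ?thesis by simp
    next
      case False
      then have "(\<nu>(j := \<nu> j + 1)) i = of_int k" using * by simp
      then have "int (m + 1) < \<bar>k\<bar>"
        using GJ nz unfolding far_def by (metis len.simps(3))
      then show ?thesis by simp
    qed
  qed
  with eq show ?case by auto
next
  case (Add a b)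
  have "far i (m + len a) f" "far i (m + len b) f"
    using Add.prems by (force simp: far_def)+
  then have *: "evr (insert i T) a f = evr T a f" "evr (insert i T) b f = evr T b f"
    "far i m (evr T a f)" "far i m (evr T b f)" using Add.IH by blast+
  have "far i m (\<lambda>\<nu>. evr T a f \<nu> + evr T b f \<nu>)"
    using *(3,4) unfolding far_def by (metis add_0)
  with * show ?case by simp
next
  case (Mul a b)
  then have "far i ((m + len b) + len a) f" by (simp add: ac_simps)
  from Mul.IH(1)[OF this] have "evr (insert i T) a f = evr T a f" "far i (m + len b) (evr T a f)" by auto
  with Mul.IH(2)[OF this(2)] show ?case by simp
qed (auto simp: far_def Hm_def)

lemma family_delta: "family i (\<lambda>\<kappa>. if \<kappa> = \<mu>(i := 0) then 1 else 0) z = delta (\<mu>(i := z))"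
proof
  fix \<nu>
  have "\<nu>(i := \<nu> i - z) = \<mu>(i := 0) \<longleftrightarrow> \<nu> = \<mu>(i := z)"
  proof
    assume *: "\<nu>(i := \<nu> i - z) = \<mu>(i := 0)"
    have "\<nu> k = (\<mu>(i := z)) k" for k using fun_cong[OF *, of k] by (cases "k = i") auto
    then show "\<nu> = \<mu>(i := z)" by auto
  qed auto
  then show "family i (\<lambda>\<kappa>. if \<kappa> = \<mu>(i := 0) then 1 else 0) z \<nu> = delta (\<mu>(i := z)) \<nu>"
    by (simp add: family_def delta_def)
qed

text \<open>Passing from \<open>insert i T\<close> to \<open>T\<close> extrapolates a polynomial identity from large positive
  integral values of the \<open>i\<close>-th weight component, where both actions agree, to all values.\<close>

lemma evr_eq_step:
  assumes i: "i \<notin> T"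
    and IH: "\<forall>\<mu>\<in>posset (insert i T). evr (insert i T) e (delta \<mu>) = evr (insert i T) e' (delta \<mu>)"
    and \<mu>: "\<mu> \<in> posset T"
  shows "evr T e (delta \<mu>) = evr T e' (delta \<mu>)"
proof -
  let ?p = "\<lambda>\<kappa>. if \<kappa> = \<mu>(i := 0) then 1 else 0"
  obtain q where q: "\<And>z. evr T e (delta (\<mu>(i := z))) = family i q z"
    using evr_family[OF i, of e ?p] unfolding family_delta by blast
  obtain q' where q': "\<And>z. evr T e' (delta (\<mu>(i := z))) = family i q' z"
    using evr_family[OF i, of e' ?p] unfolding family_delta by blast
  \<comment> \<open>Starting beyond this value, neither word can reach the truncation at 0.\<close>
  let ?N = "len e + len e'"
  have eq: "family i q (of_nat t) = family i q' (of_nat t)" if t: "t > ?N" for t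
  proof -
    have "far i m (delta (\<mu>(i := of_nat t)))" if "m < t" for m
      using that unfolding far_def delta_def
      by (auto split: if_splits) (metis of_int_eq_iff of_int_of_nat_eq of_nat_less_iff abs_of_nat)
    then have "far i (0 + len e) (delta (\<mu>(i := of_nat t)))" "far i (0 + len e') (delta (\<mu>(i := of_nat t)))"
      using t by auto
    moreover have "\<mu>(i := of_nat t) \<in> posset (insert i T)"
      using \<mu> i t by (auto simp: posset_def intro!: exI[of _ "t - 1"] simp: of_nat_diff)
    ultimately show ?thesis
      using IH evr_far[of i 0 e _ T] evr_far[of i 0 e' _ T] by (metis q q')
  qed
  \<comment> \<open>At the weight with \<open>i\<close>-th component \<open>\<kappa> i + t\<close>
    the two families are the values of \<open>q \<kappa>\<close> and \<open>q' \<kappa>\<close> at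
    \<open>t\<close>. They agree for all natural \<open>t > ?N\<close>, infinitely many points in
    characteristic zero.\<close>
  have "q \<kappa> = q' \<kappa>" for \<kappa>
  proof (rule ccontr)
    assume "q \<kappa> \<noteq> q' \<kappa>"
    then have "finite {x. poly (q \<kappa> - q' \<kappa>) x = 0}" by (intro poly_roots_finite) simp
    moreover have "of_nat ` {t. t > ?N} \<subseteq> {x. poly (q \<kappa> - q' \<kappa>) x = 0}"
    proof (clarsimp)
      fix t assume "?N < t"
      then have "family i q (of_nat t) (\<kappa>(i := \<kappa> i + of_nat t)) = family i q' (of_nat t) (\<kappa>(i := \<kappa> i + of_nat t))"
        by (simp only: eq)
      then show "poly (q \<kappa>) (of_nat t) = poly (q' \<kappa>) (of_nat t)" by (simp add: family_def)
    qed
    ultimately have "finite (of_nat ` {t. t > ?N} :: 'b set)" by (rule rev_finite_subset)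
    then have "finite {t. t > ?N}" by (rule finite_imageD) (simp add: inj_on_def)
    then show False using infinite_Ioi[of ?N] by (simp add: greaterThan_def)
  qed
  then have "q = q'" by auto
  then show ?thesis using q[of "\<mu> i"] q'[of "\<mu> i"] by simp
qed

text \<open>Whatever word is chosen for an operator, the action on \<open>fs (posset T)\<close> is
  the same. All later actions defined with \<open>SOME e. ev e = a\<close> rest on this.\<close>

lemma evr_well_defined:
  fixes e e' :: "('k::field_char_0, 'n::finite) expr"
  assumes "ev e = ev e'" "f \<in> fs (posset T)"
  shows "evr T e f = evr T e' f"
proof -
  have "\<forall>\<mu>\<in>posset (UNIV - A). evr (UNIV - A) e (delta \<mu>) = evr (UNIV - A) e' (delta \<mu>)" if "finite A" for A
    using that
  proof induction
    case empty
    have "\<forall>f\<in>fs (posset UNIV). evr UNIV e f = evr UNIV e' f" using assms(1) by (simp only: ev_eq_iff)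
    then show ?case by simp
  next
    case (insert x A)
    then have "UNIV - A = insert x (UNIV - insert x A)" by auto
    with insert.IH have "\<forall>\<mu>\<in>posset (insert x (UNIV - insert x A)).
        evr (insert x (UNIV - insert x A)) e (delta \<mu>) = evr (insert x (UNIV - insert x A)) e' (delta \<mu>)"
      by simp
    then show ?case by (intro ballI evr_eq_step[of x "UNIV - insert x A"]) simp_all
  qed
  from this[of "UNIV - T"] have "\<forall>\<mu>\<in>posset T. evr T e (delta \<mu>) = evr T e' (delta \<mu>)"
    by (simp add: double_diff)
  then have "\<And>\<nu>. \<nu> \<in> posset T \<Longrightarrow> evr T e (delta \<nu>) = evr T e' (delta \<nu>)" by simp
  then show ?thesis using assms(2) by (rule evr_eqI)
qed

section \<open>The involution\<close>

lemma involution_ev: "is_involution s \<Longrightarrow> s (ev e) = ev (st e)"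
proof (induction e)
  case (Add a b)
  then have "s (ev a \<oplus>\<^bsub>II\<^esub> ev b) = s (ev a) \<oplus>\<^bsub>II\<^esub> s (ev b)" unfolding is_involution_def by blast
  with Add show ?case by simp
next
  case (Mul a b)
  then have "s (ev a \<otimes>\<^bsub>II\<^esub> ev b) = s (ev b) \<otimes>\<^bsub>II\<^esub> s (ev a)" unfolding is_involution_def by blast
  with Mul show ?case by (simp add: o_def)
qed (auto simp: is_involution_def)

text \<open>Choosing a word and applying \<open>st\<close> is well defined by
  \<open>ev_st_cong\<close>. With the uniqueness in \<open>involution_ev\<close> it gives the
  description in \<open>star\<close> a meaning.\<close>

lemma involution_exists: "\<exists>s :: ('k::field_char_0, 'n::finite) op \<Rightarrow> ('k, 'n) op. is_involution s"
proof -
  define s where "s a = ev (st (SOME e. ev e = a))" for a :: "('k, 'n) op"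
  have s: "s (ev e) = ev (st e)" for e
    unfolding s_def by (rule ev_st_cong, rule someI) (rule refl)
  have s2: "s (s a) = a" if "a \<in> carrier II" for a using that by (auto simp: carrier_II s)
  have "bij_betw s (carrier II) (carrier II)"
    by (rule bij_betw_byWitness[where f' = s]) (auto simp: s2, auto simp: carrier_II s)
  moreover have "s (a \<oplus>\<^bsub>II\<^esub> b) = s a \<oplus>\<^bsub>II\<^esub> s b \<and> s (a \<otimes>\<^bsub>II\<^esub> b) = s b \<otimes>\<^bsub>II\<^esub> s a"
    if "a \<in> carrier II" "b \<in> carrier II" for a b
  proof -
    from that obtain e e' where "a = ev e" "b = ev e'" by (auto simp: carrier_II)
    then show ?thesis using s[of e] s[of e'] s[of "Add e e'"] s[of "Mul e e'"] by simp
  qed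
  moreover have "s (Cop c) = Cop c" "s (Dop i) = Jop i" "s (Jop i) = Dop i" "s (Hop i) = Hop i" for c i
    using s[of "Sc c"] s[of "GD i"] s[of "GJ i"] s[of "GH i"] by simp_all
  ultimately have "is_involution s" unfolding is_involution_def using s2 by blast
  then show ?thesis by (intro exI[of _ s])
qed

lemma star_ev [simp]: "star (ev e) = ev (st e)"
  unfolding star_def using involution_exists by (rule_tac the_equality) (auto simp: involution_ev)

lemma star_gens [simp]:
  "star (Cop c) = Cop c" "star (Dop i) = Jop i" "star (Jop i) = Dop i" "star (Hop i) = Hop i"
  using star_ev[of "Sc c"] star_ev[of "GD i"] star_ev[of "GJ i"] star_ev[of "GH i"] by simp_all

lemma star_closed [simp, intro]: "a \<in> carrier II \<Longrightarrow> star a \<in> carrier II"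
  and star_star [simp]: "a \<in> carrier II \<Longrightarrow> star (star a) = a"
  by (auto simp: carrier_II)

lemma star_add: "a \<in> carrier II \<Longrightarrow> b \<in> carrier II \<Longrightarrow> star (\<lambda>p. a p + b p) = (\<lambda>p. star a p + star b p)"
  and star_mult: "a \<in> carrier II \<Longrightarrow> b \<in> carrier II \<Longrightarrow> star (a \<circ> b) = star b \<circ> star a"
proof -
  assume "a \<in> carrier II" "b \<in> carrier II"
  then obtain e e' where "a = ev e" "b = ev e'" by (auto simp: carrier_II)
  then show "star (\<lambda>p. a p + b p) = (\<lambda>p. star a p + star b p)" "star (a \<circ> b) = star b \<circ> star a"
    using star_ev[of "Add e e'"] star_ev[of "Mul e e'"] by simp_all
qed

lemma star_id [simp]: "star id = id"
  using star_gens(1)[of 1] by (simp add: Cop_1)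

section \<open>Right modules\<close>

lemma right_moduleI:
  assumes "ring R" "abelian_group M"
    and "\<And>a v. a \<in> carrier R \<Longrightarrow> v \<in> carrier M \<Longrightarrow> a \<odot>\<^bsub>M\<^esub> v \<in> carrier M"
    and "\<And>a b v. a \<in> carrier R \<Longrightarrow> b \<in> carrier R \<Longrightarrow> v \<in> carrier M \<Longrightarrow>
           (a \<oplus>\<^bsub>R\<^esub> b) \<odot>\<^bsub>M\<^esub> v = a \<odot>\<^bsub>M\<^esub> v \<oplus>\<^bsub>M\<^esub> b \<odot>\<^bsub>M\<^esub> v"
    and "\<And>a u v. a \<in> carrier R \<Longrightarrow> u \<in> carrier M \<Longrightarrow> v \<in> carrier M \<Longrightarrow>
           a \<odot>\<^bsub>M\<^esub> (u \<oplus>\<^bsub>M\<^esub> v) = a \<odot>\<^bsub>M\<^esub> u \<oplus>\<^bsub>M\<^esub> a \<odot>\<^bsub>M\<^esub> v"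
    and "\<And>a b v. a \<in> carrier R \<Longrightarrow> b \<in> carrier R \<Longrightarrow> v \<in> carrier M \<Longrightarrow>
           (a \<otimes>\<^bsub>R\<^esub> b) \<odot>\<^bsub>M\<^esub> v = b \<odot>\<^bsub>M\<^esub> (a \<odot>\<^bsub>M\<^esub> v)"
    and "\<And>v. v \<in> carrier M \<Longrightarrow> \<one>\<^bsub>R\<^esub> \<odot>\<^bsub>M\<^esub> v = v"
  shows "right_module R M"
  by (rule right_module.intro[OF assms(1,2)], rule right_module_axioms.intro) (fact assms)+

lemma right_moduleD:
  assumes "right_module R M"
  shows "ring R" "abelian_group M"
    and "\<And>a v. a \<in> carrier R \<Longrightarrow> v \<in> carrier M \<Longrightarrow> a \<odot>\<^bsub>M\<^esub> v \<in> carrier M"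
    and "\<And>a b v. a \<in> carrier R \<Longrightarrow> b \<in> carrier R \<Longrightarrow> v \<in> carrier M \<Longrightarrow>
           (a \<oplus>\<^bsub>R\<^esub> b) \<odot>\<^bsub>M\<^esub> v = a \<odot>\<^bsub>M\<^esub> v \<oplus>\<^bsub>M\<^esub> b \<odot>\<^bsub>M\<^esub> v"
    and "\<And>a u v. a \<in> carrier R \<Longrightarrow> u \<in> carrier M \<Longrightarrow> v \<in> carrier M \<Longrightarrow>
           a \<odot>\<^bsub>M\<^esub> (u \<oplus>\<^bsub>M\<^esub> v) = a \<odot>\<^bsub>M\<^esub> u \<oplus>\<^bsub>M\<^esub> a \<odot>\<^bsub>M\<^esub> v"
    and "\<And>a b v. a \<in> carrier R \<Longrightarrow> b \<in> carrier R \<Longrightarrow> v \<in> carrier M \<Longrightarrow>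
           (a \<otimes>\<^bsub>R\<^esub> b) \<odot>\<^bsub>M\<^esub> v = b \<odot>\<^bsub>M\<^esub> (a \<odot>\<^bsub>M\<^esub> v)"
    and "\<And>v. v \<in> carrier M \<Longrightarrow> \<one>\<^bsub>R\<^esub> \<odot>\<^bsub>M\<^esub> v = v"
  using right_module.axioms(1,2)[OF assms]
    right_module.axioms(3)[OF assms, unfolded right_module_axioms_def] by simp_all

locale II_module =
  fixes M :: "(('k::field_char_0, 'n::finite) op, 'v) module" (structure)
  assumes right_module: "right_module II M"
begin

sublocale abelian_group M
  using right_module by (rule right_moduleD)

lemma act_closed [simp, intro]: "a \<in> carrier II \<Longrightarrow> v \<in> carrier M \<Longrightarrow> a \<odot> v \<in> carrier M"
  and act_add: "a \<in> carrier II \<Longrightarrow> u \<in> carrier M \<Longrightarrow> v \<in> carrier M \<Longrightarrow> a \<odot> (u \<oplus> v) = a \<odot> u \<oplus> a \<odot> v"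
  using right_moduleD[OF right_module] by auto

lemma act_add_op: "a \<in> carrier II \<Longrightarrow> b \<in> carrier II \<Longrightarrow> v \<in> carrier M \<Longrightarrow>
    (\<lambda>p. a p + b p) \<odot> v = a \<odot> v \<oplus> b \<odot> v"
  and act_comp: "a \<in> carrier II \<Longrightarrow> b \<in> carrier II \<Longrightarrow> v \<in> carrier M \<Longrightarrow> (a \<circ> b) \<odot> v = b \<odot> (a \<odot> v)"
  and act_id [simp]: "v \<in> carrier M \<Longrightarrow> id \<odot> v = v"
  using right_moduleD(4)[OF right_module, of a b v] right_moduleD(6)[OF right_module, of a b v]
    right_moduleD(7)[OF right_module, of v] by simp_all

lemma act_zero [simp]: "a \<in> carrier II \<Longrightarrow> a \<odot> \<zero> = \<zero>"
  using act_add[of a \<zero> \<zero>] by (metis act_closed add.r_cancel_one' r_zero zero_closed)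

lemma act_zero_op [simp]: "v \<in> carrier M \<Longrightarrow> (\<lambda>_. 0) \<odot> v = \<zero>"
proof -
  assume v: "v \<in> carrier M"
  have *: "(\<lambda>_. 0) \<odot> v \<in> carrier M"
    using act_closed[OF in_carrier_II(1)[of 0] v] by (simp only: Cop_0)
  have "(\<lambda>_. 0) \<odot> v = (\<lambda>_. 0) \<odot> v \<oplus> (\<lambda>_. 0) \<odot> v"
    using act_add_op[OF in_carrier_II(1)[of 0] in_carrier_II(1)[of 0] v] by (simp add: Cop_0)
  then show ?thesis using * by (metis add.r_cancel_one')
qed

lemma act_Cop:
  assumes "v \<in> carrier M"
  shows "Cop (c + d) \<odot> v = Cop c \<odot> v \<oplus> Cop d \<odot> v" "Cop (c * d) \<odot> v = Cop c \<odot> (Cop d \<odot> v)"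
    "Cop 1 \<odot> v = v" "Cop 0 \<odot> v = \<zero>"
proof -
  have "Cop (c + d) = (\<lambda>p. Cop c p + Cop d p :: ('k, 'n) pol)" "Cop (c * d) = Cop d \<circ> (Cop c :: ('k, 'n) op)"
    by (auto simp: Cop_add Cop_mult[symmetric] mult.commute)
  then show "Cop (c + d) \<odot> v = Cop c \<odot> v \<oplus> Cop d \<odot> v" "Cop (c * d) \<odot> v = Cop c \<odot> (Cop d \<odot> v)"
    using assms by (simp_all add: act_add_op act_comp)
  show "Cop 1 \<odot> v = v" "Cop 0 \<odot> v = \<zero>" using assms by (simp_all add: Cop_1 Cop_0)
qed

lemma Cop_minus: "v \<in> carrier M \<Longrightarrow> Cop (- c) \<odot> v = \<ominus> (Cop c \<odot> v)"
  using act_Cop(1)[of v "- c" c] act_Cop(4)[of v] by (intro minus_equality[symmetric]) auto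

lemma act_Cop_commute: "a \<in> carrier II \<Longrightarrow> v \<in> carrier M \<Longrightarrow> a \<odot> (Cop c \<odot> v) = Cop c \<odot> (a \<odot> v)"
  by (metis Cop_commute act_comp in_carrier_II(1))

text \<open>Closure under letters passes to words by induction, and negatives are multiples by the
  scalar -1.\<close>

lemma submoduleI_gens:
  assumes sub: "N \<subseteq> carrier M" and "\<zero> \<in> N" and add: "\<And>u v. u \<in> N \<Longrightarrow> v \<in> N \<Longrightarrow> u \<oplus> v \<in> N"
    and "\<And>c v. v \<in> N \<Longrightarrow> Cop c \<odot> v \<in> N" "\<And>i v. v \<in> N \<Longrightarrow> Dop i \<odot> v \<in> N"
    "\<And>i v. v \<in> N \<Longrightarrow> Jop i \<odot> v \<in> N" "\<And>i v. v \<in> N \<Longrightarrow> Hop i \<odot> v \<in> N"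
  shows "submodule N II M"
proof -
  have ev: "ev e \<odot> v \<in> N" if "v \<in> N" for e v
    using that
  proof (induction e arbitrary: v)
    case (Add a b)
    then have "ev a \<odot> v \<oplus> ev b \<odot> v \<in> N" by (intro add) blast+
    then show ?case using sub Add.prems by (simp add: act_add_op subsetD)
  next
    case (Mul a b)
    then have "ev b \<odot> (ev a \<odot> v) \<in> N" by blast
    then have "(ev a \<circ> ev b) \<odot> v \<in> N" using sub Mul.prems by (simp add: act_comp subsetD)
    then show ?case by (simp add: o_def)
  qed (use assms in auto)
  have "\<ominus> v \<in> N" if "v \<in> N" for v
    using assms(4)[OF that, of "-1"] Cop_minus[of v 1] act_Cop(3)[of v] that sub by auto
  then show ?thesis
    using assms ev by (intro submodule.intro subgroup.intro submodule_axioms.intro)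
      (auto simp: carrier_II simp flip: a_inv_def)
qed

lemma submoduleD:
  assumes "submodule N II M"
  shows "N \<subseteq> carrier M" "\<zero> \<in> N" "\<And>u v. u \<in> N \<Longrightarrow> v \<in> N \<Longrightarrow> u \<oplus> v \<in> N"
    "\<And>a v. a \<in> carrier II \<Longrightarrow> v \<in> N \<Longrightarrow> a \<odot> v \<in> N"
  using subgroup.subset[OF submodule.axioms(1)[OF assms]]
    subgroup.one_closed[OF submodule.axioms(1)[OF assms]]
    subgroup.m_closed[OF submodule.axioms(1)[OF assms]]
    submodule.smult_closed[OF assms] by auto

end

lemma (in abelian_group) minus_eq_zero_iff:
  "x \<in> carrier G \<Longrightarrow> y \<in> carrier G \<Longrightarrow> x \<ominus> y = \<zero> \<longleftrightarrow> x = y"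
  by (metis a_minus_def a_inv_closed minus_equality minus_minus r_neg)

section \<open>Weight spaces in terms of the maximal ideals of \<open>DD\<close>\<close>

lemma sub_Cop: "(\<lambda>p. Hop i p - Cop c p) = (\<lambda>p. Hop i p + Cop (- c) p)"
  by (intro ext poly_mapping_eqI) (simp add: lookup_minus lookup_add)

lemma Hop_minus_DD: "(\<lambda>p. Hop i p - Cop c p) \<in> carrier DD"
  unfolding sub_Cop by (simp add: DD_def op_ring_def subalg.add subalg.gen subalg.scalar)

lemma ideal_max_ideal: "ideal (max_ideal \<mu>) DD"
  unfolding max_ideal_def by (rule ring.genideal_ideal[OF ring_DD]) (auto simp: Hop_minus_DD)

lemma max_ideal_gen: "(\<lambda>p. Hop i p - Cop (\<mu> i) p) \<in> max_ideal \<mu>"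
  unfolding max_ideal_def
  by (rule subsetD[OF ring.genideal_self[OF ring_DD]]) (auto simp: Hop_minus_DD)

lemma ideal_power: "ideal (max_ideal \<mu> [^]\<^bsub>ideals_set DD\<^esub> (m::nat)) DD"
proof (induction m)
  case 0
  show ?case using ring.oneideal[OF ring_DD] by (simp add: nat_pow_def ideals_set_def)
next
  case (Suc m)
  then show ?case using ring.ideal_prod_is_ideal[OF ring_DD Suc ideal_max_ideal]
    by (simp add: nat_pow_def ideals_set_def)
qed

lemma ideal_power_0: "max_ideal \<mu> [^]\<^bsub>ideals_set DD\<^esub> (0::nat) = carrier DD"
  and ideal_power_Suc: "max_ideal \<mu> [^]\<^bsub>ideals_set DD\<^esub> (Suc m)
    = ideal_prod DD (max_ideal \<mu> [^]\<^bsub>ideals_set DD\<^esub> m) (max_ideal \<mu>)"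
  by (simp_all add: nat_pow_def ideals_set_def)

lemma id_DD: "id \<in> carrier DD"
  using monoid.one_closed[OF ring.is_monoid[OF ring_DD]] by simp

context II_module
begin

lemma Hop_minus_act: "v \<in> carrier M \<Longrightarrow> (\<lambda>p. Hop i p - Cop c p) \<odot> v = Hop i \<odot> v \<ominus> Cop c \<odot> v"
  unfolding sub_Cop by (simp add: act_add_op Cop_minus a_minus_def)

text \<open>The annihilator of \<open>v\<close> in \<open>DD\<close> is a two-sided ideal because
  \<open>DD\<close> is commutative. Once it contains the generators
  \<open>H\<^sub>i - \<mu>\<^sub>i\<close> it contains the ideal they generate.\<close>

lemma mem_wspace_iff: "v \<in> wspace M \<mu> \<longleftrightarrow> v \<in> carrier M \<and> (\<forall>i. Hop i \<odot> v = Cop (\<mu> i) \<odot> v)"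
proof
  assume v: "v \<in> wspace M \<mu>"
  then have c: "v \<in> carrier M" by (simp add: wspace_def)
  have "Hop i \<odot> v \<ominus> Cop (\<mu> i) \<odot> v = \<zero>" for i
    using v max_ideal_gen[of i \<mu>] unfolding Hop_minus_act[OF c, symmetric] by (simp add: wspace_def)
  then show "v \<in> carrier M \<and> (\<forall>i. Hop i \<odot> v = Cop (\<mu> i) \<odot> v)"
    using c by (simp add: minus_eq_zero_iff)
next
  assume v: "v \<in> carrier M \<and> (\<forall>i. Hop i \<odot> v = Cop (\<mu> i) \<odot> v)"
  let ?I = "{a \<in> carrier DD. a \<odot> v = \<zero>}"
  have D: "a \<in> carrier II" if "a \<in> carrier DD" for a using that carrier_DD_subset by blast
  interpret DD: ring "DD :: ('k, 'n) op ring" by (rule ring_DD)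
  have "ideal ?I DD"
  proof (rule idealI[OF ring_DD])
    show "subgroup ?I (add_monoid DD)"
    proof (rule DD.add.subgroupI)
      show "?I \<noteq> {}" using v DD.zero_closed by auto

      fix a b assume ab: "a \<in> ?I" "b \<in> ?I"
      then show "a \<oplus>\<^bsub>DD\<^esub> b \<in> ?I"
        using v DD.add.m_closed[of a b] by (auto simp: act_add_op D)
      have neg: "\<ominus>\<^bsub>DD\<^esub> a \<in> carrier DD" using ab by simp
      have "\<zero> = (\<lambda>p. (\<ominus>\<^bsub>DD\<^esub> a) p + a p) \<odot> v" using DD.l_neg[of a] ab v by simp
      also have "\<dots> = (\<ominus>\<^bsub>DD\<^esub> a) \<odot> v \<oplus> a \<odot> v" using ab v neg by (intro act_add_op) (auto simp: D)
      finally show "\<ominus>\<^bsub>DD\<^esub> a \<in> ?I"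
        using ab v neg r_zero[OF act_closed[OF D[OF neg], of v]] by auto
    qed auto
  next
    fix a x :: "('k, 'n) op" assume ax: "a \<in> ?I" "x \<in> carrier DD"
    then show "x \<otimes>\<^bsub>DD\<^esub> a \<in> ?I"
      using v DD.m_closed[of x a] DD_commute[of x a] act_comp[of a x v] D by auto
    from ax show "a \<otimes>\<^bsub>DD\<^esub> x \<in> ?I"
      using v DD.m_closed[of a x] act_comp[of a x v] D by auto
  qed
  moreover have "{(\<lambda>p. Hop i p - Cop (\<mu> i) p) | i. True} \<subseteq> ?I"
    using v by (auto simp: Hop_minus_DD Hop_minus_act minus_eq_zero_iff)
  ultimately have "max_ideal \<mu> \<subseteq> ?I" unfolding max_ideal_def by (rule DD.genideal_minimal)
  then show "v \<in> wspace M \<mu>" using v by (auto simp: wspace_def)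
qed

lemma wspace_subset_gen_wspace: "wspace M \<mu> \<subseteq> gen_wspace M \<mu>"
proof -
  have "ideal_prod DD (carrier DD) (max_ideal \<mu>) \<subseteq> max_ideal \<mu>"
    using ring.ideal_prod_inter[OF ring_DD ring.oneideal[OF ring_DD] ideal_max_ideal] by blast
  then have "max_ideal \<mu> [^]\<^bsub>ideals_set DD\<^esub> (Suc 0) \<subseteq> max_ideal \<mu>"
    by (simp only: ideal_power_Suc ideal_power_0)
  then show ?thesis unfolding wspace_def gen_wspace_def by blast
qed

text \<open>Take the least power of the ideal that kills \<open>v\<close>. Some element
  \<open>a\<close> of the preceding power does not kill \<open>v\<close>, and the image of
  \<open>v\<close> under \<open>a\<close> is killed by the ideal itself.\<close>

lemma gen_wspace_imp_wspace:
  assumes v: "v \<in> gen_wspace M \<mu>" "v \<noteq> \<zero>"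
  obtains w where "w \<in> wspace M \<mu>" "w \<noteq> \<zero>"
proof -
  let ?P = "\<lambda>m::nat. \<forall>a\<in>max_ideal \<mu> [^]\<^bsub>ideals_set DD\<^esub> m. a \<odot> v = \<zero>"
  have vc: "v \<in> carrier M" and ex: "\<exists>m. ?P m" using v by (auto simp: gen_wspace_def)
  define m where "m = (LEAST m. ?P m)"
  have Pm: "?P m" unfolding m_def using LeastI_ex[OF ex] .
  \<comment> \<open>The zeroth power is all of \<open>DD\<close> and contains \<open>id\<close>,
    which fixes the nonzero \<open>v\<close>.\<close>
  have "\<not> ?P 0" using v(2) vc id_DD unfolding ideal_power_0 by force
  then have "m \<noteq> 0" using Pm by metis
  then obtain k where k: "m = Suc k" by (cases m) auto
  then have "\<not> ?P k" using not_less_Least[of k ?P] unfolding m_def by simp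
  then obtain a where a: "a \<in> max_ideal \<mu> [^]\<^bsub>ideals_set DD\<^esub> k" "a \<odot> v \<noteq> \<zero>" by blast
  have D: "b \<in> carrier II" if "b \<in> carrier DD" for b using that carrier_DD_subset by blast
  have aII: "a \<in> carrier II" using ideal.Icarr[OF ideal_power a(1)] by (rule D)
  have "b \<odot> (a \<odot> v) = \<zero>" if b: "b \<in> max_ideal \<mu>" for b
  proof -
    have "a \<otimes>\<^bsub>DD\<^esub> b \<in> max_ideal \<mu> [^]\<^bsub>ideals_set DD\<^esub> m"
      unfolding k ideal_power_Suc using a(1) b by (rule ideal_prod.prod)
    then have "(a \<otimes>\<^bsub>DD\<^esub> b) \<odot> v = \<zero>" using Pm by blast
    then show ?thesis
      using act_comp[OF aII D[OF ideal.Icarr[OF ideal_max_ideal b]] vc] by simp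
  qed
  then have "a \<odot> v \<in> wspace M \<mu>" using aII vc by (simp add: wspace_def)
  then show ?thesis using a(2) that by blast
qed

end

section \<open>Modules with a weight basis\<close>

lemma shift_eq_iff: "\<nu>(i := \<nu> i + c) = \<mu> \<longleftrightarrow> \<nu> = \<mu>(i := \<mu> i - c :: 'k::ab_group_add)"
  by auto

lemma Dm_delta: "Dm i (delta \<mu>) = delta (\<mu>(i := \<mu> i + 1))"
  using shift_eq_iff[of _ i "-1" \<mu>] by (auto simp: Dm_def delta_def)

lemma Jm_delta: "\<not> (i \<in> T \<and> \<mu> i = 1) \<Longrightarrow> Jm T i (delta \<mu>) = delta (\<mu>(i := \<mu> i - 1))"
  using shift_eq_iff[of _ i 1 \<mu>] by (auto simp: Jm_def delta_def)

lemma Hm_delta: "Hm i (delta \<mu>) = (\<lambda>\<nu>. \<mu> i * delta \<mu> \<nu>)"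
  by (auto simp: Hm_def delta_def fun_eq_iff)

lemma wtset_nonempty: "\<exists>\<mu>. \<mu> \<in> wtset T \<rho>"
  by (rule exI[of _ "\<lambda>k. if k \<in> T then 1 else \<rho> k"])
    (auto simp: wtset_def intro: exI[of _ "0::nat"] exI[of _ "0::int"])

lemma wtset_self:
  assumes "\<And>i. i \<in> T \<Longrightarrow> \<rho> i = 1"
  shows "\<rho> \<in> wtset T \<rho>"
  using assms by (auto simp: wtset_def intro: exI[of _ "0::nat"] exI[of _ "0::int"])

lemma wtset_up: "\<mu> \<in> wtset T \<rho> \<Longrightarrow> \<mu>(i := \<mu> i + 1) \<in> wtset T \<rho>"
  and wtset_down: "\<mu> \<in> wtset T \<rho> \<Longrightarrow> \<not> (i \<in> T \<and> \<mu> i = 1) \<Longrightarrow> \<mu>(i := \<mu> i - 1) \<in> wtset T \<rho>"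
  using step_closed_wtset[of T \<rho>] unfolding step_closed_def by auto

lemma wtset_upd_nat: "\<mu> \<in> wtset T \<rho> \<Longrightarrow> \<mu>(i := \<mu> i + of_nat n) \<in> wtset T \<rho>"
proof (induction n)
  case (Suc n)
  then have "(\<mu>(i := \<mu> i + of_nat n))(i := (\<mu>(i := \<mu> i + of_nat n)) i + 1) \<in> wtset T \<rho>"
    by (intro wtset_up)
  then show "\<mu>(i := \<mu> i + of_nat (Suc n)) \<in> wtset T \<rho>" by (simp add: algebra_simps)
qed simp

text \<open>The components are brought to their target one after the other. Two admissible values of
  a component differ by an integer, and all values between them are admissible as well. It serves
  for simplicity as well as for the nonvanishing of the vectors
  \<open>b\<^sub>\<nu>\<close>.\<close>

lemma wtset_connected:
  assumes \<nu>: "\<nu> \<in> wtset T \<rho>" "\<nu> \<in> C" and \<mu>: "\<mu> \<in> wtset T \<rho>"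
    and up: "\<And>\<kappa> i. \<kappa> \<in> wtset T \<rho> \<Longrightarrow> \<kappa> \<in> C \<Longrightarrow> \<kappa>(i := \<kappa> i + 1) \<in> C"
    and down: "\<And>\<kappa> i. \<kappa> \<in> wtset T \<rho> \<Longrightarrow> \<kappa>(i := \<kappa> i + 1) \<in> C \<Longrightarrow> \<kappa> \<in> C"
  shows "\<mu> \<in> (C :: ('n::finite \<Rightarrow> 'k::field_char_0) set)"
proof -
  have ups: "\<kappa>(i := \<kappa> i + of_nat n) \<in> C" if "\<kappa> \<in> wtset T \<rho>" "\<kappa> \<in> C" for \<kappa> i n
  proof (induction n)
    case (Suc n)
    then have "(\<kappa>(i := \<kappa> i + of_nat n))(i := (\<kappa>(i := \<kappa> i + of_nat n)) i + 1) \<in> C"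
      by (intro up wtset_upd_nat that)
    then show "\<kappa>(i := \<kappa> i + of_nat (Suc n)) \<in> C" by (simp add: algebra_simps)
  qed (use that in simp)
  have downs: "\<kappa>(i := \<kappa> i + of_nat n) \<in> C \<Longrightarrow> \<kappa> \<in> C" if "\<kappa> \<in> wtset T \<rho>" for \<kappa> i n
  proof (induction n)
    case (Suc n)
    have "\<kappa>(i := \<kappa> i + of_nat n, i := (\<kappa>(i := \<kappa> i + of_nat n)) i + 1) = \<kappa>(i := \<kappa> i + of_nat (Suc n))"
      by (simp add: algebra_simps)
    then have "\<kappa>(i := \<kappa> i + of_nat n) \<in> C"
      using down[OF wtset_upd_nat[OF that], of i n i] Suc.prems by metis
    then show ?case by (rule Suc.IH)
  qed simp
  have one: "\<kappa>(i := \<mu> i) \<in> C" if \<kappa>: "\<kappa> \<in> wtset T \<rho>" "\<kappa> \<in> C" for \<kappa> i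
  proof -
    have "\<exists>d::int. \<mu> i = \<kappa> i + of_int d"
    proof (cases "i \<in> T")
      case True
      then obtain m m' :: nat where "\<mu> i = of_nat m + 1" "\<kappa> i = of_nat m' + 1"
        using \<mu> \<kappa>(1) unfolding wtset_def by fastforce
      then show ?thesis by (intro exI[of _ "int m - int m'"]) simp
    next
      case False
      then obtain m m' :: int where "\<mu> i = \<rho> i + of_int m" "\<kappa> i = \<rho> i + of_int m'"
        using \<mu> \<kappa>(1) unfolding wtset_def by fastforce
      then show ?thesis by (intro exI[of _ "m - m'"]) simp
    qed
    then obtain d :: int where d: "\<mu> i = \<kappa> i + of_int d" ..
    show ?thesis
    proof (cases d)
      case (nonneg n)
      then show ?thesis using ups[OF \<kappa>, of i n] d by simp
    next
      case (neg n)
      then have "\<kappa> i = \<mu> i + of_nat (Suc n)" using d unfolding neg by simp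
      moreover have "\<kappa>(i := \<mu> i) \<in> wtset T \<rho>" using \<mu> \<kappa> by (auto simp: wtset_def)
      ultimately show ?thesis using downs[of "\<kappa>(i := \<mu> i)" i "Suc n"] \<kappa>(2)
        by (metis fun_upd_same fun_upd_triv fun_upd_upd)
    qed
  qed
  have "(\<lambda>i. if i \<in> A then \<mu> i else \<nu> i) \<in> wtset T \<rho> \<and> (\<lambda>i. if i \<in> A then \<mu> i else \<nu> i) \<in> C"
    if "finite A" for A
    using that
  proof induction
    case empty
    then show ?case using \<nu> by simp
  next
    case (insert x A)
    have "(\<lambda>i. if i \<in> insert x A then \<mu> i else \<nu> i) = (\<lambda>i. if i \<in> A then \<mu> i else \<nu> i)(x := \<mu> x)"
      by auto
    moreover have "(\<lambda>i. if i \<in> insert x A then \<mu> i else \<nu> i) \<in> wtset T \<rho>"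
      using \<mu> \<nu>(1) by (auto simp: wtset_def)
    ultimately show ?case using one insert.IH by metis
  qed
  from this[of UNIV] show ?thesis by simp
qed

text \<open>If \<open>f\<close> has a second weight \<open>\<kappa>\<close> in its support, then
  \<open>H\<^sub>i - \<kappa>\<^sub>i\<close>, for a component in which \<open>\<kappa>\<close> and
  \<open>\<nu>\<close> differ, removes the term at \<open>\<kappa>\<close> and keeps the one at
  \<open>\<nu>\<close>. Induction on the size of the support leaves a multiple of
  \<open>delta \<nu>\<close>.\<close>

lemma weight_extract:
  assumes "f \<in> fs S" "f \<in> K" "f \<nu> \<noteq> 0"
    and add: "\<And>f g. f \<in> fs S \<Longrightarrow> g \<in> fs S \<Longrightarrow> f \<in> K \<Longrightarrow> g \<in> K \<Longrightarrow> (\<lambda>\<nu>. f \<nu> + g \<nu>) \<in> K"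
    and scale: "\<And>c f. f \<in> fs S \<Longrightarrow> f \<in> K \<Longrightarrow> (\<lambda>\<nu>. c * f \<nu>) \<in> K"
    and Hm: "\<And>i f. f \<in> fs S \<Longrightarrow> f \<in> K \<Longrightarrow> Hm i f \<in> K"
  shows "delta \<nu> \<in> (K :: (('n \<Rightarrow> 'k::field_char_0) \<Rightarrow> 'k) set)"
  using assms(1-3)
proof (induction "card {\<kappa>. f \<kappa> \<noteq> 0}" arbitrary: f rule: less_induct)
  case less
  show ?case
  proof (cases "\<exists>\<kappa>. \<kappa> \<noteq> \<nu> \<and> f \<kappa> \<noteq> 0")
    case True
    then obtain \<kappa> i where \<kappa>: "f \<kappa> \<noteq> 0" "\<kappa> i \<noteq> \<nu> i" by fastforce
    let ?g = "\<lambda>x. Hm i f x + (- \<kappa> i) * f x"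
    have g: "?g = (\<lambda>x. (x i - \<kappa> i) * f x)" by (simp add: Hm_def algebra_simps)
    have fs: "Hm i f \<in> fs S" "(\<lambda>x. (- \<kappa> i) * f x) \<in> fs S"
      using fs_scale[OF less.prems(1)] by (simp_all only: Hm_def)
    have "{x. ?g x \<noteq> 0} \<subset> {x. f x \<noteq> 0}" 
    proof -
      have *: "Hm i f x + (- \<kappa> i) * f x = (x i - \<kappa> i) * f x" for x by (simp add: Hm_def algebra_simps)
      show ?thesis unfolding * using \<kappa> less.prems(3) by auto
    qed
    then have "card {x. ?g x \<noteq> 0} < card {x. f x \<noteq> 0}"
      by (intro psubset_card_mono fs_finite[OF less.prems(1)])
    moreover have "?g \<in> K" using less.prems fs by (intro add scale Hm)
    moreover have "?g \<in> fs S" using fs by (rule fs_add)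
    moreover have "?g \<nu> \<noteq> 0" using \<kappa> less.prems(3) fun_cong[OF g, of \<nu>] by simp
    ultimately show ?thesis using less.hyps[of ?g] by blast
  next
    case False
    then have "delta \<nu> = (\<lambda>x. inverse (f \<nu>) * f x)"
      using less.prems(3) by (intro ext) (auto simp: delta_def)
    then show ?thesis using scale less.prems by simp
  qed
qed

text \<open>An isomorphism \<open>\<phi>\<close> from the standard module with parameters
  \<open>T\<close>, \<open>\<rho>\<close> onto \<open>M\<close>, recorded on the generators only;
  \<open>hom_ev\<close> extends it to all words. Simplicity, support and weight decomposition are
  proved once here for every module of the theorem.\<close>

locale model = II_module M for M :: "(('k::field_char_0, 'n::finite) op, 'v) module" (structure) +
  fixes T :: "'n set" and \<rho> :: "'n \<Rightarrow> 'k" and \<phi> :: "(('n \<Rightarrow> 'k) \<Rightarrow> 'k) \<Rightarrow> 'v"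
  assumes bij: "bij_betw \<phi> (fs (wtset T \<rho>)) (carrier M)"
    and hom_add: "\<And>f g. f \<in> fs (wtset T \<rho>) \<Longrightarrow> g \<in> fs (wtset T \<rho>) \<Longrightarrow> \<phi> (\<lambda>\<nu>. f \<nu> + g \<nu>) = \<phi> f \<oplus> \<phi> g"
    and hom_Cop: "\<And>c f. f \<in> fs (wtset T \<rho>) \<Longrightarrow> \<phi> (\<lambda>\<nu>. c * f \<nu>) = Cop c \<odot> \<phi> f"
    and hom_Dop: "\<And>i f. f \<in> fs (wtset T \<rho>) \<Longrightarrow> \<phi> (Dm i f) = Dop i \<odot> \<phi> f"
    and hom_Jop: "\<And>i f. f \<in> fs (wtset T \<rho>) \<Longrightarrow> \<phi> (Jm T i f) = Jop i \<odot> \<phi> f"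
    and hom_Hop: "\<And>i f. f \<in> fs (wtset T \<rho>) \<Longrightarrow> \<phi> (Hm i f) = Hop i \<odot> \<phi> f"
begin

abbreviation "V \<equiv> fs (wtset T \<rho>)"

lemma fs_ops [simp, intro]:
  "f \<in> V \<Longrightarrow> evr T e f \<in> V" "f \<in> V \<Longrightarrow> Dm i f \<in> V" "f \<in> V \<Longrightarrow> Jm T i f \<in> V" "f \<in> V \<Longrightarrow> Hm i f \<in> V"
  using fs_evr[OF step_closed_wtset, of f T \<rho>] fs_evr[OF step_closed_wtset, of f T \<rho> "GD i"]
    fs_evr[OF step_closed_wtset, of f T \<rho> "GJ i"] fs_evr[OF step_closed_wtset, of f T \<rho> "GH i"]
  by simp_all

lemma \<phi>_closed [simp, intro]: "f \<in> V \<Longrightarrow> \<phi> f \<in> carrier M"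
  using bij by (auto simp: bij_betw_def)

lemma \<phi>_inj: "f \<in> V \<Longrightarrow> g \<in> V \<Longrightarrow> \<phi> f = \<phi> g \<longleftrightarrow> f = g"
  using bij by (auto simp: bij_betw_def inj_on_def)

lemma \<phi>_surj: "v \<in> carrier M \<Longrightarrow> \<exists>f\<in>V. v = \<phi> f"
  using bij by (auto simp: bij_betw_def)

lemma \<phi>_zero: "\<phi> (\<lambda>_. 0) = \<zero>"
  using hom_Cop[of "\<lambda>_. 0" 0] act_Cop(4)[of "\<phi> (\<lambda>_. 0)"] by simp

lemma \<phi>_eq_zero_iff: "f \<in> V \<Longrightarrow> \<phi> f = \<zero> \<longleftrightarrow> f = (\<lambda>_. 0)"
  using \<phi>_inj[of f "\<lambda>_. 0"] \<phi>_zero by simp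

lemma hom_ev: "f \<in> V \<Longrightarrow> \<phi> (evr T e f) = ev e \<odot> \<phi> f"
proof (induction e arbitrary: f)
  case (Add a b)
  then show ?case by (simp add: hom_add act_add_op)
next
  case (Mul a b)
  then have "\<phi> (evr T (Mul a b) f) = (ev a \<circ> ev b) \<odot> \<phi> f" by (simp add: act_comp)
  then show ?case by (simp add: o_def)
qed (simp_all add: hom_Cop hom_Dop hom_Jop hom_Hop)

lemma hom_sum:
  "finite A \<Longrightarrow> (\<And>\<nu>. \<nu> \<in> A \<Longrightarrow> g \<nu> \<in> V) \<Longrightarrow>
    (\<lambda>\<kappa>. \<Sum>\<nu>\<in>A. g \<nu> \<kappa>) \<in> V \<and> \<phi> (\<lambda>\<kappa>. \<Sum>\<nu>\<in>A. g \<nu> \<kappa>) = finsum M (\<lambda>\<nu>. \<phi> (g \<nu>)) A"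
proof (induction A rule: finite_induct)
  case empty
  then show ?case by (simp add: \<phi>_zero)
next
  case (insert x A)
  then show ?case
    by (subst finsum_insert) (auto simp: hom_add Pi_def intro: fs_add)
qed

lemma mem_wspace_model: "f \<in> V \<Longrightarrow> \<phi> f \<in> wspace M \<mu> \<longleftrightarrow> (\<forall>\<nu>. f \<nu> \<noteq> 0 \<longrightarrow> \<nu> = \<mu>)"
proof -
  assume f: "f \<in> V"
  have "Hop i \<odot> \<phi> f = Cop c \<odot> \<phi> f \<longleftrightarrow> (\<forall>\<nu>. \<nu> i * f \<nu> = c * f \<nu>)" for i c
    using f \<phi>_inj[of "Hm i f" "\<lambda>\<nu>. c * f \<nu>"] by (simp add: hom_Hop hom_Cop fs_scale) (simp add: Hm_def fun_eq_iff)
  then show ?thesis using f by (auto simp: mem_wspace_iff fun_eq_iff)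
qed

primrec weight_power :: "'n \<Rightarrow> 'k \<Rightarrow> nat \<Rightarrow> ('k, 'n) expr" where
  "weight_power i c 0 = Sc 1"
| "weight_power i c (Suc m) = Mul (weight_power i c m) (Add (GH i) (Sc (- c)))"

text \<open>The \<open>m\<close>-th power of \<open>H\<^sub>i - \<mu>\<^sub>i\<close> multiplies the
  coefficient at \<open>\<nu>\<close> by \<open>(\<nu>\<^sub>i - \<mu>\<^sub>i)^m\<close>, which for
  \<open>\<nu>\<^sub>i \<noteq> \<mu>\<^sub>i\<close> is a nonzero scalar.\<close>

lemma gen_wspace_eq: "gen_wspace M \<mu> = wspace M \<mu>"
proof
  show "gen_wspace M \<mu> \<subseteq> wspace M \<mu>"
  proof
    fix v assume "v \<in> gen_wspace M \<mu>"
    then obtain m where v: "v \<in> carrier M"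
      and m: "\<forall>a\<in>max_ideal \<mu> [^]\<^bsub>ideals_set DD\<^esub> (m::nat). a \<odot> v = \<zero>"
      by (auto simp: gen_wspace_def)
    from \<phi>_surj[OF v] obtain f where f: "f \<in> V" "v = \<phi> f" by blast
    have mem: "ev (weight_power i (\<mu> i) m) \<in> max_ideal \<mu> [^]\<^bsub>ideals_set DD\<^esub> m" for i m
    proof (induction m)
      case 0
      show "ev (weight_power i (\<mu> i) 0) \<in> max_ideal \<mu> [^]\<^bsub>ideals_set DD\<^esub> (0::nat)"
        unfolding ideal_power_0 by (simp add: Cop_1 id_DD)
    next
      case (Suc m)
      from ideal_prod.prod[OF Suc max_ideal_gen[of i \<mu>], of DD] show ?case
        unfolding ideal_power_Suc by (simp add: sub_Cop o_def)
    qed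
    have val: "evr T (weight_power i c m) f \<nu> = (\<nu> i - c) ^ m * f \<nu>" for i c m \<nu>
      by (induction m) (simp_all add: Hm_def algebra_simps)
    have "evr T (weight_power i (\<mu> i) m) f = (\<lambda>_. 0)" for i
      using m mem[of i m] f hom_ev[OF f(1)] \<phi>_eq_zero_iff by (metis fs_ops(1))
    then have "(\<nu> i - \<mu> i) ^ m * f \<nu> = 0" for \<nu> i
      using val by metis
    then have "f \<nu> \<noteq> 0 \<longrightarrow> \<nu> = \<mu>" for \<nu> by auto
    then show "v \<in> wspace M \<mu>" using f mem_wspace_model by blast
  qed
qed (rule wspace_subset_gen_wspace)

lemma Supp_eq: "Supp M = wtset T \<rho>"
proof
  show "Supp M \<subseteq> wtset T \<rho>"
  proof
    fix \<mu> assume "\<mu> \<in> Supp M"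
    then have "wspace M \<mu> \<noteq> {\<zero>}" by (simp add: Supp_def gen_wspace_eq)
    moreover have "\<zero> \<in> wspace M \<mu>" by (simp add: mem_wspace_iff)
    ultimately obtain v where v: "v \<in> wspace M \<mu>" "v \<noteq> \<zero>" by blast
    then obtain f where f: "f \<in> V" "v = \<phi> f" using \<phi>_surj by (auto simp: mem_wspace_iff)
    then have "f \<noteq> (\<lambda>_. 0)" using v(2) \<phi>_zero by auto
    then obtain \<nu> where "f \<nu> \<noteq> 0" by auto
    moreover then have "\<nu> = \<mu>" using v f mem_wspace_model by blast
    ultimately show "\<mu> \<in> wtset T \<rho>" using fs_in[OF f(1)] by simp
  qed
  show "wtset T \<rho> \<subseteq> Supp M"
  proof
    fix \<mu> assume "\<mu> \<in> wtset T \<rho>"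
    then have d: "delta \<mu> \<in> V" by simp
    then have "\<phi> (delta \<mu>) \<in> wspace M \<mu>" unfolding mem_wspace_model[OF d] by (simp add: delta_def)
    moreover have "\<phi> (delta \<mu>) \<noteq> \<zero>"
      using \<phi>_eq_zero_iff[OF d] by (auto simp: delta_def fun_eq_iff)
    ultimately show "\<mu> \<in> Supp M" by (auto simp: Supp_def gen_wspace_eq)
  qed
qed

lemma direct_sum: "internal_direct_sum M (wspace M)"
  unfolding internal_direct_sum_def
proof (intro conjI allI ballI)
  show "wspace M \<mu> \<subseteq> carrier M" for \<mu> by (auto simp: mem_wspace_iff)
  fix v assume "v \<in> carrier M"
  then obtain f where f: "f \<in> V" "v = \<phi> f" using \<phi>_surj by blast
  define c where "c = (\<lambda>\<mu>. \<phi> (\<lambda>\<kappa>. f \<mu> * delta \<mu> \<kappa>))"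
  have mem: "(\<lambda>\<kappa>. f \<mu> * delta \<mu> \<kappa>) \<in> V" for \<mu>
    by (cases "f \<mu> = 0") (auto intro!: fs_scale[of "delta \<mu>"] fs_delta fs_in[OF f(1)])
  have nz: "{\<mu>. c \<mu> \<noteq> \<zero>} = {\<mu>. f \<mu> \<noteq> 0}"
    unfolding c_def \<phi>_eq_zero_iff[OF mem] by (auto simp: delta_def fun_eq_iff)
  show "\<exists>!c. (\<forall>\<mu>. c \<mu> \<in> wspace M \<mu>) \<and> finite {\<mu>. c \<mu> \<noteq> \<zero>} \<and> v = (\<Oplus>\<mu>\<in>{\<mu>. c \<mu> \<noteq> \<zero>}. c \<mu>)"
  proof (rule ex1I[of _ c], intro conjI allI)
    show "c \<mu> \<in> wspace M \<mu>" for \<mu>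
      unfolding c_def mem_wspace_model[OF mem] by (simp add: delta_def)
    show fin: "finite {\<mu>. c \<mu> \<noteq> \<zero>}" unfolding nz by (rule fs_finite[OF f(1)])
    have "(\<Oplus>\<mu>\<in>{\<mu>. c \<mu> \<noteq> \<zero>}. c \<mu>) = \<phi> (\<lambda>\<kappa>. \<Sum>\<mu> | f \<mu> \<noteq> 0. f \<mu> * delta \<mu> \<kappa>)"
      using hom_sum[of "{\<mu>. f \<mu> \<noteq> 0}" "\<lambda>\<mu> \<kappa>. f \<mu> * delta \<mu> \<kappa>"] mem fin unfolding nz by (simp add: c_def)
    also have "(\<lambda>\<kappa>. \<Sum>\<mu> | f \<mu> \<noteq> 0. f \<mu> * delta \<mu> \<kappa>) = f"
      using fin unfolding nz by (auto simp: delta_def if_distrib cong: if_cong)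
    finally show "v = (\<Oplus>\<mu>\<in>{\<mu>. c \<mu> \<noteq> \<zero>}. c \<mu>)" using f by simp
  next
    fix c' assume c': "(\<forall>\<mu>. c' \<mu> \<in> wspace M \<mu>) \<and> finite {\<mu>. c' \<mu> \<noteq> \<zero>} \<and> v = (\<Oplus>\<mu>\<in>{\<mu>. c' \<mu> \<noteq> \<zero>}. c' \<mu>)"
    then have "\<forall>\<mu>. \<exists>h\<in>V. c' \<mu> = \<phi> h" using \<phi>_surj by (auto simp: mem_wspace_iff)
    then obtain h where h: "\<And>\<mu>. h \<mu> \<in> V" "\<And>\<mu>. c' \<mu> = \<phi> (h \<mu>)" by metis
    have supp: "h \<mu> \<nu> \<noteq> 0 \<longrightarrow> \<nu> = \<mu>" for \<mu> \<nu> using c' h mem_wspace_model by metis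
    let ?A = "{\<mu>. c' \<mu> \<noteq> \<zero>}"
    have "\<phi> f = \<phi> (\<lambda>\<kappa>. \<Sum>\<mu>\<in>?A. h \<mu> \<kappa>)" and sV: "(\<lambda>\<kappa>. \<Sum>\<mu>\<in>?A. h \<mu> \<kappa>) \<in> V"
      using hom_sum[of ?A h] c' h f by simp_all
    then have eq: "f = (\<lambda>\<kappa>. \<Sum>\<mu>\<in>?A. h \<mu> \<kappa>)" using \<phi>_inj f(1) by blast
    \<comment> \<open>Each component of a competing decomposition is supported at its own weight, so
      the value of \<open>f\<close> at \<open>\<mu>\<close> is contributed by the summand with index
      \<open>\<mu>\<close> alone.\<close>
    have "h \<mu> = (\<lambda>\<kappa>. f \<mu> * delta \<mu> \<kappa>)" for \<mu>
    proof -
      have "f \<mu> = (\<Sum>\<nu>\<in>?A. if \<nu> = \<mu> then h \<mu> \<mu> else 0)"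
        unfolding eq by (rule sum.cong) (use supp in auto)
      also have "\<dots> = (if \<mu> \<in> ?A then h \<mu> \<mu> else 0)" using c' by simp
      also have "\<dots> = h \<mu> \<mu>"
        using h \<phi>_eq_zero_iff[OF h(1)[of \<mu>]] by auto
      finally have "f \<mu> = h \<mu> \<mu>" .
      then show ?thesis using supp[of \<mu>] by (intro ext) (auto simp: delta_def)
    qed
    then show "c' = c" using h by (auto simp: c_def)
  qed
qed

lemma weight: "weight M" and gen_weight: "gen_weight M"
proof -
  have "gen_wspace M = wspace M" by (rule ext) (rule gen_wspace_eq)
  then show "weight M" "gen_weight M"
    unfolding weight_def gen_weight_def using right_module direct_sum by simp_all
qed

lemma simple: "right_simple II M"
  unfolding right_simple_def
proof (intro conjI allI impI)
  show "right_module II M" by (rule right_module)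
  obtain \<mu> where "\<mu> \<in> wtset T \<rho>" using wtset_nonempty by blast
  then have d: "delta \<mu> \<in> V" by simp
  then have "\<phi> (delta \<mu>) \<noteq> \<zero>"
    using \<phi>_eq_zero_iff[OF d] by (auto simp: delta_def fun_eq_iff)
  then show "carrier M \<noteq> {\<zero>}" using d \<phi>_closed by blast
  fix N assume "submodule N II M"
  note N = submoduleD[OF this]
  show "N = {\<zero>} \<or> N = carrier M"
  proof (cases "N = {\<zero>}")
    case False
    then obtain v where v: "v \<in> N" "v \<noteq> \<zero>" using N(2) by blast
    then obtain f where f: "f \<in> V" "v = \<phi> f" using N(1) \<phi>_surj by blast
    then have "f \<noteq> (\<lambda>_. 0)" using v(2) \<phi>_zero by auto
    then obtain \<nu> where \<nu>: "f \<nu> \<noteq> 0" by auto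
    let ?K = "{f. \<phi> f \<in> N}"
    have K_add: "(\<lambda>\<nu>. f \<nu> + g \<nu>) \<in> ?K" if "f \<in> V" "g \<in> V" "f \<in> ?K" "g \<in> ?K" for f g
      using that N(3) by (simp add: hom_add)
    have K_scale: "(\<lambda>\<nu>. c * f \<nu>) \<in> ?K" if "f \<in> V" "f \<in> ?K" for c f
      using that N(4) by (simp add: hom_Cop)
    have "delta \<nu> \<in> ?K"
      by (rule weight_extract[of f "wtset T \<rho>"])
        (use f \<nu> v N K_add K_scale in \<open>simp_all add: hom_Hop\<close>)
    have all: "delta \<mu> \<in> ?K" if \<mu>: "\<mu> \<in> wtset T \<rho>" for \<mu>
    proof -
      have "\<mu> \<in> {\<mu>. delta \<mu> \<in> ?K}"
      proof (rule wtset_connected[of \<nu> T \<rho>])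
        show "\<nu> \<in> wtset T \<rho>" using \<nu> by (rule fs_in[OF f(1)])
        show "\<nu> \<in> {\<mu>. delta \<mu> \<in> ?K}" using \<open>delta \<nu> \<in> ?K\<close> by simp
        show "\<mu> \<in> wtset T \<rho>" by (rule \<mu>)
        show "\<kappa>(i := \<kappa> i + 1) \<in> {\<mu>. delta \<mu> \<in> ?K}"
          if "\<kappa> \<in> wtset T \<rho>" "\<kappa> \<in> {\<mu>. delta \<mu> \<in> ?K}" for \<kappa> i
          using that N(4) hom_Dop[of "delta \<kappa>" i] by (simp add: Dm_delta)
        show "\<kappa> \<in> {\<mu>. delta \<mu> \<in> ?K}"
          if \<kappa>: "\<kappa> \<in> wtset T \<rho>" "\<kappa>(i := \<kappa> i + 1) \<in> {\<mu>. delta \<mu> \<in> ?K}" for \<kappa> i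
        proof -
          have "\<kappa>(i := \<kappa> i + 1) \<in> wtset T \<rho>" using wtset_upd_nat[OF \<kappa>(1), of i 1] by simp
          \<comment> \<open>A step down from the raised weight is never truncated: that would mean
            \<open>\<kappa> i = 0\<close>, but for \<open>i\<close> in \<open>T\<close> this
            component is positive.\<close>
          moreover have "\<not> (i \<in> T \<and> (\<kappa>(i := \<kappa> i + 1)) i = 1)"
            using \<kappa>(1) pos_step(2)[of "\<kappa> i"] by (auto simp: wtset_def)
          ultimately show ?thesis
            using \<kappa> N(4) hom_Jop[of "delta (\<kappa>(i := \<kappa> i + 1))" i] by (simp add: Jm_delta)
        qed
      qed
      then show ?thesis by simp
    qed
    have "\<phi> g \<in> N" if "g \<in> V" for g
      using that
    proof (induction rule: fs_induct)
      case zero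
      then show ?case using N(2) by (simp add: \<phi>_zero)
    next
      case (add g \<nu> c)
      then have "(\<lambda>\<kappa>. c * delta \<nu> \<kappa> + g \<kappa>) \<in> ?K"
        by (intro K_add K_scale fs_scale all) auto
      then show ?case by simp
    qed
    then show ?thesis using N(1) \<phi>_surj by blast
  qed simp
qed

lemma simple_weight: "simple_weight M" and simple_gen_weight: "simple_gen_weight M"
  by (simp_all add: simple_weight_def simple_gen_weight_def simple weight gen_weight)

end

lemma model_axioms_all:
  assumes "model M T \<rho> \<phi>"
  shows "right_module II M" "bij_betw \<phi> (fs (wtset T \<rho>)) (carrier M)"
  using model.axioms(1)[OF assms] model.bij[OF assms] by (simp_all add: II_module_def)

lemma model_iso:
  assumes M: "model M T \<rho> \<phi>" and N: "model N T \<rho> \<psi>"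
  shows "right_iso II M N"
proof -
  interpret M: model M T \<rho> \<phi> by (rule M)
  interpret N: model N T \<rho> \<psi> by (rule N)
  define \<theta> where "\<theta> = \<psi> \<circ> inv_into M.V \<phi>"
  have \<theta>: "\<theta> (\<phi> f) = \<psi> f" if "f \<in> M.V" for f
    using that M.bij by (simp add: \<theta>_def bij_betw_inv_into_left)
  have "bij_betw \<theta> (carrier M) (carrier N)"
    unfolding \<theta>_def by (rule bij_betw_trans[OF bij_betw_inv_into[OF M.bij] N.bij])
  moreover have "\<theta> (u \<oplus>\<^bsub>M\<^esub> v) = \<theta> u \<oplus>\<^bsub>N\<^esub> \<theta> v" if uv: "u \<in> carrier M" "v \<in> carrier M" for u v
  proof -
    obtain f g where "f \<in> M.V" "g \<in> M.V" "u = \<phi> f" "v = \<phi> g"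
      using M.\<phi>_surj[OF uv(1)] M.\<phi>_surj[OF uv(2)] by auto
    then show ?thesis
      using \<theta>[of "\<lambda>\<nu>. f \<nu> + g \<nu>"] by (simp add: \<theta> M.hom_add N.hom_add fs_add)
  qed
  moreover have "\<theta> (a \<odot>\<^bsub>M\<^esub> v) = a \<odot>\<^bsub>N\<^esub> \<theta> v" if av: "a \<in> carrier II" "v \<in> carrier M" for a v
  proof -
    obtain e f where "a = ev e" "f \<in> M.V" "v = \<phi> f"
      using av M.\<phi>_surj[OF av(2)] by (auto simp: carrier_II)
    then show ?thesis
      using \<theta>[of "evr T e f"] by (simp add: \<theta> M.hom_ev N.hom_ev)
  qed
  ultimately show ?thesis
    unfolding right_iso_def iso_def hom_def bij_betw_def
    using M.right_module N.right_module by (intro conjI bexI[of _ \<theta>]) auto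
qed

lemma iso_model:
  assumes M: "model M T \<rho> \<phi>" and "right_iso II M N"
  shows "\<exists>\<psi>. model N T \<rho> \<psi>"
proof -
  interpret M: model M T \<rho> \<phi> by (rule M)
  from assms(2) obtain \<theta> where N: "right_module II N"
    and \<theta>: "bij_betw \<theta> (carrier M) (carrier N)"
    "\<And>u v. u \<in> carrier M \<Longrightarrow> v \<in> carrier M \<Longrightarrow> \<theta> (u \<oplus>\<^bsub>M\<^esub> v) = \<theta> u \<oplus>\<^bsub>N\<^esub> \<theta> v"
    "\<And>a v. a \<in> carrier II \<Longrightarrow> v \<in> carrier M \<Longrightarrow> \<theta> (a \<odot>\<^bsub>M\<^esub> v) = a \<odot>\<^bsub>N\<^esub> \<theta> v"
    unfolding right_iso_def iso_def hom_def by auto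
  have "model N T \<rho> (\<theta> \<circ> \<phi>)"
  proof (intro model.intro II_module.intro model_axioms.intro N)
    show "bij_betw (\<theta> \<circ> \<phi>) (fs (wtset T \<rho>)) (carrier N)" by (rule bij_betw_trans[OF M.bij \<theta>(1)])
  qed (simp_all add: \<theta> M.hom_add M.hom_Cop M.hom_Dop M.hom_Jop M.hom_Hop)
  then show ?thesis by (rule exI[of _ "\<theta> \<circ> \<phi>"])
qed

text \<open>A direction in \<open>T\<close> is recognized by the absence of weight 0. If
  \<open>i\<close> lay in \<open>T\<close> but not in \<open>T'\<close>, one could step from
  component 1 down to 0 within the common set.\<close>

lemma wtset_eq_imp: "wtset T \<rho> = wtset T' \<rho>' \<Longrightarrow> T = T'"
proof -
  have "i \<in> T'" if eq: "wtset T \<rho> = wtset T' \<rho>'" and i: "i \<in> T"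
    for T T' i and \<rho> \<rho>' :: "'n \<Rightarrow> 'k::field_char_0"
  proof (rule ccontr)
    assume i': "i \<notin> T'"
    obtain \<mu> where \<mu>: "\<mu> \<in> wtset T \<rho>" using wtset_nonempty by blast
    then have "\<mu>(i := 1) \<in> wtset T \<rho>" using i by (auto simp: wtset_def intro: exI[of _ "0::nat"])
    then have "(\<mu>(i := 1))(i := (\<mu>(i := 1)) i - 1) \<in> wtset T \<rho>"
      unfolding eq using i' by (intro wtset_down) simp_all
    then have "(\<mu>(i := 0)) \<in> wtset T \<rho>" by simp
    then have "if i \<in> T then \<exists>m::nat. (\<mu>(i := 0)) i = of_nat m + 1 else \<exists>m::int. (\<mu>(i := 0)) i = \<rho> i + of_int m"
      unfolding wtset_def mem_Collect_eq by (rule spec)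
    then have "\<exists>m::nat. 0 = of_nat m + (1 :: 'k)" using i by simp
    then show False using pos_step(2)[of "0 :: 'k"] by simp
  qed
  from this[of T \<rho> T' \<rho>'] this[of T' \<rho>' T \<rho>]
  show "wtset T \<rho> = wtset T' \<rho>' \<Longrightarrow> T = T'" by auto
qed

lemma model_wtset_cong:
  assumes "model M T \<rho> \<phi>" "wtset T \<rho> = wtset T' \<rho>'"
  shows "model M T' \<rho>' \<phi>"
  using assms wtset_eq_imp[OF assms(2)] by (simp add: model_def model_axioms_def)

text \<open>The weight set is the support, hence an invariant; by \<open>model_iso\<close> it is a
  complete one.\<close>

lemma model_iso_iff:
  assumes M: "model M T \<rho> \<phi>" and N: "model N T' \<rho>' \<psi>"
  shows "right_iso II M N \<longleftrightarrow> wtset T \<rho> = wtset T' \<rho>'"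
proof
  assume "right_iso II M N"
  then obtain \<chi> where \<chi>: "model N T \<rho> \<chi>" using iso_model[OF M] by auto
  show "wtset T \<rho> = wtset T' \<rho>'" using model.Supp_eq[OF N] model.Supp_eq[OF \<chi>] by simp
next
  assume "wtset T \<rho> = wtset T' \<rho>'"
  then show "right_iso II M N" by (rule model_iso[OF model_wtset_cong[OF M] N])
qed

section \<open>The standard weight modules\<close>

text \<open>The word picked by \<open>SOME\<close> does not matter, by
  \<open>evr_well_defined\<close>; \<open>wmodule_act\<close> evaluates the action with any
  word.\<close>

definition wmodule :: "'n set \<Rightarrow> ('n \<Rightarrow> 'k) \<Rightarrow> (('k::field_char_0, 'n::finite) op, ('n \<Rightarrow> 'k) \<Rightarrow> 'k) module" where
  "wmodule T \<rho> = \<lparr>carrier = fs (wtset T \<rho>), monoid.mult = undefined, one = undefined, zero = (\<lambda>_. 0),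
     add = (\<lambda>f g \<nu>. f \<nu> + g \<nu>), module.smult = (\<lambda>a. evr T (SOME e. ev e = a))\<rparr>"

lemma wmodule_act: "f \<in> fs (wtset T \<rho>) \<Longrightarrow> ev e \<odot>\<^bsub>wmodule T \<rho>\<^esub> f = evr T e f"
proof -
  assume "f \<in> fs (wtset T \<rho>)"
  then have f: "f \<in> fs (posset T)" using wtset_subset fs_mono by blast
  have "ev (SOME e'. ev e' = ev e) = ev e" by (rule someI[of _ e]) simp
  then have "evr T (SOME e'. ev e' = ev e) f = evr T e f" using f by (rule evr_well_defined)
  then show ?thesis by (simp add: wmodule_def)
qed

lemma model_wmodule:
  fixes \<rho> :: "'n::finite \<Rightarrow> 'k::field_char_0"
  shows "model (wmodule T \<rho>) T \<rho> id"
proof -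
  have fsE: "evr T e f \<in> fs (wtset T \<rho>)" if "f \<in> fs (wtset T \<rho>)" for e f
    using that by (rule fs_evr[OF step_closed_wtset])
  have "right_module II (wmodule T \<rho>)"
  proof (rule right_moduleI[OF ring_II])
    show "abelian_group (wmodule T \<rho>)"
    proof (rule abelian_groupI)
      fix f assume f: "f \<in> carrier (wmodule T \<rho>)"
      then have "(\<lambda>\<nu>. - 1 * f \<nu>) \<in> carrier (wmodule T \<rho>)"
        unfolding wmodule_def partial_object.simps by (rule fs_scale)
      then show "\<exists>g\<in>carrier (wmodule T \<rho>). g \<oplus>\<^bsub>wmodule T \<rho>\<^esub> f = \<zero>\<^bsub>wmodule T \<rho>\<^esub>"
        by (rule bexI[rotated]) (simp add: wmodule_def)
    qed (auto simp: wmodule_def fs_add algebra_simps)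
  next
    fix a b :: "('k, 'n) op" and f g
    assume "a \<in> carrier II" "b \<in> carrier II" and f: "f \<in> carrier (wmodule T \<rho>)"
    then obtain e e' where e: "a = ev e" "b = ev e'" by (auto simp: carrier_II)
    have fV: "f \<in> fs (wtset T \<rho>)" using f by (simp add: wmodule_def)
    note act = wmodule_act[of _ T \<rho>]
    have p: "g \<oplus>\<^bsub>wmodule T \<rho>\<^esub> h = (\<lambda>\<nu>. g \<nu> + h \<nu>)" for g h by (simp add: wmodule_def)
    show "(a \<oplus>\<^bsub>II\<^esub> b) \<odot>\<^bsub>wmodule T \<rho>\<^esub> f = a \<odot>\<^bsub>wmodule T \<rho>\<^esub> f \<oplus>\<^bsub>wmodule T \<rho>\<^esub> b \<odot>\<^bsub>wmodule T \<rho>\<^esub> f"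
      using act[OF fV, of "Add e e'"] act[OF fV] by (simp add: e p)
    show "(a \<otimes>\<^bsub>II\<^esub> b) \<odot>\<^bsub>wmodule T \<rho>\<^esub> f = b \<odot>\<^bsub>wmodule T \<rho>\<^esub> (a \<odot>\<^bsub>wmodule T \<rho>\<^esub> f)"
      using act[OF fV, of "Mul e e'"] act[OF fV] act[OF fsE[OF fV]] by (simp add: e p)
  next
    fix a :: "('k, 'n) op" and f
    assume "a \<in> carrier II" and f: "f \<in> carrier (wmodule T \<rho>)"
    then obtain e where e: "a = ev e" by (auto simp: carrier_II)
    have fV: "f \<in> fs (wtset T \<rho>)" using f by (simp add: wmodule_def)
    show "a \<odot>\<^bsub>wmodule T \<rho>\<^esub> f \<in> carrier (wmodule T \<rho>)"
      unfolding e wmodule_act[OF fV] using fsE[OF fV] by (simp add: wmodule_def)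
    fix g assume "g \<in> carrier (wmodule T \<rho>)"
    then have gV: "g \<in> fs (wtset T \<rho>)" by (simp add: wmodule_def)
    have p: "g \<oplus>\<^bsub>wmodule T \<rho>\<^esub> h = (\<lambda>\<nu>. g \<nu> + h \<nu>)" for g h by (simp add: wmodule_def)
    show "a \<odot>\<^bsub>wmodule T \<rho>\<^esub> (f \<oplus>\<^bsub>wmodule T \<rho>\<^esub> g) = a \<odot>\<^bsub>wmodule T \<rho>\<^esub> f \<oplus>\<^bsub>wmodule T \<rho>\<^esub> a \<odot>\<^bsub>wmodule T \<rho>\<^esub> g"
      unfolding e p wmodule_act[OF fV] wmodule_act[OF gV] wmodule_act[OF fs_add[OF fV gV]] by (rule evr_add)
  next
    fix f assume f: "f \<in> carrier (wmodule T \<rho>)"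
    then have fV: "f \<in> fs (wtset T \<rho>)" by (simp add: wmodule_def)
    show "\<one>\<^bsub>II\<^esub> \<odot>\<^bsub>wmodule T \<rho>\<^esub> f = f"
      using wmodule_act[OF fV, of "Sc 1"] by (simp add: Cop_1)
  qed
  then show ?thesis
  proof (intro model.intro II_module.intro model_axioms.intro)
    fix f :: "('n \<Rightarrow> 'k) \<Rightarrow> 'k" and c i assume f: "f \<in> fs (wtset T \<rho>)"
    show "id (\<lambda>\<nu>. c * f \<nu>) = Cop c \<odot>\<^bsub>wmodule T \<rho>\<^esub> id f" using wmodule_act[OF f, of "Sc c"] by simp
    show "id (Dm i f) = Dop i \<odot>\<^bsub>wmodule T \<rho>\<^esub> id f" using wmodule_act[OF f, of "GD i"] by simp
    show "id (Jm T i f) = Jop i \<odot>\<^bsub>wmodule T \<rho>\<^esub> id f" using wmodule_act[OF f, of "GJ i"] by simp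
    show "id (Hm i f) = Hop i \<odot>\<^bsub>wmodule T \<rho>\<^esub> id f" using wmodule_act[OF f, of "GH i"] by simp
  qed (simp_all add: wmodule_def)
qed

section \<open>Simple modules with a weight vector\<close>

lemma wtset_pos: "\<nu> \<in> wtset T \<rho> \<Longrightarrow> i \<in> T \<Longrightarrow> \<exists>m::nat. \<nu> i = of_nat m + 1"
  unfolding wtset_def mem_Collect_eq by (drule spec[of _ i]) simp

lemma (in abelian_group) minus_eq_minusI:
  assumes "a \<oplus> b = c \<oplus> d" "a \<in> carrier G" "b \<in> carrier G" "c \<in> carrier G" "d \<in> carrier G"
  shows "a \<ominus> c = d \<ominus> b"
proof -
  have "a = (c \<oplus> d) \<oplus> \<ominus> b" using assms add.inv_solve_right[of a "c \<oplus> d" b] by simp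
  then have "a = c \<oplus> (d \<ominus> b)" using assms(2-) by (simp add: a_minus_def a_assoc)
  then have "a \<ominus> c = (d \<ominus> b) \<oplus> c \<ominus> c" using assms(2-) by (simp add: a_comm)
  also have "\<dots> = d \<ominus> b" using assms(2-) by (simp add: a_minus_def a_assoc r_neg)
  finally show ?thesis .
qed

context II_module
begin

text \<open>Independence comes from the weights: a nonzero combination equal to 0 would by
  \<open>weight_extract\<close> force one of the nonzero \<open>b \<nu>\<close> to be 0. The span is
  closed under the generators, hence a submodule, and \<open>gen\<close> makes it
  everything.\<close>

lemma model_from_basis:
  assumes b: "\<And>\<nu>. \<nu> \<in> wtset T \<rho> \<Longrightarrow> b \<nu> \<in> carrier M" "\<And>\<nu>. \<nu> \<in> wtset T \<rho> \<Longrightarrow> b \<nu> \<noteq> \<zero>"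
    and D: "\<And>\<nu> i. \<nu> \<in> wtset T \<rho> \<Longrightarrow> Dop i \<odot> b \<nu> = b (\<nu>(i := \<nu> i + 1))"
    and J: "\<And>\<nu> i. \<nu> \<in> wtset T \<rho> \<Longrightarrow> Jop i \<odot> b \<nu> = (if i \<in> T \<and> \<nu> i = 1 then \<zero> else b (\<nu>(i := \<nu> i - 1)))"
    and H: "\<And>\<nu> i. \<nu> \<in> wtset T \<rho> \<Longrightarrow> Hop i \<odot> b \<nu> = Cop (\<nu> i) \<odot> b \<nu>"
    and gen: "\<And>N. submodule N II M \<Longrightarrow> (\<And>\<nu>. \<nu> \<in> wtset T \<rho> \<Longrightarrow> b \<nu> \<in> N) \<Longrightarrow> N = carrier M"
  shows "\<exists>\<phi>. model M T \<rho> \<phi>"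
proof -
  let ?V = "fs (wtset T \<rho>) :: (('n \<Rightarrow> 'k) \<Rightarrow> 'k) set"
  define \<phi> where "\<phi> f = (\<Oplus>\<nu>\<in>{\<nu>. f \<nu> \<noteq> 0}. Cop (f \<nu>) \<odot> b \<nu>)" for f
  have \<phi>: "\<phi> f = (\<Oplus>\<nu>\<in>A. Cop (f \<nu>) \<odot> b \<nu>)"
    if "f \<in> ?V" "finite A" "{\<nu>. f \<nu> \<noteq> 0} \<subseteq> A" "A \<subseteq> wtset T \<rho>" for f A
    unfolding \<phi>_def
    by (rule add.finprod_mono_neutral_cong_left) (use that in \<open>auto simp: act_Cop(4) b subset_iff\<close>)
  have supp: "{\<nu>. f \<nu> \<noteq> 0} \<subseteq> wtset T \<rho>" if "f \<in> ?V" for f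
    using fs_in[OF that] by auto
  have closed: "\<phi> f \<in> carrier M" if "f \<in> ?V" for f
    unfolding \<phi>_def by (rule finsum_closed) (use supp[OF that] b in auto)
  have hadd: "\<phi> (\<lambda>\<nu>. f \<nu> + g \<nu>) = \<phi> f \<oplus> \<phi> g" if f: "f \<in> ?V" and g: "g \<in> ?V" for f g
  proof -
    let ?A = "{\<nu>. f \<nu> \<noteq> 0} \<union> {\<nu>. g \<nu> \<noteq> 0}"
    have A: "finite ?A" "?A \<subseteq> wtset T \<rho>"
      using supp[OF f] supp[OF g] fs_finite[OF f] fs_finite[OF g] by auto
    have "\<phi> (\<lambda>\<nu>. f \<nu> + g \<nu>) = (\<Oplus>\<nu>\<in>?A. Cop (f \<nu> + g \<nu>) \<odot> b \<nu>)"
      by (rule \<phi>[OF fs_add[OF f g] A(1) _ A(2)]) auto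
    also have "\<dots> = (\<Oplus>\<nu>\<in>?A. Cop (f \<nu>) \<odot> b \<nu> \<oplus> Cop (g \<nu>) \<odot> b \<nu>)"
      by (rule add.finprod_cong') (use A(2) b in \<open>auto simp: act_Cop(1)\<close>)
    also have "\<dots> = (\<Oplus>\<nu>\<in>?A. Cop (f \<nu>) \<odot> b \<nu>) \<oplus> (\<Oplus>\<nu>\<in>?A. Cop (g \<nu>) \<odot> b \<nu>)"
      by (rule finsum_addf) (use A(2) b in auto)
    also have "\<dots> = \<phi> f \<oplus> \<phi> g" using \<phi>[OF f A(1) _ A(2)] \<phi>[OF g A(1) _ A(2)] by simp
    finally show ?thesis .
  qed
  have cdelta: "\<phi> (\<lambda>\<kappa>. c * delta \<nu> \<kappa>) = Cop c \<odot> b \<nu>" if \<nu>: "\<nu> \<in> wtset T \<rho>" for c \<nu>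
  proof -
    have "(\<lambda>\<kappa>. c * delta \<nu> \<kappa>) \<in> ?V" using \<nu> by (intro fs_scale) simp
    then have "\<phi> (\<lambda>\<kappa>. c * delta \<nu> \<kappa>) = (\<Oplus>\<kappa>\<in>{\<nu>}. Cop (c * delta \<nu> \<kappa>) \<odot> b \<kappa>)"
      by (rule \<phi>) (use \<nu> in \<open>auto simp: delta_def\<close>)
    also have "\<dots> = Cop c \<odot> b \<nu>" using b(1)[OF \<nu>] by (simp add: finsum_insert Pi_def) (simp add: delta_def)
    finally show ?thesis .
  qed
  have delta: "\<phi> (delta \<nu>) = b \<nu>" if "\<nu> \<in> wtset T \<rho>" for \<nu>
    using cdelta[OF that, of 1] b(1)[OF that] by (simp add: act_Cop(3))
  have hzero: "\<phi> (\<lambda>_. 0) = \<zero>" by (simp add: \<phi>_def)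
  have cV: "(\<lambda>\<kappa>. c * delta \<nu> \<kappa>) \<in> ?V" if "\<nu> \<in> wtset T \<rho>" for c \<nu>
    using that by (intro fs_scale) simp
  have scale: "\<phi> (\<lambda>\<nu>. c * f \<nu>) = Cop c \<odot> \<phi> f" if "f \<in> ?V" for c f
    using that
  proof (induction rule: fs_induct)
    case zero
    then show ?case by (simp add: hzero)
  next
    case (add g \<nu> d)
    have "\<phi> (\<lambda>\<kappa>. c * (d * delta \<nu> \<kappa> + g \<kappa>)) = \<phi> (\<lambda>\<kappa>. (c * d) * delta \<nu> \<kappa> + c * g \<kappa>)"
      by (simp add: algebra_simps)
    also have "\<dots> = Cop (c * d) \<odot> b \<nu> \<oplus> Cop c \<odot> \<phi> g"
      using add cV fs_scale[OF add(1)] by (simp add: hadd cdelta)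
    also have "\<dots> = Cop c \<odot> \<phi> (\<lambda>\<kappa>. d * delta \<nu> \<kappa> + g \<kappa>)"
      using add cV closed[OF add(1)] b(1)[OF add(2)]
      by (simp add: hadd cdelta act_Cop(2) act_add)
    finally show ?case .
  qed
  have gen_hom: "\<phi> (evr T e f) = ev e \<odot> \<phi> f"
    if f: "f \<in> ?V" and e: "\<And>\<nu>. \<nu> \<in> wtset T \<rho> \<Longrightarrow> \<phi> (evr T e (delta \<nu>)) = ev e \<odot> b \<nu>" for e f
    using f
  proof (induction rule: fs_induct)
    case zero
    then show ?case by (simp add: hzero evr_zero)
  next
    case (add g \<nu> c)
    have E: "evr T e h \<in> ?V" if "h \<in> ?V" for h using that by (rule fs_evr[OF step_closed_wtset])
    have "\<phi> (evr T e (\<lambda>\<kappa>. c * delta \<nu> \<kappa> + g \<kappa>)) = Cop c \<odot> (ev e \<odot> b \<nu>) \<oplus> ev e \<odot> \<phi> g"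
      using add E fs_scale[OF E[OF fs_delta[OF add(2)]]]
      by (simp add: evr_add evr_scale hadd scale e)
    also have "\<dots> = ev e \<odot> \<phi> (\<lambda>\<kappa>. c * delta \<nu> \<kappa> + g \<kappa>)"
      using add cV closed[OF add(1)] b(1)[OF add(2)]
      by (simp add: hadd cdelta act_Cop_commute act_add)
    finally show ?case .
  qed
  have hD: "\<phi> (Dm i f) = Dop i \<odot> \<phi> f" if "f \<in> ?V" for i f
    using gen_hom[OF that, of "GD i"] by (simp add: Dm_delta delta wtset_up D)
  have hJ: "\<phi> (Jm T i f) = Jop i \<odot> \<phi> f" if "f \<in> ?V" for i f
  proof -
    have "\<phi> (Jm T i (delta \<nu>)) = Jop i \<odot> b \<nu>" if \<nu>: "\<nu> \<in> wtset T \<rho>" for \<nu>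
    proof (cases "i \<in> T \<and> \<nu> i = 1")
      case True
      then have "Jm T i (delta \<nu>) = (\<lambda>_. 0)" by (intro ext) (auto simp: Jm_def delta_def)
      with True show ?thesis by (simp add: hzero J \<nu>)
    next
      case False
      then show ?thesis by (auto simp: Jm_delta delta wtset_down J \<nu>)
    qed
    then show ?thesis using gen_hom[OF that, of "GJ i"] by simp
  qed
  have hH: "\<phi> (Hm i f) = Hop i \<odot> \<phi> f" if "f \<in> ?V" for i f
    using gen_hom[OF that, of "GH i"] by (simp add: Hm_delta cdelta H)
  have ker: "f = (\<lambda>_. 0)" if f: "f \<in> ?V" "\<phi> f = \<zero>" for f
  proof (rule ccontr)
    assume "f \<noteq> (\<lambda>_. 0)"
    then obtain \<nu> where \<nu>: "f \<nu> \<noteq> 0" by auto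
    have "delta \<nu> \<in> {f. \<phi> f = \<zero>}"
      by (rule weight_extract[of f "wtset T \<rho>"]) (use f \<nu> in \<open>simp_all add: hadd scale hH\<close>)
    moreover have "\<nu> \<in> wtset T \<rho>" using \<nu> by (rule fs_in[OF f(1)])
    ultimately show False using delta b(2) by simp
  qed
  have inj: "inj_on \<phi> ?V"
  proof (rule inj_onI)
    fix f g assume f: "f \<in> ?V" and g: "g \<in> ?V" and eq: "\<phi> f = \<phi> g"
    have g': "(\<lambda>\<nu>. (- 1) * g \<nu>) \<in> ?V" using g by (rule fs_scale)
    have "\<phi> (\<lambda>\<nu>. f \<nu> + (- 1) * g \<nu>) = \<phi> g \<oplus> Cop (- 1) \<odot> \<phi> g"
      using hadd[OF f g'] scale[OF g, of "- 1"] eq by simp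
    also have "\<dots> = \<zero>" using closed[OF g] Cop_minus[of "\<phi> g" 1] by (simp add: act_Cop(3) r_neg)
    finally have "(\<lambda>\<nu>. f \<nu> + (- 1) * g \<nu>) = (\<lambda>_. 0)" by (rule ker[OF fs_add[OF f g']])
    then have "f \<nu> = g \<nu>" for \<nu> using fun_cong[of _ _ \<nu>] by fastforce
    then show "f = g" by auto
  qed
  have "submodule (\<phi> ` ?V) II M"
  proof (rule submoduleI_gens)
    show "\<phi> ` ?V \<subseteq> carrier M" using closed by auto
    show "\<zero> \<in> \<phi> ` ?V" using hzero by (metis fs_zero imageI)
    show "u \<oplus> v \<in> \<phi> ` ?V" if "u \<in> \<phi> ` ?V" "v \<in> \<phi> ` ?V" for u v
      using that by (auto simp: hadd[symmetric] intro: fs_add)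
    show "Cop c \<odot> v \<in> \<phi> ` ?V" "Dop i \<odot> v \<in> \<phi> ` ?V" "Jop i \<odot> v \<in> \<phi> ` ?V" "Hop i \<odot> v \<in> \<phi> ` ?V"
      if v: "v \<in> \<phi> ` ?V" for c i v
    proof -
      obtain f where f: "f \<in> ?V" "v = \<phi> f" using v by auto
      have "evr T e f \<in> ?V" for e using f(1) by (rule fs_evr[OF step_closed_wtset])
      from this[of "Sc c"] this[of "GD i"] this[of "GJ i"] this[of "GH i"] f
      show "Cop c \<odot> v \<in> \<phi> ` ?V" "Dop i \<odot> v \<in> \<phi> ` ?V" "Jop i \<odot> v \<in> \<phi> ` ?V" "Hop i \<odot> v \<in> \<phi> ` ?V"
        by (simp_all add: scale[symmetric] hD[symmetric] hJ[symmetric] hH[symmetric])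
    qed
  qed
  then have "\<phi> ` ?V = carrier M"
    by (rule gen) (metis delta fs_delta imageI)
  then have "model M T \<rho> \<phi>"
    by (intro model.intro II_module_axioms model_axioms.intro)
      (simp_all add: bij_betw_def inj hadd scale hD hJ hH)
  then show ?thesis by (rule exI[of _ \<phi>])
qed

section \<open>Strings of vectors in a single direction\<close>

definition pw :: "('k, 'n) op \<Rightarrow> nat \<Rightarrow> 'v \<Rightarrow> 'v" where
  "pw a s = (\<lambda>v. a \<odot> v) ^^ s"

lemma pw_0 [simp]: "pw a 0 v = v"
  and pw_Suc [simp]: "pw a (Suc s) v = a \<odot> pw a s v"
  by (simp_all add: pw_def)

lemma pw_Suc': "pw a (Suc s) v = pw a s (a \<odot> v)"
  by (simp add: pw_def funpow_swap1)

lemma pw_closed [simp, intro]: "a \<in> carrier II \<Longrightarrow> v \<in> carrier M \<Longrightarrow> pw a s v \<in> carrier M"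
  by (induction s) auto

lemma act_commute:
  assumes "a \<circ> b = b \<circ> a" "a \<in> carrier II" "b \<in> carrier II" "v \<in> carrier M"
  shows "a \<odot> (b \<odot> v) = b \<odot> (a \<odot> v)"
  using assms by (metis act_comp)

lemma pw_commute:
  assumes "a \<circ> b = b \<circ> a" "a \<in> carrier II" "b \<in> carrier II" "v \<in> carrier M"
  shows "b \<odot> pw a s v = pw a s (b \<odot> v)"
  using assms
proof (induction s)
  case (Suc s)
  then have "b \<odot> (a \<odot> pw a s v) = a \<odot> (b \<odot> pw a s v)"
    by (intro act_commute) (simp_all del: o_apply)
  with Suc show ?case by simp
qed simp

lemma pw_zero: "a \<in> carrier II \<Longrightarrow> pw a s \<zero> = \<zero>"
  by (induction s) auto

text \<open>Read on the right this is \<open>v \<partial>\<^sub>i \<integral>\<^sub>i = v\<close>,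
  from \<open>\<partial>\<^sub>i \<integral>\<^sub>i = 1\<close>. The other order
  \<open>v \<integral>\<^sub>i \<partial>\<^sub>i\<close> gives \<open>v\<close> only in the
  directions outside \<open>T\<close>.\<close>

lemma J_D: "v \<in> carrier M \<Longrightarrow> Jop i \<odot> (Dop i \<odot> v) = v"
  by (metis act_comp act_id in_carrier_II(2,3) op_relations(1))

lemma H_D: "v \<in> carrier M \<Longrightarrow> Hop i \<odot> (Dop i \<odot> v) = Dop i \<odot> (Hop i \<odot> v) \<oplus> Dop i \<odot> v"
  using arg_cong[OF op_relations(2)[of i], of "\<lambda>a. a \<odot> v"]
  by (simp only: act_add_op act_comp in_carrier_II carrier_II_mult)

lemma J_H: "v \<in> carrier M \<Longrightarrow> Jop i \<odot> (Hop i \<odot> v) = Hop i \<odot> (Jop i \<odot> v) \<oplus> Jop i \<odot> v"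
  using arg_cong[OF op_relations(3)[of i], of "\<lambda>a. a \<odot> v"]
  by (simp only: act_add_op act_comp in_carrier_II carrier_II_mult)

lemma H_D_weight:
  assumes "v \<in> carrier M" "Hop i \<odot> v = Cop c \<odot> v"
  shows "Hop i \<odot> (Dop i \<odot> v) = Cop (c + 1) \<odot> (Dop i \<odot> v)"
  using assms by (simp add: H_D act_Cop_commute act_Cop)

lemma H_J_weight:
  assumes v: "v \<in> carrier M" "Hop i \<odot> v = Cop c \<odot> v"
  shows "Hop i \<odot> (Jop i \<odot> v) = Cop (c - 1) \<odot> (Jop i \<odot> v)"
proof -
  have "Hop i \<odot> (Jop i \<odot> v) \<oplus> Jop i \<odot> v = Cop c \<odot> (Jop i \<odot> v)"
    using J_H[OF v(1), of i] v by (simp add: act_Cop_commute)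
  also have "\<dots> = Cop (c - 1) \<odot> (Jop i \<odot> v) \<oplus> Jop i \<odot> v"
    using v act_Cop(1)[of "Jop i \<odot> v" "c - 1" 1] by (simp add: act_Cop(3))
  finally show ?thesis using v by (simp add: add.right_cancel)
qed

lemma H_pw_D:
  "v \<in> carrier M \<Longrightarrow> Hop i \<odot> v = Cop c \<odot> v \<Longrightarrow>
    Hop i \<odot> pw (Dop i) s v = Cop (c + of_nat s) \<odot> pw (Dop i) s v"
  by (induction s) (simp_all add: H_D_weight algebra_simps)

lemma H_pw_J:
  "v \<in> carrier M \<Longrightarrow> Hop i \<odot> v = Cop c \<odot> v \<Longrightarrow>
    Hop i \<odot> pw (Jop i) s v = Cop (c - of_nat s) \<odot> pw (Jop i) s v"
  by (induction s) (simp_all add: H_J_weight algebra_simps)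

text \<open>The string through \<open>v\<close> in direction \<open>i\<close>, with integration
  playing the part of the negative powers of the derivation.\<close>

definition zpw :: "'n \<Rightarrow> int \<Rightarrow> 'v \<Rightarrow> 'v" where
  "zpw i k v = (if k \<ge> 0 then pw (Dop i) (nat k) v else pw (Jop i) (nat (- k)) v)"

lemma zpw_closed [simp, intro]: "v \<in> carrier M \<Longrightarrow> zpw i k v \<in> carrier M"
  by (simp add: zpw_def)

lemma zpw_commute:
  assumes "i \<noteq> j" "v \<in> carrier M"
  shows "Dop j \<odot> zpw i k v = zpw i k (Dop j \<odot> v)" "Jop j \<odot> zpw i k v = zpw i k (Jop j \<odot> v)"
    "Hop j \<odot> zpw i k v = zpw i k (Hop j \<odot> v)"
  unfolding zpw_def using pw_commute[OF op_commute(1)[OF assms(1)] _ _ assms(2)]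
    pw_commute[OF op_commute(4)[OF assms(1)] _ _ assms(2)]
    pw_commute[OF op_commute(2)[OF assms(1)] _ _ assms(2)]
    pw_commute[OF op_commute(5)[OF assms(1)] _ _ assms(2)]
    pw_commute[OF op_commute(3)[OF assms(1)] _ _ assms(2)]
    pw_commute[OF op_commute(6)[OF assms(1)] _ _ assms(2)] by simp_all

lemma zpw_Cop: "v \<in> carrier M \<Longrightarrow> zpw i k (Cop c \<odot> v) = Cop c \<odot> zpw i k v"
  using pw_commute[OF Cop_commute, of "Dop i" c v] pw_commute[OF Cop_commute, of "Jop i" c v]
  by (simp add: zpw_def)

lemma zpw_zero [simp]: "zpw i k \<zero> = \<zero>"
  by (simp add: zpw_def pw_zero)

lemma H_zpw:
  assumes "v \<in> carrier M" "Hop i \<odot> v = Cop c \<odot> v"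
  shows "Hop i \<odot> zpw i k v = Cop (c + of_int k) \<odot> zpw i k v"
  using H_pw_D[OF assms, of "nat k"] H_pw_J[OF assms, of "nat (- k)"] by (simp add: zpw_def)

text \<open>At a negative index the step up has to undo an integration, which requires
  \<open>\<integral>\<^sub>i \<partial>\<^sub>i\<close> to act as the identity.\<close>

lemma D_zpw:
  assumes "v \<in> carrier M" "k \<ge> 0 \<or> (\<forall>w\<in>carrier M. Dop i \<odot> (Jop i \<odot> w) = w)"
  shows "Dop i \<odot> zpw i k v = zpw i (k + 1) v"
proof (cases "k \<ge> 0")
  case True
  then show ?thesis by (simp add: zpw_def nat_add_distrib)
next
  case False
  then have "nat (- k) = Suc (nat (- (k + 1)))" by simp
  with False assms show ?thesis by (auto simp: zpw_def)
qed

lemma J_zpw: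
  assumes "v \<in> carrier M"
  shows "Jop i \<odot> zpw i k v = zpw i (k - 1) v"
proof (cases "k > 0")
  case True
  then have "nat k = Suc (nat (k - 1))" by simp
  with True assms show ?thesis by (simp add: zpw_def J_D)
next
  case False
  then have "nat (- (k - 1)) = Suc (nat (- k))" by simp
  with False show ?thesis by (cases "k = 0") (simp_all add: zpw_def)
qed

text \<open>The basis vector of weight \<open>\<nu>\<close> is \<open>v\<close> moved by
  \<open>\<nu>\<^sub>i - \<mu>\<^sub>i\<close> steps in each direction \<open>i\<close>. The moves
  in different directions commute, so they can be made one direction at a time.\<close>

lemma model_from_vector:
  assumes v: "v \<in> carrier M" "v \<noteq> \<zero>" "\<And>i. Hop i \<odot> v = Cop (\<mu> i) \<odot> v"
    and T: "\<And>i. i \<in> T \<Longrightarrow> \<mu> i = 1" "\<And>i. i \<in> T \<Longrightarrow> Jop i \<odot> v = \<zero>"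
    and L: "\<And>i w. i \<notin> T \<Longrightarrow> w \<in> carrier M \<Longrightarrow> Dop i \<odot> (Jop i \<odot> w) = w"
    and gen: "\<And>N. submodule N II M \<Longrightarrow> v \<in> N \<Longrightarrow> N = carrier M"
  shows "\<exists>\<phi>. model M T \<mu> \<phi>"
proof -
  let ?S = "wtset T \<mu>"
  \<comment> \<open>A partial inverse of the embedding of the integers; it is evaluated only at the
    differences \<open>\<nu> j - \<mu> j\<close>, which \<open>shift\<close> shows to be
    integral.\<close>
  define iv where "iv x = (THE k::int. x = of_int k)" for x :: 'k
  have iv [simp]: "iv (of_int k) = k" for k by (simp add: iv_def)
  have shift: "\<exists>k. \<nu> i = \<mu> i + of_int k \<and> (i \<in> T \<longrightarrow> k \<ge> 0)" if \<nu>S: "\<nu> \<in> ?S" for \<nu> i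
  proof (cases "i \<in> T")
    case True
    then obtain m :: nat where "\<nu> i = of_nat m + 1" using wtset_pos[OF \<nu>S True] by blast
    then show ?thesis using T(1)[OF True] by (intro exI[of _ "int m"]) simp
  next
    case False
    then show ?thesis using \<nu>S by (auto simp: wtset_def)
  qed
  \<comment> \<open>Invariant with the directions in \<open>A\<close> treated:
    \<open>b \<nu>\<close> depends only on the components in \<open>A\<close>, the formulas for a
    basis hold in these directions, and in all others \<open>b \<nu>\<close> still behaves like
    \<open>v\<close>, namely it has weight component \<open>\<mu> i\<close> and is killed by
    integration if \<open>i\<close> is in \<open>T\<close>.\<close>
  have "\<exists>b. b \<mu> = v \<and> (\<forall>\<nu>\<in>?S. b \<nu> \<in> carrier M) \<and> (\<forall>\<nu> j x. j \<notin> A \<longrightarrow> b (\<nu>(j := x)) = b \<nu>) \<and>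
      (\<forall>\<nu>\<in>?S. \<forall>i\<in>A. Dop i \<odot> b \<nu> = b (\<nu>(i := \<nu> i + 1)) \<and>
         Jop i \<odot> b \<nu> = (if i \<in> T \<and> \<nu> i = 1 then \<zero> else b (\<nu>(i := \<nu> i - 1))) \<and>
         Hop i \<odot> b \<nu> = Cop (\<nu> i) \<odot> b \<nu>) \<and>
      (\<forall>\<nu>\<in>?S. \<forall>i. i \<notin> A \<longrightarrow> Hop i \<odot> b \<nu> = Cop (\<mu> i) \<odot> b \<nu> \<and> (i \<in> T \<longrightarrow> Jop i \<odot> b \<nu> = \<zero>))"
    if "finite A" for A
    using that
  proof induction
    case empty
    show ?case by (rule exI[of _ "\<lambda>_. v"]) (use v T in auto)
  next
    case (insert j A)
    from insert.IH obtain b where B: "b \<mu> = v \<and> (\<forall>\<nu>\<in>?S. b \<nu> \<in> carrier M) \<and> (\<forall>\<nu> j x. j \<notin> A \<longrightarrow> b (\<nu>(j := x)) = b \<nu>) \<and>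
      (\<forall>\<nu>\<in>?S. \<forall>i\<in>A. Dop i \<odot> b \<nu> = b (\<nu>(i := \<nu> i + 1)) \<and>
         Jop i \<odot> b \<nu> = (if i \<in> T \<and> \<nu> i = 1 then \<zero> else b (\<nu>(i := \<nu> i - 1))) \<and>
         Hop i \<odot> b \<nu> = Cop (\<nu> i) \<odot> b \<nu>) \<and>
      (\<forall>\<nu>\<in>?S. \<forall>i. i \<notin> A \<longrightarrow> Hop i \<odot> b \<nu> = Cop (\<mu> i) \<odot> b \<nu> \<and> (i \<in> T \<longrightarrow> Jop i \<odot> b \<nu> = \<zero>))"
      by (rule exE)
    have b: "b \<mu> = v" "\<And>\<nu>. \<nu> \<in> ?S \<Longrightarrow> b \<nu> \<in> carrier M"
      "\<And>\<nu> j x. j \<notin> A \<Longrightarrow> b (\<nu>(j := x)) = b \<nu>"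
      "\<And>\<nu> i. \<nu> \<in> ?S \<Longrightarrow> i \<in> A \<Longrightarrow> Dop i \<odot> b \<nu> = b (\<nu>(i := \<nu> i + 1))"
      "\<And>\<nu> i. \<nu> \<in> ?S \<Longrightarrow> i \<in> A \<Longrightarrow> Jop i \<odot> b \<nu> = (if i \<in> T \<and> \<nu> i = 1 then \<zero> else b (\<nu>(i := \<nu> i - 1)))"
      "\<And>\<nu> i. \<nu> \<in> ?S \<Longrightarrow> i \<in> A \<Longrightarrow> Hop i \<odot> b \<nu> = Cop (\<nu> i) \<odot> b \<nu>"
      "\<And>\<nu> i. \<nu> \<in> ?S \<Longrightarrow> i \<notin> A \<Longrightarrow> Hop i \<odot> b \<nu> = Cop (\<mu> i) \<odot> b \<nu>"
      "\<And>\<nu> i. \<nu> \<in> ?S \<Longrightarrow> i \<notin> A \<Longrightarrow> i \<in> T \<Longrightarrow> Jop i \<odot> b \<nu> = \<zero>"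
      using B by (blast+)
    define b' where "b' \<nu> = zpw j (iv (\<nu> j - \<mu> j)) (b \<nu>)" for \<nu>
    show ?case
    proof (rule exI[of _ b'], intro conjI allI ballI impI)
      show "b' \<mu> = v" using iv[of 0] by (simp add: b'_def b zpw_def)
      show "b' \<nu> \<in> carrier M" if "\<nu> \<in> ?S" for \<nu> using that by (simp add: b'_def b)
      show "b' (\<nu>(i := x)) = b' \<nu>" if "i \<notin> insert j A" for \<nu> i x
        using that by (auto simp: b'_def b)
      fix \<nu> assume \<nu>: "\<nu> \<in> ?S"
      show "Hop i \<odot> b' \<nu> = Cop (\<mu> i) \<odot> b' \<nu>" if "i \<notin> insert j A" for i
        using that \<nu> zpw_commute(3)[of j i "b \<nu>"] by (auto simp: b'_def b zpw_Cop)
      show "Jop i \<odot> b' \<nu> = \<zero>" if "i \<notin> insert j A" "i \<in> T" for i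
        using that \<nu> zpw_commute(2)[of j i "b \<nu>"] by (auto simp: b'_def b)
      obtain k where k: "\<nu> j = \<mu> j + of_int k" "j \<in> T \<longrightarrow> k \<ge> 0" using shift[OF \<nu>] by blast
      fix i assume "i \<in> insert j A"
      then consider "i = j" | "i \<in> A" "i \<noteq> j" by auto
      then show "Dop i \<odot> b' \<nu> = b' (\<nu>(i := \<nu> i + 1))"
      proof cases
        case 1
        have "iv (\<nu> j + 1 - \<mu> j) = k + 1" using iv[of "k + 1"] by (simp add: k algebra_simps)
        then show ?thesis
          using 1 k L insert.hyps(2) D_zpw[OF b(2)[OF \<nu>], of k j] by (auto simp: b'_def b)
      next
        case 2
        then show ?thesis using \<nu> b(2) zpw_commute(1)[of j i "b \<nu>"] by (simp add: b'_def b)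
      qed
      from \<open>i \<in> insert j A\<close> consider "i = j" | "i \<in> A" "i \<noteq> j" by auto
      then show "Jop i \<odot> b' \<nu> = (if i \<in> T \<and> \<nu> i = 1 then \<zero> else b' (\<nu>(i := \<nu> i - 1)))"
      proof cases
        case 1
        have iv': "iv (\<nu> j - 1 - \<mu> j) = k - 1" using iv[of "k - 1"] by (simp add: k algebra_simps)
        show ?thesis
        proof (cases "j \<in> T \<and> \<nu> j = 1")
          case True
          then have "k = 0" using k T(1)[of j] by simp
          with True 1 show ?thesis
            using b(8)[OF \<nu> insert.hyps(2)] iv[of 0] by (simp add: b'_def k zpw_def)
        next
          case False
          then show ?thesis
            using 1 iv' insert.hyps(2) J_zpw[OF b(2)[OF \<nu>], of j k] by (auto simp: b'_def b k)
        qed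
      next
        case 2
        then show ?thesis using \<nu> b(2) zpw_commute(2)[of j i "b \<nu>"] by (auto simp: b'_def b)
      qed
      from \<open>i \<in> insert j A\<close> consider "i = j" | "i \<in> A" "i \<noteq> j" by auto
      then show "Hop i \<odot> b' \<nu> = Cop (\<nu> i) \<odot> b' \<nu>"
      proof cases
        case 1
        then show ?thesis
          using H_zpw[OF b(2)[OF \<nu>] b(7)[OF \<nu> insert.hyps(2)], of k] by (simp add: b'_def k)
      next
        case 2
        then show ?thesis using \<nu> b(2) zpw_commute(3)[of j i "b \<nu>"] by (simp add: b'_def b zpw_Cop)
      qed
    qed
  qed
  from this[of UNIV] obtain b where b: "b \<mu> = v" "\<And>\<nu>. \<nu> \<in> ?S \<Longrightarrow> b \<nu> \<in> carrier M"
      "\<And>\<nu> i. \<nu> \<in> ?S \<Longrightarrow> Dop i \<odot> b \<nu> = b (\<nu>(i := \<nu> i + 1))"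
      "\<And>\<nu> i. \<nu> \<in> ?S \<Longrightarrow> Jop i \<odot> b \<nu> = (if i \<in> T \<and> \<nu> i = 1 then \<zero> else b (\<nu>(i := \<nu> i - 1)))"
      "\<And>\<nu> i. \<nu> \<in> ?S \<Longrightarrow> Hop i \<odot> b \<nu> = Cop (\<nu> i) \<odot> b \<nu>"
    by auto
  have \<mu>S: "\<mu> \<in> ?S" by (rule wtset_self) (rule T(1))
  \<comment> \<open>Nonvanishing spreads along the grid: upwards because
    \<open>\<integral>\<^sub>i\<close> takes the raised vector back, downwards because the raised
    vector is an image of the lower one under \<open>\<partial>\<^sub>i\<close>.\<close>
  have nz: "b \<nu> \<noteq> \<zero>" if "\<nu> \<in> ?S" for \<nu>
  proof -
    have "\<nu> \<in> {\<nu>. b \<nu> \<noteq> \<zero>}"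
    proof (rule wtset_connected[OF \<mu>S _ that])
      show "\<mu> \<in> {\<nu>. b \<nu> \<noteq> \<zero>}" using b v by simp
      show "\<kappa>(i := \<kappa> i + 1) \<in> {\<nu>. b \<nu> \<noteq> \<zero>}" if "\<kappa> \<in> ?S" "\<kappa> \<in> {\<nu>. b \<nu> \<noteq> \<zero>}" for \<kappa> i
        using J_D[OF b(2)[OF that(1)], of i] that(2) b(3)[OF that(1), of i] by auto
      show "\<kappa> \<in> {\<nu>. b \<nu> \<noteq> \<zero>}" if "\<kappa> \<in> ?S" "\<kappa>(i := \<kappa> i + 1) \<in> {\<nu>. b \<nu> \<noteq> \<zero>}" for \<kappa> i
        using that(2) b(3)[OF that(1), of i] by auto
    qed
    then show ?thesis by simp
  qed
  show ?thesis
    by (rule model_from_basis[of T \<mu> b]) (use b nz gen \<mu>S in auto)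
qed

text \<open>The right action of the idempotent
  \<open>1 - \<integral>\<^sub>i \<partial>\<^sub>i\<close>.\<close>

definition idem :: "'n \<Rightarrow> 'v \<Rightarrow> 'v" where
  "idem i v = v \<ominus> Dop i \<odot> (Jop i \<odot> v)"

lemma idem_closed [simp, intro]: "v \<in> carrier M \<Longrightarrow> idem i v \<in> carrier M"
  by (simp add: idem_def)

lemma act_minus: "a \<in> carrier II \<Longrightarrow> u \<in> carrier M \<Longrightarrow> v \<in> carrier M \<Longrightarrow> a \<odot> (u \<ominus> v) = a \<odot> u \<ominus> a \<odot> v"
  using act_Cop_commute[of a v "-1"] Cop_minus[of v 1] Cop_minus[of "a \<odot> v" 1]
  by (simp add: a_minus_def act_add act_Cop(3))

lemma idem_add:
  assumes "u \<in> carrier M" "v \<in> carrier M"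
  shows "idem i (u \<oplus> v) = idem i u \<oplus> idem i v"
  using assms unfolding idem_def by (simp add: act_add a_minus_def minus_add a_ac)

lemma act_idem:
  assumes "a \<circ> Dop i = Dop i \<circ> a" "a \<circ> Jop i = Jop i \<circ> a" "a \<in> carrier II" "v \<in> carrier M"
  shows "a \<odot> idem i v = idem i (a \<odot> v)"
  using assms unfolding idem_def
  by (simp add: act_minus act_commute[of a "Dop i"] act_commute[of a "Jop i"])

lemma idem_Dop: "v \<in> carrier M \<Longrightarrow> idem i (Dop i \<odot> v) = \<zero>"
  by (simp add: idem_def J_D minus_eq_zero_iff)

lemma Jop_idem: "v \<in> carrier M \<Longrightarrow> Jop i \<odot> idem i v = \<zero>"
  by (simp add: idem_def J_D act_minus minus_eq_zero_iff)

lemma D_H: "v \<in> carrier M \<Longrightarrow> Dop i \<odot> (Hop i \<odot> v) = Hop i \<odot> (Dop i \<odot> v) \<ominus> Dop i \<odot> v"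
  by (simp add: H_D a_minus_def a_assoc r_neg)

lemma idem_Hop: "v \<in> carrier M \<Longrightarrow> idem i (Hop i \<odot> v) = Hop i \<odot> idem i v"
proof -
  assume v: "v \<in> carrier M"
  have "Dop i \<odot> (Jop i \<odot> (Hop i \<odot> v)) = Dop i \<odot> (Hop i \<odot> (Jop i \<odot> v)) \<oplus> Dop i \<odot> (Jop i \<odot> v)"
    using v by (simp add: J_H act_add)
  also have "\<dots> = Hop i \<odot> (Dop i \<odot> (Jop i \<odot> v))"
    using v by (simp add: D_H a_minus_def a_assoc l_neg)
  finally show ?thesis using v by (simp add: idem_def act_minus)
qed

text \<open>The fourth relation of \<open>op_relations\<close>, moved to the module. It is the
  source of weight 1 in the truncated directions.\<close>

lemma Hop_idem: "v \<in> carrier M \<Longrightarrow> Hop i \<odot> idem i v = idem i v"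
proof -
  assume v: "v \<in> carrier M"
  have e: "(\<lambda>p. Hop i p + (Jop i \<circ> Dop i) p) = (\<lambda>p. (Jop i \<circ> Dop i \<circ> Hop i) p + id p :: ('k, 'n) pol)"
    using op_relations(4)[of i] by (simp add: o_def)
  have m: "Jop i \<circ> Dop i \<in> carrier II" "Jop i \<circ> Dop i \<circ> Hop i \<in> carrier II" "id \<in> carrier II"
    by (intro carrier_II_mult carrier_II_id in_carrier_II)+
  have "Hop i \<odot> v \<oplus> Dop i \<odot> (Jop i \<odot> v) = Hop i \<odot> (Dop i \<odot> (Jop i \<odot> v)) \<oplus> v"
    using arg_cong[OF e, of "\<lambda>a. a \<odot> v"] v m
    by (simp only: act_add_op act_comp in_carrier_II carrier_II_mult carrier_II_id act_id)
  then have "Hop i \<odot> v \<ominus> Hop i \<odot> (Dop i \<odot> (Jop i \<odot> v)) = v \<ominus> Dop i \<odot> (Jop i \<odot> v)"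
    using v by (intro minus_eq_minusI) auto
  then show ?thesis using v by (simp add: idem_def act_minus)
qed

text \<open>Write \<open>e\<close> for the idempotent of direction \<open>j\<close>. Letters of the
  other directions commute with everything involved. In direction \<open>j\<close>,
  \<open>\<integral>\<close> raises \<open>s\<close>; \<open>\<partial>\<close> lowers
  \<open>s\<close>, and at \<open>s = 0\<close> it meets \<open>\<partial> e = 0\<close>;
  \<open>H\<close> commutes with \<open>e\<close> and passes \<open>\<integral>^s\<close> at the
  price of elements of the same kind.\<close>

lemma submodule_idem_kernel:
  "submodule {v \<in> carrier M. \<forall>s. idem j (pw (Jop j) s v) = \<zero>} II M"
proof (rule submoduleI_gens)
  let ?N = "{v \<in> carrier M. \<forall>s. idem j (pw (Jop j) s v) = \<zero>}"
  have pw_add: "pw (Jop j) s (u \<oplus> v) = pw (Jop j) s u \<oplus> pw (Jop j) s v"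
    if "u \<in> carrier M" "v \<in> carrier M" for u v s
    using that by (induction s) (simp_all add: act_add)
  have com: "a \<odot> v \<in> ?N"
    if v: "v \<in> ?N" and a: "a \<circ> Dop j = Dop j \<circ> a" "a \<circ> Jop j = Jop j \<circ> a" "a \<in> carrier II" for a v
  proof -
    have "idem j (pw (Jop j) s (a \<odot> v)) = a \<odot> idem j (pw (Jop j) s v)" for s
    proof -
      have "idem j (pw (Jop j) s (a \<odot> v)) = idem j (a \<odot> pw (Jop j) s v)"
        using v a by (simp add: pw_commute[OF a(2)[symmetric], symmetric])
      also have "\<dots> = a \<odot> idem j (pw (Jop j) s v)" using v a by (intro act_idem[symmetric]) auto
      finally show ?thesis .
    qed
    then show ?thesis using v a by simp
  qed
  show "?N \<subseteq> carrier M" by auto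
  show "\<zero> \<in> ?N" by (simp add: pw_zero) (simp add: idem_def a_minus_def)
  show "u \<oplus> v \<in> ?N" if "u \<in> ?N" "v \<in> ?N" for u v
    using that by (simp add: pw_add idem_add)
  show "Cop c \<odot> v \<in> ?N" if "v \<in> ?N" for c v
    using that by (rule com) (simp_all add: Cop_commute)
  fix i v assume v: "v \<in> ?N"
  show "Dop i \<odot> v \<in> ?N"
  proof (cases "i = j")
    case True
    have "idem j (pw (Jop j) s (Dop j \<odot> v)) = \<zero>" for s
      using v by (cases s) (simp_all add: idem_Dop pw_Suc' J_D del: pw_Suc)
    then show ?thesis using v True by simp
  next
    case False
    show ?thesis by (rule com[OF v op_commute(1)[OF False] op_commute(2)[OF False]]) simp
  qed
  show "Jop i \<odot> v \<in> ?N"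
  proof (cases "i = j")
    case True
    then show ?thesis using v by (simp add: pw_Suc'[symmetric] del: pw_Suc)
  next
    case False
    show ?thesis by (rule com[OF v op_commute(4)[OF False] op_commute(5)[OF False]]) simp
  qed
  show "Hop i \<odot> v \<in> ?N"
  proof (cases "i = j")
    case True
    \<comment> \<open>Induction on \<open>s\<close> for all \<open>u\<close> at once:
      \<open>u H \<integral> = (u \<integral>) H + u \<integral>\<close>, and
      \<open>u \<integral>\<close> again satisfies the hypothesis.\<close>
    have "idem j (pw (Jop j) s (Hop j \<odot> u)) = \<zero>"
      if "u \<in> carrier M" "\<forall>s. idem j (pw (Jop j) s u) = \<zero>" for s u
      using that
    proof (induction s arbitrary: u)
      case 0
      then show ?case using spec[OF 0(2), of 0] by (simp add: idem_Hop)
    next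
      case (Suc s)
      have "\<forall>s. idem j (pw (Jop j) s (Jop j \<odot> u)) = \<zero>"
        using Suc.prems(2) by (simp add: pw_Suc'[symmetric] del: pw_Suc)
      with Suc show ?case
        by (simp add: pw_Suc' J_H pw_add idem_add del: pw_Suc)
    qed
    then show ?thesis using v True by simp
  next
    case False
    show ?thesis by (rule com[OF v op_commute(7)[OF False] op_commute(8)[OF False]]) simp
  qed
qed

text \<open>\<open>T\<close> collects the directions in which the kernel of
  \<open>submodule_idem_kernel\<close> is 0. Outside \<open>T\<close> the kernel is all of
  \<open>M\<close>, and its condition for \<open>s = 0\<close> says that
  \<open>\<integral>\<^sub>i \<partial>\<^sub>i\<close> acts as 1. A generator for
  \<open>model_from_vector\<close> is found by correcting the given weight vector in each direction
  of \<open>T\<close>.\<close>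

lemma simple_imp_model:
  assumes simple: "right_simple II M" and v0: "v0 \<in> wspace M \<mu>0" "v0 \<noteq> \<zero>"
  shows "\<exists>T \<rho> \<phi>. model M T \<rho> \<phi>"
proof -
  let ?N = "\<lambda>j. {v \<in> carrier M. \<forall>s. idem j (pw (Jop j) s v) = \<zero>}"
  define T where "T = {j. ?N j = {\<zero>}}"
  have L: "Dop i \<odot> (Jop i \<odot> w) = w" if "i \<notin> T" "w \<in> carrier M" for i w
  proof -
    have "?N i = carrier M"
      using that(1) submodule_idem_kernel[of i] simple unfolding T_def right_simple_def by blast
    then have "idem i (pw (Jop i) 0 w) = \<zero>" using that(2) by blast
    then show ?thesis using that(2) by (simp add: idem_def minus_eq_zero_iff)
  qed
  have "\<exists>v \<mu>. v \<in> carrier M \<and> v \<noteq> \<zero> \<and> (\<forall>i. Hop i \<odot> v = Cop (\<mu> i) \<odot> v) \<and>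
      (\<forall>i\<in>A. \<mu> i = 1 \<and> Jop i \<odot> v = \<zero>)" if "finite A" "A \<subseteq> T" for A
    using that
  proof induction
    case empty
    then show ?case using v0 by (auto simp: mem_wspace_iff)
  next
    case (insert j A)
    then obtain v \<mu> where v: "v \<in> carrier M" "v \<noteq> \<zero>" "\<And>i. Hop i \<odot> v = Cop (\<mu> i) \<odot> v"
      and A: "\<And>i. i \<in> A \<Longrightarrow> \<mu> i = 1" "\<And>i. i \<in> A \<Longrightarrow> Jop i \<odot> v = \<zero>" by auto
    have "?N j = {\<zero>}" using insert.prems by (simp add: T_def)
    then have "v \<notin> ?N j" using v by simp
    then obtain s where s: "idem j (pw (Jop j) s v) \<noteq> \<zero>" using v by auto
    \<comment> \<open>The kernel in direction \<open>j\<close> is 0, so some \<open>s\<close> gives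
      a nonzero vector. It has weight 1 and is killed by integration in direction \<open>j\<close>;
      being made from letters of that direction only, it keeps what was achieved in the
      others.\<close>
    define v' where "v' = idem j (pw (Jop j) s v)"
    have com: "a \<odot> v' = idem j (pw (Jop j) s (a \<odot> v))"
      if "a \<circ> Dop j = Dop j \<circ> a" "a \<circ> Jop j = Jop j \<circ> a" "a \<in> carrier II" for a
      using that v by (simp add: v'_def pw_commute[OF that(2)[symmetric], symmetric] act_idem)
    have v': "v' \<in> carrier M" using v by (simp add: v'_def)
    have "Hop i \<odot> v' = Cop ((\<mu>(j := 1)) i) \<odot> v'" for i
    proof (cases "i = j")
      case True
      then show ?thesis using v v' by (simp add: v'_def Hop_idem act_Cop)
    next
      case False
      have "Hop i \<odot> v' = Cop (\<mu> i) \<odot> v'"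
        using com[OF op_commute(7)[OF False] op_commute(8)[OF False]] v(3)[of i]
          com[OF Cop_commute[symmetric] Cop_commute[symmetric], of "\<mu> i"] by simp
      then show ?thesis using False by simp
    qed
    moreover have "Jop i \<odot> v' = \<zero>" if "i \<in> insert j A" for i
    proof (cases "i = j")
      case True
      then show ?thesis using v by (simp add: v'_def Jop_idem)
    next
      case False
      then have "Jop i \<odot> v = \<zero>" using that A(2) by simp
      then show ?thesis
        using com[OF op_commute(4)[OF False] op_commute(5)[OF False]]
        by (simp add: pw_zero) (simp add: idem_def a_minus_def)
    qed
    ultimately show ?case
      using v' s A(1) by (intro exI[of _ v'] exI[of _ "\<mu>(j := 1)"]) (auto simp: v'_def)
  qed
  from this[of T] obtain v \<mu> where v: "v \<in> carrier M" "v \<noteq> \<zero>" "\<And>i. Hop i \<odot> v = Cop (\<mu> i) \<odot> v"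
    and T: "\<And>i. i \<in> T \<Longrightarrow> \<mu> i = 1" "\<And>i. i \<in> T \<Longrightarrow> Jop i \<odot> v = \<zero>" by auto
  have "N = carrier M" if "submodule N II M" "v \<in> N" for N
    using that v simple unfolding right_simple_def by blast
  then have "\<exists>\<phi>. model M T \<mu> \<phi>" by (intro model_from_vector[of v \<mu> T] v T L)
  then show ?thesis by auto
qed

lemma direct_sum_nonzero:
  assumes "internal_direct_sum M W" "carrier M \<noteq> {\<zero>}"
  shows "\<exists>i. \<exists>v\<in>W i. v \<noteq> \<zero>"
proof (rule ccontr)
  assume *: "\<not> ?thesis"
  obtain v where v: "v \<in> carrier M" "v \<noteq> \<zero>" using assms(2) zero_closed by blast
  then obtain c where c: "\<forall>i. c i \<in> W i" "v = (\<Oplus>i\<in>{i. c i \<noteq> \<zero>}. c i)"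
    using assms(1) unfolding internal_direct_sum_def by blast
  then have "{i. c i \<noteq> \<zero>} = {}" using * by blast
  then show False using c v by simp
qed

end

text \<open>A nonzero direct sum of either kind contains a nonzero generalized weight vector, and
  this leads to a weight vector. As models satisfy both definitions, the two notions of simple
  module coincide.\<close>

theorem simple_weight_iff_model:
  "simple_weight M \<longleftrightarrow> (\<exists>T \<rho> \<phi>. model M T \<rho> \<phi>)"
  and simple_gen_weight_iff_model:
  "simple_gen_weight M \<longleftrightarrow> (\<exists>T \<rho> \<phi>. model M T \<rho> \<phi>)"
proof -
  have 1: "\<exists>T \<rho> \<phi>. model M T \<rho> \<phi>" if "simple_gen_weight M \<or> simple_weight M"
  proof -
    have rs: "right_simple II M" using that by (auto simp: simple_weight_def simple_gen_weight_def)
    then interpret II_module M by (simp add: II_module_def right_simple_def)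
    have "carrier M \<noteq> {\<zero>\<^bsub>M\<^esub>}" using rs by (simp add: right_simple_def)
    moreover have "internal_direct_sum M (gen_wspace M) \<or> internal_direct_sum M (wspace M)"
      using that by (auto simp: simple_weight_def simple_gen_weight_def weight_def gen_weight_def)
    ultimately obtain \<mu> v where "v \<in> gen_wspace M \<mu>" "v \<noteq> \<zero>\<^bsub>M\<^esub>"
      using direct_sum_nonzero wspace_subset_gen_wspace by blast
    then obtain w where "w \<in> wspace M \<mu>" "w \<noteq> \<zero>\<^bsub>M\<^esub>" by (rule gen_wspace_imp_wspace)
    then show ?thesis using rs by (intro simple_imp_model)
  qed
  show "simple_weight M \<longleftrightarrow> (\<exists>T \<rho> \<phi>. model M T \<rho> \<phi>)"
    "simple_gen_weight M \<longleftrightarrow> (\<exists>T \<rho> \<phi>. model M T \<rho> \<phi>)"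
    using 1 model.simple_weight model.simple_gen_weight by blast+
qed

section \<open>Quotients\<close>

lemma (in abelian_group) minus_zero_right: "x \<in> carrier G \<Longrightarrow> x \<ominus> \<zero> = x"
  using minus_eq_minusI[of x \<zero> \<zero> x] by (simp add: a_minus_def r_neg)

text \<open>Only the additive group enters, so that the same facts serve quotients of
  \<open>II\<close>-modules and the \<open>K\<close>-space underlying a tensor product.\<close>

locale quotient_setup = abelian_group M for M :: "('r, 'v) module" (structure) +
  fixes N :: "'v set"
  assumes subgroup_N: "subgroup N (add_monoid M)"
begin

sublocale abelian_subgroup N M
  by (intro abelian_subgroupI3 additive_subgroup.intro subgroup_N abelian_group_axioms)

abbreviation "Q \<equiv> quot_module M N"

lemma carrier_quot: "carrier Q = (+>) N ` carrier M"
  by (auto simp: quot_module_def A_RCOSETS_def')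

lemma zero_quot: "\<zero>\<^bsub>Q\<^esub> = N +> \<zero>"
  by (simp add: quot_module_def a_rcos_const)

lemma add_quot: "u \<in> carrier M \<Longrightarrow> v \<in> carrier M \<Longrightarrow> (N +> u) \<oplus>\<^bsub>Q\<^esub> (N +> v) = N +> (u \<oplus> v)"
  by (simp add: quot_module_def a_rcos_sum)

lemma coset_eq_iff: "u \<in> carrier M \<Longrightarrow> v \<in> carrier M \<Longrightarrow> N +> u = N +> v \<longleftrightarrow> u \<ominus> v \<in> N"
  by (metis a_minus_def a_rcos_module a_repr_independence' a_rcos_self)

lemma coset_eq_zero_iff: "u \<in> carrier M \<Longrightarrow> N +> u = \<zero>\<^bsub>Q\<^esub> \<longleftrightarrow> u \<in> N"
  unfolding zero_quot by (simp add: coset_eq_iff minus_zero_right)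

lemma abelian_group_quot: "abelian_group Q"
proof (rule abelian_groupI)
  fix x assume "x \<in> carrier Q"
  then obtain v where "v \<in> carrier M" "x = N +> v" by (auto simp: carrier_quot)
  then show "\<exists>y\<in>carrier Q. y \<oplus>\<^bsub>Q\<^esub> x = \<zero>\<^bsub>Q\<^esub>"
    by (intro bexI[of _ "N +> (\<ominus> v)"]) (auto simp: carrier_quot add_quot zero_quot l_neg)
qed (auto simp: carrier_quot add_quot zero_quot a_ac)

text \<open>The action in \<open>quot_module\<close> is a union over representatives. It collapses
  to a single coset because \<open>a\<close> is additive and preserves \<open>N\<close>.\<close>

lemma smult_quot:
  assumes a: "\<And>v. v \<in> carrier M \<Longrightarrow> a \<odot> v \<in> carrier M"
    "\<And>u v. u \<in> carrier M \<Longrightarrow> v \<in> carrier M \<Longrightarrow> a \<odot> (u \<oplus> v) = a \<odot> u \<oplus> a \<odot> v"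
    "\<And>v. v \<in> N \<Longrightarrow> a \<odot> v \<in> N" and v: "v \<in> carrier M"
  shows "a \<odot>\<^bsub>Q\<^esub> (N +> v) = N +> (a \<odot> v)"
proof -
  have *: "N +> (a \<odot> w) = N +> (a \<odot> v)" if "w \<in> N +> v" for w
  proof -
    have wc: "w \<in> carrier M" using that v a_elemrcos_carrier by blast
    have "w \<oplus> \<ominus> v \<in> N" using a_rcos_module[OF v wc] that by simp
    then have "a \<odot> (w \<oplus> \<ominus> v) \<in> N" by (rule a(3))
    moreover have "a \<odot> w = a \<odot> (w \<oplus> \<ominus> v) \<oplus> a \<odot> v"
      using wc v by (subst a(2)[symmetric]) (simp_all add: a_assoc l_neg)
    then have "a \<odot> w \<ominus> a \<odot> v = a \<odot> (w \<oplus> \<ominus> v)"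
      using wc v a(1) by (simp add: a_minus_def a_assoc r_neg)
    ultimately show ?thesis using wc v a(1) coset_eq_iff by simp
  qed
  have "a \<odot>\<^bsub>Q\<^esub> (N +> v) = (\<Union>w\<in>N +> v. N +> (a \<odot> w))" by (simp add: quot_module_def)
  also have "\<dots> = N +> (a \<odot> v)" using * a_rcos_self[OF v] by blast
  finally show ?thesis .
qed

end

lemma right_module_quot:
  assumes R: "right_module R M" and N: "submodule N R M"
  shows "quotient_setup M N" "right_module R (quot_module M N)"
    "\<And>a v. a \<in> carrier R \<Longrightarrow> v \<in> carrier M \<Longrightarrow> a \<odot>\<^bsub>quot_module M N\<^esub> (N +>\<^bsub>M\<^esub> v) = N +>\<^bsub>M\<^esub> (a \<odot>\<^bsub>M\<^esub> v)"
proof -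
  note R' = right_moduleD[OF R]
  show q: "quotient_setup M N"
    by (intro quotient_setup.intro quotient_setup_axioms.intro R' submodule.axioms(1)[OF N])
  interpret quotient_setup M N by (rule q)
  show s: "a \<odot>\<^bsub>Q\<^esub> (N +>\<^bsub>M\<^esub> v) = N +>\<^bsub>M\<^esub> (a \<odot>\<^bsub>M\<^esub> v)" if "a \<in> carrier R" "v \<in> carrier M" for a v
    using that R' submodule.smult_closed[OF N] by (intro smult_quot) auto
  interpret R: ring R by (rule R'(1))
  show "right_module R Q"
    by (rule right_moduleI[OF R'(1) abelian_group_quot])
      (auto simp: carrier_quot s add_quot R')
qed

text \<open>Recognizes a cyclic quotient as a standard module, with all conditions stated upstairs
  modulo \<open>N\<close>: cyclicity of \<open>X\<close> makes the class of \<open>u\<close>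
  generate, and \<open>model_from_vector\<close> does the rest.\<close>

lemma model_quotient:
  assumes X: "right_module II X" and N: "submodule N II X"
    and u: "u \<in> carrier X" "u \<notin> N" "carrier X \<subseteq> {a \<odot>\<^bsub>X\<^esub> u | a. a \<in> carrier II}"
    and H: "\<And>i. Hop i \<odot>\<^bsub>X\<^esub> u \<ominus>\<^bsub>X\<^esub> Cop (\<mu> i) \<odot>\<^bsub>X\<^esub> u \<in> N"
    and T: "\<And>i. i \<in> T \<Longrightarrow> \<mu> i = 1" "\<And>i. i \<in> T \<Longrightarrow> Jop i \<odot>\<^bsub>X\<^esub> u \<in> N"
    and L: "\<And>i w. i \<notin> T \<Longrightarrow> w \<in> carrier X \<Longrightarrow> Dop i \<odot>\<^bsub>X\<^esub> (Jop i \<odot>\<^bsub>X\<^esub> w) \<ominus>\<^bsub>X\<^esub> w \<in> N"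
  shows "\<exists>\<phi>. model (quot_module X N) T \<mu> \<phi>"
proof -
  interpret X: II_module X using X by (rule II_module.intro)
  interpret quotient_setup X N by (rule right_module_quot(1)[OF X N])
  note s = right_module_quot(3)[OF X N]
  interpret Q: II_module Q by (rule II_module.intro) (rule right_module_quot(2)[OF X N])
  show ?thesis
  proof (rule Q.model_from_vector)
    show "N +>\<^bsub>X\<^esub> u \<in> carrier Q" using u(1) by (simp add: carrier_quot)
    show "N +>\<^bsub>X\<^esub> u \<noteq> \<zero>\<^bsub>Q\<^esub>" using u by (simp add: coset_eq_zero_iff)
    show "Hop i \<odot>\<^bsub>Q\<^esub> (N +>\<^bsub>X\<^esub> u) = Cop (\<mu> i) \<odot>\<^bsub>Q\<^esub> (N +>\<^bsub>X\<^esub> u)" for i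
      using u(1) H[of i] by (simp add: s coset_eq_iff)
    show "\<mu> i = 1" if "i \<in> T" for i using that by (rule T)
    show "Jop i \<odot>\<^bsub>Q\<^esub> (N +>\<^bsub>X\<^esub> u) = \<zero>\<^bsub>Q\<^esub>" if "i \<in> T" for i
      using u(1) T(2)[OF that] by (simp add: s coset_eq_zero_iff)
    show "Dop i \<odot>\<^bsub>Q\<^esub> (Jop i \<odot>\<^bsub>Q\<^esub> w) = w" if i: "i \<notin> T" and w: "w \<in> carrier Q" for i w
    proof -
      obtain x where x: "x \<in> carrier X" "w = N +>\<^bsub>X\<^esub> x" using w by (auto simp: carrier_quot)
      then show ?thesis using L[OF i x(1)] by (simp add: s coset_eq_iff)
    qed
    fix N' assume N': "submodule N' II Q" "N +>\<^bsub>X\<^esub> u \<in> N'"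
    have "w \<in> N'" if w: "w \<in> carrier Q" for w
    proof -
      obtain a where "a \<in> carrier II" "w = N +>\<^bsub>X\<^esub> (a \<odot>\<^bsub>X\<^esub> u)"
        using w u(3) by (auto simp: carrier_quot)
      then show ?thesis using Q.submoduleD(4)[OF N'(1) _ N'(2)] u(1) by (metis s)
    qed
    then show "N' = carrier Q" using Q.submoduleD(1)[OF N'(1)] by blast
  qed
qed

section \<open>Realizations inside the regular module\<close>

definition regular :: "(('k::field_char_0, 'n::finite) op, ('k, 'n) op) module" where
  "regular = with_action II (\<lambda>a b. b \<otimes>\<^bsub>II\<^esub> a)"

lemma regular_simps [simp]:
  "carrier regular = carrier II" "a \<oplus>\<^bsub>regular\<^esub> b = (\<lambda>p. a p + b p)" "a \<odot>\<^bsub>regular\<^esub> b = b \<circ> a"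
  "\<zero>\<^bsub>regular\<^esub> = (\<lambda>_. 0)"
  by (simp_all add: regular_def with_action_def)

lemma abelian_group_with_action: "abelian_group M \<Longrightarrow> abelian_group (with_action M \<sigma>)"
proof -
  assume "abelian_group M"
  then interpret abelian_group M .
  show ?thesis
  proof (rule abelian_groupI)
    fix x assume "x \<in> carrier (with_action M \<sigma>)"
    then show "\<exists>y\<in>carrier (with_action M \<sigma>). y \<oplus>\<^bsub>with_action M \<sigma>\<^esub> x = \<zero>\<^bsub>with_action M \<sigma>\<^esub>"
      by (intro bexI[of _ "\<ominus>\<^bsub>M\<^esub> x"]) (simp_all add: with_action_def l_neg)
  qed (auto simp: with_action_def a_ac)
qed

lemma right_module_regular: "right_module II (regular :: (('k::field_char_0, 'n::finite) op, ('k, 'n) op) module)"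
proof (rule right_moduleI[OF ring_II])
  show "abelian_group (regular :: (('k, 'n) op, ('k, 'n) op) module)"
    unfolding regular_def by (intro abelian_group_with_action ring.is_abelian_group ring_II)
  fix a b :: "('k, 'n) op" and u v :: "('k, 'n) op"
  assume "v \<in> carrier regular"
  then obtain e where "v = ev e" by (auto simp: carrier_II)
  then show "(a \<oplus>\<^bsub>II\<^esub> b) \<odot>\<^bsub>regular\<^esub> v = a \<odot>\<^bsub>regular\<^esub> v \<oplus>\<^bsub>regular\<^esub> b \<odot>\<^bsub>regular\<^esub> v"
    by (simp add: ev_add o_def)
next
  fix a v :: "('k, 'n) op"
  assume "a \<in> carrier II" "v \<in> carrier regular"
  then show "a \<odot>\<^bsub>regular\<^esub> v \<in> carrier regular" by (simp add: carrier_II_mult del: o_apply)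
qed (auto simp: o_def)

lemma regular_minus: "v \<in> carrier II \<Longrightarrow> u \<ominus>\<^bsub>regular\<^esub> v = (\<lambda>p. u p - v p)"
proof -
  assume v: "v \<in> carrier II"
  interpret R: II_module regular by (rule II_module.intro) (rule right_module_regular)
  have "\<ominus>\<^bsub>regular\<^esub> v = v \<circ> Cop (-1)" using R.Cop_minus[of v 1] v by (simp add: Cop_1)
  also have "\<dots> = Cop (-1) \<circ> v" using v by (rule Cop_commute)
  finally show ?thesis by (simp add: a_minus_def Cop_minus_1)
qed

text \<open>The theorem promises tensor factors whose elements are sets of operators, whereas
  \<open>wmodule\<close> consists of functions. The standard module is therefore rebuilt as the
  regular module modulo the annihilator of a weight vector.\<close>

lemma exists_op_set_model:
  fixes \<rho> :: "'n::finite \<Rightarrow> 'k::field_char_0"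
  shows "\<exists>(M :: (('k, 'n) op, ('k, 'n) op set) module) \<phi>. model M T \<rho> \<phi>"
proof -
  \<comment> \<open>Inside \<open>T\<close> the weight set does not depend on \<open>\<rho>\<close>;
    with the value 1 there, \<open>\<rho>'\<close> is itself a weight, the lowest one in these
    directions.\<close>
  define \<rho>' where "\<rho>' = (\<lambda>i. if i \<in> T then 1 else \<rho> i)"
  have S: "wtset T \<rho>' = wtset T \<rho>" by (simp add: wtset_def \<rho>'_def cong: if_cong)
  have T1: "\<rho>' i = 1" if "i \<in> T" for i using that by (simp add: \<rho>'_def)
  interpret W: model "wmodule T \<rho>'" T \<rho>' id by (rule model_wmodule)
  interpret R: II_module "regular :: (('k, 'n) op, ('k, 'n) op) module"
    by (rule II_module.intro) (rule right_module_regular)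
  have \<rho>S: "\<rho>' \<in> wtset T \<rho>'" by (rule wtset_self) (rule T1)
  then have dc: "delta \<rho>' \<in> carrier (wmodule T \<rho>')" using W.\<phi>_closed[of "delta \<rho>'"] by simp
  have dnz: "delta \<rho>' \<noteq> \<zero>\<^bsub>wmodule T \<rho>'\<^esub>"
    using W.\<phi>_eq_zero_iff[OF fs_delta[OF \<rho>S]] by (auto simp: delta_def fun_eq_iff)
  \<comment> \<open>The annihilator of the weight vector, a right ideal; equations between elements
    of the quotient are checked on this vector.\<close>
  let ?N = "{a \<in> carrier II. a \<odot>\<^bsub>wmodule T \<rho>'\<^esub> delta \<rho>' = \<zero>\<^bsub>wmodule T \<rho>'\<^esub>}"
  have add: "(\<lambda>p. a p + b p) \<in> ?N" if "a \<in> ?N" "b \<in> ?N" for a b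
    using that dc by (simp add: W.act_add_op carrier_II_add)
  have mul: "a \<circ> b \<in> ?N" if "a \<in> ?N" "b \<in> carrier II" for a b
    using that dc by (simp add: W.act_comp carrier_II_mult del: o_apply)
  have sub: "submodule ?N II regular"
  proof (rule R.submoduleI_gens)
    show "\<zero>\<^bsub>regular\<^esub> \<in> ?N" using dc R.zero_closed by simp
    show "?N \<subseteq> carrier regular" by auto
  qed (simp_all only: regular_simps add mul in_carrier_II)
  have minus: "a \<ominus>\<^bsub>regular\<^esub> b \<in> ?N"
    if "a \<in> carrier II" "b \<in> carrier II" "a \<odot>\<^bsub>wmodule T \<rho>'\<^esub> delta \<rho>' = b \<odot>\<^bsub>wmodule T \<rho>'\<^esub> delta \<rho>'" for a b
  proof -
    have eq: "a \<ominus>\<^bsub>regular\<^esub> b = (\<lambda>p. a p + (b \<circ> Cop (-1)) p)"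
      using that(2) Cop_commute[OF that(2), of "-1"] by (simp add: regular_minus Cop_minus_1 fun_eq_iff)
    have "(b \<circ> Cop (-1)) \<odot>\<^bsub>wmodule T \<rho>'\<^esub> delta \<rho>' = \<ominus>\<^bsub>wmodule T \<rho>'\<^esub> (b \<odot>\<^bsub>wmodule T \<rho>'\<^esub> delta \<rho>')"
      using that dc W.Cop_minus[of "b \<odot>\<^bsub>wmodule T \<rho>'\<^esub> delta \<rho>'" 1] by (simp add: W.act_comp W.act_Cop del: o_apply)
    then show ?thesis
      using that dc unfolding eq
      by (simp add: W.act_add_op carrier_II_add carrier_II_mult W.r_neg del: o_apply)
  qed
  have "\<exists>\<phi>. model (quot_module regular ?N) T \<rho>' \<phi>"
  proof (rule model_quotient[OF right_module_regular sub])
    show "id \<in> carrier regular" by (simp add: carrier_II_id)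
    show "id \<notin> ?N" using dc dnz by simp
    show "carrier regular \<subseteq> {a \<odot>\<^bsub>regular\<^esub> id | a. a \<in> carrier II}" by auto
    show "Hop i \<odot>\<^bsub>regular\<^esub> id \<ominus>\<^bsub>regular\<^esub> Cop (\<rho>' i) \<odot>\<^bsub>regular\<^esub> id \<in> ?N" for i
      using W.hom_Hop[OF fs_delta[OF \<rho>S], of i] W.hom_Cop[OF fs_delta[OF \<rho>S], of "\<rho>' i"]
      by (simp only: regular_simps id_o, intro minus) (simp_all add: Hm_delta)
    show "\<rho>' i = 1" if "i \<in> T" for i using that by (rule T1)
    show "Jop i \<odot>\<^bsub>regular\<^esub> id \<in> ?N" if "i \<in> T" for i
    proof -
      have "Jm T i (delta \<rho>') = (\<lambda>_. 0)"
        using that T1[OF that] by (intro ext) (auto simp: Jm_def delta_def)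
      then show ?thesis using W.hom_Jop[OF fs_delta[OF \<rho>S], of i] W.\<phi>_zero by simp
    qed
    show "Dop i \<odot>\<^bsub>regular\<^esub> (Jop i \<odot>\<^bsub>regular\<^esub> w) \<ominus>\<^bsub>regular\<^esub> w \<in> ?N" if i: "i \<notin> T" and "w \<in> carrier regular" for i w
    proof -
      have w: "w \<in> carrier II" using that by simp
      then have wc: "w \<odot>\<^bsub>wmodule T \<rho>'\<^esub> delta \<rho>' \<in> carrier (wmodule T \<rho>')" using dc by (rule W.act_closed)
      have "Dm i (Jm T i f) = f" for f :: "('n \<Rightarrow> 'k) \<Rightarrow> 'k" using i by (simp add: Dm_def Jm_def)
      then have "Dop i \<odot>\<^bsub>wmodule T \<rho>'\<^esub> (Jop i \<odot>\<^bsub>wmodule T \<rho>'\<^esub> f) = f" if "f \<in> W.V" for f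
        using W.hom_Dop[of "Jm T i f" i] W.hom_Jop[of f i] that by simp
      then have "(w \<circ> Jop i \<circ> Dop i) \<odot>\<^bsub>wmodule T \<rho>'\<^esub> delta \<rho>' = w \<odot>\<^bsub>wmodule T \<rho>'\<^esub> delta \<rho>'"
        using w dc wc W.\<phi>_surj[OF wc] by (simp add: W.act_comp carrier_II_mult del: o_apply)
      then show ?thesis
        unfolding regular_simps using w by (intro minus) (simp_all add: carrier_II_mult del: o_apply)
    qed
  qed
  then obtain \<phi> where "model (quot_module regular ?N) T \<rho>' \<phi>" by (rule exE)
  then have "model (quot_module regular ?N) T \<rho> \<phi>" by (rule model_wtset_cong) (rule S)
  then show ?thesis by (intro exI)
qed

text \<open>The class of the identity generates, is killed by integration, and has weight 1 because
  \<open>H - 1\<close> is a right multiple of \<open>\<integral>\<close>.\<close>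

lemma I1_mod_int_model:
  "\<exists>\<phi>. model (I1_mod_int :: (('k::field_char_0, unit) op, ('k, unit) op set) module) UNIV (\<lambda>_. 1) \<phi>"
proof -
  interpret R: II_module "regular :: (('k, unit) op, ('k, unit) op) module"
    by (rule II_module.intro) (rule right_module_regular)
  let ?N = "{Jop () \<otimes>\<^bsub>II\<^esub> b | b. b \<in> carrier II} :: ('k, unit) op set"
  have memI: "Jop () \<circ> b \<in> ?N" if "b \<in> carrier II" for b using that by auto
  have sub: "submodule ?N II regular"
  proof (rule R.submoduleI_gens)
    have gens: "a \<odot>\<^bsub>regular\<^esub> v \<in> ?N" if "v \<in> ?N" "a \<in> carrier II" for a v
      using that memI[OF carrier_II_mult[OF _ that(2)]] by (auto simp: o_assoc simp del: o_apply)
    then show "Cop c \<odot>\<^bsub>regular\<^esub> v \<in> ?N" "Dop i \<odot>\<^bsub>regular\<^esub> v \<in> ?N" "Jop i \<odot>\<^bsub>regular\<^esub> v \<in> ?N"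
      "Hop i \<odot>\<^bsub>regular\<^esub> v \<in> ?N" if "v \<in> ?N" for v c i
      using that by blast+
    show "?N \<subseteq> carrier regular" by (auto simp: carrier_II_mult simp del: o_apply)
    have 0: "Jop () \<circ> (\<lambda>_. 0) = (\<lambda>_. 0 :: ('k, unit) pol)"
      by (intro ext poly_mapping_eqI) simp
    have "(\<lambda>_. 0 :: ('k, unit) pol) \<in> carrier II" using R.zero_closed by (simp only: regular_simps)
    from memI[OF this] show "\<zero>\<^bsub>regular\<^esub> \<in> ?N" unfolding 0 regular_simps .
    show "u \<oplus>\<^bsub>regular\<^esub> v \<in> ?N" if uv: "u \<in> ?N" "v \<in> ?N" for u v
    proof -
      obtain b b' where b: "b \<in> carrier II" "b' \<in> carrier II" "u = Jop () \<circ> b" "v = Jop () \<circ> b'"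
        using uv by auto
      have "(\<lambda>p. (Jop () \<circ> b) p + (Jop () \<circ> b') p) = Jop () \<circ> (\<lambda>p. b p + b' p)"
        by (simp add: gens_add fun_eq_iff)
      then show ?thesis using memI[OF carrier_II_add[OF b(1,2)]] unfolding b regular_simps by (simp only:)
    qed
  qed
  have "\<exists>\<phi>. model (quot_module regular ?N) UNIV (\<lambda>_. 1) \<phi>"
  proof (rule model_quotient[OF right_module_regular sub])
    show "id \<in> carrier regular" by (simp add: carrier_II_id)
    \<comment> \<open>A right multiple of \<open>\<integral>\<close> has only values with zero
      constant term, unlike the identity at 1.\<close>
    show "id \<notin> ?N"
    proof
      assume "id \<in> ?N"
      then obtain b where "id = Jop () \<circ> (b :: ('k, unit) op)" by auto
      then have "lk (id 1 :: ('k, unit) pol) 0 = lk (Jop () (b 1)) 0" by (metis o_apply)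
      then show False by simp
    qed
    show "carrier regular \<subseteq> {a \<odot>\<^bsub>regular\<^esub> id | a. a \<in> carrier II}" by auto
    show "Hop i \<odot>\<^bsub>regular\<^esub> id \<ominus>\<^bsub>regular\<^esub> Cop 1 \<odot>\<^bsub>regular\<^esub> id \<in> ?N" for i :: unit
    proof -
      \<comment> \<open>The fourth relation solved for \<open>H - 1\<close>: it equals
        \<open>\<integral> (\<partial> H - \<partial>)\<close>.\<close>
      let ?b = "(\<lambda>p. (Dop () \<circ> Hop ()) p + (Cop (-1) \<circ> Dop ()) p) :: ('k, unit) op"
      have "?b \<in> carrier II" by (intro carrier_II_add carrier_II_mult) auto
      moreover have "(\<lambda>p. Hop () p - Cop 1 p) = Jop () \<circ> ?b"
      proof
        fix p :: "('k, unit) pol"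
        have diff_eq: "a - d = b - c" if "a = b + d - c" for a b c d :: "('k, unit) pol"
          using that by (simp add: algebra_simps)
        have neg: "Jop () (- q) = - Jop () q" for q :: "('k, unit) pol"
          by (intro poly_mapping_eqI) simp
        have "Hop () p = Jop () (Dop () (Hop () p)) + p - Jop () (Dop () p)"
          using fun_cong[OF op_relations(4)[of "()"], of p] by (simp only: eq_diff_eq)
        moreover have "(Jop () \<circ> ?b) p = Jop () (Dop () (Hop () p)) - Jop () (Dop () p)"
          unfolding o_apply Cop_minus_1 gens_add neg by simp
        ultimately show "Hop () p - Cop 1 p = (Jop () \<circ> ?b) p"
          unfolding Cop_1 id_apply by (metis diff_eq)
      qed
      ultimately show ?thesis using memI[of ?b] by (simp add: regular_minus)
    qed
    show "Jop i \<odot>\<^bsub>regular\<^esub> id \<in> ?N" for i :: unit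
      using memI[OF carrier_II_id] by simp
  qed simp_all
  then show ?thesis by (simp only: I1_mod_int_def regular_def)
qed


section \<open>Transport of structure\<close>

text \<open>If \<open>\<theta>\<close> carries \<open>\<sigma>\<close> to \<open>evr T\<close>, the
  module laws for \<open>\<sigma>\<close> are inherited from the recursion equations of
  \<open>evr\<close>. The hypothesis speaks of \<open>\<sigma> (ev e)\<close> for every word
  \<open>e\<close>, so it already contains independence of the word.\<close>

lemma model_transport:
  fixes X :: "('v, 'x) ring_scheme" and \<rho> :: "'n::finite \<Rightarrow> 'k::field_char_0"
  assumes X: "abelian_group X" and bij: "bij_betw \<theta> (carrier X) (fs (wtset T \<rho>))"
    and add: "\<And>u v. u \<in> carrier X \<Longrightarrow> v \<in> carrier X \<Longrightarrow> \<theta> (u \<oplus>\<^bsub>X\<^esub> v) = (\<lambda>\<nu>. \<theta> u \<nu> + \<theta> v \<nu>)"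
    and closed: "\<And>e u. u \<in> carrier X \<Longrightarrow> \<sigma> (ev e) u \<in> carrier X"
    and act: "\<And>e u. u \<in> carrier X \<Longrightarrow> \<theta> (\<sigma> (ev e) u) = evr T e (\<theta> u)"
  shows "\<exists>\<phi>. model (with_action X \<sigma>) T \<rho> \<phi>"
proof -
  let ?M = "with_action X \<sigma>"
  interpret X: abelian_group X by (rule X)
  have M: "carrier ?M = carrier X" "\<And>u v. u \<oplus>\<^bsub>?M\<^esub> v = u \<oplus>\<^bsub>X\<^esub> v" "\<And>a v. a \<odot>\<^bsub>?M\<^esub> v = \<sigma> a v"
    by (simp_all add: with_action_def)
  have inj: "u = v" if "u \<in> carrier X" "v \<in> carrier X" "\<theta> u = \<theta> v" for u v
    using bij that by (auto simp: bij_betw_def dest: inj_onD)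
  have \<theta>: "\<theta> u \<in> fs (wtset T \<rho>)" if "u \<in> carrier X" for u
    using bij that by (auto simp: bij_betw_def)
  have rm: "right_module II ?M"
  proof (rule right_moduleI[OF ring_II abelian_group_with_action[OF X]], unfold M)
    fix a b :: "('k, 'n) op" and u v
    assume "a \<in> carrier II" "b \<in> carrier II" and u: "u \<in> carrier X"
    then obtain e e' where e: "a = ev e" "b = ev e'" by (auto simp: carrier_II)
    have "\<theta> (\<sigma> (ev (Add e e')) u) = \<theta> (\<sigma> (ev e) u \<oplus>\<^bsub>X\<^esub> \<sigma> (ev e') u)"
      using u by (simp only: act add closed evr.simps)
    then have "\<sigma> (ev (Add e e')) u = \<sigma> (ev e) u \<oplus>\<^bsub>X\<^esub> \<sigma> (ev e') u"
      by (intro inj X.a_closed closed u)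
    then show "\<sigma> (a \<oplus>\<^bsub>II\<^esub> b) u = \<sigma> a u \<oplus>\<^bsub>X\<^esub> \<sigma> b u" by (simp add: e)
    have "\<theta> (\<sigma> (ev (Mul e e')) u) = \<theta> (\<sigma> (ev e') (\<sigma> (ev e) u))"
      using u by (simp only: act closed evr.simps)
    then have "\<sigma> (ev (Mul e e')) u = \<sigma> (ev e') (\<sigma> (ev e) u)"
      by (intro inj closed u)
    then show "\<sigma> (a \<otimes>\<^bsub>II\<^esub> b) u = \<sigma> b (\<sigma> a u)" by (simp add: e)
  next
    fix a :: "('k, 'n) op" and u v
    assume "a \<in> carrier II" and u: "u \<in> carrier X"
    then obtain e where e: "a = ev e" by (auto simp: carrier_II)
    show "\<sigma> a u \<in> carrier X" unfolding e using u by (rule closed)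
    assume v: "v \<in> carrier X"
    have "\<theta> (\<sigma> (ev e) (u \<oplus>\<^bsub>X\<^esub> v)) = \<theta> (\<sigma> (ev e) u \<oplus>\<^bsub>X\<^esub> \<sigma> (ev e) v)"
      using u v by (simp add: act add closed evr_add)
    then show "\<sigma> a (u \<oplus>\<^bsub>X\<^esub> v) = \<sigma> a u \<oplus>\<^bsub>X\<^esub> \<sigma> a v"
      unfolding e using u v by (intro inj) (auto intro: closed)
  next
    fix u assume u: "u \<in> carrier X"
    have "\<theta> (\<sigma> (ev (Sc 1)) u) = \<theta> u" using u by (simp only: act evr.simps) simp
    then have "\<sigma> (ev (Sc 1)) u = u" using u by (intro inj closed)
    then show "\<sigma> \<one>\<^bsub>II\<^esub> u = u" by (simp add: Cop_1)
  qed
  define \<phi> where "\<phi> = inv_into (carrier X) \<theta>"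
  have \<phi>: "\<phi> f \<in> carrier X" "\<theta> (\<phi> f) = f" if "f \<in> fs (wtset T \<rho>)" for f
    using that bij by (auto simp: \<phi>_def bij_betw_def inv_into_into f_inv_into_f)
  have \<phi>_eq: "\<phi> f = u" if "u \<in> carrier X" "\<theta> u = f" for f u
    using that \<phi>[OF \<theta>[OF that(1)]] by (auto intro: inj)
  have hom: "\<phi> (evr T e f) = \<sigma> (ev e) (\<phi> f)" if "f \<in> fs (wtset T \<rho>)" for e f
    using that by (intro \<phi>_eq) (simp_all add: act closed \<phi>)
  have "model ?M T \<rho> \<phi>"
  proof (intro model.intro II_module.intro rm model_axioms.intro, unfold M)
    show "bij_betw \<phi> (fs (wtset T \<rho>)) (carrier X)" unfolding \<phi>_def using bij by (rule bij_betw_inv_into)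
    fix f :: "('n \<Rightarrow> 'k) \<Rightarrow> 'k" and c i assume f: "f \<in> fs (wtset T \<rho>)"
    show "\<phi> (\<lambda>\<nu>. f \<nu> + g \<nu>) = \<phi> f \<oplus>\<^bsub>X\<^esub> \<phi> g" if "g \<in> fs (wtset T \<rho>)" for g
      using f that by (intro \<phi>_eq) (simp_all add: \<phi> add)
    show "\<phi> (\<lambda>\<nu>. c * f \<nu>) = \<sigma> (Cop c) (\<phi> f)" using hom[OF f, of "Sc c"] by simp
    show "\<phi> (Dm i f) = \<sigma> (Dop i) (\<phi> f)" using hom[OF f, of "GD i"] by simp
    show "\<phi> (Jm T i f) = \<sigma> (Jop i) (\<phi> f)" using hom[OF f, of "GJ i"] by simp
    show "\<phi> (Hm i f) = \<sigma> (Hop i) (\<phi> f)" using hom[OF f, of "GH i"] by simp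
  qed
  then show ?thesis by (rule exI[of _ \<phi>])
qed

section \<open>The polynomial module turned into a right module\<close>

lemma wtset_UNIV: "wtset UNIV \<rho> = posset UNIV"
  by (simp add: wtset_def posset_def)

text \<open>Coordinates with respect to divided powers: the involution in \<open>star_module\<close>
  cancels the \<open>st\<close> in \<open>divided_ev\<close>.\<close>

lemma star_P1_model:
  "\<exists>\<phi>. model (star_module (P1 :: (('k::field_char_0, unit) op, ('k, unit) pol) module)) UNIV (\<lambda>_. 1) \<phi>"
  unfolding star_module_def
proof (rule model_transport[where \<theta> = divided])
  show "abelian_group (P1 :: (('k, unit) op, ('k, unit) pol) module)"
    by (rule abelian_groupI) (auto simp: P1_def ac_simps intro: exI[of _ "- _"])
  show "bij_betw divided (carrier (P1 :: (('k, unit) op, ('k, unit) pol) module)) (fs (wtset UNIV (\<lambda>_. 1)))"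
    unfolding wtset_UNIV bij_betw_def
    using divided_fs divided_surj by (fastforce simp: P1_def intro: inj_divided)
  fix u v :: "('k, unit) pol" and e
  show "divided (u \<oplus>\<^bsub>P1\<^esub> v) = (\<lambda>\<nu>. divided u \<nu> + divided v \<nu>)"
    by (intro divided_eqI) (simp_all add: divided_out P1_def lookup_add distrib_left)
  show "star (ev e) \<odot>\<^bsub>P1\<^esub> u \<in> carrier P1" by (simp add: P1_def)
  show "divided (star (ev e) \<odot>\<^bsub>P1\<^esub> u) = evr UNIV e (divided u)"
    by (simp add: P1_def divided_ev)
qed

section \<open>The module \<open>K[\<partial>]\<close>, where the power with exponent
  \<open>k\<close> has weight \<open>k + 1\<close>\<close>

definition poly_wt :: "'k::field_char_0 poly \<Rightarrow> (unit \<Rightarrow> 'k) \<Rightarrow> 'k" where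
  "poly_wt p \<nu> = (if \<nu> \<in> posset UNIV then coeff p (THE k. \<nu> () = of_nat k + 1) else 0)"

lemma poly_wt_nat [simp]: "poly_wt p (\<lambda>_. of_nat k + 1) = coeff p k"
  by (auto simp: poly_wt_def posset_def)

lemma poly_wt_out: "\<nu> \<notin> posset UNIV \<Longrightarrow> poly_wt p \<nu> = 0"
  by (simp add: poly_wt_def)

lemma posset_unit: "\<nu> \<in> posset UNIV \<longleftrightarrow> (\<exists>k::nat. \<nu> = (\<lambda>_::unit. of_nat k + 1))"
  by (auto simp: posset_def fun_eq_iff)

lemma poly_wt_eqI:
  assumes "\<And>k::nat. f (\<lambda>_. of_nat k + 1) = g (\<lambda>_. of_nat k + 1)"
    "\<And>\<nu>. \<nu> \<notin> posset UNIV \<Longrightarrow> f \<nu> = 0" "\<And>\<nu>. \<nu> \<notin> posset UNIV \<Longrightarrow> g \<nu> = 0"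
  shows "f = (g :: (unit \<Rightarrow> 'k::field_char_0) \<Rightarrow> 'b::zero)"
proof
  fix \<nu> show "f \<nu> = g \<nu>" using assms by (cases "\<nu> \<in> posset UNIV") (auto simp: posset_unit)
qed

lemma poly_wt_bij: "bij_betw (poly_wt :: 'k::field_char_0 poly \<Rightarrow> _) UNIV (fs (posset UNIV))"
proof (rule bij_betwI')
  fix p q :: "'k poly"
  show "(poly_wt p = poly_wt q) = (p = q)"
    by (metis poly_eqI poly_wt_nat)
  show "poly_wt p \<in> fs (posset UNIV)"
  proof (rule fsI)
    have "{\<nu>. poly_wt p \<nu> \<noteq> 0} \<subseteq> (\<lambda>k _. of_nat k + 1) ` {..degree p}"
    proof
      fix \<nu> assume *: "\<nu> \<in> {\<nu>. poly_wt p \<nu> \<noteq> 0}"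
      then have "\<nu> \<in> posset UNIV" using poly_wt_out by blast
      then obtain k :: nat where "\<nu> = (\<lambda>_. of_nat k + 1)" by (auto simp: posset_unit)
      with * show "\<nu> \<in> (\<lambda>k _. of_nat k + 1) ` {..degree p}" by (auto intro: le_degree)
    qed
    then show "finite {\<nu>. poly_wt p \<nu> \<noteq> 0}" by (rule finite_subset) simp
  qed (use poly_wt_out in blast)
next
  fix f :: "(unit \<Rightarrow> 'k) \<Rightarrow> 'k" assume f: "f \<in> fs (posset UNIV)"
  have "inj (\<lambda>k::nat. (\<lambda>_::unit. of_nat k + 1 :: 'k))" by (rule injI) (simp add: fun_eq_iff)
  from finite_vimageI[OF fs_finite[OF f] this]
  have "finite {k::nat. f (\<lambda>_. of_nat k + 1) \<noteq> 0}" by (simp add: vimage_def)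
  then have "\<forall>\<^sub>\<infinity> k::nat. f (\<lambda>_. of_nat k + 1) = 0" by (simp add: eventually_cofinite)
  then have "coeff (Abs_poly (\<lambda>k. f (\<lambda>_. of_nat k + 1))) = (\<lambda>k. f (\<lambda>_. of_nat k + 1))"
    by (intro Abs_poly_inverse) simp
  then have "f = poly_wt (Abs_poly (\<lambda>k. f (\<lambda>_. of_nat k + 1)))"
    by (intro poly_wt_eqI) (simp_all add: poly_wt_out fs_out[OF f])
  then show "\<exists>p\<in>UNIV. f = poly_wt p" by blast
qed

text \<open>The uniqueness half of the description in \<open>Kd\<close>. The prescribed values agree
  with \<open>evr UNIV\<close> on monomials, linearity extends this to polynomials for each letter,
  and the module laws extend it to words.\<close>

lemma poly_wt_evr:
  assumes "is_Kd_action \<sigma>"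
  shows "poly_wt (\<sigma> (ev e) p) = evr UNIV e (poly_wt p)"
proof -
  let ?M = "with_action poly_space \<sigma>"
  have \<sigma>: "right_module II ?M" "\<And>c p. \<sigma> (Cop c) p = Polynomial.smult c p"
    "\<And>k. \<sigma> (Hop ()) (Polynomial.monom 1 k) = Polynomial.monom (of_nat k + 1) k"
    "\<And>k. \<sigma> (Dop ()) (Polynomial.monom 1 k) = Polynomial.monom 1 (k + 1)"
    "\<And>k. k \<ge> 1 \<Longrightarrow> \<sigma> (Jop ()) (Polynomial.monom 1 k) = Polynomial.monom 1 (k - 1)"
    "\<sigma> (Jop ()) 1 = 0"
    using assms unfolding is_Kd_action_def by auto
  interpret II_module ?M by (rule II_module.intro) (rule \<sigma>(1))
  have M: "carrier ?M = UNIV" "\<And>u v. u \<oplus>\<^bsub>?M\<^esub> v = u + v" "\<And>a v. a \<odot>\<^bsub>?M\<^esub> v = \<sigma> a v"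
    by (simp_all add: with_action_def poly_space_def)
  have add: "\<sigma> (ev e) (p + q) = \<sigma> (ev e) p + \<sigma> (ev e) q" for e p q
    using act_add[of "ev e" p q] by (simp add: M)
  have smult: "\<sigma> (ev e) (Polynomial.smult c p) = Polynomial.smult c (\<sigma> (ev e) p)" for e c p
    using act_Cop_commute[of "ev e" p c] by (simp add: M \<sigma>(2))
  have wt_add: "poly_wt (p + q) = (\<lambda>\<nu>. poly_wt p \<nu> + poly_wt q \<nu>)" for p q :: "'a poly"
    by (rule poly_wt_eqI) (simp_all add: poly_wt_out)
  have wt_smult: "poly_wt (Polynomial.smult c p) = (\<lambda>\<nu>. c * poly_wt p \<nu>)" for c and p :: "'a poly"
    by (rule poly_wt_eqI) (simp_all add: poly_wt_out)
  have wt_monom: "poly_wt (Polynomial.monom 1 k) = delta (\<lambda>_. of_nat k + 1 :: 'a)" for k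
    by (rule poly_wt_eqI) (auto simp: poly_wt_out delta_def posset_unit fun_eq_iff)
  have gen: "poly_wt (\<sigma> (ev e) p) = evr UNIV e (poly_wt p)"
    if mon: "\<And>k. poly_wt (\<sigma> (ev e) (Polynomial.monom 1 k)) = evr UNIV e (delta (\<lambda>_. of_nat k + 1))" for e p
  proof -
    have 0: "\<sigma> (ev e) 0 = 0" using smult[of e 0 0] by simp
    have p0: "poly_wt 0 = (\<lambda>_. 0 :: 'a)" by (rule poly_wt_eqI) (simp_all add: poly_wt_out)
    have mon': "poly_wt (\<sigma> (ev e) (Polynomial.monom c k)) = evr UNIV e (poly_wt (Polynomial.monom c k))" for c k
      using mon[of k] smult[of e c "Polynomial.monom 1 k"] wt_smult[of c "Polynomial.monom 1 k"]
      by (simp add: Polynomial.smult_monom wt_monom evr_scale wt_smult)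
    have "poly_wt (\<sigma> (ev e) (\<Sum>k\<in>A. Polynomial.monom (coeff p k) k))
        = evr UNIV e (poly_wt (\<Sum>k\<in>A. Polynomial.monom (coeff p k) k))" if "finite A" for A
      using that by induction (simp_all add: 0 p0 evr_zero add wt_add mon' evr_add)
    from this[of "{..degree p}"] show ?thesis by (simp add: poly_as_sum_of_monoms)
  qed
  have wt0: "poly_wt 0 = (\<lambda>_. 0 :: 'a)" by (rule poly_wt_eqI) (simp_all add: poly_wt_out)
  have gD: "poly_wt (\<sigma> (ev (GD ())) p) = evr UNIV (GD ()) (poly_wt p)" for p
  proof (rule gen)
    fix k
    have "Dm () (delta (\<lambda>_. of_nat k + 1 :: 'a)) = delta (\<lambda>_. of_nat (k + 1) + 1)"
      by (subst Dm_delta) (auto simp: fun_upd_def ac_simps)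
    then show "poly_wt (\<sigma> (ev (GD ())) (Polynomial.monom 1 k)) = evr UNIV (GD ()) (delta (\<lambda>_. of_nat k + 1))"
      by (simp only: ev.simps evr.simps \<sigma>(4) wt_monom)
  qed
  have gH: "poly_wt (\<sigma> (ev (GH ())) p) = evr UNIV (GH ()) (poly_wt p)" for p
  proof (rule gen)
    fix k
    have "poly_wt (Polynomial.monom (of_nat k + 1) k) = (\<lambda>\<nu>. (of_nat k + 1) * delta (\<lambda>_. of_nat k + 1 :: 'a) \<nu>)"
      using wt_smult[of "of_nat k + 1" "Polynomial.monom 1 k"] by (simp only: Polynomial.smult_monom wt_monom mult_1_right)
    then show "poly_wt (\<sigma> (ev (GH ())) (Polynomial.monom 1 k)) = evr UNIV (GH ()) (delta (\<lambda>_. of_nat k + 1))"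
      by (simp only: ev.simps evr.simps \<sigma>(3) Hm_delta)
  qed
  have gJ: "poly_wt (\<sigma> (ev (GJ ())) p) = evr UNIV (GJ ()) (poly_wt p)" for p
  proof (rule gen)
    fix k
    show "poly_wt (\<sigma> (ev (GJ ())) (Polynomial.monom 1 k)) = evr UNIV (GJ ()) (delta (\<lambda>_. of_nat k + 1))"
    proof (cases k)
      case 0
      have "Jm UNIV () (delta (\<lambda>_. 1 :: 'a)) = (\<lambda>_. 0)"
        by (intro ext) (auto simp: Jm_def delta_def fun_eq_iff)
      then show ?thesis using \<sigma>(6) 0 by (simp add: wt0)
    next
      case (Suc m)
      have "Jm UNIV () (delta (\<lambda>_. of_nat (Suc m) + 1 :: 'a)) = delta (\<lambda>_. of_nat m + 1)"
        by (subst Jm_delta) (auto simp: fun_upd_def ac_simps)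
      moreover have "\<sigma> (Jop ()) (Polynomial.monom 1 (Suc m)) = Polynomial.monom 1 m"
        using \<sigma>(5)[of "Suc m"] by simp
      ultimately show ?thesis unfolding Suc by (simp only: ev.simps evr.simps wt_monom)
    qed
  qed
  show ?thesis
  proof (induction e arbitrary: p)
    case (Sc c)
    then show ?case by (simp add: \<sigma>(2) wt_smult)
  next
    case (Add a b)
    have "\<sigma> (ev (Add a b)) p = \<sigma> (ev a) p + \<sigma> (ev b) p"
      using act_add_op[of "ev a" "ev b" p] by (simp add: M)
    then show ?case by (simp add: wt_add Add)
  next
    case (Mul a b)
    have "\<sigma> (ev (Mul a b)) p = \<sigma> (ev b) (\<sigma> (ev a) p)"
      using act_comp[of "ev a" "ev b" p] by (simp add: M del: o_apply)
    then show ?case by (simp add: Mul o_def)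
  qed (use gD gJ gH in simp_all)
qed

lemma abelian_group_poly_space: "abelian_group poly_space"
  by (rule abelian_groupI) (auto simp: poly_space_def ac_simps intro: exI[of _ "- _"])

text \<open>The existence half: pull \<open>evr UNIV\<close> back along \<open>poly_wt\<close> and
  compare coefficients with the prescribed values.\<close>

lemma Kd_action_exists: "\<exists>\<sigma> :: ('k::field_char_0, unit) op \<Rightarrow> 'k poly \<Rightarrow> 'k poly. is_Kd_action \<sigma>"
proof -
  define \<sigma> :: "('k, unit) op \<Rightarrow> 'k poly \<Rightarrow> 'k poly"
    where "\<sigma> a p = inv_into UNIV poly_wt (evr UNIV (SOME e. ev e = a) (poly_wt p))" for a p
  have fs: "poly_wt p \<in> fs (posset UNIV)" for p :: "'k poly"
    using poly_wt_bij by (auto simp: bij_betw_def)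
  have inj: "p = q" if "poly_wt p = poly_wt q" for p q :: "'k poly"
    using poly_wt_bij that by (auto simp: bij_betw_def dest: injD)
  have act: "poly_wt (\<sigma> (ev e) p) = evr UNIV e (poly_wt p)" for e p
  proof -
    have "ev (SOME e'. ev e' = ev e) = ev e" by (rule someI[of _ e]) simp
    then have "evr UNIV (SOME e'. ev e' = ev e) (poly_wt p) = evr UNIV e (poly_wt p)"
      using fs by (rule evr_well_defined)
    moreover have "evr UNIV e (poly_wt p) \<in> range poly_wt"
      using fs_evr[OF step_closed_posset fs] poly_wt_bij by (auto simp: bij_betw_def)
    ultimately show ?thesis by (simp add: \<sigma>_def f_inv_into_f)
  qed
  have "\<exists>\<phi>. model (with_action poly_space \<sigma>) UNIV (\<lambda>_. 1) \<phi>"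
  proof (rule model_transport[where \<theta> = poly_wt, OF abelian_group_poly_space])
    show "bij_betw poly_wt (carrier poly_space) (fs (wtset UNIV (\<lambda>_. 1)) :: ((unit \<Rightarrow> 'k) \<Rightarrow> 'k) set)"
      using poly_wt_bij by (simp add: wtset_UNIV poly_space_def)
    fix p q :: "'k poly" and e
    show "poly_wt (p \<oplus>\<^bsub>poly_space\<^esub> q) = (\<lambda>\<nu>. poly_wt p \<nu> + poly_wt q \<nu>)"
      by (rule poly_wt_eqI) (simp_all add: poly_wt_out poly_space_def)
    show "\<sigma> (ev e) p \<in> carrier poly_space" by (simp add: poly_space_def)
    show "poly_wt (\<sigma> (ev e) p) = evr UNIV e (poly_wt p)" by (rule act)
  qed
  then obtain \<phi> where "model (with_action poly_space \<sigma>) UNIV (\<lambda>_. 1) \<phi>" by (rule exE)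
  then have "right_module II (with_action poly_space \<sigma>)" by (rule model_axioms_all)
  moreover have "\<sigma> (Cop c) p = Polynomial.smult c p" for c p
    by (rule inj, rule poly_wt_eqI) (use act[of "Sc c" p] in \<open>simp_all add: poly_wt_out\<close>)
  moreover have "\<sigma> (Hop ()) (Polynomial.monom 1 k) = Polynomial.monom (of_nat k + 1) k" for k
    by (rule inj, rule poly_wt_eqI) (use act[of "GH ()" "Polynomial.monom 1 k"] in \<open>auto simp: poly_wt_out Hm_def\<close>)
  moreover have "\<sigma> (Dop ()) (Polynomial.monom 1 k) = Polynomial.monom 1 (k + 1)" for k
  proof (rule inj, rule poly_wt_eqI)
    fix m :: nat
    have "(\<lambda>_. of_nat m + 1) (() := of_nat m + 1 - 1 :: 'k) = (\<lambda>_. of_nat m)" by auto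
    \<comment> \<open>For \<open>m = 0\<close> the lowered weight is 0, where \<open>poly_wt\<close>
      vanishes; this matches the zero constant coefficient of a monomial of exponent
      \<open>Suc k\<close>.\<close>
    moreover have "poly_wt (Polynomial.monom 1 k) (\<lambda>_. of_nat m) = coeff (Polynomial.monom (1 :: 'k) (Suc k)) m"
    proof (cases m)
      case 0
      then have "(\<lambda>_. of_nat m) \<notin> (posset UNIV :: (unit \<Rightarrow> 'k) set)"
        using pos_step(2)[of 0] by (auto simp: posset_def)
      then show ?thesis using 0 by (simp add: poly_wt_out)
    next
      case (Suc j)
      then have "(\<lambda>_::unit. of_nat m :: 'k) = (\<lambda>_. of_nat j + 1)" by (simp add: fun_eq_iff)
      then show ?thesis using Suc by (simp only: poly_wt_nat) (simp add: Polynomial.coeff_monom)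
    qed
    ultimately show "poly_wt (\<sigma> (Dop ()) (Polynomial.monom 1 k)) (\<lambda>_. of_nat m + 1)
        = poly_wt (Polynomial.monom 1 (k + 1)) (\<lambda>_. of_nat m + 1)"
      using act[of "GD ()" "Polynomial.monom 1 k"] by (simp add: Dm_def)
  qed (simp_all add: poly_wt_out)
  moreover have J: "\<sigma> (Jop ()) p = poly_shift 1 p" for p
  proof (rule inj, rule poly_wt_eqI)
    fix m :: nat
    have "(\<lambda>_. of_nat m + 1) (() := of_nat m + 1 + 1 :: 'k) = (\<lambda>_. of_nat (Suc m) + 1)" by (auto simp: ac_simps)
    then show "poly_wt (\<sigma> (Jop ()) p) (\<lambda>_. of_nat m + 1) = poly_wt (poly_shift 1 p) (\<lambda>_. of_nat m + 1)"
      using fun_cong[OF act[of "GJ ()" p], of "\<lambda>_. of_nat m + 1"] poly_wt_nat[of p "Suc m"]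
        poly_wt_nat[of "poly_shift 1 p" m]
      by (simp only: ev.simps evr.simps Jm_def) (simp add: coeff_poly_shift)
  qed (simp_all add: poly_wt_out)
  moreover have "poly_shift 1 (Polynomial.monom 1 k) = Polynomial.monom 1 (k - 1)" if "k \<ge> 1" for k
    using that by (intro poly_eqI) (auto simp: coeff_poly_shift)
  moreover have "poly_shift 1 1 = (0 :: 'k poly)" by (intro poly_eqI) (simp add: coeff_poly_shift)
  ultimately have "is_Kd_action \<sigma>" unfolding is_Kd_action_def by auto
  then show ?thesis by (rule exI[of _ \<sigma>])
qed

lemma Kd_model: "\<exists>\<phi>. model (Kd :: (('k::field_char_0, unit) op, 'k poly) module) UNIV (\<lambda>_. 1) \<phi>"
  unfolding Kd_def
proof (rule model_transport[where \<theta> = poly_wt, OF abelian_group_poly_space])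
  show "bij_betw poly_wt (carrier poly_space) (fs (wtset UNIV (\<lambda>_. 1)) :: ((unit \<Rightarrow> 'k) \<Rightarrow> 'k) set)"
    using poly_wt_bij by (simp add: wtset_UNIV poly_space_def)
  fix p q :: "'k poly" and e
  show "poly_wt (p \<oplus>\<^bsub>poly_space\<^esub> q) = (\<lambda>\<nu>. poly_wt p \<nu> + poly_wt q \<nu>)"
    by (rule poly_wt_eqI) (simp_all add: poly_wt_out poly_space_def)
  let ?s = "THE r. \<exists>\<sigma>. is_Kd_action \<sigma> \<and> r = \<sigma> (ev e) p"
  show "?s \<in> carrier poly_space" by (simp add: poly_space_def)
  obtain \<sigma> :: "('k, unit) op \<Rightarrow> 'k poly \<Rightarrow> 'k poly" where \<sigma>: "is_Kd_action \<sigma>"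
    using Kd_action_exists by blast
  have "?s = \<sigma> (ev e) p"
  proof (rule the_equality)
    fix r assume "\<exists>\<sigma>'. is_Kd_action \<sigma>' \<and> r = \<sigma>' (ev e) p"
    then have "poly_wt r = poly_wt (\<sigma> (ev e) p)" using \<sigma> poly_wt_evr by metis
    then show "r = \<sigma> (ev e) p" using poly_wt_bij by (auto simp: bij_betw_def dest: injD)
  qed (use \<sigma> in blast)
  then show "poly_wt ?s = evr UNIV e (poly_wt p)" using poly_wt_evr[OF \<sigma>] by simp
qed

section \<open>The ideal \<open>F\<close> and the algebra \<open>B\<^sub>1\<close>\<close>

abbreviation xpow :: "nat \<Rightarrow> unit \<Rightarrow>\<^sub>0 nat" where "xpow s \<equiv> sgl () s"

lemma unit_mon: "\<beta> = xpow (lk \<beta> ())"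
  by (rule poly_mapping_eqI) simp

lemma xpow_eqI: "(\<And>m. lk p (xpow m) = lk q (xpow m)) \<Longrightarrow> p = q"
  by (rule poly_mapping_eqI) (metis unit_mon)

lemma xpow_add: "xpow m + xpow n = xpow (m + n)" and xpow_diff: "xpow m - xpow n = xpow (m - n)"
  by (simp_all add: single_add single_diff)

lemma xpow_eq_iff [simp]: "xpow m = xpow n \<longleftrightarrow> m = n"
  by (metis lookup_single_eq)

lemma Dop_power:
  fixes p :: "('k::field_char_0, unit) pol"
  shows "lk ((Dop () ^^ t) p) (xpow m) = fact (m + t) / fact m * lk p (xpow (m + t))"
proof (induction t arbitrary: m)
  case (Suc t)
  have "u * (x / (u * w) * y) = x / w * y" if "u \<noteq> 0" for u w x y :: 'k using that by simp
  from this[of "of_nat (Suc m)" _ "fact m"]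
  have "of_nat (m + 1) * (x / fact (Suc m) * y) = x / fact m * y" for x y :: 'k by (simp add: fact_Suc)
  then show "lk ((Dop () ^^ Suc t) p) (xpow m) = fact (m + Suc t) / fact m * lk p (xpow (m + Suc t))"
    using Suc[of "Suc m"] by (simp add: xpow_add del: fact_Suc)
qed simp

lemma Jop_power: "lk ((Jop () ^^ s) p) (xpow m) = (if m < s then 0 else fact (m - s) / fact m * lk p (xpow (m - s)))"
proof (induction s arbitrary: m)
  case (Suc s)
  then show ?case by (cases m) (simp_all add: xpow_diff)
qed simp

text \<open>A scaled matrix unit: it sends \<open>x^t\<close> to \<open>c x^s\<close> and every
  other monomial to 0.\<close>

definition Fel :: "nat \<Rightarrow> nat \<Rightarrow> 'k \<Rightarrow> ('k::field_char_0, unit) op" where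
  "Fel s t c = (\<lambda>p. sgl (xpow s) (c * lk p (xpow t)))"

text \<open>The operators \<open>\<integral>^s \<partial>^t\<close> and
  \<open>\<integral>^(s+1) \<partial>^(t+1)\<close> agree on all monomials except
  \<open>x^t\<close>, where the second is 0 and the first gives \<open>t!/s! x^s\<close>.\<close>

lemma matrix_unit: "Cop c ((Jop () ^^ s) ((Dop () ^^ t) p) - (Jop () ^^ (s + 1)) ((Dop () ^^ (t + 1)) p))
    = Fel s t (c * fact t / fact s) p"
proof (rule xpow_eqI)
  fix m
  show "lk (Cop c ((Jop () ^^ s) ((Dop () ^^ t) p) - (Jop () ^^ (s + 1)) ((Dop () ^^ (t + 1)) p))) (xpow m)
    = lk (Fel s t (c * fact t / fact s) p) (xpow m)"
    unfolding lookup_Cop lookup_minus Jop_power Dop_power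
    by (cases "m < s"; cases "m = s")
      (auto simp: Fel_def lookup_single when_def Suc_diff_Suc[symmetric])
qed

lemma mem_Fideal_iff:
  "f \<in> Fideal \<longleftrightarrow> (\<exists>T c. finite T \<and> f = (\<lambda>p. \<Sum>(s, t)\<in>T. Fel s t (c s t) p))"
proof
  assume "f \<in> Fideal"
  then obtain T c where "finite T" "f = (\<lambda>p. \<Sum>(s, t)\<in>T. Fel s t (c s t * fact t / fact s) p)"
    unfolding Fideal_def matrix_unit by blast
  then show "\<exists>T c. finite T \<and> f = (\<lambda>p. \<Sum>(s, t)\<in>T. Fel s t (c s t) p)"
    by (intro exI[of _ T] exI[of _ "\<lambda>s t. c s t * fact t / fact s"]) simp
next
  assume "\<exists>T c. finite T \<and> f = (\<lambda>p. \<Sum>(s, t)\<in>T. Fel s t (c s t) p)"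
  then obtain T c where T: "finite T" "f = (\<lambda>p. \<Sum>(s, t)\<in>T. Fel s t (c s t) p)" by blast
  have "f = (\<lambda>p. \<Sum>(s, t)\<in>T. Fel s t (c s t * fact s / fact t * fact t / fact s) p)"
    unfolding T(2) by (intro ext sum.cong) auto
  then show "f \<in> Fideal"
    unfolding Fideal_def matrix_unit using T(1)
    by (intro CollectI exI[of _ T] exI[of _ "\<lambda>s t. c s t * fact s / fact t"]) simp
qed

lemma Fel_add: "Fel s t (c + d) p = Fel s t c p + Fel s t d p"
  and Fel_0: "Fel s t 0 = (\<lambda>_. 0)"
  by (auto simp: Fel_def distrib_right single_add)

lemma Fideal_zero: "(\<lambda>_. 0) \<in> Fideal"
  unfolding mem_Fideal_iff by (intro exI[of _ "{}"]) simp

lemma Fel_mem: "Fel s t c \<in> Fideal"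
  unfolding mem_Fideal_iff by (intro exI[of _ "{(s, t)}"] exI[of _ "\<lambda>_ _. c"]) simp

lemma Fideal_add:
  assumes "f \<in> Fideal" "g \<in> Fideal" shows "(\<lambda>p. f p + g p) \<in> Fideal"
proof -
  obtain T c where T: "finite T" "f = (\<lambda>p. \<Sum>(s, t)\<in>T. Fel s t (c s t) p)"
    using assms(1) unfolding mem_Fideal_iff by blast
  obtain T' c' where T': "finite T'" "g = (\<lambda>p. \<Sum>(s, t)\<in>T'. Fel s t (c' s t) p)"
    using assms(2) unfolding mem_Fideal_iff by blast
  let ?c = "\<lambda>s t. (if (s, t) \<in> T then c s t else 0) + (if (s, t) \<in> T' then c' s t else 0)"
  have "(\<lambda>p. f p + g p) = (\<lambda>p. \<Sum>(s, t)\<in>T \<union> T'. Fel s t (?c s t) p)"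
  proof
    fix p
    have "f p = (\<Sum>(s, t)\<in>T \<union> T'. Fel s t (if (s, t) \<in> T then c s t else 0) p)"
      unfolding T(2) by (rule sum.mono_neutral_cong_left) (use T T' in \<open>auto simp: Fel_0\<close>)
    moreover have "g p = (\<Sum>(s, t)\<in>T \<union> T'. Fel s t (if (s, t) \<in> T' then c' s t else 0) p)"
      unfolding T'(2) by (rule sum.mono_neutral_cong_left) (use T T' in \<open>auto simp: Fel_0\<close>)
    ultimately show "f p + g p = (\<Sum>(s, t)\<in>T \<union> T'. Fel s t (?c s t) p)"
      unfolding Fel_add by (simp add: sum.distrib[symmetric] case_prod_unfold)
  qed
  then show ?thesis unfolding mem_Fideal_iff using T T' by (intro exI[of _ "T \<union> T'"] exI[of _ ?c]) simp
qed

lemma Fideal_induct [consumes 1, case_names zero add]: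
  assumes "f \<in> Fideal" and "P (\<lambda>_. 0)"
    and step: "\<And>s t c g. g \<in> Fideal \<Longrightarrow> P g \<Longrightarrow> P (\<lambda>p. Fel s t c p + g p)"
  shows "P f"
proof -
  obtain T c where T: "finite T" "f = (\<lambda>p. \<Sum>(s, t)\<in>T. Fel s t (c s t) p)"
    using assms(1) unfolding mem_Fideal_iff by blast
  have "P (\<lambda>p. \<Sum>(s, t)\<in>T. Fel s t (c s t) p)"
    using T(1)
  proof (induction T rule: finite_induct)
    case empty
    then show ?case using assms(2) by simp
  next
    case (insert x T)
    obtain s t where x: "x = (s, t)" by (cases x)
    have "P (\<lambda>p. Fel s t (c s t) p + (\<Sum>(s, t)\<in>T. Fel s t (c s t) p))"
      using insert by (intro step) (auto simp: mem_Fideal_iff)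
    then show "P (\<lambda>p. \<Sum>(s, t)\<in>insert x T. Fel s t (c s t) p)" using insert x by simp
  qed
  then show ?thesis unfolding T(2) .
qed

primrec pwr :: "('k, 'n) expr \<Rightarrow> nat \<Rightarrow> ('k::field_char_0, 'n) expr" where
  "pwr e 0 = Sc 1"
| "pwr e (Suc n) = Mul e (pwr e n)"

lemma ev_pwr: "ev (pwr e n) = ev e ^^ n"
  by (induction n) (simp_all add: Cop_1 o_def id_def)

lemma evr_pwr: "evr T (pwr e n) f = (evr T e ^^ n) f"
  by (induction n arbitrary: f) (simp_all add: funpow_swap1)

lemma evr_st_pwr: "evr T (st (pwr e n)) f = (evr T (st e) ^^ n) f"
  by (induction n arbitrary: f) simp_all

text \<open>A word for \<open>Fel s t c\<close>, so that \<open>evr\<close> and \<open>star\<close>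
  can be computed on it. The scalar \<open>s!/t!\<close> undoes the factor from
  \<open>matrix_unit\<close>.\<close>

definition Fexpr :: "nat \<Rightarrow> nat \<Rightarrow> 'k \<Rightarrow> ('k::field_char_0, unit) expr" where
  "Fexpr s t c = Mul (Sc (c * fact s / fact t)) (Add (Mul (pwr (GJ ()) s) (pwr (GD ()) t))
     (Mul (Sc (- 1)) (Mul (pwr (GJ ()) (s + 1)) (pwr (GD ()) (t + 1)))))"

lemma ev_Fexpr: "ev (Fexpr s t c) = Fel s t c"
proof
  fix p :: "('a, unit) pol"
  have "ev (Fexpr s t c) p = Cop (c * fact s / fact t)
      ((Jop () ^^ s) ((Dop () ^^ t) p) - (Jop () ^^ (s + 1)) ((Dop () ^^ (t + 1)) p))"
    unfolding Fexpr_def ev.simps ev_Mul ev_pwr o_apply Cop_minus_1 by simp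
  also have "\<dots> = Fel s t c p" unfolding matrix_unit by simp
  finally show "ev (Fexpr s t c) p = Fel s t c p" .
qed

lemma Dm_Jm: "i \<notin> T \<Longrightarrow> Dm i (Jm T i f) = f"
  by (simp add: Dm_def Jm_def)

lemma Dm_Jm_power: "(Dm () ^^ Suc t) ((Jm {} () ^^ Suc s) f) = (Dm () ^^ t) ((Jm {} () ^^ s) f)"
  by (simp add: funpow_swap1 Dm_Jm) (simp add: Dm_Jm flip: funpow_swap1)

lemma evr_cancel:
  "(\<And>g. evr T a g = evr T b g) \<Longrightarrow> evr T (Mul (Sc c) (Add a (Mul (Sc (- 1)) b))) f = (\<lambda>_. 0)"
  "(\<And>g. evr T (st a) g = evr T (st b) g) \<Longrightarrow> evr T (st (Mul (Sc c) (Add a (Mul (Sc (- 1)) b)))) f = (\<lambda>_. 0)"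
  using evr_scale[of T b "- 1"] by simp_all

lemma evr_gens: "evr T (GD i) = Dm i" "evr T (GJ i) = Jm T i"
  by (rule ext, simp)+

text \<open>Without truncation \<open>\<partial>\<close> and \<open>\<integral>\<close> are mutually
  inverse shifts, so both terms of a spanning element of \<open>F\<close> act alike. The version
  with \<open>st\<close> serves modules reached through the involution.\<close>

lemma evr_Fexpr: "evr {} (Fexpr s t c) f = (\<lambda>_. 0)" "evr {} (st (Fexpr s t c)) f = (\<lambda>_. 0)"
proof -
  have "evr {} (Mul (pwr (GJ ()) s) (pwr (GD ()) t)) g
      = evr {} (Mul (pwr (GJ ()) (s + 1)) (pwr (GD ()) (t + 1))) g" for g :: "(unit \<Rightarrow> 'a) \<Rightarrow> 'a"
    using Dm_Jm_power[of t s g] by (simp add: evr_pwr evr_gens del: funpow.simps pwr.simps)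
  then show "evr {} (Fexpr s t c) f = (\<lambda>_. 0)"
    unfolding Fexpr_def by (rule evr_cancel(1))
  have "evr {} (st (Mul (pwr (GJ ()) s) (pwr (GD ()) t))) g
      = evr {} (st (Mul (pwr (GJ ()) (s + 1)) (pwr (GD ()) (t + 1)))) g" for g :: "(unit \<Rightarrow> 'a) \<Rightarrow> 'a"
    using Dm_Jm_power[of s t g] by (simp add: evr_st_pwr evr_gens del: funpow.simps pwr.simps)
  then show "evr {} (st (Fexpr s t c)) f = (\<lambda>_. 0)"
    unfolding Fexpr_def by (rule evr_cancel(2))
qed

lemma Fideal_subset: "f \<in> Fideal \<Longrightarrow> f \<in> carrier II"
proof (induction rule: Fideal_induct)
  case zero
  show ?case using in_carrier_II(1)[of 0] by (simp add: Cop_0)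
next
  case (add s t c g)
  then show "(\<lambda>p. Fel s t c p + g p) \<in> carrier II"
    by (intro carrier_II_add) (simp_all flip: ev_Fexpr)
qed

lemma Fel_left:
  "Cop d (Fel s t c p) = Fel s t (d * c) p"
  "Dop () (Fel s t c p) = (if s = 0 then 0 else Fel (s - 1) t (of_nat s * c) p)"
  "Jop () (Fel s t c p) = Fel (Suc s) t (c / of_nat (Suc s)) p"
  "Hop () (Fel s t c p) = Fel s t (of_nat (Suc s) * c) p"
  by (rule xpow_eqI; auto simp: Fel_def lookup_single when_def xpow_add xpow_diff)+

lemma Fel_right:
  "Fel s t c (Cop d p) = Fel s t (c * d) p"
  "Fel s t c (Dop () p) = Fel s (Suc t) (of_nat (Suc t) * c) p"
  "Fel s t c (Jop () p) = (if t = 0 then 0 else Fel s (t - 1) (c / of_nat t) p)"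
  "Fel s t c (Hop () p) = Fel s t (of_nat (Suc t) * c) p"
  by (rule xpow_eqI; auto simp: Fel_def lookup_single when_def xpow_add xpow_diff)+

text \<open>On either side a letter turns a matrix unit into a multiple of a matrix unit, or into 0
  when an exponent would become negative.\<close>

lemma Fideal_mult: "f \<in> Fideal \<Longrightarrow> ev e \<circ> f \<in> Fideal" "f \<in> Fideal \<Longrightarrow> f \<circ> ev e \<in> Fideal"
proof -
  have L: "g \<circ> f \<in> Fideal"
    if f: "f \<in> Fideal" and g: "\<And>s t c. g \<circ> Fel s t c \<in> Fideal" "\<And>p q. g (p + q) = g p + g q" for f g
    using f
  proof (induction rule: Fideal_induct)
    case zero
    have "g 0 = 0" using g(2)[of 0 0] by simp
    then show "g \<circ> (\<lambda>_. 0) \<in> Fideal" using Fideal_zero by (simp add: o_def)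
  next
    case (add s t c f)
    then show "g \<circ> (\<lambda>p. Fel s t c p + f p) \<in> Fideal"
      using Fideal_add[OF g(1) add(2)] by (simp add: o_def g(2))
  qed
  have R: "f \<circ> g \<in> Fideal"
    if f: "f \<in> Fideal" and g: "\<And>s t c. Fel s t c \<circ> g \<in> Fideal" for f g
    using f
  proof (induction rule: Fideal_induct)
    case zero
    show "(\<lambda>_. 0) \<circ> g \<in> Fideal" using Fideal_zero by (simp add: o_def)
  next
    case (add s t c f)
    then show "(\<lambda>p. Fel s t c p + f p) \<circ> g \<in> Fideal"
      using Fideal_add[OF g add(2)] by (simp add: o_def)
  qed
  have Feq: "(\<lambda>p. Fel s t c p) \<in> Fideal" for s t c by (rule Fel_mem)
  have Feq0: "(\<lambda>p. if b then 0 else Fel s t c p) \<in> Fideal" for b s t c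
    by (cases b) (simp_all add: Feq Fideal_zero)
  show "ev e \<circ> f \<in> Fideal" if "f \<in> Fideal" for f
    using that
  proof (induction e arbitrary: f)
    case (Add a b)
    from Fideal_add[OF Add.IH[OF Add.prems]] show "ev (Add a b) \<circ> f \<in> Fideal" by (simp add: o_def)
  next
    case (Mul a b)
    from Mul.IH(1)[OF Mul.IH(2)[OF Mul.prems]] show "ev (Mul a b) \<circ> f \<in> Fideal" by (simp add: o_def)
  next
    case (GD i)
    show "ev (GD i) \<circ> f \<in> Fideal"
      by (rule L[OF GD]) (cases i, auto simp: o_def Fel_left gens_add Feq0)
  next
    case (GJ i)
    show "ev (GJ i) \<circ> f \<in> Fideal"
      by (rule L[OF GJ]) (cases i, auto simp: o_def Fel_left gens_add Feq)
  next
    case (GH i)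
    show "ev (GH i) \<circ> f \<in> Fideal"
      by (rule L[OF GH]) (cases i, auto simp: o_def Fel_left gens_add Feq)
  next
    case (Sc d)
    show "ev (Sc d) \<circ> f \<in> Fideal"
      by (rule L[OF Sc]) (auto simp: o_def Fel_left gens_add Feq)
  qed
  show "f \<circ> ev e \<in> Fideal" if "f \<in> Fideal" for f
    using that
  proof (induction e arbitrary: f)
    case (Add a b)
    have add: "f (p + q) = f p + f q" for p q
      using Fideal_subset[OF Add.prems] by (auto simp: carrier_II ev_add)
    from Fideal_add[OF Add.IH(1)[OF Add.prems] Add.IH(2)[OF Add.prems]]
    show "f \<circ> ev (Add a b) \<in> Fideal" by (simp add: o_def add)
  next
    case (Mul a b)
    from Mul.IH(2)[OF Mul.IH(1)[OF Mul.prems]] show "f \<circ> ev (Mul a b) \<in> Fideal" by (simp add: o_def)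
  next
    case (GD i)
    show "f \<circ> ev (GD i) \<in> Fideal"
      by (rule R[OF GD]) (cases i, auto simp: o_def Fel_right Feq)
  next
    case (GJ i)
    show "f \<circ> ev (GJ i) \<in> Fideal"
      by (rule R[OF GJ]) (cases i, auto simp: o_def Fel_right Feq0)
  next
    case (GH i)
    show "f \<circ> ev (GH i) \<in> Fideal"
      by (rule R[OF GH]) (cases i, auto simp: o_def Fel_right Feq)
  next
    case (Sc d)
    show "f \<circ> ev (Sc d) \<in> Fideal"
      by (rule R[OF Sc]) (auto simp: o_def Fel_right Feq)
  qed
qed

lemma ideal_Fideal: "ideal (Fideal :: ('k::field_char_0, unit) op set) II"
proof -
  interpret R: ring "II :: ('k, unit) op ring" by (rule ring_II)
  show ?thesis
  proof (rule idealI[OF ring_II])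
    show "subgroup (Fideal :: ('k, unit) op set) (add_monoid II)"
    proof (rule R.add.subgroupI)
      show "(Fideal :: ('k, unit) op set) \<subseteq> carrier II" using Fideal_subset by blast
      show "(Fideal :: ('k, unit) op set) \<noteq> {}" using Fideal_zero by blast
      fix f g :: "('k, unit) op" assume f: "f \<in> Fideal" and g: "g \<in> Fideal"
      have m: "Cop (-1) \<circ> f \<in> Fideal" using Fideal_mult(1)[OF f, of "Sc (-1)"] by simp
      have "(Cop (-1) \<circ> f) \<oplus>\<^bsub>II\<^esub> f = \<zero>\<^bsub>II\<^esub>" by (simp add: Cop_minus_1)
      then have "\<ominus>\<^bsub>II\<^esub> f = Cop (-1) \<circ> f"
        using Fideal_subset[OF f] Fideal_subset[OF m] by (intro R.minus_equality)
      with m show "\<ominus>\<^bsub>II\<^esub> f \<in> Fideal" by simp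
      show "f \<oplus>\<^bsub>II\<^esub> g \<in> Fideal" using Fideal_add[OF f g] by simp
    qed
    fix f a :: "('k, unit) op" assume f: "f \<in> Fideal" and "a \<in> carrier II"
    then obtain e where "a = ev e" by (auto simp: carrier_II)
    then show "a \<otimes>\<^bsub>II\<^esub> f \<in> Fideal" "f \<otimes>\<^bsub>II\<^esub> a \<in> Fideal" using Fideal_mult[OF f] by simp_all
  qed
qed

text \<open>Hence \<open>B\<^sub>1\<close> can be tested on the standard modules with empty
  \<open>T\<close>, for its right ideals directly and for its left ideals after applying
  \<open>star\<close>.\<close>

lemma Fideal_acts_zero:
  assumes "f \<in> Fideal" "w \<in> fs (wtset {} \<rho>)"
  shows "f \<odot>\<^bsub>wmodule {} \<rho>\<^esub> w = (\<lambda>_. 0)" "star f \<odot>\<^bsub>wmodule {} \<rho>\<^esub> w = (\<lambda>_. 0)"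
proof -
  interpret W: model "wmodule {} \<rho>" "{}" \<rho> id by (rule model_wmodule)
  have w: "w \<in> carrier (wmodule {} \<rho>)" using assms(2) by (simp add: wmodule_def)
  have p: "g \<oplus>\<^bsub>wmodule {} \<rho>\<^esub> h = (\<lambda>\<nu>. g \<nu> + h \<nu>)" for g h by (simp add: wmodule_def)
  have z: "\<zero>\<^bsub>wmodule {} \<rho>\<^esub> = (\<lambda>_. 0)" by (simp add: wmodule_def)
  have Fw: "Fel s t c \<odot>\<^bsub>wmodule {} \<rho>\<^esub> w = (\<lambda>_. 0)" "star (Fel s t c) \<odot>\<^bsub>wmodule {} \<rho>\<^esub> w = (\<lambda>_. 0)" for s t c
    using wmodule_act[OF assms(2), of "Fexpr s t c"] wmodule_act[OF assms(2), of "st (Fexpr s t c)"]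
    by (simp_all add: evr_Fexpr flip: ev_Fexpr)
  have "f \<odot>\<^bsub>wmodule {} \<rho>\<^esub> w = (\<lambda>_. 0) \<and> star f \<odot>\<^bsub>wmodule {} \<rho>\<^esub> w = (\<lambda>_. 0)"
    using assms(1)
  proof (induction rule: Fideal_induct)
    case zero
    have "star (\<lambda>_. 0) = (\<lambda>_. 0 :: ('a, unit) pol)" using star_gens(1)[of 0] by (simp add: Cop_0)
    then show ?case using W.act_zero_op[OF w] z by simp
  next
    case (add s t c g)
    have F: "Fel s t c \<in> carrier II" "g \<in> carrier II" using Fideal_subset[OF Fel_mem] Fideal_subset[OF add(1)] by auto
    show "(\<lambda>p. Fel s t c p + g p) \<odot>\<^bsub>wmodule {} \<rho>\<^esub> w = (\<lambda>_. 0) \<and>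
      star (\<lambda>p. Fel s t c p + g p) \<odot>\<^bsub>wmodule {} \<rho>\<^esub> w = (\<lambda>_. 0)"
      using F w add(2) by (simp add: star_add W.act_add_op Fw p)
  qed
  then show "f \<odot>\<^bsub>wmodule {} \<rho>\<^esub> w = (\<lambda>_. 0)" "star f \<odot>\<^bsub>wmodule {} \<rho>\<^esub> w = (\<lambda>_. 0)" by auto
qed

section \<open>Computing in the quotient algebra \<open>B1\<close>\<close>

lemma ring_B1: "ring B1"
  unfolding B1_def by (rule ideal.quotient_is_ring[OF ideal_Fideal])

lemma carrier_B1: "carrier B1 = toB1 ` carrier II"
  by (auto simp: B1_def FactRing_def A_RCOSETS_def')

lemma toB1_closed [simp, intro]: "a \<in> carrier II \<Longrightarrow> toB1 a \<in> carrier B1"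
  by (auto simp: carrier_B1)

lemma toB1_add: "a \<in> carrier II \<Longrightarrow> b \<in> carrier II \<Longrightarrow> toB1 (\<lambda>p. a p + b p) = toB1 a \<oplus>\<^bsub>B1\<^esub> toB1 b"
  and toB1_mult: "a \<in> carrier II \<Longrightarrow> b \<in> carrier II \<Longrightarrow> toB1 (a \<circ> b) = toB1 a \<otimes>\<^bsub>B1\<^esub> toB1 b"
  and toB1_id: "toB1 id = \<one>\<^bsub>B1\<^esub>"
  using ring_hom_add[OF ideal.rcos_ring_hom[OF ideal_Fideal], of a b]
    ring_hom_mult[OF ideal.rcos_ring_hom[OF ideal_Fideal], of a b]
    ring_hom_one[OF ideal.rcos_ring_hom[OF ideal_Fideal]]
  by (simp_all add: B1_def del: o_apply)

lemma toB1_eqD: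
  assumes "a \<in> carrier II" "b \<in> carrier II" "toB1 a = toB1 b"
  shows "\<exists>f\<in>Fideal. a = (\<lambda>p. f p + b p)"
proof -
  have "a \<in> Fideal +>\<^bsub>II\<^esub> a"
    by (rule abelian_subgroup.a_rcos_self[OF _ assms(1)])
      (intro abelian_subgroupI3 ideal.axioms(1)[OF ideal_Fideal] ring.is_abelian_group ring_II)
  then have "a \<in> Fideal +>\<^bsub>II\<^esub> b" using assms(3) by simp
  then show ?thesis by (auto simp: a_r_coset_def')
qed

lemma toB1_Fideal: "f \<in> Fideal \<Longrightarrow> toB1 f = \<zero>\<^bsub>B1\<^esub>"
proof -
  assume "f \<in> Fideal"
  moreover have "abelian_subgroup Fideal (II :: ('a, unit) op ring)"
    by (intro abelian_subgroupI3 ideal.axioms(1)[OF ideal_Fideal] ring.is_abelian_group ring_II)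
  ultimately show ?thesis by (simp add: B1_def FactRing_def abelian_subgroup.a_rcos_const)
qed

text \<open>The difference \<open>1 - \<integral> \<partial>\<close> is the matrix unit
  \<open>Fel 0 0 1\<close>, an element of \<open>F\<close>. So \<open>\<integral>\<close> becomes a
  two-sided inverse of \<open>\<partial>\<close> in \<open>B1\<close>.\<close>

lemma toB1_JD: "toB1 (Jop ()) \<otimes>\<^bsub>B1\<^esub> toB1 (Dop ()) = \<one>\<^bsub>B1\<^esub>"
proof -
  interpret B: ring B1 by (rule ring_B1)
  have "p = Fel 0 0 1 p + Jop () (Dop () p)" for p :: "('a, unit) pol"
    using matrix_unit[of 1 0 0 p] by (simp add: Cop_1) (metis diff_add_cancel)
  then have eq: "id = (\<lambda>p. Fel 0 0 1 p + (Jop () \<circ> Dop ()) p :: ('a, unit) pol)"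
    by (auto simp: fun_eq_iff)
  have "\<one>\<^bsub>B1\<^esub> = toB1 (id :: ('a, unit) op)" by (rule toB1_id[symmetric])
  also have "\<dots> = toB1 (\<lambda>p. Fel 0 0 1 p + (Jop () \<circ> Dop ()) p)" by (rule arg_cong[OF eq])
  also have "\<dots> = toB1 (Fel 0 0 1) \<oplus>\<^bsub>B1\<^esub> toB1 (Jop () \<circ> Dop () :: ('a, unit) op)"
    by (rule toB1_add[OF Fideal_subset[OF Fel_mem] carrier_II_mult]) simp_all
  finally show ?thesis using toB1_Fideal[OF Fel_mem, of 0 0 "1 :: 'a"]
    by (simp add: toB1_mult del: o_apply)
qed

section \<open>The two quotients of \<open>B1\<close> by the ideals of
  \<open>H - \<mu>\<close>\<close>

lemma (in abelian_group) add_minus_cancel: "x \<in> carrier G \<Longrightarrow> y \<in> carrier G \<Longrightarrow> (x \<oplus> y) \<ominus> y = x"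
  by (simp add: a_minus_def a_assoc r_neg)

text \<open>Cosets and their sums ignore the action, so the involution can be moved inside the
  quotient and \<open>model_quotient\<close> applies.\<close>

lemma star_module_quot: "star_module (quot_module (with_action B f) N) = quot_module (with_action B (\<lambda>a. f (star a))) N"
proof -
  have "set_add (with_action B f) = set_add (with_action B (\<lambda>a. f (star a)))"
    by (intro ext) (simp add: set_add_def' with_action_def)
  then show ?thesis
    unfolding star_module_def quot_module_def by (simp add: with_action_def A_RCOSETS_def' a_r_coset_def')
qed

definition hminus :: "'k \<Rightarrow> ('k::field_char_0, unit) op" where
  "hminus \<mu> = (\<lambda>p. Hop () p - Cop \<mu> p)"

lemma hminus_ev: "hminus \<mu> = ev (Add (GH ()) (Sc (- \<mu>)))"
  by (simp add: hminus_def sub_Cop)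

lemma hminus_II [simp, intro]: "hminus \<mu> \<in> carrier II"
  by (simp only: hminus_ev ev_in_carrier_II)

lemma star_hminus: "star (hminus \<mu>) = hminus \<mu>"
  unfolding hminus_ev star_ev by simp

text \<open>Both one-sided ideals of \<open>H - \<mu>\<close> are proper. The standard module with
  empty \<open>T\<close> has a vector of weight \<open>\<mu>\<close>, killed by \<open>F\<close> and
  by \<open>H - \<mu>\<close>; an equation \<open>1 = f + (H - \<mu>) a\<close> with
  \<open>f\<close> in \<open>F\<close> would kill it too. For the left ideal \<open>star\<close>
  first turns the equation round.\<close>

lemma not_in_ideal:
  assumes a: "a \<in> carrier II"
  shows "toB1 (a \<circ> hminus \<mu>) \<noteq> \<one>\<^bsub>B1\<^esub>" "toB1 (hminus \<mu> \<circ> a) \<noteq> \<one>\<^bsub>B1\<^esub>"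
proof -
  let ?W = "wmodule {} (\<lambda>_. \<mu>)"
  let ?d = "delta (\<lambda>_. \<mu>) :: (unit \<Rightarrow> 'a) \<Rightarrow> 'a"
  interpret W: model ?W "{}" "\<lambda>_. \<mu>" id by (rule model_wmodule)
  have d: "?d \<in> fs (wtset {} (\<lambda>_. \<mu>))" by (intro fs_delta wtset_self) simp
  then have dc: "?d \<in> carrier ?W" by (simp add: wmodule_def)
  have p: "g \<oplus>\<^bsub>?W\<^esub> h = (\<lambda>\<nu>. g \<nu> + h \<nu>)" for g h by (simp add: wmodule_def)
  have z: "\<zero>\<^bsub>?W\<^esub> = (\<lambda>_. 0)" by (simp add: wmodule_def)
  have h: "hminus \<mu> \<odot>\<^bsub>?W\<^esub> ?d = (\<lambda>_. 0)"
    unfolding hminus_ev using wmodule_act[OF d, of "Add (GH ()) (Sc (- \<mu>))"] by (simp add: Hm_delta)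
  have h': "(hminus \<mu> \<circ> b) \<odot>\<^bsub>?W\<^esub> ?d = (\<lambda>_. 0)" if "b \<in> carrier II" for b
    using that dc W.act_zero[OF that] by (simp add: W.act_comp h z del: o_apply)
  have contra: False if "f \<in> carrier II" "f \<odot>\<^bsub>?W\<^esub> ?d = (\<lambda>_. 0)" "b \<in> carrier II"
    "id = (\<lambda>p. f p + (hminus \<mu> \<circ> b) p)" for f b
  proof -
    have "?d = id \<odot>\<^bsub>?W\<^esub> ?d" using W.act_id[OF dc] by simp
    also have "\<dots> = (\<lambda>p. f p + (hminus \<mu> \<circ> b) p) \<odot>\<^bsub>?W\<^esub> ?d" by (rule arg_cong[OF that(4)])
    also have "\<dots> = (\<lambda>_. 0)" using that(1-3) dc by (simp add: W.act_add_op carrier_II_mult h' p del: o_apply)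
    finally have "?d = (\<lambda>_. 0)" .
    from fun_cong[OF this, of "\<lambda>_. \<mu>"] show False by (simp add: delta_def)
  qed
  show "toB1 (hminus \<mu> \<circ> a) \<noteq> \<one>\<^bsub>B1\<^esub>"
  proof
    assume "toB1 (hminus \<mu> \<circ> a) = \<one>\<^bsub>B1\<^esub>"
    then have "toB1 id = toB1 (hminus \<mu> \<circ> a)" by (simp add: toB1_id)
    then obtain f where f: "f \<in> Fideal" "id = (\<lambda>p. f p + (hminus \<mu> \<circ> a) p)"
      using toB1_eqD[OF carrier_II_id carrier_II_mult[OF hminus_II a]] by blast
    show False by (rule contra[OF Fideal_subset[OF f(1)] Fideal_acts_zero(1)[OF f(1) d] a f(2)])
  qed
  show "toB1 (a \<circ> hminus \<mu>) \<noteq> \<one>\<^bsub>B1\<^esub>"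
  proof
    assume "toB1 (a \<circ> hminus \<mu>) = \<one>\<^bsub>B1\<^esub>"
    then have "toB1 id = toB1 (a \<circ> hminus \<mu>)" by (simp add: toB1_id)
    then obtain f where f: "f \<in> Fideal" "id = (\<lambda>p. f p + (a \<circ> hminus \<mu>) p)"
      using toB1_eqD[OF carrier_II_id carrier_II_mult[OF a hminus_II]] by blast
    have fII: "f \<in> carrier II" using f(1) by (rule Fideal_subset)
    have "id = star (\<lambda>p. f p + (a \<circ> hminus \<mu>) p)"
      using arg_cong[OF f(2), of star] by (simp only: star_id)
    also have "\<dots> = (\<lambda>p. star f p + (hminus \<mu> \<circ> star a) p)"
      using fII a by (simp add: star_add star_mult carrier_II_mult star_hminus del: o_apply)
    finally show False
      by (rule contra[OF star_closed[OF fII] Fideal_acts_zero(2)[OF f(1) d] star_closed[OF a]])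
  qed
qed

text \<open>The common part of both quotients. The map \<open>s\<close> records which class the unit
  is sent to: it is the identity for the quotient by the right ideal and \<open>star\<close> for the
  module obtained from a left one.\<close>

lemma B1_quotient_model:
  fixes \<mu> :: "'k::field_char_0" and act :: "('k, unit) op \<Rightarrow> ('k, unit) op set \<Rightarrow> ('k, unit) op set"
  defines "X \<equiv> with_action B1 act"
  assumes rm: "right_module II X" and sub: "submodule N II X"
    and one: "\<And>a. a \<in> carrier II \<Longrightarrow> act a \<one>\<^bsub>B1\<^esub> = toB1 (s a)"
    and s: "\<And>a. a \<in> carrier II \<Longrightarrow> s a \<in> carrier II" "\<And>a. a \<in> carrier II \<Longrightarrow> s (s a) = a"
      "s (Hop ()) = Hop ()" "s (Cop \<mu>) = Cop \<mu>"
    and DJ: "\<And>w. w \<in> carrier B1 \<Longrightarrow> act (Dop ()) (act (Jop ()) w) = w"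
    and h: "toB1 (hminus \<mu>) \<in> N" and N: "\<one>\<^bsub>B1\<^esub> \<notin> N"
  shows "\<exists>\<phi>. model (quot_module X N) {} (\<lambda>_. \<mu>) \<phi>"
proof -
  interpret B: ring "B1 :: ('k, unit) op set ring" by (rule ring_B1)
  have X [simp]: "carrier X = carrier B1" "u \<oplus>\<^bsub>X\<^esub> v = u \<oplus>\<^bsub>B1\<^esub> v" "\<zero>\<^bsub>X\<^esub> = \<zero>\<^bsub>B1\<^esub>"
    "a \<odot>\<^bsub>X\<^esub> v = act a v" for u v a by (simp_all add: X_def with_action_def)
  interpret X: II_module X by (rule II_module.intro) (rule rm)
  show ?thesis
  proof (rule model_quotient[OF rm sub])
    show "\<one>\<^bsub>B1\<^esub> \<in> carrier X" by simp
    show "carrier X \<subseteq> {a \<odot>\<^bsub>X\<^esub> \<one>\<^bsub>B1\<^esub> | a. a \<in> carrier II}"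
    proof
      fix x assume "x \<in> carrier X"
      then obtain a where "a \<in> carrier II" "x = toB1 a" by (auto simp: carrier_B1)
      then show "x \<in> {a \<odot>\<^bsub>X\<^esub> \<one>\<^bsub>B1\<^esub> | a. a \<in> carrier II}"
        by (intro CollectI exI[of _ "s a"]) (simp add: one s)
    qed
    show "Hop i \<odot>\<^bsub>X\<^esub> \<one>\<^bsub>B1\<^esub> \<ominus>\<^bsub>X\<^esub> Cop \<mu> \<odot>\<^bsub>X\<^esub> \<one>\<^bsub>B1\<^esub> \<in> N" for i
    proof -
      have "Hop i = (\<lambda>p. hminus \<mu> p + Cop \<mu> p)" by (cases i) (simp add: hminus_def)
      then have "toB1 (Hop i) = toB1 (hminus \<mu>) \<oplus>\<^bsub>B1\<^esub> toB1 (Cop \<mu>)"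
        using toB1_add[OF hminus_II in_carrier_II(1), of \<mu> \<mu>] by simp
      then have "Hop i \<odot>\<^bsub>X\<^esub> \<one>\<^bsub>B1\<^esub> \<ominus>\<^bsub>X\<^esub> Cop \<mu> \<odot>\<^bsub>X\<^esub> \<one>\<^bsub>B1\<^esub>
          = (toB1 (hminus \<mu>) \<oplus>\<^bsub>X\<^esub> toB1 (Cop \<mu>)) \<ominus>\<^bsub>X\<^esub> toB1 (Cop \<mu>)"
        by (cases i) (simp add: one s)
      also have "\<dots> = toB1 (hminus \<mu>)" by (rule X.add_minus_cancel) simp_all
      finally show ?thesis using h by simp
    qed
    show "Dop i \<odot>\<^bsub>X\<^esub> (Jop i \<odot>\<^bsub>X\<^esub> w) \<ominus>\<^bsub>X\<^esub> w \<in> N" if w: "w \<in> carrier X" for i w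
      using w X.minus_eq_zero_iff[of w w] X.submoduleD(2)[OF sub] by (cases i) (simp add: DJ)
  qed (simp_all add: N)
qed

lemma M1_model:
  fixes \<mu> :: "'k::field_char_0"
  shows "\<exists>\<phi>. model (star_module (M1 \<mu>)) {} (\<lambda>_. \<mu>) \<phi>"
proof -
  interpret B: ring "B1 :: ('k, unit) op set ring" by (rule ring_B1)
  let ?X = "with_action B1 (\<lambda>a b. toB1 (star a) \<otimes>\<^bsub>B1\<^esub> b) :: (('k, unit) op, ('k, unit) op set) module"
  let ?N = "{b \<otimes>\<^bsub>B1\<^esub> toB1 (hminus \<mu>) | b. b \<in> carrier B1}"
  have X [simp]: "carrier ?X = carrier B1" "u \<oplus>\<^bsub>?X\<^esub> v = u \<oplus>\<^bsub>B1\<^esub> v" "\<zero>\<^bsub>?X\<^esub> = \<zero>\<^bsub>B1\<^esub>"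
    "a \<odot>\<^bsub>?X\<^esub> v = toB1 (star a) \<otimes>\<^bsub>B1\<^esub> v" for u v a by (simp_all add: with_action_def)
  have rm: "right_module II ?X"
  proof (rule right_moduleI[OF ring_II abelian_group_with_action[OF B.is_abelian_group]], unfold X)
    fix a b :: "('k, unit) op" and v assume ab: "a \<in> carrier II" "b \<in> carrier II" and v: "(v :: ('k, unit) op set) \<in> carrier B1"
    show "toB1 (star (a \<oplus>\<^bsub>II\<^esub> b)) \<otimes>\<^bsub>B1\<^esub> v = toB1 (star a) \<otimes>\<^bsub>B1\<^esub> v \<oplus>\<^bsub>B1\<^esub> toB1 (star b) \<otimes>\<^bsub>B1\<^esub> v"
      using ab v by (simp add: star_add toB1_add B.l_distr)
    show "toB1 (star (a \<otimes>\<^bsub>II\<^esub> b)) \<otimes>\<^bsub>B1\<^esub> v = toB1 (star b) \<otimes>\<^bsub>B1\<^esub> (toB1 (star a) \<otimes>\<^bsub>B1\<^esub> v)"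
      using ab v by (simp add: star_mult toB1_mult B.m_assoc del: o_apply)
  qed (auto simp: toB1_id B.r_distr)
  interpret X: II_module ?X by (rule II_module.intro) (rule rm)
  have hB: "toB1 (hminus \<mu>) \<in> carrier B1" by simp
  have mem: "b \<otimes>\<^bsub>B1\<^esub> toB1 (hminus \<mu>) \<in> ?N" if "b \<in> carrier B1" for b using that by blast
  have sub: "submodule ?N II ?X"
  proof (rule X.submoduleI_gens)
    show "?N \<subseteq> carrier ?X" using hB by auto
    show "\<zero>\<^bsub>?X\<^esub> \<in> ?N" using mem[of "\<zero>\<^bsub>B1\<^esub>"] hB by simp
    show "u \<oplus>\<^bsub>?X\<^esub> v \<in> ?N" if uv: "u \<in> ?N" "v \<in> ?N" for u v
    proof -
      obtain b b' where b: "b \<in> carrier B1" "b' \<in> carrier B1" "u = b \<otimes>\<^bsub>B1\<^esub> toB1 (hminus \<mu>)" "v = b' \<otimes>\<^bsub>B1\<^esub> toB1 (hminus \<mu>)"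
        using uv by auto
      then show ?thesis using mem[of "b \<oplus>\<^bsub>B1\<^esub> b'"] hB by (simp add: B.l_distr)
    qed
    have act: "a \<odot>\<^bsub>?X\<^esub> v \<in> ?N" if a: "a \<in> carrier II" and v: "v \<in> ?N" for a v
    proof -
      obtain b where b: "b \<in> carrier B1" "v = b \<otimes>\<^bsub>B1\<^esub> toB1 (hminus \<mu>)" using v by auto
      then show ?thesis using mem[of "toB1 (star a) \<otimes>\<^bsub>B1\<^esub> b"] a hB by (simp add: B.m_assoc)
    qed
    show "Cop c \<odot>\<^bsub>?X\<^esub> v \<in> ?N" "Dop i \<odot>\<^bsub>?X\<^esub> v \<in> ?N" "Jop i \<odot>\<^bsub>?X\<^esub> v \<in> ?N" "Hop i \<odot>\<^bsub>?X\<^esub> v \<in> ?N"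
      if "v \<in> ?N" for c i v using that by (intro act in_carrier_II; assumption)+
  qed
  have "\<exists>\<phi>. model (quot_module ?X ?N) {} (\<lambda>_. \<mu>) \<phi>"
  proof (rule B1_quotient_model[OF rm sub, of star])
    show "toB1 (hminus \<mu>) \<in> ?N" using mem[of "\<one>\<^bsub>B1\<^esub>"] by simp
    show "\<one>\<^bsub>B1\<^esub> \<notin> ?N"
    proof
      assume "\<one>\<^bsub>B1\<^esub> \<in> ?N"
      then obtain a where "a \<in> carrier II" "\<one>\<^bsub>B1\<^esub> = toB1 a \<otimes>\<^bsub>B1\<^esub> toB1 (hminus \<mu>)" by (auto simp: carrier_B1)
      then show False using not_in_ideal(1)[of a \<mu>] by (simp add: toB1_mult del: o_apply)
    qed
  qed (simp_all add: toB1_JD flip: B.m_assoc)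
  then show ?thesis unfolding M1_def star_module_quot by (simp only: hminus_def)
qed

lemma B1_mod_right_model:
  fixes \<mu> :: "'k::field_char_0"
  shows "\<exists>\<phi>. model (B1_mod_right \<mu>) {} (\<lambda>_. \<mu>) \<phi>"
proof -
  interpret B: ring "B1 :: ('k, unit) op set ring" by (rule ring_B1)
  let ?X = "with_action B1 (\<lambda>a b. b \<otimes>\<^bsub>B1\<^esub> toB1 a) :: (('k, unit) op, ('k, unit) op set) module"
  let ?N = "{toB1 (hminus \<mu>) \<otimes>\<^bsub>B1\<^esub> b | b. b \<in> carrier B1}"
  have X [simp]: "carrier ?X = carrier B1" "u \<oplus>\<^bsub>?X\<^esub> v = u \<oplus>\<^bsub>B1\<^esub> v" "\<zero>\<^bsub>?X\<^esub> = \<zero>\<^bsub>B1\<^esub>"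
    "a \<odot>\<^bsub>?X\<^esub> v = v \<otimes>\<^bsub>B1\<^esub> toB1 a" for u v a by (simp_all add: with_action_def)
  have rm: "right_module II ?X"
  proof (rule right_moduleI[OF ring_II abelian_group_with_action[OF B.is_abelian_group]], unfold X)
    fix a b :: "('k, unit) op" and v assume ab: "a \<in> carrier II" "b \<in> carrier II" and v: "(v :: ('k, unit) op set) \<in> carrier B1"
    show "v \<otimes>\<^bsub>B1\<^esub> toB1 (a \<oplus>\<^bsub>II\<^esub> b) = v \<otimes>\<^bsub>B1\<^esub> toB1 a \<oplus>\<^bsub>B1\<^esub> v \<otimes>\<^bsub>B1\<^esub> toB1 b"
      using ab v by (simp add: toB1_add B.r_distr)
    show "v \<otimes>\<^bsub>B1\<^esub> toB1 (a \<otimes>\<^bsub>II\<^esub> b) = v \<otimes>\<^bsub>B1\<^esub> toB1 a \<otimes>\<^bsub>B1\<^esub> toB1 b"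
      using ab v by (simp add: toB1_mult B.m_assoc del: o_apply)
  qed (auto simp: toB1_id B.l_distr)
  interpret X: II_module ?X by (rule II_module.intro) (rule rm)
  have hB: "toB1 (hminus \<mu>) \<in> carrier B1" by simp
  have mem: "toB1 (hminus \<mu>) \<otimes>\<^bsub>B1\<^esub> b \<in> ?N" if "b \<in> carrier B1" for b using that by blast
  have sub: "submodule ?N II ?X"
  proof (rule X.submoduleI_gens)
    show "?N \<subseteq> carrier ?X" using hB by auto
    show "\<zero>\<^bsub>?X\<^esub> \<in> ?N" using mem[of "\<zero>\<^bsub>B1\<^esub>"] hB by simp
    show "u \<oplus>\<^bsub>?X\<^esub> v \<in> ?N" if uv: "u \<in> ?N" "v \<in> ?N" for u v
    proof -
      obtain b b' where b: "b \<in> carrier B1" "b' \<in> carrier B1" "u = toB1 (hminus \<mu>) \<otimes>\<^bsub>B1\<^esub> b" "v = toB1 (hminus \<mu>) \<otimes>\<^bsub>B1\<^esub> b'"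
        using uv by auto
      then show ?thesis using mem[of "b \<oplus>\<^bsub>B1\<^esub> b'"] hB by (simp add: B.r_distr)
    qed
    have act: "a \<odot>\<^bsub>?X\<^esub> v \<in> ?N" if a: "a \<in> carrier II" and v: "v \<in> ?N" for a v
    proof -
      obtain b where b: "b \<in> carrier B1" "v = toB1 (hminus \<mu>) \<otimes>\<^bsub>B1\<^esub> b" using v by auto
      then show ?thesis using mem[of "b \<otimes>\<^bsub>B1\<^esub> toB1 a"] a hB by (simp add: B.m_assoc)
    qed
    show "Cop c \<odot>\<^bsub>?X\<^esub> v \<in> ?N" "Dop i \<odot>\<^bsub>?X\<^esub> v \<in> ?N" "Jop i \<odot>\<^bsub>?X\<^esub> v \<in> ?N" "Hop i \<odot>\<^bsub>?X\<^esub> v \<in> ?N"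
      if "v \<in> ?N" for c i v using that by (intro act in_carrier_II; assumption)+
  qed
  have "\<exists>\<phi>. model (quot_module ?X ?N) {} (\<lambda>_. \<mu>) \<phi>"
  proof (rule B1_quotient_model[OF rm sub, of "\<lambda>a. a"])
    show "toB1 (hminus \<mu>) \<in> ?N" using mem[of "\<one>\<^bsub>B1\<^esub>"] by simp
    show "\<one>\<^bsub>B1\<^esub> \<notin> ?N"
    proof
      assume "\<one>\<^bsub>B1\<^esub> \<in> ?N"
      then obtain a where "a \<in> carrier II" "\<one>\<^bsub>B1\<^esub> = toB1 (hminus \<mu>) \<otimes>\<^bsub>B1\<^esub> toB1 a" by (auto simp: carrier_B1)
      then show False using not_in_ideal(2)[of a \<mu>] by (simp add: toB1_mult del: o_apply)
    qed
  qed (simp_all add: toB1_JD B.m_assoc)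
  then show ?thesis unfolding B1_mod_right_def by (simp only: hminus_def)
qed

section \<open>Tensor products\<close>

lemma lookup_pm_scale [simp]: "lk (pm_scale c P) f = c * lk P f"
  by (simp add: pm_scale_def map.rep_eq when_def)

lemma pm_module: "Modules.module (pm_scale :: 'k::field_char_0 \<Rightarrow> ('f \<Rightarrow>\<^sub>0 'k) \<Rightarrow> _)"
  by (rule Modules.module.intro; intro poly_mapping_eqI; simp add: lookup_add algebra_simps)

locale tensor_setup =
  fixes Mi :: "'n::finite \<Rightarrow> (('k::field_char_0, unit) op, 'w) module"
    and Ti :: "'n \<Rightarrow> unit set" and Ri :: "'n \<Rightarrow> unit \<Rightarrow> 'k" and \<phi> :: "'n \<Rightarrow> ((unit \<Rightarrow> 'k) \<Rightarrow> 'k) \<Rightarrow> 'w"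
  assumes Mi: "\<And>i. model (Mi i) (Ti i) (Ri i) (\<phi> i)"
begin

sublocale Mi: model "Mi i" "Ti i" "Ri i" "\<phi> i" for i
  by (rule Mi)

sublocale pm: Modules.module "pm_scale :: 'k \<Rightarrow> (('n \<Rightarrow> 'w) \<Rightarrow>\<^sub>0 'k) \<Rightarrow> _"
  by (rule pm_module)

text \<open>A factor has a single direction, so each \<open>Ti i\<close> is empty or everything;
  this records for which factors it is everything.\<close>

definition TT :: "'n set" where "TT = {i. () \<in> Ti i}"
definition RR :: "'n \<Rightarrow> 'k" where "RR i = Ri i ()"

lemma wtset_TT: "\<mu> \<in> wtset TT RR \<longleftrightarrow> (\<forall>i. (\<lambda>_. \<mu> i) \<in> wtset (Ti i) (Ri i))"
  by (auto simp: wtset_def TT_def RR_def)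

section \<open>Coordinates in the factors, as functions on \<open>K\<close>, and their
  products\<close>

definition cf :: "'n \<Rightarrow> 'w \<Rightarrow> 'k \<Rightarrow> 'k" where
  "cf i u x = inv_into (fs (wtset (Ti i) (Ri i))) (\<phi> i) u (\<lambda>_. x)"

lemma cf_\<phi>: "f \<in> fs (wtset (Ti i) (Ri i)) \<Longrightarrow> cf i (\<phi> i f) x = f (\<lambda>_. x)"
  using Mi.bij[of i] by (simp add: cf_def bij_betw_def)

lemma cf_add: "u \<in> carrier (Mi i) \<Longrightarrow> v \<in> carrier (Mi i) \<Longrightarrow> cf i (u \<oplus>\<^bsub>Mi i\<^esub> v) x = cf i u x + cf i v x"
  using Mi.\<phi>_surj[of u i] Mi.\<phi>_surj[of v i] by (auto simp: cf_\<phi> fs_add simp flip: Mi.hom_add)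

lemma cf_Cop: "u \<in> carrier (Mi i) \<Longrightarrow> cf i (Cop c \<odot>\<^bsub>Mi i\<^esub> u) x = c * cf i u x"
  using Mi.\<phi>_surj[of u i] by (auto simp: cf_\<phi> fs_scale simp flip: Mi.hom_Cop)

lemma cf_Dop: "u \<in> carrier (Mi i) \<Longrightarrow> cf i (Dop () \<odot>\<^bsub>Mi i\<^esub> u) x = cf i u (x - 1)"
  using Mi.\<phi>_surj[of u i] by (auto simp: cf_\<phi> Mi.fs_ops simp flip: Mi.hom_Dop) (simp add: Dm_def fun_upd_def)

lemma cf_Jop: "u \<in> carrier (Mi i) \<Longrightarrow>
    cf i (Jop () \<odot>\<^bsub>Mi i\<^esub> u) x = (if i \<in> TT \<and> x = 0 then 0 else cf i u (x + 1))"
  using Mi.\<phi>_surj[of u i] by (auto simp: cf_\<phi> Mi.fs_ops TT_def simp flip: Mi.hom_Jop) (simp_all add: Jm_def fun_upd_def)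

lemma cf_Hop: "u \<in> carrier (Mi i) \<Longrightarrow> cf i (Hop () \<odot>\<^bsub>Mi i\<^esub> u) x = x * cf i u x"
  using Mi.\<phi>_surj[of u i] by (auto simp: cf_\<phi> Mi.fs_ops simp flip: Mi.hom_Hop) (simp add: Hm_def)

lemma Xop_act: "u \<in> carrier (Mi i) \<Longrightarrow> Xop () \<odot>\<^bsub>Mi i\<^esub> u = Hop () \<odot>\<^bsub>Mi i\<^esub> (Jop () \<odot>\<^bsub>Mi i\<^esub> u)"
  unfolding Xop_eq by (rule Mi.act_comp) simp_all

lemma Hop_act: "u \<in> carrier (Mi i) \<Longrightarrow> Hop () \<odot>\<^bsub>Mi i\<^esub> u = Xop () \<odot>\<^bsub>Mi i\<^esub> (Dop () \<odot>\<^bsub>Mi i\<^esub> u)"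
  unfolding Hop_def by (rule Mi.act_comp) simp_all

lemma cf_finite: "u \<in> carrier (Mi i) \<Longrightarrow> finite {x. cf i u x \<noteq> 0}"
proof -
  assume "u \<in> carrier (Mi i)"
  then obtain f where f: "f \<in> fs (wtset (Ti i) (Ri i))" "u = \<phi> i f" using Mi.\<phi>_surj by blast
  have "inj (\<lambda>x::'k. (\<lambda>_::unit. x))" by (rule injI) (simp add: fun_eq_iff)
  from finite_vimageI[OF fs_finite[OF f(1)] this] show ?thesis using f by (simp add: cf_\<phi> vimage_def)
qed

lemma cf_supp: "u \<in> carrier (Mi i) \<Longrightarrow> cf i u x \<noteq> 0 \<Longrightarrow> (\<lambda>_. x) \<in> wtset (Ti i) (Ri i)"
  using Mi.\<phi>_surj[of u i] fs_in by (fastforce simp: cf_\<phi>)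

text \<open>The coordinates a pure tensor has to have, with respect to the tensors of basis
  vectors.\<close>

definition prodf :: "('n \<Rightarrow> 'w) \<Rightarrow> ('n \<Rightarrow> 'k) \<Rightarrow> 'k" where
  "prodf f \<mu> = (\<Prod>i\<in>UNIV. cf i (f i) (\<mu> i))"

lemma tfamiliesD: "f \<in> tfamilies Mi \<Longrightarrow> f i \<in> carrier (Mi i)"
  by (simp add: tfamilies_def)

lemma tfamilies_upd [simp, intro]: "f \<in> tfamilies Mi \<Longrightarrow> u \<in> carrier (Mi i) \<Longrightarrow> f(i := u) \<in> tfamilies Mi"
  by (simp add: tfamilies_def)

lemma prodf_fs: "f \<in> tfamilies Mi \<Longrightarrow> prodf f \<in> fs (wtset TT RR)"
proof (rule fsI)
  assume f: "f \<in> tfamilies Mi"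
  have "{\<mu>. prodf f \<mu> \<noteq> 0} \<subseteq> PiE UNIV (\<lambda>i. {x. cf i (f i) x \<noteq> 0})"
    by (auto simp: prodf_def PiE_def Pi_def)
  then show "finite {\<mu>. prodf f \<mu> \<noteq> 0}"
    by (rule finite_subset) (intro finite_PiE finite_UNIV cf_finite tfamiliesD[OF f])
  fix \<mu> assume "prodf f \<mu> \<noteq> 0"
  then show "\<mu> \<in> wtset TT RR"
    using cf_supp[OF tfamiliesD[OF f]] by (auto simp: prodf_def wtset_TT)
qed

definition rest :: "'n \<Rightarrow> ('n \<Rightarrow> 'w) \<Rightarrow> ('n \<Rightarrow> 'k) \<Rightarrow> 'k" where
  "rest i f \<mu> = (\<Prod>j\<in>UNIV - {i}. cf j (f j) (\<mu> j))"

lemma rest_upd [simp]: "rest i (f(i := u)) \<mu> = rest i f \<mu>" "rest i f (\<mu>(i := x)) = rest i f \<mu>"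
  unfolding rest_def by (intro prod.cong; auto)+

lemma prodf_rest: "prodf f \<mu> = cf i (f i) (\<mu> i) * rest i f \<mu>"
  unfolding prodf_def rest_def by (rule prod.remove) auto

lemma prodf_add: "u \<in> carrier (Mi i) \<Longrightarrow> v \<in> carrier (Mi i) \<Longrightarrow>
    prodf (f(i := u \<oplus>\<^bsub>Mi i\<^esub> v)) \<mu> = prodf (f(i := u)) \<mu> + prodf (f(i := v)) \<mu>"
  and prodf_Cop: "u \<in> carrier (Mi i) \<Longrightarrow> prodf (f(i := Cop c \<odot>\<^bsub>Mi i\<^esub> u)) \<mu> = c * prodf (f(i := u)) \<mu>"
  by (simp_all add: prodf_rest[of _ _ i] cf_add cf_Cop distrib_right)

lemma prodf_ops:
  assumes "f \<in> tfamilies Mi"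
  shows "prodf (f(i := Dop () \<odot>\<^bsub>Mi i\<^esub> f i)) = Dm i (prodf f)"
    "prodf (f(i := Jop () \<odot>\<^bsub>Mi i\<^esub> f i)) = Jm TT i (prodf f)"
    "prodf (f(i := Hop () \<odot>\<^bsub>Mi i\<^esub> f i)) = Hm i (prodf f)"
    "prodf (f(i := Xop () \<odot>\<^bsub>Mi i\<^esub> f i)) = Hm i (Jm TT i (prodf f))"
  using tfamiliesD[OF assms, of i]
  by (intro ext; simp add: prodf_rest[of _ _ i] Dm_def Jm_def Hm_def Xop_act cf_Dop cf_Jop cf_Hop)+

definition lin :: "(('n \<Rightarrow> 'w) \<Rightarrow>\<^sub>0 'k) \<Rightarrow> ('n \<Rightarrow> 'k) \<Rightarrow> 'k" where
  "lin P \<mu> = (\<Sum>f\<in>Poly_Mapping.keys P. lk P f * prodf f \<mu>)"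

lemma lin_add: "lin (P + Q) \<mu> = lin P \<mu> + lin Q \<mu>"
  unfolding lin_def by (rule setsum_keys_plus_distrib) (simp_all add: distrib_right)

lemma lin_single: "lin (sgl f c) \<mu> = c * prodf f \<mu>"
  by (simp add: lin_def)

lemma lin_scale: "lin (pm_scale c P) \<mu> = c * lin P \<mu>"
proof -
  have "lin (pm_scale c P) \<mu> = (\<Sum>f\<in>Poly_Mapping.keys P. lk (pm_scale c P) f * prodf f \<mu>)"
    unfolding lin_def by (rule sum.mono_neutral_left) (auto simp: in_keys_iff)
  then show ?thesis by (simp add: lin_def sum_distrib_left mult.assoc)
qed

lemma lin_zero: "lin 0 \<mu> = 0"
  by (simp add: lin_def)

lemma lin_diff: "lin (P - Q) \<mu> = lin P \<mu> - lin Q \<mu>"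
  using lin_add[of "P - Q" Q \<mu>] by simp

lemma lin_sum: "lin (sum g A) \<mu> = (\<Sum>x\<in>A. lin (g x) \<mu>)"
  by (induction A rule: infinite_finite_induct) (simp_all add: lin_zero lin_add)

abbreviation "TF \<equiv> {P :: ('n \<Rightarrow> 'w) \<Rightarrow>\<^sub>0 'k. Poly_Mapping.keys P \<subseteq> tfamilies Mi}"

lemma subspace_TF: "pm.subspace TF"
proof (rule pm.subspaceI)
  fix P Q and c :: 'k assume P: "P \<in> TF"
  show "P + Q \<in> TF" if "Q \<in> TF" using P that keys_add[of P Q] by auto
  show "pm_scale c P \<in> TF" using P by (auto simp: in_keys_iff subset_iff)
qed simp

lemma basis_TF [simp]: "f \<in> tfamilies Mi \<Longrightarrow> basis_vec f \<in> TF"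
  by simp

lemma lin_fs: "P \<in> TF \<Longrightarrow> lin P \<in> fs (wtset TT RR)"
proof -
  assume "P \<in> TF"
  then have P: "\<And>f. f \<in> Poly_Mapping.keys P \<Longrightarrow> prodf f \<in> fs (wtset TT RR)" using prodf_fs by auto
  have "(\<lambda>\<mu>. \<Sum>f\<in>A. lk P f * prodf f \<mu>) \<in> fs (wtset TT RR)"
    if "finite A" "A \<subseteq> Poly_Mapping.keys P" for A
    using that by induction (auto intro!: fs_add fs_scale P)
  from this[of "Poly_Mapping.keys P"] show ?thesis by (simp add: lin_def[abs_def])
qed

section \<open>The multilinearity relations are the kernel of \<open>lin\<close>\<close>

lemma trels_add: "f \<in> tfamilies Mi \<Longrightarrow> u \<in> carrier (Mi i) \<Longrightarrow> v \<in> carrier (Mi i) \<Longrightarrow>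
    basis_vec (f(i := u \<oplus>\<^bsub>Mi i\<^esub> v)) - basis_vec (f(i := u)) - basis_vec (f(i := v)) \<in> trels Mi"
  and trels_Cop: "f \<in> tfamilies Mi \<Longrightarrow> u \<in> carrier (Mi i) \<Longrightarrow>
    basis_vec (f(i := Cop c \<odot>\<^bsub>Mi i\<^esub> u)) - pm_scale c (basis_vec (f(i := u))) \<in> trels Mi"
  unfolding trels_def by (intro pm.span_base; blast)+

lemma subspace_trels: "pm.subspace (trels Mi)"
  unfolding trels_def by (rule pm.subspace_span)

lemma trels_minimal:
  assumes "pm.subspace W"
    and "\<And>f i u v. f \<in> tfamilies Mi \<Longrightarrow> u \<in> carrier (Mi i) \<Longrightarrow> v \<in> carrier (Mi i) \<Longrightarrow>
      basis_vec (f(i := u \<oplus>\<^bsub>Mi i\<^esub> v)) - basis_vec (f(i := u)) - basis_vec (f(i := v)) \<in> W"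
    and "\<And>f i c u. f \<in> tfamilies Mi \<Longrightarrow> u \<in> carrier (Mi i) \<Longrightarrow>
      basis_vec (f(i := Cop c \<odot>\<^bsub>Mi i\<^esub> u)) - pm_scale c (basis_vec (f(i := u))) \<in> W"
  shows "trels Mi \<subseteq> W"
  unfolding trels_def by (rule pm.span_minimal[OF _ assms(1)]) (use assms(2,3) in blast)

lemma trels_TF: "trels Mi \<subseteq> TF"
  by (rule trels_minimal[OF subspace_TF])
    (intro pm.subspace_diff[OF subspace_TF] pm.subspace_scale[OF subspace_TF] basis_TF tfamilies_upd; simp)+

lemma lin_trels: "P \<in> trels Mi \<Longrightarrow> lin P = (\<lambda>_. 0)"
proof -
  assume P: "P \<in> trels Mi"
  have "trels Mi \<subseteq> {P. lin P = (\<lambda>_. 0)}"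
  proof (rule trels_minimal)
    show "pm.subspace {P. lin P = (\<lambda>_. 0)}"
      by (rule pm.subspaceI) (simp_all add: fun_eq_iff lin_zero lin_add lin_scale)
  qed (simp_all add: fun_eq_iff lin_diff lin_single lin_scale prodf_add prodf_Cop)
  then show ?thesis using P by blast
qed

definition bb :: "('n \<Rightarrow> 'k) \<Rightarrow> 'n \<Rightarrow> 'w" where
  "bb \<mu> i = \<phi> i (delta (\<lambda>_. \<mu> i))"

lemma bb_tfamilies: "\<mu> \<in> wtset TT RR \<Longrightarrow> bb \<mu> \<in> tfamilies Mi"
  by (simp add: tfamilies_def bb_def wtset_TT)

lemma prodf_bb: "\<mu> \<in> wtset TT RR \<Longrightarrow> prodf (bb \<mu>) = delta \<mu>"
proof
  fix \<nu> assume "\<mu> \<in> wtset TT RR"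
  then have "cf i (bb \<mu> i) (\<nu> i) = (if \<nu> i = \<mu> i then 1 else 0)" for i
    by (simp add: bb_def cf_\<phi> wtset_TT) (simp add: delta_def fun_eq_iff)
  then show "prodf (bb \<mu>) \<nu> = delta \<mu> \<nu>" by (auto simp: prodf_def delta_def fun_eq_iff)
qed

text \<open>A section of \<open>lin\<close>, with values in the combinations of tensors of basis
  vectors.\<close>

definition unlin :: "(('n \<Rightarrow> 'k) \<Rightarrow> 'k) \<Rightarrow> ('n \<Rightarrow> 'w) \<Rightarrow>\<^sub>0 'k" where
  "unlin h = (\<Sum>\<mu> | h \<mu> \<noteq> 0. sgl (bb \<mu>) (h \<mu>))"

lemma unlin_superset: "finite A \<Longrightarrow> {\<mu>. h \<mu> \<noteq> 0} \<subseteq> A \<Longrightarrow> unlin h = (\<Sum>\<mu>\<in>A. sgl (bb \<mu>) (h \<mu>))"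
  unfolding unlin_def by (rule sum.mono_neutral_left) auto

lemma unlin_add:
  assumes "h \<in> fs S" "k \<in> fs S"
  shows "unlin (\<lambda>\<mu>. h \<mu> + k \<mu>) = unlin h + unlin k"
proof -
  let ?A = "{\<mu>. h \<mu> \<noteq> 0} \<union> {\<mu>. k \<mu> \<noteq> 0}"
  have "finite ?A" using assms by (simp add: fs_finite)
  then show ?thesis
    by (subst (1 2 3) unlin_superset[of ?A]) (auto simp: sum.distrib single_add)
qed

lemma unlin_scale:
  assumes "h \<in> fs S"
  shows "unlin (\<lambda>\<mu>. c * h \<mu>) = pm_scale c (unlin h)"
proof -
  have "unlin (\<lambda>\<mu>. c * h \<mu>) = (\<Sum>\<mu> | h \<mu> \<noteq> 0. sgl (bb \<mu>) (c * h \<mu>))"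
    using fs_finite[OF assms] by (intro unlin_superset) auto
  also have "\<dots> = (\<Sum>\<mu> | h \<mu> \<noteq> 0. pm_scale c (sgl (bb \<mu>) (h \<mu>)))"
    by (intro sum.cong refl poly_mapping_eqI) (simp add: lookup_single when_def)
  also have "\<dots> = pm_scale c (unlin h)" by (simp add: unlin_def pm.scale_sum_right)
  finally show ?thesis .
qed

lemma unlin_TF: "h \<in> fs (wtset TT RR) \<Longrightarrow> unlin h \<in> TF"
  unfolding unlin_def by (rule pm.subspace_sum[OF subspace_TF]) (auto dest: bb_tfamilies fs_in)

lemma lin_unlin: "h \<in> fs (wtset TT RR) \<Longrightarrow> lin (unlin h) = h"
proof
  fix \<nu> assume h: "h \<in> fs (wtset TT RR)"
  have "lin (unlin h) \<nu> = (\<Sum>\<mu> | h \<mu> \<noteq> 0. h \<mu> * delta \<mu> \<nu>)"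
    unfolding unlin_def lin_sum lin_single by (rule sum.cong) (use fs_in[OF h] prodf_bb in auto)
  also have "\<dots> = h \<nu>"
    using fs_finite[OF h] by (simp add: delta_def if_distrib cong: if_cong)
  finally show "lin (unlin h) \<nu> = h \<nu>" .
qed

text \<open>Multilinear expansion, one slot at a time: the induction runs over a finite set of slots
  that may hold arbitrary vectors while all other slots already hold basis vectors.\<close>

lemma reduce_basis:
  assumes "f \<in> tfamilies Mi"
  shows "\<exists>h\<in>fs (wtset TT RR). basis_vec f - unlin h \<in> trels Mi"
proof -
  let ?C = "{P. \<exists>h\<in>fs (wtset TT RR). P - unlin h \<in> trels Mi}"
  have C_trels: "P \<in> ?C" if "P \<in> trels Mi" for P
    using that by (auto intro!: bexI[of _ "\<lambda>_. 0"] simp: unlin_def)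
  have C_add: "P + Q \<in> ?C" if PQ: "P \<in> ?C" "Q \<in> ?C" for P Q
  proof -
    obtain h k where h: "h \<in> fs (wtset TT RR)" "P - unlin h \<in> trels Mi"
      and k: "k \<in> fs (wtset TT RR)" "Q - unlin k \<in> trels Mi" using PQ by auto
    have "P + Q - unlin (\<lambda>\<mu>. h \<mu> + k \<mu>) = (P - unlin h) + (Q - unlin k)"
      using unlin_add[OF h(1) k(1)] by simp
    then have "P + Q - unlin (\<lambda>\<mu>. h \<mu> + k \<mu>) \<in> trels Mi"
      using pm.subspace_add[OF subspace_trels h(2) k(2)] by (simp only:)
    then show ?thesis using fs_add[OF h(1) k(1)] by blast
  qed
  have C_scale: "pm_scale c P \<in> ?C" if P: "P \<in> ?C" for c P
  proof -
    obtain h where h: "h \<in> fs (wtset TT RR)" "P - unlin h \<in> trels Mi" using P by auto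
    have "pm_scale c P - unlin (\<lambda>\<mu>. c * h \<mu>) = pm_scale c (P - unlin h)"
      using unlin_scale[OF h(1)] by (simp add: pm.scale_right_diff_distrib)
    then have "pm_scale c P - unlin (\<lambda>\<mu>. c * h \<mu>) \<in> trels Mi"
      using pm.subspace_scale[OF subspace_trels h(2)] by (simp only:)
    then show ?thesis using fs_scale[OF h(1), of "\<lambda>_. c"] by blast
  qed
  have "\<forall>f\<in>tfamilies Mi. (\<forall>i. i \<notin> A \<longrightarrow> (\<exists>\<nu>\<in>wtset (Ti i) (Ri i). f i = \<phi> i (delta \<nu>))) \<longrightarrow> basis_vec f \<in> ?C"
    if "finite A" for A
    using that
  proof induction
    case empty
    show ?case
    proof (intro ballI impI)
      fix f assume f: "f \<in> tfamilies Mi"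
        "\<forall>i. i \<notin> {} \<longrightarrow> (\<exists>\<nu>\<in>wtset (Ti i) (Ri i). f i = \<phi> i (delta \<nu>))"
      then have "\<forall>i. \<exists>\<nu>\<in>wtset (Ti i) (Ri i). f i = \<phi> i (delta \<nu>)" by simp
      then obtain \<nu> where \<nu>: "\<And>i. \<nu> i \<in> wtset (Ti i) (Ri i)" "\<And>i. f i = \<phi> i (delta (\<nu> i))" by metis
      have eta: "(\<lambda>_. \<nu> i ()) = \<nu> i" for i by (rule ext) simp
      have \<mu>: "(\<lambda>i. \<nu> i ()) \<in> wtset TT RR" using \<nu>(1) by (simp add: wtset_TT eta)
      have "f = bb (\<lambda>i. \<nu> i ())" using \<nu>(2) by (auto simp: bb_def eta)
      moreover have "unlin (delta (\<lambda>i. \<nu> i ())) = basis_vec (bb (\<lambda>i. \<nu> i ()))"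
        by (simp add: unlin_def delta_def)
      ultimately have "basis_vec f - unlin (delta (\<lambda>i. \<nu> i ())) \<in> trels Mi"
        using pm.subspace_0[OF subspace_trels] by simp
      then show "basis_vec f \<in> ?C" using fs_delta[OF \<mu>] by blast
    qed
  next
    case (insert j A)
    show ?case
    proof (intro ballI impI)
      fix f assume f: "f \<in> tfamilies Mi"
        "\<forall>i. i \<notin> insert j A \<longrightarrow> (\<exists>\<nu>\<in>wtset (Ti i) (Ri i). f i = \<phi> i (delta \<nu>))"
      have all: "basis_vec (f(j := \<phi> j h)) \<in> ?C" if "h \<in> fs (wtset (Ti j) (Ri j))" for h
        using that
      proof (induction rule: fs_induct)
        case zero
        \<comment> \<open>A tensor with a zero entry is a relation: it is the scalar relation for
          \<open>c = 0\<close>.\<close>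
        have "basis_vec (f(j := Cop 0 \<odot>\<^bsub>Mi j\<^esub> \<zero>\<^bsub>Mi j\<^esub>)) - pm_scale 0 (basis_vec (f(j := \<zero>\<^bsub>Mi j\<^esub>))) \<in> trels Mi"
          by (rule trels_Cop[OF f(1)]) simp
        then show "basis_vec (f(j := \<phi> j (\<lambda>_. 0))) \<in> ?C"
          by (intro C_trels) (simp add: Mi.\<phi>_zero)
      next
        case (add g \<nu> c)
        let ?d = "\<phi> j (delta \<nu>)"
        have d: "?d \<in> carrier (Mi j)" "\<phi> j g \<in> carrier (Mi j)" using add by auto
        have "\<forall>i. i \<notin> A \<longrightarrow> (\<exists>\<nu>\<in>wtset (Ti i) (Ri i). (f(j := ?d)) i = \<phi> i (delta \<nu>))"
          using f(2) add(2) by auto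
        with bspec[OF insert.IH tfamilies_upd[OF f(1) d(1)]] have "basis_vec (f(j := ?d)) \<in> ?C"
          by (rule mp)
        from C_add[OF C_trels[OF trels_Cop[OF f(1) d(1), of c]] C_scale[OF this, of c]]
        have *: "basis_vec (f(j := Cop c \<odot>\<^bsub>Mi j\<^esub> ?d)) \<in> ?C" by (simp only: diff_add_cancel)
        have "basis_vec (f(j := Cop c \<odot>\<^bsub>Mi j\<^esub> ?d \<oplus>\<^bsub>Mi j\<^esub> \<phi> j g)) - basis_vec (f(j := Cop c \<odot>\<^bsub>Mi j\<^esub> ?d))
            - basis_vec (f(j := \<phi> j g)) \<in> ?C"
          using d by (intro C_trels trels_add f(1)) simp_all
        from C_add[OF C_add[OF this add(3)] *]
        have "basis_vec (f(j := Cop c \<odot>\<^bsub>Mi j\<^esub> ?d \<oplus>\<^bsub>Mi j\<^esub> \<phi> j g)) \<in> ?C" by (simp only: diff_add_cancel)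
        moreover have "\<phi> j (\<lambda>\<kappa>. c * delta \<nu> \<kappa> + g \<kappa>) = Cop c \<odot>\<^bsub>Mi j\<^esub> ?d \<oplus>\<^bsub>Mi j\<^esub> \<phi> j g"
          using add by (simp add: Mi.hom_add Mi.hom_Cop fs_scale)
        ultimately show "basis_vec (f(j := \<phi> j (\<lambda>\<kappa>. c * delta \<nu> \<kappa> + g \<kappa>))) \<in> ?C" by simp
      qed
      obtain h where h: "h \<in> fs (wtset (Ti j) (Ri j))" "f j = \<phi> j h"
        using Mi.\<phi>_surj[OF tfamiliesD[OF f(1)], of j] by (auto elim: bexE)
      then have "f(j := \<phi> j h) = f" by (simp add: fun_upd_idem)
      with all[OF h(1)] show "basis_vec f \<in> ?C" by (simp only:)
    qed
  qed
  from this[of UNIV] show ?thesis using assms by simp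
qed

lemma pm_expand: "P = (\<Sum>f\<in>Poly_Mapping.keys P. pm_scale (lk P f) (basis_vec f))"
  by (rule poly_mapping_eqI)
    (auto simp: lookup_sum lookup_single when_def in_keys_iff if_distrib cong: if_cong)

text \<open>Modulo relations \<open>P\<close> becomes some \<open>unlin h\<close>, and relations are
  invisible to \<open>lin\<close>, so \<open>h = lin P = 0\<close>. This is the independence of the
  tensors of basis vectors.\<close>

lemma kernel_lin:
  assumes "P \<in> TF" "lin P = (\<lambda>_. 0)" shows "P \<in> trels Mi"
proof -
  have "\<exists>h\<in>fs (wtset TT RR). (\<Sum>f\<in>A. pm_scale (lk P f) (basis_vec f)) - unlin h \<in> trels Mi"
    if "finite A" "A \<subseteq> tfamilies Mi" for A
    using that
  proof induction
    case empty
    show ?case by (rule bexI[of _ "\<lambda>_. 0"]) (simp_all add: unlin_def pm.subspace_0[OF subspace_trels])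
  next
    case (insert f A)
    then obtain h where h: "h \<in> fs (wtset TT RR)"
      "(\<Sum>f\<in>A. pm_scale (lk P f) (basis_vec f)) - unlin h \<in> trels Mi" by auto
    obtain k where k: "k \<in> fs (wtset TT RR)" "basis_vec f - unlin k \<in> trels Mi"
      using reduce_basis insert.prems by blast
    have k': "(\<lambda>\<mu>. lk P f * k \<mu>) \<in> fs (wtset TT RR)" using k(1) by (rule fs_scale)
    have "(\<Sum>f\<in>insert f A. pm_scale (lk P f) (basis_vec f)) - unlin (\<lambda>\<mu>. lk P f * k \<mu> + h \<mu>)
        = pm_scale (lk P f) (basis_vec f - unlin k) + ((\<Sum>f\<in>A. pm_scale (lk P f) (basis_vec f)) - unlin h)"
      using insert.hyps unlin_add[OF k' h(1)] unlin_scale[OF k(1)]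
      by (simp add: pm.scale_right_diff_distrib)
    also have "\<dots> \<in> trels Mi"
      using h(2) k(2) by (intro pm.subspace_add pm.subspace_scale subspace_trels)
    finally show ?case using fs_add[OF k' h(1)] by blast
  qed
  from this[of "Poly_Mapping.keys P"] assms(1)
  obtain h where h: "h \<in> fs (wtset TT RR)" "P - unlin h \<in> trels Mi"
    unfolding pm_expand[of P, symmetric] by auto
  have "h = lin (unlin h)" using lin_unlin[OF h(1)] by simp
  also have "\<dots> = lin P" using lin_trels[OF h(2)] by (auto simp: fun_eq_iff lin_diff)
  finally have "h = (\<lambda>_. 0)" using assms(2) by simp
  with h(2) show ?thesis by (simp add: unlin_def)
qed

section \<open>The tensor space as a quotient and its coordinates\<close>

lemma tfree_simps [simp]: "carrier (tfree Mi) = TF" "P \<oplus>\<^bsub>tfree Mi\<^esub> Q = P + Q" "\<zero>\<^bsub>tfree Mi\<^esub> = 0"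
  "c \<odot>\<^bsub>tfree Mi\<^esub> P = pm_scale c P"
  by (simp_all add: tfree_def)

lemma abelian_group_tfree: "abelian_group (tfree Mi)"
proof (rule abelian_groupI)
  fix P assume "P \<in> carrier (tfree Mi)"
  then show "\<exists>Q\<in>carrier (tfree Mi). Q \<oplus>\<^bsub>tfree Mi\<^esub> P = \<zero>\<^bsub>tfree Mi\<^esub>"
    using pm.subspace_neg[OF subspace_TF, of P] by (intro bexI[of _ "- P"]) simp_all
qed (use pm.subspace_add[OF subspace_TF] in \<open>auto simp: ac_simps\<close>)

sublocale quot: quotient_setup "tfree Mi" "trels Mi"
proof (intro quotient_setup.intro abelian_group_tfree quotient_setup_axioms.intro)
  interpret abelian_group "tfree Mi" by (rule abelian_group_tfree)
  show "subgroup (trels Mi) (add_monoid (tfree Mi))"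
  proof (rule add.subgroupI)
    show "trels Mi \<subseteq> carrier (tfree Mi)" using trels_TF by simp
    show "trels Mi \<noteq> {}" using pm.subspace_0[OF subspace_trels] by blast
    fix P Q assume P: "P \<in> trels Mi" and Q: "Q \<in> trels Mi"
    have "- P \<in> trels Mi" using P by (rule pm.subspace_neg[OF subspace_trels])
    moreover have "\<ominus>\<^bsub>tfree Mi\<^esub> P = - P"
      using P \<open>- P \<in> trels Mi\<close> trels_TF by (intro minus_equality) auto
    ultimately show "\<ominus>\<^bsub>tfree Mi\<^esub> P \<in> trels Mi" by simp
    show "P \<oplus>\<^bsub>tfree Mi\<^esub> Q \<in> trels Mi" using pm.subspace_add[OF subspace_trels P Q] by simp
  qed
qed

abbreviation cls :: "(('n \<Rightarrow> 'w) \<Rightarrow>\<^sub>0 'k) \<Rightarrow> (('n \<Rightarrow> 'w) \<Rightarrow>\<^sub>0 'k) set" where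
  "cls P \<equiv> trels Mi +>\<^bsub>tfree Mi\<^esub> P"

lemma carrier_tspace: "carrier (tspace Mi) = cls ` TF"
  unfolding tspace_def quot.carrier_quot by simp

lemma cls_add: "P \<in> TF \<Longrightarrow> Q \<in> TF \<Longrightarrow> cls P \<oplus>\<^bsub>tspace Mi\<^esub> cls Q = cls (P + Q)"
  using quot.add_quot[of P Q] by (simp add: tspace_def)

lemma cls_scale: "P \<in> TF \<Longrightarrow> c \<odot>\<^bsub>tspace Mi\<^esub> cls P = cls (pm_scale c P)"
proof -
  assume P: "P \<in> TF"
  have "c \<odot>\<^bsub>quot_module (tfree Mi) (trels Mi)\<^esub> cls P = cls (c \<odot>\<^bsub>tfree Mi\<^esub> P)"
    using P pm.subspace_scale[OF subspace_TF] pm.subspace_scale[OF subspace_trels]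
    by (intro quot.smult_quot) (simp_all add: pm.scale_right_distrib)
  then show ?thesis by (simp add: tspace_def)
qed

lemma cls_eq_iff: "P \<in> TF \<Longrightarrow> Q \<in> TF \<Longrightarrow> cls P = cls Q \<longleftrightarrow> lin P = lin Q"
proof -
  assume P: "P \<in> TF" and Q: "Q \<in> TF"
  have "- Q \<in> TF" using Q by (rule pm.subspace_neg[OF subspace_TF])
  then have "\<ominus>\<^bsub>tfree Mi\<^esub> Q = - Q" using Q by (intro quot.minus_equality) simp_all
  then have "P \<ominus>\<^bsub>tfree Mi\<^esub> Q = P - Q" by (simp add: a_minus_def)
  then have "cls P = cls Q \<longleftrightarrow> P - Q \<in> trels Mi" using P Q by (simp add: quot.coset_eq_iff)
  also have "\<dots> \<longleftrightarrow> lin (P - Q) = (\<lambda>_. 0)"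
    using lin_trels kernel_lin[OF pm.subspace_diff[OF subspace_TF P Q]] by blast
  finally show ?thesis by (auto simp: fun_eq_iff lin_diff)
qed

text \<open>Independent of the representative, because classes agree exactly when their values under
  \<open>lin\<close> do.\<close>

definition coord :: "(('n \<Rightarrow> 'w) \<Rightarrow>\<^sub>0 'k) set \<Rightarrow> ('n \<Rightarrow> 'k) \<Rightarrow> 'k" where
  "coord W = lin (SOME P. P \<in> TF \<and> W = cls P)"

lemma coord_cls: "P \<in> TF \<Longrightarrow> coord (cls P) = lin P"
proof -
  assume P: "P \<in> TF"
  let ?Q = "SOME Q. Q \<in> TF \<and> cls P = cls Q"
  have "?Q \<in> TF \<and> cls P = cls ?Q" by (rule someI[of _ P]) (use P in simp)
  then show ?thesis unfolding coord_def using P cls_eq_iff by blast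
qed

lemma coord_bij: "bij_betw coord (carrier (tspace Mi)) (fs (wtset TT RR))"
proof (rule bij_betwI')
  fix W W' assume "W \<in> carrier (tspace Mi)" "W' \<in> carrier (tspace Mi)"
  then obtain P P' where "P \<in> TF" "P' \<in> TF" "W = cls P" "W' = cls P'" unfolding carrier_tspace by blast
  then show "(coord W = coord W') = (W = W')" by (simp only: coord_cls cls_eq_iff)
next
  fix W assume "W \<in> carrier (tspace Mi)"
  then obtain P where "P \<in> TF" "W = cls P" unfolding carrier_tspace by blast
  then show "coord W \<in> fs (wtset TT RR)" by (simp only: coord_cls lin_fs)
next
  fix h :: "('n \<Rightarrow> 'k) \<Rightarrow> 'k" assume h: "h \<in> fs (wtset TT RR)"
  then have "h = coord (cls (unlin h))" using unlin_TF[OF h] by (simp only: coord_cls lin_unlin)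
  then show "\<exists>W\<in>carrier (tspace Mi). h = coord W" using unlin_TF[OF h] unfolding carrier_tspace by blast
qed

lemma coord_inj: "W \<in> carrier (tspace Mi) \<Longrightarrow> W' \<in> carrier (tspace Mi) \<Longrightarrow> coord W = coord W' \<Longrightarrow> W = W'"
  using coord_bij unfolding bij_betw_def inj_on_def by blast

lemma coord_add:
  assumes "W \<in> carrier (tspace Mi)" "W' \<in> carrier (tspace Mi)"
  shows "coord (W \<oplus>\<^bsub>tspace Mi\<^esub> W') = (\<lambda>\<mu>. coord W \<mu> + coord W' \<mu>)"
proof -
  obtain P P' where P: "P \<in> TF" "P' \<in> TF" "W = cls P" "W' = cls P'" using assms unfolding carrier_tspace by blast
  then have "P + P' \<in> TF" by (intro pm.subspace_add[OF subspace_TF])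
  with P show ?thesis by (simp only: cls_add coord_cls) (simp add: fun_eq_iff lin_add)
qed

lemma coord_scale:
  assumes "W \<in> carrier (tspace Mi)"
  shows "coord (c \<odot>\<^bsub>tspace Mi\<^esub> W) = (\<lambda>\<mu>. c * coord W \<mu>)" "c \<odot>\<^bsub>tspace Mi\<^esub> W \<in> carrier (tspace Mi)"
proof -
  obtain P where P: "P \<in> TF" "W = cls P" using assms unfolding carrier_tspace by blast
  then have "pm_scale c P \<in> TF" by (intro pm.subspace_scale[OF subspace_TF])
  with P show "coord (c \<odot>\<^bsub>tspace Mi\<^esub> W) = (\<lambda>\<mu>. c * coord W \<mu>)"
    by (simp only: cls_scale coord_cls) (simp add: fun_eq_iff lin_scale)
  show "c \<odot>\<^bsub>tspace Mi\<^esub> W \<in> carrier (tspace Mi)"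
    using P \<open>pm_scale c P \<in> TF\<close> unfolding carrier_tspace by (simp only: cls_scale image_eqI)
qed

lemma pure_tensor_closed: "f \<in> tfamilies Mi \<Longrightarrow> pure_tensor Mi f \<in> carrier (tspace Mi)"
  unfolding pure_tensor_def carrier_tspace using basis_TF by blast

lemma coord_pure: "f \<in> tfamilies Mi \<Longrightarrow> coord (pure_tensor Mi f) = prodf f"
  unfolding pure_tensor_def by (simp only: coord_cls[OF basis_TF]) (simp add: fun_eq_iff lin_single)

lemma tspace_induct [consumes 1, case_names zero add]:
  assumes W: "W \<in> carrier (tspace Mi)"
    and zero: "Q (\<zero>\<^bsub>tspace Mi\<^esub>)"
    and step: "\<And>f c W. f \<in> tfamilies Mi \<Longrightarrow> W \<in> carrier (tspace Mi) \<Longrightarrow> Q W \<Longrightarrow>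
      Q ((c \<odot>\<^bsub>tspace Mi\<^esub> pure_tensor Mi f) \<oplus>\<^bsub>tspace Mi\<^esub> W)"
  shows "Q W"
proof -
  obtain P where P: "P \<in> TF" "W = cls P" using W unfolding carrier_tspace by blast
  have "(\<Sum>f\<in>A. pm_scale (lk P f) (basis_vec f)) \<in> TF \<and> Q (cls (\<Sum>f\<in>A. pm_scale (lk P f) (basis_vec f)))"
    if "finite A" "A \<subseteq> tfamilies Mi" for A
    using that
  proof induction
    case empty
    then show ?case using zero pm.subspace_0[OF subspace_TF] quot.zero_quot by (simp add: tspace_def)
  next
    case (insert f A)
    let ?R = "\<Sum>f\<in>A. pm_scale (lk P f) (basis_vec f)"
    have R: "?R \<in> TF" "Q (cls ?R)" and f: "f \<in> tfamilies Mi" using insert by auto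
    have s: "pm_scale (lk P f) (basis_vec f) \<in> TF" using f by (intro pm.subspace_scale[OF subspace_TF] basis_TF)
    have "Q ((lk P f \<odot>\<^bsub>tspace Mi\<^esub> pure_tensor Mi f) \<oplus>\<^bsub>tspace Mi\<^esub> cls ?R)"
      using R f unfolding carrier_tspace by (intro step) (auto simp: carrier_tspace)
    moreover have "(lk P f \<odot>\<^bsub>tspace Mi\<^esub> pure_tensor Mi f) \<oplus>\<^bsub>tspace Mi\<^esub> cls ?R
        = cls (pm_scale (lk P f) (basis_vec f) + ?R)"
      unfolding pure_tensor_def using R s by (simp only: cls_scale[OF basis_TF[OF f]] cls_add)
    ultimately show ?case using insert.hyps pm.subspace_add[OF subspace_TF s R(1)] by simp
  qed
  from this[of "Poly_Mapping.keys P"] P show ?thesis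
    unfolding pm_expand[of P, symmetric] by simp
qed

section \<open>The action on the tensor space\<close>

lemma abelian_group_tspace: "abelian_group (tspace Mi)"
  unfolding tspace_def by (rule quot.abelian_group_quot)

text \<open>The uniqueness half of the description in \<open>tensor\<close>: on pure tensors the
  prescribed values are those of \<open>evr TT\<close> by \<open>prodf_ops\<close>, then linearity
  and the module laws leave no choice.\<close>

lemma coord_tensor_action:
  assumes \<sigma>: "is_tensor_action Mi \<sigma>" and W: "W \<in> carrier (tspace Mi)"
  shows "\<sigma> (ev e) W \<in> carrier (tspace Mi)" "coord (\<sigma> (ev e) W) = evr TT e (coord W)"
proof -
  let ?M = "with_action (tspace Mi) \<sigma>"
  interpret tens: II_module ?M
    using \<sigma> by (intro II_module.intro) (simp add: is_tensor_action_def)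
  have M: "carrier ?M = carrier (tspace Mi)" "\<And>u v. u \<oplus>\<^bsub>?M\<^esub> v = u \<oplus>\<^bsub>tspace Mi\<^esub> v" "\<And>a v. a \<odot>\<^bsub>?M\<^esub> v = \<sigma> a v"
    "\<zero>\<^bsub>?M\<^esub> = \<zero>\<^bsub>tspace Mi\<^esub>"
    by (simp_all add: with_action_def)
  have closed: "\<sigma> (ev e) W \<in> carrier (tspace Mi)" if "W \<in> carrier (tspace Mi)" for e W
    using tens.act_closed[of "ev e" W] that by (simp add: M)
  have C: "\<sigma> (Cop c) W = c \<odot>\<^bsub>tspace Mi\<^esub> W" if "W \<in> carrier (tspace Mi)" for c W
    using \<sigma> that by (simp add: is_tensor_action_def)
  have gen: "coord (\<sigma> (ev e) W) = evr TT e (coord W)"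
    if pure: "\<And>f. f \<in> tfamilies Mi \<Longrightarrow> coord (\<sigma> (ev e) (pure_tensor Mi f)) = evr TT e (prodf f)"
      and W: "W \<in> carrier (tspace Mi)" for e W
    using W
  proof (induction rule: tspace_induct)
    case zero
    have z: "coord \<zero>\<^bsub>tspace Mi\<^esub> = (\<lambda>_. 0)"
      using coord_cls[OF pm.subspace_0[OF subspace_TF]] quot.zero_quot by (simp add: tspace_def fun_eq_iff lin_zero)
    have "\<sigma> (ev e) \<zero>\<^bsub>tspace Mi\<^esub> = \<zero>\<^bsub>tspace Mi\<^esub>" using tens.act_zero[of "ev e"] by (simp add: M)
    then show ?case by (simp add: z evr_zero)
  next
    case (add f c W)
    let ?p = "pure_tensor Mi f"
    note p = pure_tensor_closed[OF add(1)]
    have cp: "c \<odot>\<^bsub>tspace Mi\<^esub> ?p \<in> carrier (tspace Mi)" using p by (rule coord_scale)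
    have "\<sigma> (ev e) (c \<odot>\<^bsub>tspace Mi\<^esub> ?p \<oplus>\<^bsub>tspace Mi\<^esub> W) = c \<odot>\<^bsub>tspace Mi\<^esub> \<sigma> (ev e) ?p \<oplus>\<^bsub>tspace Mi\<^esub> \<sigma> (ev e) W"
      using tens.act_add[of "ev e" "c \<odot>\<^bsub>tspace Mi\<^esub> ?p" W] tens.act_Cop_commute[of "ev e" ?p c] cp p add(2) closed
      by (simp add: M C)
    then show ?case
      using p cp add closed coord_scale[OF closed[OF p, of e], of c]
      by (simp add: coord_add coord_scale coord_pure pure evr_add evr_scale)
  qed
  have D: "\<sigma> (Dop i) (pure_tensor Mi f) = pure_tensor Mi (f(i := Dop () \<odot>\<^bsub>Mi i\<^esub> f i))"
    and J: "\<sigma> (Jop i) (pure_tensor Mi f) = pure_tensor Mi (f(i := Jop () \<odot>\<^bsub>Mi i\<^esub> f i))"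
    and X: "\<sigma> (Xop i) (pure_tensor Mi f) = pure_tensor Mi (f(i := Xop () \<odot>\<^bsub>Mi i\<^esub> f i))"
    if "f \<in> tfamilies Mi" for i f
    using \<sigma> that unfolding is_tensor_action_def by blast+
  \<comment> \<open>The definition prescribes the action of \<open>x\<^sub>i\<close>,
    \<open>\<partial>\<^sub>i\<close> and \<open>\<integral>\<^sub>i\<close> only, while words use
    \<open>H\<^sub>i\<close>; it is recovered from
    \<open>H\<^sub>i = \<partial>\<^sub>i x\<^sub>i\<close>.\<close>
  have H: "\<sigma> (Hop i) (pure_tensor Mi f) = pure_tensor Mi (f(i := Hop () \<odot>\<^bsub>Mi i\<^esub> f i))"
    if f: "f \<in> tfamilies Mi" for i f
  proof -
    have "\<sigma> (Hop i) (pure_tensor Mi f) = \<sigma> (Xop i) (\<sigma> (Dop i) (pure_tensor Mi f))"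
      using tens.act_comp[of "Dop i" "Xop i" "pure_tensor Mi f"] pure_tensor_closed[OF f]
      by (simp add: M Hop_def[symmetric] del: o_apply)
    then show ?thesis
      using f X[of "f(i := Dop () \<odot>\<^bsub>Mi i\<^esub> f i)" i] tfamiliesD[OF f, of i] by (simp add: D Hop_act)
  qed
  show "\<sigma> (ev e) W \<in> carrier (tspace Mi)" using W by (rule closed)
  show "coord (\<sigma> (ev e) W) = evr TT e (coord W)"
    using W
  proof (induction e arbitrary: W)
    case (Sc c)
    then show "coord (\<sigma> (ev (Sc c)) W) = evr TT (Sc c) (coord W)" by (simp add: C coord_scale)
  next
    case (GD i)
    then show "coord (\<sigma> (ev (GD i)) W) = evr TT (GD i) (coord W)"
      using tfamiliesD by (intro gen) (simp_all add: D coord_pure prodf_ops)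
  next
    case (GJ i)
    then show "coord (\<sigma> (ev (GJ i)) W) = evr TT (GJ i) (coord W)"
      using tfamiliesD by (intro gen) (simp_all add: J coord_pure prodf_ops)
  next
    case (GH i)
    then show "coord (\<sigma> (ev (GH i)) W) = evr TT (GH i) (coord W)"
      using tfamiliesD by (intro gen) (simp_all add: H coord_pure prodf_ops)
  next
    case (Add a b)
    have "\<sigma> (ev (Add a b)) W = \<sigma> (ev a) W \<oplus>\<^bsub>tspace Mi\<^esub> \<sigma> (ev b) W"
      using tens.act_add_op[of "ev a" "ev b" W] Add.prems by (simp add: M)
    then show "coord (\<sigma> (ev (Add a b)) W) = evr TT (Add a b) (coord W)"
      using Add closed by (simp only: coord_add evr.simps)
  next
    case (Mul a b)
    have "\<sigma> (ev (Mul a b)) W = \<sigma> (ev b) (\<sigma> (ev a) W)"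
      using tens.act_comp[of "ev a" "ev b" W] Mul.prems by (simp add: M del: o_apply)
    then show "coord (\<sigma> (ev (Mul a b)) W) = evr TT (Mul a b) (coord W)"
      using Mul closed by (simp only: evr.simps)
  qed
qed

text \<open>The existence half: \<open>evr TT\<close> is pulled back along the bijection
  \<open>coord\<close>, with \<open>evr_well_defined\<close> removing the dependence on
  words.\<close>

lemma tensor_action_exists: "\<exists>\<sigma>. is_tensor_action Mi \<sigma>"
proof -
  define \<sigma> where "\<sigma> a W = inv_into (carrier (tspace Mi)) coord (evr TT (SOME e. ev e = a) (coord W))"
    for a :: "('k, 'n) op" and W
  have fs: "coord W \<in> fs (wtset TT RR)" if "W \<in> carrier (tspace Mi)" for W
    using coord_bij that by (auto simp: bij_betw_def)
  have act: "\<sigma> (ev e) W \<in> carrier (tspace Mi)" "coord (\<sigma> (ev e) W) = evr TT e (coord W)"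
    if W: "W \<in> carrier (tspace Mi)" for e W
  proof -
    have "ev (SOME e'. ev e' = ev e) = ev e" by (rule someI[of _ e]) simp
    then have "evr TT (SOME e'. ev e' = ev e) (coord W) = evr TT e (coord W)"
      using fs_mono[OF wtset_subset fs[OF W]] by (rule evr_well_defined)
    moreover have "evr TT e (coord W) \<in> coord ` carrier (tspace Mi)"
      using fs_evr[OF step_closed_wtset fs[OF W]] coord_bij by (simp add: bij_betw_def)
    ultimately show "\<sigma> (ev e) W \<in> carrier (tspace Mi)" "coord (\<sigma> (ev e) W) = evr TT e (coord W)"
      by (simp_all add: \<sigma>_def f_inv_into_f inv_into_into)
  qed
  obtain \<theta> where "model (with_action (tspace Mi) \<sigma>) TT RR \<theta>"
    using model_transport[OF abelian_group_tspace coord_bij coord_add act] by blast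
  then have rm: "right_module II (with_action (tspace Mi) \<sigma>)" by (rule model_axioms_all)
  have C: "\<sigma> (Cop c) W = c \<odot>\<^bsub>tspace Mi\<^esub> W" if "W \<in> carrier (tspace Mi)" for c W
    using that act[OF that, of "Sc c"] coord_scale[OF that, of c] by (intro coord_inj) simp_all
  have pure: "\<sigma> (Xop i) (pure_tensor Mi f) = pure_tensor Mi (f(i := Xop () \<odot>\<^bsub>Mi i\<^esub> f i))"
    "\<sigma> (Dop i) (pure_tensor Mi f) = pure_tensor Mi (f(i := Dop () \<odot>\<^bsub>Mi i\<^esub> f i))"
    "\<sigma> (Jop i) (pure_tensor Mi f) = pure_tensor Mi (f(i := Jop () \<odot>\<^bsub>Mi i\<^esub> f i))"
    if f: "f \<in> tfamilies Mi" for f i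
  proof -
    note a = act[OF pure_tensor_closed[OF f]]
    have u: "f(i := a \<odot>\<^bsub>Mi i\<^esub> f i) \<in> tfamilies Mi" if "a \<in> carrier II" for a
      using f tfamiliesD[OF f, of i] that by auto
    show "\<sigma> (Xop i) (pure_tensor Mi f) = pure_tensor Mi (f(i := Xop () \<odot>\<^bsub>Mi i\<^esub> f i))"
      using a[of "Mul (GJ i) (GH i)"] pure_tensor_closed[OF u[of "Xop ()"]] coord_pure[OF u[of "Xop ()"]] coord_pure[OF f]
      by (intro coord_inj) (simp_all add: Xop_eq[symmetric] prodf_ops f)
    show "\<sigma> (Dop i) (pure_tensor Mi f) = pure_tensor Mi (f(i := Dop () \<odot>\<^bsub>Mi i\<^esub> f i))"
      using a[of "GD i"] pure_tensor_closed[OF u[of "Dop ()"]] coord_pure[OF u[of "Dop ()"]] coord_pure[OF f]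
      by (intro coord_inj) (simp_all add: prodf_ops f)
    show "\<sigma> (Jop i) (pure_tensor Mi f) = pure_tensor Mi (f(i := Jop () \<odot>\<^bsub>Mi i\<^esub> f i))"
      using a[of "GJ i"] pure_tensor_closed[OF u[of "Jop ()"]] coord_pure[OF u[of "Jop ()"]] coord_pure[OF f]
      by (intro coord_inj) (simp_all add: prodf_ops f)
  qed
  have "is_tensor_action Mi \<sigma>" unfolding is_tensor_action_def using rm C pure by blast
  then show ?thesis by (rule exI[of _ \<sigma>])
qed

lemma tensor_model: "\<exists>\<theta>. model (tensor Mi) TT RR \<theta>"
  unfolding tensor_def
proof (rule model_transport[OF abelian_group_tspace coord_bij coord_add])
  obtain \<sigma> where \<sigma>: "is_tensor_action Mi \<sigma>" using tensor_action_exists by blast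
  fix e :: "('k, 'n) expr" and W assume W: "W \<in> carrier (tspace Mi)"
  let ?s = "THE u. \<exists>\<sigma>. is_tensor_action Mi \<sigma> \<and> u = \<sigma> (ev e) W"
  have "?s = \<sigma> (ev e) W"
  proof (rule the_equality)
    fix u assume "\<exists>\<sigma>'. is_tensor_action Mi \<sigma>' \<and> u = \<sigma>' (ev e) W"
    then obtain \<sigma>' where "is_tensor_action Mi \<sigma>'" "u = \<sigma>' (ev e) W" by blast
    then show "u = \<sigma> (ev e) W"
      using coord_tensor_action[OF _ W, of \<sigma>' e] coord_tensor_action[OF \<sigma> W, of e]
      by (intro coord_inj) simp_all
  qed (use \<sigma> in blast)
  then show "?s \<in> carrier (tspace Mi)" "coord ?s = evr TT e (coord W)"
    using coord_tensor_action[OF \<sigma> W, of e] by simp_all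
qed

end

section \<open>The classification\<close>

text \<open>The outcome of the locale in the form used below: a tensor product of models is a model,
  and its weight set is the product of the weight sets.\<close>

lemma tensor_of_models:
  assumes "\<forall>i. model (Mi i) (Ti i) (Ri i) (\<phi> i)"
  obtains T \<rho> \<theta> where "model (tensor Mi) T \<rho> \<theta>"
    "\<forall>\<mu>. \<mu> \<in> wtset T \<rho> \<longleftrightarrow> (\<forall>i. (\<lambda>_. \<mu> i) \<in> wtset (Ti i) (Ri i))"
proof -
  interpret tensor_setup Mi Ti Ri \<phi> by (rule tensor_setup.intro) (rule assms[rule_format])
  from tensor_model obtain \<theta> where "model (tensor Mi) TT RR \<theta>" by blast
  then show ?thesis by (rule that) (simp add: wtset_TT)
qed

lemma simple_weight_family:
  assumes "\<forall>i. simple_weight (Mi i)"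
  obtains Ti Ri \<phi> where "\<forall>i. model (Mi i) (Ti i) (Ri i) (\<phi> i)"
proof -
  have "\<forall>i. \<exists>T \<rho> \<phi>. model (Mi i) T \<rho> \<phi>" using assms by (simp add: simple_weight_iff_model)
  then obtain Ti where "\<forall>i. \<exists>\<rho> \<phi>. model (Mi i) (Ti i) \<rho> \<phi>" by (rule choice[THEN exE])
  then obtain Ri where "\<forall>i. \<exists>\<phi>. model (Mi i) (Ti i) (Ri i) \<phi>" by (rule choice[THEN exE])
  then obtain \<phi> where "\<forall>i. model (Mi i) (Ti i) (Ri i) (\<phi> i)" by (rule choice[THEN exE])
  then show ?thesis by (rule that)
qed

lemma tensor_simple_weight:
  assumes "\<forall>i. simple_weight (Mi i)" shows "simple_weight (tensor Mi)"
proof -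
  obtain Ti Ri \<phi> where "\<forall>i. model (Mi i) (Ti i) (Ri i) (\<phi> i)"
    using assms by (rule simple_weight_family)
  then obtain T \<rho> \<theta> where "model (tensor Mi) T \<rho> \<theta>" by (rule tensor_of_models)
  then show ?thesis by (rule model.simple_weight)
qed

lemma simple_weight_is_tensor:
  fixes M :: "(('k::field_char_0, 'n::finite) op, 'v) module"
  assumes "simple_weight M"
  shows "\<exists>Mi :: 'n \<Rightarrow> (('k, unit) op, ('k, unit) op set) module.
    (\<forall>i. simple_weight (Mi i)) \<and> right_iso II M (tensor Mi)"
proof -
  obtain T \<rho> \<phi> where M: "model M T \<rho> \<phi>" using assms simple_weight_iff_model by blast
  \<comment> \<open>The comprehension does not depend on \<open>u\<close>: it is everything when
    \<open>i\<close> is in \<open>T\<close> and empty otherwise.\<close>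
  let ?T = "\<lambda>i. {u :: unit. i \<in> T}" and ?R = "\<lambda>i (_ :: unit). \<rho> i"
  have "\<forall>i. \<exists>(N :: (('k, unit) op, ('k, unit) op set) module). \<exists>\<phi>. model N (?T i) (?R i) \<phi>"
    using exists_op_set_model by blast
  then obtain Mi :: "'n \<Rightarrow> (('k, unit) op, ('k, unit) op set) module"
    where "\<forall>i. \<exists>\<phi>. model (Mi i) (?T i) (?R i) \<phi>" by (rule choice[THEN exE])
  then obtain \<phi>i where Mi: "\<forall>i. model (Mi i) (?T i) (?R i) (\<phi>i i)" by (rule choice[THEN exE])
  obtain T' \<rho>' \<theta> where t: "model (tensor Mi) T' \<rho>' \<theta>"
    "\<forall>\<mu>. \<mu> \<in> wtset T' \<rho>' \<longleftrightarrow> (\<forall>i. (\<lambda>_. \<mu> i) \<in> wtset (?T i) (?R i))"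
    using Mi by (rule tensor_of_models)
  have "wtset T \<rho> = wtset T' \<rho>'"
  proof (rule Set.set_eqI)
    fix \<mu> :: "'n \<Rightarrow> 'k"
    show "\<mu> \<in> wtset T \<rho> \<longleftrightarrow> \<mu> \<in> wtset T' \<rho>'" unfolding t(2)[rule_format] by (auto simp: wtset_def)
  qed
  then have "right_iso II M (tensor Mi)" using model_iso_iff[OF M t(1)] by blast
  moreover have "simple_weight (Mi i)" for i using model.simple_weight[OF Mi[rule_format]] .
  ultimately show ?thesis by blast
qed

text \<open>A nonempty product determines its factors: change one component of a point of the
  product and keep the others.\<close>

lemma product_subset_imp:
  assumes \<mu>: "\<And>i. (\<lambda>_. \<mu> i) \<in> A i" and sub: "\<And>\<mu>. (\<forall>i. (\<lambda>_. \<mu> i) \<in> A i) \<Longrightarrow> (\<forall>i. (\<lambda>_. \<mu> i) \<in> B i)"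
  shows "A i \<subseteq> (B i :: (unit \<Rightarrow> 'k) set)"
proof
  fix \<nu> assume "\<nu> \<in> A i"
  moreover have eta: "(\<lambda>_. \<nu> ()) = \<nu>" by (rule ext) simp
  ultimately have "\<forall>j. (\<lambda>_. (\<mu>(i := \<nu> ())) j) \<in> A j" using \<mu> by simp
  from sub[OF this] have "(\<lambda>_. (\<mu>(i := \<nu> ())) i) \<in> B i" by (rule spec)
  then show "\<nu> \<in> B i" by (simp add: eta)
qed

lemma tensor_iso_iff:
  fixes Mi :: "'n::finite \<Rightarrow> (('k::field_char_0, unit) op, 'w) module"
    and Mi' :: "'n \<Rightarrow> (('k, unit) op, 'u) module"
  assumes "\<forall>i. simple_weight (Mi i)" "\<forall>i. simple_weight (Mi' i)"
  shows "right_iso II (tensor Mi) (tensor Mi') \<longleftrightarrow> (\<forall>i. right_iso II (Mi i) (Mi' i))"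
proof -
  obtain Ti Ri \<phi> where M: "\<forall>i. model (Mi i) (Ti i) (Ri i) (\<phi> i)"
    using assms(1) by (rule simple_weight_family)
  obtain Ti' Ri' \<phi>' where M': "\<forall>i. model (Mi' i) (Ti' i) (Ri' i) (\<phi>' i)"
    using assms(2) by (rule simple_weight_family)
  obtain T \<rho> \<theta> where t: "model (tensor Mi) T \<rho> \<theta>"
    "\<forall>\<mu>. \<mu> \<in> wtset T \<rho> \<longleftrightarrow> (\<forall>i. (\<lambda>_. \<mu> i) \<in> wtset (Ti i) (Ri i))"
    using M by (rule tensor_of_models)
  obtain T' \<rho>' \<theta>' where t': "model (tensor Mi') T' \<rho>' \<theta>'"
    "\<forall>\<mu>. \<mu> \<in> wtset T' \<rho>' \<longleftrightarrow> (\<forall>i. (\<lambda>_. \<mu> i) \<in> wtset (Ti' i) (Ri' i))"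
    using M' by (rule tensor_of_models)
  have "wtset T \<rho> = wtset T' \<rho>' \<longleftrightarrow> (\<forall>i. wtset (Ti i) (Ri i) = wtset (Ti' i) (Ri' i))"
  proof
    assume eq: "wtset T \<rho> = wtset T' \<rho>'"
    obtain \<mu> where \<mu>: "\<mu> \<in> wtset T \<rho>" using wtset_nonempty by blast
    have 1: "(\<forall>i. (\<lambda>_. \<mu> i) \<in> wtset (Ti i) (Ri i)) \<longleftrightarrow> (\<forall>i. (\<lambda>_. \<mu> i) \<in> wtset (Ti' i) (Ri' i))" for \<mu>
      using t(2)[rule_format, of \<mu>] t'(2)[rule_format, of \<mu>] eq by simp
    have 2: "\<And>i. (\<lambda>_. \<mu> i) \<in> wtset (Ti i) (Ri i)" "\<And>i. (\<lambda>_. \<mu> i) \<in> wtset (Ti' i) (Ri' i)"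
      using \<mu> t(2)[rule_format, of \<mu>] 1[of \<mu>] by auto
    show "\<forall>i. wtset (Ti i) (Ri i) = wtset (Ti' i) (Ri' i)"
      using product_subset_imp[of \<mu> "\<lambda>i. wtset (Ti i) (Ri i)" "\<lambda>i. wtset (Ti' i) (Ri' i)", OF 2(1) 1[THEN iffD1]]
        product_subset_imp[of \<mu> "\<lambda>i. wtset (Ti' i) (Ri' i)" "\<lambda>i. wtset (Ti i) (Ri i)", OF 2(2) 1[THEN iffD2]]
      by (intro allI equalityI) assumption+
  next
    assume "\<forall>i. wtset (Ti i) (Ri i) = wtset (Ti' i) (Ri' i)"
    then show "wtset T \<rho> = wtset T' \<rho>'" by (intro Set.set_eqI) (simp only: t(2)[rule_format] t'(2)[rule_format])
  qed
  then show ?thesis using model_iso_iff[OF t(1) t'(1)] model_iso_iff[OF M[rule_format] M'[rule_format]] by simp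
qed

lemma model_iso_exists: "\<exists>\<phi>. model M T \<rho> \<phi> \<Longrightarrow> \<exists>\<psi>. model N T \<rho> \<psi> \<Longrightarrow> right_iso II M N"
  by (elim exE) (rule model_iso)

text \<open>With a single direction \<open>T\<close> is everything or empty. In the first case the
  weight set does not depend on \<open>\<rho>\<close>, which gives one module; in the second
  \<open>\<rho>\<close> is the parameter of the family.\<close>

lemma simple_weight_unit:
  fixes M :: "(('k::field_char_0, unit) op, 'w) module"
  assumes "simple_weight M"
  shows "right_iso II M (star_module P1) \<or> (\<exists>\<mu>. right_iso II M (star_module (M1 \<mu>)))"
proof -
  obtain T \<rho> \<phi> where M: "model M T \<rho> \<phi>" using assms simple_weight_iff_model by blast
  consider "T = UNIV" | "T = {}" by (cases "() \<in> T") (auto simp: set_eq_iff)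
  then show ?thesis
  proof cases
    case 1
    obtain \<psi> where P: "model (star_module (P1 :: (('k, unit) op, ('k, unit) pol) module)) UNIV (\<lambda>_. 1) \<psi>"
      using star_P1_model by blast
    have "right_iso II M (star_module P1)"
      using model_iso_iff[OF M P] 1 by (simp add: wtset_UNIV)
    then show ?thesis ..
  next
    case 2
    have "\<rho> = (\<lambda>_. \<rho> ())" by (rule ext) simp
    then have "\<exists>\<phi>. model M {} (\<lambda>_. \<rho> ()) \<phi>" using M 2 by metis
    then have "right_iso II M (star_module (M1 (\<rho> ())))" using M1_model by (rule model_iso_exists)
    then show ?thesis by blast
  qed
qed

section \<open>Supports\<close>

lemma model_Supp1: "model M T \<rho> \<phi> \<Longrightarrow> Supp1 M = (\<lambda>\<mu>. \<mu> ()) ` wtset T \<rho>"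
  by (simp add: Supp1_def model.Supp_eq)

lemma Supp1_Kd: "Supp1 (Kd :: (('k::field_char_0, unit) op, 'k poly) module) = {of_nat k | k. k \<ge> 1}"
proof -
  obtain \<phi> where "model (Kd :: (('k, unit) op, 'k poly) module) UNIV (\<lambda>_. 1) \<phi>" using Kd_model by blast
  then have "Supp1 (Kd :: (('k, unit) op, 'k poly) module) = (\<lambda>\<mu>. \<mu> ()) ` posset UNIV"
    by (simp add: model_Supp1 wtset_UNIV)
  also have "\<dots> = {of_nat k | k. k \<ge> 1}"
  proof (intro equalityI subsetI)
    fix x :: 'k assume "x \<in> (\<lambda>\<mu>. \<mu> ()) ` posset UNIV"
    then obtain k :: nat where "x = of_nat k + 1" by (auto simp: posset_def)
    then show "x \<in> {of_nat k | k. k \<ge> 1}" by (intro CollectI exI[of _ "Suc k"]) simp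
  next
    fix x :: 'k assume "x \<in> {of_nat k | k. k \<ge> 1}"
    then obtain k :: nat where "x = of_nat k" "k \<ge> 1" by blast
    then have "(\<lambda>_::unit. x) \<in> posset UNIV" by (auto simp: posset_def of_nat_diff intro!: exI[of _ "k - 1"])
    then show "x \<in> (\<lambda>\<mu>. \<mu> ()) ` posset UNIV" by (rule rev_image_eqI) simp
  qed
  finally show ?thesis .
qed

lemma Supp1_M1: "Supp1 (star_module (M1 \<mu>)) = {\<mu> + of_int m | m. True}"
proof -
  obtain \<phi> where "model (star_module (M1 \<mu>)) {} (\<lambda>_. \<mu>) \<phi>" using M1_model by blast
  then have "Supp1 (star_module (M1 \<mu>)) = (\<lambda>\<mu>. \<mu> ()) ` wtset {} (\<lambda>_. \<mu>)" by (rule model_Supp1)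
  also have "\<dots> = {\<mu> + of_int m | m. True}"
    by (auto simp: wtset_def intro!: image_eqI[of _ _ "\<lambda>_. \<mu> + of_int _"])
  finally show ?thesis .
qed

lemma Supp_tensor:
  assumes "\<forall>i. simple_weight (Mi i)" "right_iso II M (tensor Mi)" "simple_weight M"
  shows "Supp M = {\<mu>. \<forall>i. \<mu> i \<in> Supp1 (Mi i)}"
proof -
  obtain Ti Ri \<phi> where Mi: "\<forall>i. model (Mi i) (Ti i) (Ri i) (\<phi> i)"
    using assms(1) by (rule simple_weight_family)
  obtain T \<rho> \<theta> where t: "model (tensor Mi) T \<rho> \<theta>"
    "\<forall>\<mu>. \<mu> \<in> wtset T \<rho> \<longleftrightarrow> (\<forall>i. (\<lambda>_. \<mu> i) \<in> wtset (Ti i) (Ri i))"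
    using Mi by (rule tensor_of_models)
  obtain T' \<rho>' \<psi> where M: "model M T' \<rho>' \<psi>" using assms(3) simple_weight_iff_model by blast
  have "Supp M = wtset T \<rho>"
    using model_iso_iff[OF M t(1)] assms(2) model.Supp_eq[OF M] by simp
  moreover have "x \<in> Supp1 (Mi i) \<longleftrightarrow> (\<lambda>_. x) \<in> wtset (Ti i) (Ri i)" for i x
  proof -
    have "(\<lambda>_. \<nu> ()) = \<nu>" for \<nu> :: "unit \<Rightarrow> 'a" by (rule ext) simp
    then show ?thesis unfolding model_Supp1[OF Mi[rule_format]] by (auto intro: rev_image_eqI)
  qed
  ultimately show ?thesis using t(2) by auto
qed

theorem theorem4p2:
  shows
    "(\<forall>M :: (('k::field_char_0, 'n::finite) op, 'v) module.
        simple_gen_weight M \<longleftrightarrow> simple_weight M) \<and>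
     (\<forall>Mi :: 'n \<Rightarrow> (('k, unit) op, 'w) module.
        (\<forall>i. simple_weight (Mi i)) \<longrightarrow> simple_weight (tensor Mi)) \<and>
     (\<forall>M :: (('k, 'n) op, 'v) module. simple_weight M \<longrightarrow>
        (\<exists>Mi :: 'n \<Rightarrow> (('k, unit) op, ('k, unit) op set) module.
           (\<forall>i. simple_weight (Mi i)) \<and> right_iso II M (tensor Mi))) \<and>
     (\<forall>(Mi :: 'n \<Rightarrow> (('k, unit) op, 'w) module) (Mi' :: 'n \<Rightarrow> (('k, unit) op, 'u) module).
        (\<forall>i. simple_weight (Mi i)) \<longrightarrow> (\<forall>i. simple_weight (Mi' i)) \<longrightarrow>
        (right_iso II (tensor Mi) (tensor Mi') \<longleftrightarrow> (\<forall>i. right_iso II (Mi i) (Mi' i)))) \<and>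
     simple_weight (star_module (P1 :: (('k, unit) op, ('k, unit) pol) module)) \<and>
     right_iso II (star_module (P1 :: (('k, unit) op, ('k, unit) pol) module)) I1_mod_int \<and>
     right_iso II (I1_mod_int :: (('k, unit) op, ('k, unit) op set) module) Kd \<and>
     (\<forall>\<mu> :: 'k. simple_weight (star_module (M1 \<mu>)) \<and>
        right_iso II (star_module (M1 \<mu>)) (B1_mod_right \<mu>)) \<and>
     (\<forall>M :: (('k, unit) op, 'w) module. simple_weight M \<longrightarrow>
        right_iso II M (star_module P1) \<or> (\<exists>\<mu>. right_iso II M (star_module (M1 \<mu>)))) \<and>
     Supp1 (Kd :: (('k, unit) op, 'k poly) module) = {of_nat k | k. k \<ge> 1} \<and>
     (\<forall>\<mu> :: 'k. Supp1 (star_module (M1 \<mu>)) = {\<mu> + of_int m | m. True}) \<and>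
     (\<forall>(M :: (('k, 'n) op, 'v) module) (Mi :: 'n \<Rightarrow> (('k, unit) op, 'w) module).
        simple_weight M \<longrightarrow> (\<forall>i. simple_weight (Mi i)) \<longrightarrow> right_iso II M (tensor Mi) \<longrightarrow>
        Supp M = {\<mu>. \<forall>i. \<mu> i \<in> Supp1 (Mi i)})"
proof (intro conjI allI impI)
  fix M :: "(('k, 'n) op, 'v) module"
  show "simple_gen_weight M \<longleftrightarrow> simple_weight M"
    by (simp add: simple_weight_iff_model simple_gen_weight_iff_model)
next
  fix Mi :: "'n \<Rightarrow> (('k, unit) op, 'w) module"
  assume "\<forall>i. simple_weight (Mi i)"
  then show "simple_weight (tensor Mi)" by (rule tensor_simple_weight)
next
  fix M :: "(('k, 'n) op, 'v) module"
  assume "simple_weight M"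
  then show "\<exists>Mi :: 'n \<Rightarrow> (('k, unit) op, ('k, unit) op set) module.
      (\<forall>i. simple_weight (Mi i)) \<and> right_iso II M (tensor Mi)"
    by (rule simple_weight_is_tensor)
next
  fix Mi :: "'n \<Rightarrow> (('k, unit) op, 'w) module" and Mi' :: "'n \<Rightarrow> (('k, unit) op, 'u) module"
  assume "\<forall>i. simple_weight (Mi i)" "\<forall>i. simple_weight (Mi' i)"
  then show "right_iso II (tensor Mi) (tensor Mi') \<longleftrightarrow> (\<forall>i. right_iso II (Mi i) (Mi' i))"
    by (rule tensor_iso_iff)
next
  show "simple_weight (star_module (P1 :: (('k, unit) op, ('k, unit) pol) module))"
    using star_P1_model by (elim exE) (rule model.simple_weight)
  show "right_iso II (star_module (P1 :: (('k, unit) op, ('k, unit) pol) module)) I1_mod_int"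
    by (rule model_iso_exists[OF star_P1_model I1_mod_int_model])
  show "right_iso II (I1_mod_int :: (('k, unit) op, ('k, unit) op set) module) Kd"
    by (rule model_iso_exists[OF I1_mod_int_model Kd_model])
  fix \<mu> :: 'k
  show "simple_weight (star_module (M1 \<mu>))"
    using M1_model[of \<mu>] by (elim exE) (rule model.simple_weight)
  show "right_iso II (star_module (M1 \<mu>)) (B1_mod_right \<mu>)"
    by (rule model_iso_exists[OF M1_model B1_mod_right_model])
next
  fix M :: "(('k, unit) op, 'w) module"
  assume "simple_weight M"
  then show "right_iso II M (star_module P1) \<or> (\<exists>\<mu>. right_iso II M (star_module (M1 \<mu>)))"
    by (rule simple_weight_unit)
next
  show "Supp1 (Kd :: (('k, unit) op, 'k poly) module) = {of_nat k | k. k \<ge> 1}" by (rule Supp1_Kd)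
  show "Supp1 (star_module (M1 \<mu>)) = {\<mu> + of_int m | m. True}" for \<mu> :: 'k by (rule Supp1_M1)
next
  fix M :: "(('k, 'n) op, 'v) module" and Mi :: "'n \<Rightarrow> (('k, unit) op, 'w) module"
  assume "simple_weight M" "\<forall>i. simple_weight (Mi i)" "right_iso II M (tensor Mi)"
  then show "Supp M = {\<mu>. \<forall>i. \<mu> i \<in> Supp1 (Mi i)}" by (intro Supp_tensor)
qed

end
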